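(* Let $0<a<b$, let $A=\{x\in\mathbb{R}^2:a<|x|<b\}$, let $h_0$ satisfy (H1)--(H4) listed in the context, let $N\ge1$ be an integer, and let $u_*^N$ minimize $$I_0(u)=\int_A\tfrac12|\nabla u|^2+h_0(\det\nabla u)\,dx$$ in $\tilde{\mathcal{A}}_{N,\mathrm{sym}}$. If $u_*^N$ is expressed in the form $u_*^N(r,\theta)=\rho(r)e_r(\theta+\psi(r))$, then $\dot\rho\in C([a,b])$ (i.e. $\dot\rho$ extends continuously to $[a,b]$), with $\dot\rho(a)>0$ and $\dot\rho(b)<\infty$.
   Context: $e_r(\theta)=(\cos\theta,\sin\theta)$; a dot denotes $d/dr$. Hypotheses on $h_0:\mathbb{R}\to[0,+\infty]$: (H1) $h_0$ is convex and $h_0\ge0$; (H2) $h_0\in C^3((0,+\infty))$ and for some positive constants $s,c_1,c_2,d_0$: $c_1t^{-s-j}\le(-1)^jh_0^{(j)}(t)\le c_2t^{-s-j}$ for $0<t<d_0$ and $j=0,1,2$; (H3) $h_0(t)=+\infty$ for $t\le0$; (H4) for some real number $\tau$ and positive constants $c_3,c_4,d_1$: $c_3t^\tau\le h_0''(t)\le c_4t^\tau$ for $t\ge d_1$. $\tilde{\mathcal{A}}_N$ is the set of $u\in W^{1,2}(A;\mathbb{R}^2)$ with $u=\mathrm{id}$ on $\partial A$ (in the sense of trace), $\det\nabla u\ge0$ a.e. in $A$, and $\mathrm{wind}\#\gamma_\theta=N$ for a.e. $\theta\in[0,2\pi]$, where in polar coordinates $\gamma_\theta(r)=u(r,\theta)/|u(r,\theta)|$,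 $a\le r\le b$. The winding number of a closed $C^1$ curve $\gamma=(x,y):[a,b]\to\mathbb{R}^2\setminus\{0\}$ is $\frac1{2\pi}\int_a^b\frac{xy'-x'y}{x^2+y^2}\,dr$, extended to closed continuous curves by approximation. $\tilde{\mathcal{A}}_{N,\mathrm{sym}}=\{u\in\tilde{\mathcal{A}}_N:u(x)=Q^Tu(Qx)\text{ for all }Q\in SO(2)\}$. It is known (Post and Sivaloganathan, 1997) that $\rho,\psi$ are of class $C^2(a,b)$ (and, under the present hypotheses, $\rho\in C([a,b])\cap C^3(a,b)$) and that $u_*^N$ solves the Euler-Lagrange equations, which for such maps read, with $d=\rho\dot\rho/r$ and a constant $\omega$: $[r\dot\rho+\rho h_0'(d)]'=\frac\rho r+r\rho\dot\psi^2+\dot\rho h_0'(d)$ and $r\rho^2\dot\psi=\omega$. *)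

theory Defs
  imports "HOL-Complex_Analysis.Complex_Analysis"
begin

section \<open>Hypotheses on the stored energy\<close>

text \<open>Since \<open>h\<close> takes values in \<open>[0,\<infinity>]\<close> and \<open>0 * \<infinity> = 0\<close> in \<^typ>\<open>ereal\<close>, the convexity
  inequality may be stated for all \<open>t\<close> in the closed unit interval.\<close>

definition hyp_H1 :: "(real \<Rightarrow> ereal) \<Rightarrow> bool" where
  "hyp_H1 h \<longleftrightarrow>
     (\<forall>x y. \<forall>t\<in>{0..1}. h ((1 - t) * x + t * y) \<le> ereal (1 - t) * h x + ereal t * h y) \<and>
     (\<forall>x. 0 \<le> h x)"

definition hyp_H2 :: "(real \<Rightarrow> ereal) \<Rightarrow> bool" where
  "hyp_H2 h \<longleftrightarrow>
     (\<forall>t>0. \<bar>h t\<bar> \<noteq> \<infinity>) \<and>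
     (\<forall>j<3. \<forall>t>0. (deriv ^^ j) (\<lambda>t. real_of_ereal (h t)) field_differentiable at t) \<and>
     continuous_on {0<..} ((deriv ^^ 3) (\<lambda>t. real_of_ereal (h t))) \<and>
     (\<exists>s>0. \<exists>c1>0. \<exists>c2>0. \<exists>d0>0. \<forall>t. 0 < t \<and> t < d0 \<longrightarrow> (\<forall>j\<in>{0,1,2}.
        c1 * t powr (- s - real j) \<le> (-1) ^ j * (deriv ^^ j) (\<lambda>t. real_of_ereal (h t)) t \<and>
        (-1) ^ j * (deriv ^^ j) (\<lambda>t. real_of_ereal (h t)) t \<le> c2 * t powr (- s - real j)))"

definition hyp_H3 :: "(real \<Rightarrow> ereal) \<Rightarrow> bool" where
  "hyp_H3 h \<longleftrightarrow> (\<forall>t\<le>0. h t = \<infinity>)"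

definition hyp_H4 :: "(real \<Rightarrow> ereal) \<Rightarrow> bool" where
  "hyp_H4 h \<longleftrightarrow>
     (\<exists>\<tau>. \<exists>c3>0. \<exists>c4>0. \<exists>d1>0. \<forall>t\<ge>d1.
        c3 * t powr \<tau> \<le> (deriv ^^ 2) (\<lambda>t. real_of_ereal (h t)) t \<and>
        (deriv ^^ 2) (\<lambda>t. real_of_ereal (h t)) t \<le> c4 * t powr \<tau>)"

section \<open>Smooth functions and the Sobolev space \<open>W\<^sup>1\<^sup>,\<^sup>2\<close>\<close>

primrec Ck :: "nat \<Rightarrow> ('a::euclidean_space \<Rightarrow> 'b::real_normed_vector) \<Rightarrow> bool" where
  "Ck 0 f \<longleftrightarrow> continuous_on UNIV f"
| "Ck (Suc k) f \<longleftrightarrow> (\<forall>x. f differentiable at x) \<and>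
     (\<forall>v\<in>Basis. Ck k (\<lambda>x. frechet_derivative f (at x) v))"

definition smooth :: "('a::euclidean_space \<Rightarrow> 'b::real_normed_vector) \<Rightarrow> bool" where
  "smooth f \<longleftrightarrow> (\<forall>k. Ck k f)"

definition test_functions :: "(real^2) set \<Rightarrow> (real^2 \<Rightarrow> real) set" where
  "test_functions S = {\<phi>. smooth \<phi> \<and> compact (closure {x. \<phi> x \<noteq> 0}) \<and> closure {x. \<phi> x \<noteq> 0} \<subseteq> S}"

text \<open>Elements of \<open>L\<^sup>2\<close> and \<open>W\<^sup>1\<^sup>,\<^sup>2\<close> are represented by functions; all notions below are
  invariant under changing a map on a null set.\<close>

definition L2_on :: "(real^2) set \<Rightarrow> (real^2 \<Rightarrow> 'b::euclidean_space) \<Rightarrow> bool" where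
  "L2_on S f \<longleftrightarrow> set_borel_measurable lebesgue S f \<and>
     set_integrable lebesgue S (\<lambda>x. (norm (f x))\<^sup>2)"

text \<open>\<open>G x $ i $ j\<close> is the weak partial derivative of the \<open>i\<close>-th component of \<open>u\<close> in
  direction \<open>j\<close>.\<close>

definition is_weak_gradient ::
  "(real^2) set \<Rightarrow> (real^2 \<Rightarrow> real^2) \<Rightarrow> (real^2 \<Rightarrow> real^2^2) \<Rightarrow> bool" where
  "is_weak_gradient S u G \<longleftrightarrow> (\<forall>\<phi>\<in>test_functions S. \<forall>i j.
     (LINT x:S|lebesgue. u x $ i * frechet_derivative \<phi> (at x) (axis j 1)) =
     - (LINT x:S|lebesgue. G x $ i $ j * \<phi> x))"

definition W12 :: "(real^2) set \<Rightarrow> (real^2 \<Rightarrow> real^2) set" where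
  "W12 S = {u. L2_on S u \<and> (\<exists>G. L2_on S G \<and> is_weak_gradient S u G)}"

text \<open>For \<open>u \<in> W12 S\<close> with \<open>S\<close> open, the weak gradient is determined up to a null subset of \<open>S\<close>.\<close>

definition weak_grad :: "(real^2) set \<Rightarrow> (real^2 \<Rightarrow> real^2) \<Rightarrow> real^2 \<Rightarrow> real^2^2" where
  "weak_grad S u = (SOME G. L2_on S G \<and> is_weak_gradient S u G)"

section \<open>The admissible maps on the annulus\<close>

definition annulus :: "real \<Rightarrow> real \<Rightarrow> (real^2) set" where
  "annulus a b = {x. a < norm x \<and> norm x < b}"

definition e\<^sub>r :: "real \<Rightarrow> real^2" where
  "e\<^sub>r \<theta> = vector [cos \<theta>, sin \<theta>]"

text \<open>The trace operator is the continuous extension from \<open>W\<^sup>1\<^sup>,\<^sup>2\<close> of the annulus to \<open>L\<^sup>2\<close> of its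
  boundary of the restriction map on functions smooth up to the boundary. So \<open>u\<close> has trace \<open>g\<close>
  iff some smooth maps converge to \<open>u\<close> in \<open>W\<^sup>1\<^sup>,\<^sup>2\<close> while their boundary values converge
  to \<open>g\<close> in \<open>L\<^sup>2\<close> of the two bounding circles. (The constant factors \<open>a\<close>, \<open>b\<close> relating \<open>d\<theta>\<close>
  to arc length are immaterial.)\<close>

definition has_trace :: "real \<Rightarrow> real \<Rightarrow> (real^2 \<Rightarrow> real^2) \<Rightarrow> (real^2 \<Rightarrow> real^2) \<Rightarrow> bool" where
  "has_trace a b u g \<longleftrightarrow> (\<exists>U :: nat \<Rightarrow> real^2 \<Rightarrow> real^2.
     (\<forall>n. smooth (U n)) \<and>
     (\<lambda>n. \<integral>\<^sup>+x\<in>annulus a b. ennreal ((norm (U n x - u x))\<^sup>2) \<partial>lebesgue) \<longlonglongrightarrow> 0 \<and>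
     (\<lambda>n. \<integral>\<^sup>+x\<in>annulus a b. ennreal ((norm (matrix (frechet_derivative (U n) (at x))
            - weak_grad (annulus a b) u x))\<^sup>2) \<partial>lebesgue) \<longlonglongrightarrow> 0 \<and>
     (\<forall>R\<in>{a, b}. (\<lambda>n. \<integral>\<^sup>+\<theta>\<in>{0..2*pi}.
            ennreal ((norm (U n (R *\<^sub>R e\<^sub>r \<theta>) - g (R *\<^sub>R e\<^sub>r \<theta>)))\<^sup>2) \<partial>lebesgue) \<longlonglongrightarrow> 0))"

definition to_complex :: "real^2 \<Rightarrow> complex" where
  "to_complex y = Complex (y $ 1) (y $ 2)"

text \<open>The curve \<open>r \<mapsto> u(r,\<theta>)/|u(r,\<theta>)|\<close> on \<open>[a,b]\<close>, reparametrised over \<open>[0,1]\<close> as required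
  by \<^const>\<open>winding_number\<close>.\<close>

definition radial_curve :: "real \<Rightarrow> real \<Rightarrow> (real^2 \<Rightarrow> real^2) \<Rightarrow> real \<Rightarrow> real \<Rightarrow> complex" where
  "radial_curve a b u \<theta> t =
     (let y = u ((a + (b - a) * t) *\<^sub>R e\<^sub>r \<theta>) in to_complex ((1 / norm y) *\<^sub>R y))"

text \<open>A Sobolev map is only given up to null sets. The curves are those of a representative
  \<open>w\<close> which, on almost every ray, is continuous up to the boundary; by Fubini these curves do not
  depend on the choice of \<open>w\<close> for almost every \<open>\<theta>\<close>.\<close>

definition has_radial_winding :: "real \<Rightarrow> real \<Rightarrow> int \<Rightarrow> (real^2 \<Rightarrow> real^2) \<Rightarrow> bool" where
  "has_radial_winding a b N u \<longleftrightarrow> (\<exists>w.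
     (AE x in lebesgue. x \<in> annulus a b \<longrightarrow> w x = u x) \<and>
     (AE \<theta> in lebesgue. \<theta> \<in> {0..2*pi} \<longrightarrow>
        continuous_on {a..b} (\<lambda>r. w (r *\<^sub>R e\<^sub>r \<theta>)) \<and>
        (\<forall>r\<in>{a..b}. w (r *\<^sub>R e\<^sub>r \<theta>) \<noteq> 0) \<and>
        winding_number (radial_curve a b w \<theta>) 0 = of_int N))"

definition admissible :: "real \<Rightarrow> real \<Rightarrow> int \<Rightarrow> (real^2 \<Rightarrow> real^2) set" where
  "admissible a b N = {u \<in> W12 (annulus a b).
     has_trace a b u (\<lambda>x. x) \<and>
     (AE x in lebesgue. x \<in> annulus a b \<longrightarrow> 0 \<le> det (weak_grad (annulus a b) u x)) \<and>
     has_radial_winding a b N u}"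

definition admissible_sym :: "real \<Rightarrow> real \<Rightarrow> int \<Rightarrow> (real^2 \<Rightarrow> real^2) set" where
  "admissible_sym a b N = {u \<in> admissible a b N. \<forall>Q. rotation_matrix Q \<longrightarrow>
     (AE x in lebesgue. x \<in> annulus a b \<longrightarrow> u x = transpose Q *v u (Q *v x))}"

text \<open>The norm on \<^typ>\<open>real^2^2\<close> is the Frobenius norm. For \<open>h \<ge> 0\<close> the conversion
  \<^const>\<open>e2ennreal\<close> loses nothing.\<close>

definition energy ::
  "real \<Rightarrow> real \<Rightarrow> (real \<Rightarrow> ereal) \<Rightarrow> (real^2 \<Rightarrow> real^2) \<Rightarrow> ennreal" where
  "energy a b h u = (\<integral>\<^sup>+x\<in>annulus a b.
     (ennreal ((norm (weak_grad (annulus a b) u x))\<^sup>2 / 2)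
      + e2ennreal (h (det (weak_grad (annulus a b) u x)))) \<partial>lebesgue)"

end

theory Submission
  imports Defs
begin

text \<open>In the variable \<open>s = r\<^sup>2\<close> area becomes \<open>\<pi> ds\<close>, and a map in polar form becomes a planar
  curve \<open>w s = \<rho> e\<^sub>r(\<psi>)\<close>; passing to the limit in smooth approximations shows that \<open>w\<close> is a primitive of
  an integrable function. The minimiser is compared with its compositions with the equivariant
  diffeomorphisms \<open>x \<mapsto> A(|x|\<^sup>2) rot(\<eta>(|x|\<^sup>2)) x\<close> of the annulus. Those with \<open>A = 1\<close> give
  \<open>r \<rho>\<^sup>2 \<psi>' = \<omega>\<close>. For \<open>\<eta> = 0\<close> the change of variables replaces \<open>h(d)\<close> by \<open>h(J d) / J\<close> with \<open>J\<close> close to \<open>1\<close>;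
  by convexity and the growth of \<open>h\<close> near \<open>0\<close> and \<open>\<infinity>\<close> the difference quotients are dominated by a multiple of
  \<open>1 + d + h(d)\<close>, so no integrability of \<open>h'(d)\<close> has to be known beforehand. The resulting
  integrated Euler-Lagrange equation says that \<open>(t / (2 \<rho>\<^sup>2)) d\<^sup>2 + d h'(d) - h(d)\<close> is a continuous function
  of \<open>t = r\<^sup>2\<close> on the closed interval. The left-hand side is strictly increasing in \<open>d\<close> and unbounded
  below as \<open>d \<rightarrow> 0\<close>, so \<open>d = \<rho> \<rho>' / r\<close> is continuous and positive up to the boundary.\<close>

section \<open>Smooth functions and test functions\<close>

text \<open>An additive perturbation of the minimiser may make the determinant nonpositive, where
  \<open>h0\<close> is infinite, and nothing bounds the energy of such a map. Composition with a
  diffeomorphism only multiplies the determinant by a positive factor, which is why inner variations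
  are used throughout. The diffeomorphisms commute with rotations, so they stay within the symmetric
  class; they are the identity near both boundary circles, so they keep the trace; and their
  coefficients depend on |x|^2, so they are smooth on the whole plane, also at the origin. The last
  point matters because a Sobolev map is only accessible through the globally smooth maps in the
  definition of the trace: every chain rule is proved for those and then passed to the limit.
  Allowing the angle \<eta> to end at a multiple of 2 pi also supplies, from the identity map, a
  competitor of finite energy with any winding number. The two families of variations complement
  each other: the first yields the conserved quantity \<omega>, and inserting it eliminates \<psi>'
  from the second, so that for each t a scalar equation in d alone remains.\<close>

lemma Ck_SucI:
  assumes "\<And>x. (f has_derivative f' x) (at x)" and "\<And>v. v \<in> Basis \<Longrightarrow> Ck k (\<lambda>x. f' x v)"
  shows "Ck (Suc k) f"
proof -
  have "frechet_derivative f (at x) = f' x" for x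
    using frechet_derivative_at[OF assms(1)] by simp
  then show ?thesis using assms by (auto simp: differentiable_def)
qed

lemma Ck_has_derivative:
  assumes "Ck (Suc k) f"
  shows "(f has_derivative frechet_derivative f (at x)) (at x)"
  using assms frechet_derivative_works by auto

lemma Ck_SucD: "Ck (Suc k) f \<Longrightarrow> Ck k f"
proof (induction k arbitrary: f)
  case 0
  then show ?case
    by (auto intro!: continuous_at_imp_continuous_on differentiable_imp_continuous_within)
qed auto

lemma Ck_const: "Ck k (\<lambda>x. c)"
proof (induction k arbitrary: c)
  case (Suc k)
  show ?case by (rule Ck_SucI[where f' = "\<lambda>x v. 0"]) (auto intro: Suc)
qed auto

lemma Ck_bounded_linear: "bounded_linear f \<Longrightarrow> Ck k f"
  by (cases k) (auto intro!: Ck_SucI[where f' = "\<lambda>x. f"] Ck_const linear_continuous_on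
      bounded_linear_imp_has_derivative simp del: Ck.simps(2))

lemma Ck_add: "Ck k f \<Longrightarrow> Ck k g \<Longrightarrow> Ck k (\<lambda>x. f x + g x)"
proof (induction k arbitrary: f g)
  case (Suc k)
  show ?case
    by (rule Ck_SucI[OF has_derivative_add[OF Ck_has_derivative[OF Suc.prems(1)]
            Ck_has_derivative[OF Suc.prems(2)]]])
       (use Suc in auto)
qed (auto intro: continuous_on_add)

lemma Ck_sum: "(\<And>i. i \<in> I \<Longrightarrow> Ck k (f i)) \<Longrightarrow> Ck k (\<lambda>x. \<Sum>i\<in>I. f i x)"
  by (induction I rule: infinite_finite_induct) (auto intro: Ck_const Ck_add)

lemma Ck_bilinear:
  assumes B: "bounded_bilinear B"
  shows "Ck k f \<Longrightarrow> Ck k g \<Longrightarrow> Ck k (\<lambda>x. B (f x) (g x))"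
proof (induction k arbitrary: f g)
  case 0
  then show ?case using bounded_bilinear.continuous_on[OF B] by auto
next
  case (Suc k)
  show ?case
    by (rule Ck_SucI[OF bounded_bilinear.FDERIV[OF B Ck_has_derivative[OF Suc.prems(1)]
            Ck_has_derivative[OF Suc.prems(2)]]])
       (use Suc Ck_SucD[OF Suc.prems(1)] Ck_SucD[OF Suc.prems(2)] in \<open>auto intro!: Ck_add Suc.IH\<close>)
qed

lemma Ck_compose:
  fixes f :: "'b::euclidean_space \<Rightarrow> 'c::real_normed_vector" and g :: "'a::euclidean_space \<Rightarrow> 'b"
  shows "Ck k f \<Longrightarrow> Ck k g \<Longrightarrow> Ck k (\<lambda>x. f (g x))"
proof (induction k arbitrary: f)
  case 0
  then show ?case using continuous_on_compose2 by fastforce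
next
  case (Suc k)
  let ?f' = "\<lambda>y. frechet_derivative f (at y)" and ?g' = "\<lambda>x. frechet_derivative g (at x)"
  have d: "((\<lambda>x. f (g x)) has_derivative (\<lambda>v. ?f' (g x) (?g' x v))) (at x)" for x
    by (rule has_derivative_compose[OF Ck_has_derivative[OF Suc.prems(2)] Ck_has_derivative[OF Suc.prems(1)]])
  have "Ck k (\<lambda>x. ?f' (g x) (?g' x v))" if v: "v \<in> Basis" for v
  proof -
    \<comment> \<open>\<open>Ck\<close> constrains derivatives only along basis vectors, whereas
      \<open>?g' x v\<close> is an arbitrary direction. Expanded in the basis, the derivative
      becomes a sum of products to which the induction hypothesis and the product rule
      apply.\<close>
    have "?f' (g x) (?g' x v) = (\<Sum>b\<in>Basis. (?g' x v \<bullet> b) *\<^sub>R ?f' (g x) b)" for x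
    proof -
      have lin: "linear (?f' (g x))"
        using Ck_has_derivative[OF Suc.prems(1)] has_derivative_linear by blast
      have "?f' (g x) (?g' x v) = ?f' (g x) (\<Sum>b\<in>Basis. (?g' x v \<bullet> b) *\<^sub>R b)"
        by (simp add: euclidean_representation)
      also have "\<dots> = (\<Sum>b\<in>Basis. (?g' x v \<bullet> b) *\<^sub>R ?f' (g x) b)"
        by (simp add: linear_sum[OF lin] linear_cmul[OF lin])
      finally show ?thesis .
    qed
    moreover have "Ck k (\<lambda>x. \<Sum>b\<in>Basis. (?g' x v \<bullet> b) *\<^sub>R ?f' (g x) b)"
      by (intro Ck_sum Ck_bilinear[OF bounded_bilinear_scaleR] Ck_bilinear[OF bounded_bilinear_inner]
          Ck_const Suc.IH Ck_SucD[OF Suc.prems(2)])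
         (use Suc.prems v in auto)
    ultimately show ?thesis by simp
  qed
  then show ?case by (rule Ck_SucI[OF d])
qed

lemma Ck_realI:
  fixes f f' :: "real \<Rightarrow> real"
  assumes "\<And>x. (f has_real_derivative f' x) (at x)" "Ck k f'"
  shows "Ck (Suc k) f"
  by (rule Ck_SucI[OF assms(1)[unfolded has_field_derivative_def]]) (use assms(2) in simp)

lemma smooth_const: "smooth (\<lambda>x. c)"
  by (simp add: smooth_def Ck_const)

lemma smooth_bounded_linear: "bounded_linear f \<Longrightarrow> smooth f"
  by (simp add: smooth_def Ck_bounded_linear)

lemma smooth_add: "smooth f \<Longrightarrow> smooth g \<Longrightarrow> smooth (\<lambda>x. f x + g x)"
  by (simp add: smooth_def Ck_add)

lemma smooth_bilinear: "bounded_bilinear B \<Longrightarrow> smooth f \<Longrightarrow> smooth g \<Longrightarrow> smooth (\<lambda>x. B (f x) (g x))"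
  by (simp add: smooth_def Ck_bilinear)

lemmas smooth_mult = smooth_bilinear[OF bounded_bilinear_mult]
lemmas smooth_scaleR = smooth_bilinear[OF bounded_bilinear_scaleR]
lemmas smooth_inner = smooth_bilinear[OF bounded_bilinear_inner]

lemma smooth_compose:
  fixes f :: "'b::euclidean_space \<Rightarrow> 'c::real_normed_vector" and g :: "'a::euclidean_space \<Rightarrow> 'b"
  shows "smooth f \<Longrightarrow> smooth g \<Longrightarrow> smooth (\<lambda>x. f (g x))"
  by (simp add: smooth_def Ck_compose)

lemma smooth_compose_bounded_linear:
  fixes f :: "'b::euclidean_space \<Rightarrow> 'c::real_normed_vector"
  shows "bounded_linear f \<Longrightarrow> smooth g \<Longrightarrow> smooth (\<lambda>x::'a::euclidean_space. f (g x))"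
  by (rule smooth_compose[OF smooth_bounded_linear])

lemma smooth_id: "smooth (\<lambda>x. x)"
  by (rule smooth_bounded_linear) (rule bounded_linear_ident)

lemma smooth_minus: "smooth f \<Longrightarrow> smooth g \<Longrightarrow> smooth (\<lambda>x. f x - g x :: 'b::real_normed_vector)"
  using smooth_add[of f "\<lambda>x. (-1) *\<^sub>R g x"] smooth_scaleR[OF smooth_const, of g "-1"] by simp

lemma smooth_prod:
  "(\<And>i. i \<in> I \<Longrightarrow> smooth (f i)) \<Longrightarrow> smooth (\<lambda>x. \<Prod>i\<in>I. f i x :: real)"
  by (induction I rule: infinite_finite_induct) (auto intro: smooth_const smooth_mult)

lemma smooth_has_derivative: "smooth f \<Longrightarrow> (f has_derivative frechet_derivative f (at x)) (at x)"
  unfolding smooth_def using Ck_has_derivative by blast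

lemma smooth_partial:
  assumes "smooth f"
  shows "smooth (\<lambda>x. frechet_derivative f (at x) v)"
proof -
  have 1: "smooth (\<lambda>x. frechet_derivative f (at x) b)" if "b \<in> Basis" for b
    using assms that unfolding smooth_def by (metis Ck.simps(2))
  have lin: "linear (frechet_derivative f (at x))" for x
    using smooth_has_derivative[OF assms] has_derivative_linear by blast
  have "frechet_derivative f (at x) v = (\<Sum>b\<in>Basis. (v \<bullet> b) *\<^sub>R frechet_derivative f (at x) b)" for x
    by (subst euclidean_representation[of v, symmetric]) (simp only: linear_sum[OF lin] linear_cmul[OF lin])
  moreover have "smooth (\<lambda>x. \<Sum>b\<in>Basis. (v \<bullet> b) *\<^sub>R frechet_derivative f (at x) b)"
    using smooth_scaleR[OF smooth_const 1] by (auto simp: smooth_def intro: Ck_sum)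
  ultimately show ?thesis by simp
qed

lemma smooth_continuous_on: "smooth f \<Longrightarrow> continuous_on S f"
  unfolding smooth_def using Ck.simps(1) continuous_on_subset by blast

lemma smooth_borel_measurable: "smooth f \<Longrightarrow> f \<in> borel_measurable borel"
  by (rule borel_measurable_continuous_onI) (rule smooth_continuous_on)

lemma smooth_realI:
  fixes f f' :: "real \<Rightarrow> real"
  assumes "\<And>x. (f has_real_derivative f' x) (at x)" "smooth f'"
  shows "smooth f"
  unfolding smooth_def
proof
  show "Ck k f" for k
    using Ck_realI[OF assms(1)] assms(2) Ck_SucD unfolding smooth_def by blast
qed

lemma smooth_DERIV:
  fixes f :: "real \<Rightarrow> real"
  assumes "smooth f"
  shows "(f has_real_derivative deriv f x) (at x)" and "smooth (deriv f)"
proof -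
  have d: "(f has_real_derivative frechet_derivative f (at x) 1) (at x)" for x
  proof -
    have "linear (frechet_derivative f (at x))"
      using smooth_has_derivative[OF assms] has_derivative_linear by blast
    then have "frechet_derivative f (at x) = (*) (frechet_derivative f (at x) 1)"
      by (auto simp: fun_eq_iff) (metis linear_cmul mult.commute mult.right_neutral real_scaleR_def)
    then show ?thesis
      using smooth_has_derivative[OF assms, of x] by (simp add: has_field_derivative_def)
  qed
  then have e: "deriv f = (\<lambda>x. frechet_derivative f (at x) 1)"
    by (auto intro: DERIV_imp_deriv)
  show "(f has_real_derivative deriv f x) (at x)" "smooth (deriv f)"
    using d smooth_partial[OF assms] by (simp_all add: e)
qed

lemma smooth_sin_cos: "smooth (sin :: real \<Rightarrow> real)" "smooth (cos :: real \<Rightarrow> real)"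
proof -
  \<comment> \<open>The three statements are proved together because differentiation leads from sin
    to cos, from cos to -sin, and from -sin to -cos, the last being a constant multiple of
    cos.\<close>
  have "Ck k (sin :: real \<Rightarrow> real) \<and> Ck k (cos :: real \<Rightarrow> real) \<and> Ck k (\<lambda>x. - sin x :: real)" for k
  proof (induction k)
    case 0
    show ?case by (auto intro!: continuous_intros)
  next
    case (Suc k)
    have "Ck k (\<lambda>x. - cos x :: real)"
      using Ck_bilinear[OF bounded_bilinear_mult Ck_const, of k "cos :: real \<Rightarrow> real" "-1"] Suc by simp
    moreover have "Ck k (sin :: real \<Rightarrow> real)" "Ck k (cos :: real \<Rightarrow> real)" "Ck k (\<lambda>x. - sin x :: real)"
      using Suc by auto
    ultimately show ?case
      by (intro conjI Ck_realI[of sin cos] Ck_realI[of cos "\<lambda>x. - sin x"] Ck_realI[of "\<lambda>x. - sin x" "\<lambda>x. - cos x"])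
         (auto intro!: derivative_eq_intros)
  qed
  then show "smooth (sin :: real \<Rightarrow> real)" "smooth (cos :: real \<Rightarrow> real)"
    by (auto simp: smooth_def)
qed

section \<open>Smooth bump functions converging to indicators of boxes\<close>

definition flat_exp :: "nat \<Rightarrow> real \<Rightarrow> real" where
  "flat_exp n t = (if t \<le> 0 then 0 else exp (- 1 / t) / t ^ n)"

text \<open>The single term of index \<open>n + 2\<close> in the exponential series at 1/t already
  bounds exp(1/t) from below well enough. A quadratic bound makes the difference quotient at 0
  vanish.\<close>

lemma flat_exp_bound: "\<bar>flat_exp n t\<bar> \<le> fact (n + 2) * t\<^sup>2"
proof (cases "t \<le> 0")
  case False
  then have t: "t > 0" by simp
  have "(1 / t) ^ (n + 2) / fact (n + 2) \<le> exp (1 / t)"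
  proof -
    have "inverse (fact (n+2)) * (1 / t) ^ (n + 2) \<le> (\<Sum>k. inverse (fact k) * (1 / t) ^ k)"
      using sum_le_suminf[OF summable_exp[of "1/t"], of "{n+2}"] t by simp
    then show ?thesis by (simp add: exp_def divide_inverse mult.commute)
  qed
  then have "1 / t ^ (n + 2) \<le> fact (n + 2) * exp (1 / t)"
    by (subst (asm) pos_divide_le_eq) (simp_all only: power_one_over fact_gt_zero mult.commute)
  then have "1 / t ^ (n + 2) * exp (- 1 / t) \<le> fact (n + 2) * exp (1 / t) * exp (- 1 / t)"
    by (intro mult_right_mono) auto
  also have "\<dots> = fact (n + 2)" by (simp add: mult.assoc flip: exp_add)
  finally have "exp (- 1 / t) / t ^ n * (1 / t\<^sup>2) \<le> fact (n + 2)"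
    by (simp add: power_add power2_eq_square field_simps)
  then have "exp (- 1 / t) / t ^ n \<le> fact (n + 2) * t\<^sup>2"
    using t pos_divide_le_eq[of "t\<^sup>2" "exp (- 1 / t) / t ^ n" "fact (n + 2)"] by simp
  then show ?thesis using t by (simp add: flat_exp_def)
next
  case True
  then have "flat_exp n t = 0" by (simp add: flat_exp_def)
  moreover have "0 \<le> fact (n + 2) * t\<^sup>2" by (intro mult_nonneg_nonneg fact_ge_zero zero_le_power2)
  ultimately show ?thesis by (simp only: abs_zero)
qed

text \<open>The family over all \<open>n\<close> is closed under differentiation up to linear
  combinations. Smoothness of every member is therefore an induction over the order of
  differentiation with \<open>n\<close> arbitrary.\<close>

lemma flat_exp_DERIV:
  "(flat_exp n has_real_derivative flat_exp (n + 2) t - real n * flat_exp (n + 1) t) (at t)"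
proof -
  consider "t < 0" | "t = 0" | "t > 0" by linarith
  then show ?thesis
  proof cases
    case 1
    have "(flat_exp n has_real_derivative 0) (at t)"
      by (rule has_field_derivative_transform_within_open[where f = "\<lambda>_. 0" and S = "{..<0}"])
         (use 1 in \<open>auto simp: flat_exp_def\<close>)
    then show ?thesis using 1 by (simp add: flat_exp_def)
  next
    case 2
    have "((\<lambda>h. flat_exp n h / h) \<longlongrightarrow> 0) (at 0)"
    proof (rule Lim_null_comparison)
      show "\<forall>\<^sub>F h in at 0. norm (flat_exp n h / h) \<le> fact (n + 2) * \<bar>h\<bar>"
        using flat_exp_bound[of n]
        by (auto simp: eventually_at_filter divide_le_eq power2_eq_square mult.assoc
            simp del: fact_Suc)
      show "((\<lambda>h. fact (n + 2) * \<bar>h\<bar>) \<longlongrightarrow> (0::real)) (at 0)"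
        by (auto intro!: tendsto_eq_intros)
    qed
    then show ?thesis using 2 by (simp add: has_field_derivative_iff flat_exp_def)
  next
    case 3
    have "((\<lambda>t. exp (- 1 / t) / t ^ n) has_real_derivative
        flat_exp (n + 2) t - real n * flat_exp (n + 1) t) (at t)"
      using 3 by (auto intro!: derivative_eq_intros simp: flat_exp_def)
        (cases n; simp add: field_simps power2_eq_square power_add)
    then show ?thesis
      by (rule has_field_derivative_transform_within_open[where S = "{0<..}"])
         (use 3 in \<open>auto simp: flat_exp_def\<close>)
  qed
qed

lemma smooth_flat_exp: "smooth (flat_exp n)"
  unfolding smooth_def
proof
  show "Ck k (flat_exp n)" for k
  proof (induction k arbitrary: n)
    case 0
    show ?case
      by (simp add: continuous_at_imp_continuous_on DERIV_isCont[OF flat_exp_DERIV])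
  next
    case (Suc k)
    have "Ck k (\<lambda>t. flat_exp (n + 2) t + (- real n) * flat_exp (n + 1) t)"
      by (intro Ck_add Suc Ck_bilinear[OF bounded_bilinear_mult] Ck_const)
    then show ?case by (intro Ck_realI[OF flat_exp_DERIV]) simp
  qed
qed

text \<open>The factor \<open>Suc n\<close> steepens both flanks, so that for fixed \<open>p\<close>
  and \<open>q\<close> the bumps converge pointwise to the indicator of the open interval. Their
  values stay in [0,1], as dominated convergence requires.\<close>

definition bump :: "real \<Rightarrow> real \<Rightarrow> nat \<Rightarrow> real \<Rightarrow> real" where
  "bump p q n t = flat_exp 0 (real (Suc n) * (t - p)) * flat_exp 0 (real (Suc n) * (q - t))"

lemma smooth_bump: "smooth (bump p q n)"
  unfolding bump_def
  by (intro smooth_mult smooth_compose[OF smooth_flat_exp] smooth_const smooth_minus smooth_id)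

lemma bump_zero: "t \<notin> {p<..<q} \<Longrightarrow> bump p q n t = 0"
  by (auto simp: bump_def flat_exp_def mult_le_0_iff)

lemma bump_pos: "t \<in> {p<..<q} \<Longrightarrow> 0 < bump p q n t"
  by (auto simp: bump_def flat_exp_def mult_le_0_iff)

lemma bump_range: "0 \<le> bump p q n t" "bump p q n t \<le> 1"
proof -
  have "0 \<le> flat_exp 0 s \<and> flat_exp 0 s \<le> 1" for s by (auto simp: flat_exp_def)
  then show "0 \<le> bump p q n t" "bump p q n t \<le> 1"
    unfolding bump_def by (auto intro!: mult_le_one)
qed

lemma bump_tendsto: "(\<lambda>n. bump p q n t) \<longlonglongrightarrow> indicator {p<..<q} t"
proof (cases "t \<in> {p<..<q}")
  case True
  have *: "(\<lambda>n. flat_exp 0 (real (Suc n) * c)) \<longlonglongrightarrow> 1" if "c > 0" for c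
  proof -
    have "(\<lambda>n. - (1 / c) * inverse (real (Suc n))) \<longlonglongrightarrow> - (1 / c) * 0"
      by (intro tendsto_intros LIMSEQ_inverse_real_of_nat)
    then have "(\<lambda>n. exp (- (1 / c) * inverse (real (Suc n)))) \<longlonglongrightarrow> exp (- (1 / c) * 0)"
      by (rule tendsto_exp)
    moreover have "exp (- (1 / c) * inverse (real (Suc n))) = flat_exp 0 (real (Suc n) * c)" for n
      using that by (auto simp: flat_exp_def mult_le_0_iff field_simps simp del: of_nat_Suc)
    ultimately show ?thesis by simp
  qed
  have "(\<lambda>n. bump p q n t) \<longlonglongrightarrow> 1 * 1"
    unfolding bump_def using True by (intro tendsto_mult *) auto
  then show ?thesis using True by simp
qed (simp add: bump_zero)

definition box_bump :: "'a::euclidean_space \<Rightarrow> 'a \<Rightarrow> nat \<Rightarrow> 'a \<Rightarrow> real" where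
  "box_bump l u n x = (\<Prod>b\<in>Basis. bump (l \<bullet> b) (u \<bullet> b) n (x \<bullet> b))"

lemma smooth_box_bump: "smooth (box_bump l u n)"
  unfolding box_bump_def
  by (intro smooth_prod smooth_compose[OF smooth_bump] smooth_inner smooth_const smooth_id)

lemma box_bump_zero: "x \<notin> box l u \<Longrightarrow> box_bump l u n x = 0"
  by (auto simp: box_bump_def box_def intro!: bexI bump_zero)

lemma box_bump_range: "0 \<le> box_bump l u n x" "box_bump l u n x \<le> 1"
  by (auto simp: box_bump_def bump_range intro!: prod_nonneg prod_le_1)

lemma box_bump_tendsto: "(\<lambda>n. box_bump l u n x) \<longlonglongrightarrow> indicator (box l u) x"
proof -
  have "(\<lambda>n. box_bump l u n x) \<longlonglongrightarrow> (\<Prod>b\<in>Basis. indicator {l \<bullet> b<..<u \<bullet> b} (x \<bullet> b))"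
    unfolding box_bump_def by (intro tendsto_prod bump_tendsto)
  moreover have "(\<Prod>b\<in>Basis. indicator {l \<bullet> b<..<u \<bullet> b} (x \<bullet> b)) = (indicator (box l u) x :: real)"
    by (auto simp: indicator_def box_def)
  ultimately show ?thesis by simp
qed

lemma box_bump_support:
  assumes "cbox l u \<subseteq> S"
  shows "compact (closure {x. box_bump l u n x \<noteq> 0})" "closure {x. box_bump l u n x \<noteq> 0} \<subseteq> S"
proof -
  have "{x. box_bump l u n x \<noteq> 0} \<subseteq> cbox l u"
    using box_bump_zero box_subset_cbox by blast
  then have *: "closure {x. box_bump l u n x \<noteq> 0} \<subseteq> cbox l u"
    by (simp add: closure_minimal closed_cbox)
  then show "closure {x. box_bump l u n x \<noteq> 0} \<subseteq> S" using assms by simp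
  show "compact (closure {x. box_bump l u n x \<noteq> 0})"
    using * by (meson closed_closure compact_eq_bounded_closed bounded_subset bounded_cbox)
qed

section \<open>The fundamental lemma of the calculus of variations\<close>

lemma enn2real_eq_iff: "x < top \<Longrightarrow> y < top \<Longrightarrow> enn2real x = enn2real y \<longleftrightarrow> x = y"
  by (metis ennreal_enn2real)

text \<open>On a fixed box the positive and negative parts of \<open>f\<close> are densities of two
  finite measures that agree on all boxes, a generator closed under intersection. Uniqueness of
  measures makes the densities equal almost everywhere, so both parts vanish. The open set is then
  exhausted by countably many closed boxes.\<close>

lemma AE_zero_if_box_integrals_zero:
  fixes f :: "'a::euclidean_space \<Rightarrow> real"
  assumes [measurable]: "f \<in> borel_measurable borel" and "open S"
    and int: "\<And>l u. cbox l u \<subseteq> S \<Longrightarrow> set_integrable lborel (box l u) f"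
    and zero: "\<And>l u. cbox l u \<subseteq> S \<Longrightarrow> (LINT x:box l u|lborel. f x) = 0"
  shows "AE x in lborel. x \<in> S \<longrightarrow> f x = 0"
proof -
  have box0: "AE x in lborel. x \<in> box l u \<longrightarrow> f x = 0" if lu: "cbox l u \<subseteq> S" for l u
  proof -
    define P where "P x = ennreal (indicator (box l u) x * f x)" for x
    define M where "M x = ennreal (- (indicator (box l u) x * f x))" for x
    have [measurable]: "P \<in> borel_measurable borel" "M \<in> borel_measurable borel"
      unfolding P_def M_def by measurable
    have I: "integrable lborel (\<lambda>x. indicator (box l u) x * f x)"
      using int[OF lu] by (simp add: set_integrable_def)
    have fin: "(\<integral>\<^sup>+x. P x \<partial>lborel) \<noteq> \<infinity>" "(\<integral>\<^sup>+x. M x \<partial>lborel) \<noteq> \<infinity>"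
      using I unfolding P_def M_def real_integrable_def by auto
    have "density lborel P = density lborel M"
    proof (rule measure_eqI_generator_eq)
      let ?E = "range (\<lambda>(a, b). box a b::'a set)"
      show "Int_stable ?E"
        by (auto simp: Int_stable_def box_Int_box)
      show "?E \<subseteq> Pow UNIV" "sets (density lborel P) = sigma_sets UNIV ?E"
        "sets (density lborel M) = sigma_sets UNIV ?E"
        by (simp_all add: borel_eq_box)
      let ?A = "\<lambda>n::nat. box (- (real n *\<^sub>R One)) (real n *\<^sub>R One) :: 'a set"
      show "range ?A \<subseteq> ?E" "(\<Union>i. ?A i) = UNIV"
        unfolding UN_box_eq_UNIV by auto
      show "emeasure (density lborel P) (?A n) \<noteq> \<infinity>" for n
      proof -
        have "(\<integral>\<^sup>+x. P x * indicator (?A n) x \<partial>lborel) \<le> (\<integral>\<^sup>+x. P x \<partial>lborel)"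
          by (intro nn_integral_mono) (auto simp: indicator_def)
        then show ?thesis using fin(1) by (auto simp: emeasure_density top_unique)
      qed
      show "emeasure (density lborel P) X = emeasure (density lborel M) X" if XE: "X \<in> ?E" for X
      proof -
        obtain c d where X: "X = box c d" using XE by (auto simp: image_iff)
        obtain l' u' where B: "box l u \<inter> box c d = box l' u'" "cbox l u \<inter> cbox c d = cbox l' u'"
          unfolding box_Int_box Int_interval by blast
        then have lu': "cbox l' u' \<subseteq> S" using lu by blast
        have I': "integrable lborel (\<lambda>x. indicator (box l' u') x * f x)"
          using int[OF lu'] by (simp add: set_integrable_def)
        have eq: "P x * indicator X x = ennreal (indicator (box l' u') x * f x)"
          "M x * indicator X x = ennreal (- (indicator (box l' u') x * f x))" for x
          unfolding P_def M_def X B(1)[symmetric] by (auto simp: indicator_def)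
        have "(LINT x|lborel. indicator (box l' u') x * f x) = 0"
          using zero[OF lu'] by (simp add: set_lebesgue_integral_def)
        then have "(\<integral>\<^sup>+x. P x * indicator X x \<partial>lborel) = (\<integral>\<^sup>+x. M x * indicator X x \<partial>lborel)"
          unfolding eq real_lebesgue_integral_def[OF I']
          using I' by (auto simp: real_integrable_def enn2real_eq_iff less_top)
        then show ?thesis by (simp add: emeasure_density X)
      qed
    qed
    then have "AE x in lborel. P x = M x"
      using fin by (subst (asm) finite_density_unique) auto
    then show ?thesis
    proof eventually_elim
      case (elim x)
      show ?case
      proof
        assume "x \<in> box l u"
        then have "ennreal (f x) = ennreal (- f x)" using elim by (simp add: P_def M_def)
        then show "f x = 0"
          by (metis ennreal_eq_0_iff ennreal_neg linorder_le_cases neg_0_le_iff_le neg_le_0_iff_le order_antisym)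
      qed
    qed
  qed
  obtain D where D: "countable D" "D \<subseteq> Pow S" "\<And>X. X \<in> D \<Longrightarrow> \<exists>l u. X = cbox l u" "\<Union>D = S"
    using open_countable_Union_open_cbox[OF \<open>open S\<close>] by metis
  have "AE x in lborel. x \<in> X \<longrightarrow> f x = 0" if "X \<in> D" for X
  proof -
    obtain l u where X: "X = cbox l u" using D(3)[OF \<open>X \<in> D\<close>] by blast
    \<comment> \<open>The argument so far covers open boxes, while the countable cover consists of
      closed ones; the boundary of a box is a null set.\<close>
    have "cbox l u - box l u \<in> null_sets lebesgue"
      using negligible_frontier_interval negligible_iff_null_sets by blast
    then have "AE x in lebesgue. x \<notin> cbox l u - box l u" by (rule AE_not_in)
    then have "AE x in lborel. x \<notin> cbox l u - box l u" by (simp add: AE_completion_iff)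
    moreover have "AE x in lborel. x \<in> box l u \<longrightarrow> f x = 0"
      by (rule box0) (use D(2) \<open>X \<in> D\<close> X in auto)
    ultimately show ?thesis by eventually_elim (auto simp: X)
  qed
  then have "AE x in lborel. \<forall>X\<in>D. x \<in> X \<longrightarrow> f x = 0"
    using D(1) by (subst AE_ball_countable) auto
  then show ?thesis by eventually_elim (use D(4) in blast)
qed

text \<open>The box bumps are admissible test functions as soon as the closed box lies in
  \<open>S\<close>. Dominated convergence turns their integrals into integrals over the box.\<close>

lemma AE_zero_if_test_integrals_zero:
  fixes f :: "'a::euclidean_space \<Rightarrow> real"
  assumes [measurable]: "f \<in> borel_measurable borel" and "open S"
    and int: "set_integrable lborel S f"
    and zero: "\<And>\<phi>. smooth \<phi> \<Longrightarrow> compact (closure {x. \<phi> x \<noteq> 0}) \<Longrightarrow> closure {x. \<phi> x \<noteq> 0} \<subseteq> S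
      \<Longrightarrow> (LINT x:S|lborel. f x * \<phi> x) = 0"
  shows "AE x in lborel. x \<in> S \<longrightarrow> f x = 0"
proof (rule AE_zero_if_box_integrals_zero)
  have [measurable]: "S \<in> sets borel" using \<open>open S\<close> by simp
  fix l u :: 'a assume lu: "cbox l u \<subseteq> S"
  then have sub: "box l u \<subseteq> S" using box_subset_cbox by blast
  show "set_integrable lborel (box l u) f"
    by (rule set_integrable_subset[OF int]) (use sub in auto)
  have [measurable]: "box_bump l u n \<in> borel_measurable borel" for n
    by (rule smooth_borel_measurable[OF smooth_box_bump])
  have "(\<lambda>n. LINT x|lborel. indicator S x * (f x * box_bump l u n x))
      \<longlonglongrightarrow> (LINT x|lborel. indicator S x * (f x * indicator (box l u) x))"
  proof (rule integral_dominated_convergence[where w = "\<lambda>x. \<bar>indicator S x * f x\<bar>"])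
    show "integrable lborel (\<lambda>x. \<bar>indicator S x * f x\<bar>)"
      using int by (simp add: set_integrable_def)
    show "AE x in lborel. (\<lambda>n. indicator S x * (f x * box_bump l u n x))
        \<longlonglongrightarrow> indicator S x * (f x * indicator (box l u) x)"
      by (intro AE_I2 tendsto_intros box_bump_tendsto)
    show "AE x in lborel. norm (indicator S x * (f x * box_bump l u n x)) \<le> \<bar>indicator S x * f x\<bar>" for n
      using box_bump_range[of l u n]
      by (intro AE_I2) (auto simp: indicator_def abs_mult mult_left_le)
  qed measurable
  moreover have "(LINT x|lborel. indicator S x * (f x * box_bump l u n x)) = 0" for n
    using zero[OF smooth_box_bump box_bump_support[OF lu]]
    by (simp add: set_lebesgue_integral_def)
  ultimately have "(LINT x|lborel. indicator S x * (f x * indicator (box l u) x)) = 0"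
    by (simp add: LIMSEQ_const_iff)
  moreover have "indicator S x * (f x * indicator (box l u) x) = indicator (box l u) x * f x" for x
    using sub by (auto simp: indicator_def)
  ultimately show "(LINT x:box l u|lborel. f x) = 0"
    by (simp add: set_lebesgue_integral_def)
qed fact+

section \<open>Polar coordinates\<close>

lemma nn_integral_change_of_variables:
  fixes g :: "real^'n::{finite,wellorder} \<Rightarrow> real^'n::_"
  assumes S: "open S"
    and der: "\<And>x. x \<in> S \<Longrightarrow> (g has_derivative g' x) (at x)"
    and inj: "inj_on g S"
    and img: "g ` S \<in> sets borel" "emeasure lborel (g ` S) < \<infinity>"
    and cont: "continuous_on S (\<lambda>x. det (matrix (g' x)))"
    and f[measurable]: "f \<in> borel_measurable borel"
  shows "(\<integral>\<^sup>+y\<in>g ` S. f y \<partial>lborel) = (\<integral>\<^sup>+x\<in>S. f (g x) * ennreal \<bar>det (matrix (g' x))\<bar> \<partial>lborel)"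
proof -
  define J where "J x = (if x \<in> S then \<bar>det (matrix (g' x))\<bar> else 0)" for x
  define G where "G x = (if x \<in> S then g x else 0)" for x
  have [measurable]: "S \<in> sets borel" using S by simp
  have contg: "continuous_on S g"
    using der S by (auto intro!: continuous_at_imp_continuous_on has_derivative_continuous)
  have [measurable]: "G \<in> borel_measurable borel"
    unfolding G_def by (rule borel_measurable_continuous_on_if) (use contg in auto)
  have [measurable]: "J \<in> borel_measurable borel"
    unfolding J_def by (rule borel_measurable_continuous_on_if) (use cont in \<open>auto intro: continuous_on_rabs\<close>)
  define M where "M = distr (density lborel (\<lambda>x. ennreal (J x))) borel G"
  define N where "N = density lborel (indicator (g ` S))"
  have "M = N"
  proof (rule measure_eqI)
    show "sets M = sets N" by (simp add: M_def N_def)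
    fix B assume "B \<in> sets M"
    then have [measurable]: "B \<in> sets borel" by (simp add: M_def)
    define T where "T = {x \<in> S. G x \<in> B}"
    have T[measurable]: "T \<in> sets borel" unfolding T_def by measurable
    have TS: "T \<subseteq> S" by (auto simp: T_def)
    have gT: "g ` T = g ` S \<inter> B" by (auto simp: T_def G_def)
    have gT': "g ` T \<in> sets borel" using img by (simp add: gT)
    have fin: "emeasure lborel (g ` T) < \<infinity>"
      using le_less_trans[OF emeasure_mono img(2)] img(1) by (simp add: gT)
    then have lm: "g ` T \<in> lmeasurable"
      using gT' by (simp add: fmeasurable_def)
    have "((\<lambda>x. \<bar>det (matrix (g' x))\<bar>) has_integral measure lebesgue (g ` T)) T"
    proof (subst has_measure_differentiable_image[symmetric])
      show "T \<in> sets lebesgue" by simp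
      show "(g has_derivative g' x) (at x within T)" if "x \<in> T" for x
        using der[of x] that TS by (auto intro: has_derivative_at_withinI)
      show "inj_on g T" using inj TS by (rule inj_on_subset)
    qed (use lm in auto)
    then have "(\<integral>\<^sup>+x. ennreal \<bar>det (matrix (g' x))\<bar> * indicator T x \<partial>lborel) = ennreal (measure lebesgue (g ` T))"
      by (rule nn_integral_has_integral_lebesgue'[rotated]) simp
    also have "\<dots> = emeasure lborel (g ` T)"
      using fin gT' by (simp add: emeasure_eq_ennreal_measure less_top)
    finally have 1: "(\<integral>\<^sup>+x. ennreal \<bar>det (matrix (g' x))\<bar> * indicator T x \<partial>lborel) = emeasure lborel (g ` S \<inter> B)"
      by (simp add: gT)
    have "G -` B \<in> sets borel"
      using measurable_sets_borel[OF \<open>G \<in> borel_measurable borel\<close> \<open>B \<in> sets borel\<close>] .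
    then have "emeasure M B = (\<integral>\<^sup>+x. ennreal (J x) * indicator (G -` B) x \<partial>lborel)"
      unfolding M_def by (subst emeasure_distr) (auto simp: emeasure_density)
    also have "\<dots> = (\<integral>\<^sup>+x. ennreal \<bar>det (matrix (g' x))\<bar> * indicator T x \<partial>lborel)"
      by (intro nn_integral_cong) (auto simp: J_def T_def indicator_def)
    also have "\<dots> = emeasure lborel (g ` S \<inter> B)" by (rule 1)
    also have "\<dots> = emeasure N B"
      unfolding N_def using img(1)
      by (subst emeasure_density) (auto simp flip: indicator_inter_arith simp: mult.commute Int_commute)
    finally show "emeasure M B = emeasure N B" .
  qed
  have "(\<integral>\<^sup>+y\<in>g ` S. f y \<partial>lborel) = (\<integral>\<^sup>+y. f y \<partial>N)"
    unfolding N_def using img(1) by (subst nn_integral_density) (auto simp: mult.commute)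
  also have "\<dots> = (\<integral>\<^sup>+y. f y \<partial>M)" by (simp add: \<open>M = N\<close>)
  also have "\<dots> = (\<integral>\<^sup>+x. ennreal (J x) * f (G x) \<partial>lborel)"
    unfolding M_def by (subst nn_integral_distr) (auto simp: nn_integral_density)
  also have "\<dots> = (\<integral>\<^sup>+x\<in>S. f (g x) * ennreal \<bar>det (matrix (g' x))\<bar> \<partial>lborel)"
    by (intro nn_integral_cong) (auto simp: J_def G_def indicator_def mult.commute)
  finally show ?thesis .
qed

lemma Basis_real2: "(Basis :: (real^2) set) = {axis 1 1, axis 2 1}"
  by (auto simp: Basis_vec_def UNIV_2)

lemma axis_2_neq: "axis 1 (1::real) \<noteq> (axis 2 1 :: real^2)"
  by (simp add: axis_eq_axis)

lemma inner_real2: "(x :: real^2) \<bullet> y = x $ 1 * y $ 1 + x $ 2 * y $ 2"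
  by (simp add: inner_vec_def sum_2)

lemma box_real2: "box l u = {x :: real^2. l $ 1 < x $ 1 \<and> x $ 1 < u $ 1 \<and> l $ 2 < x $ 2 \<and> x $ 2 < u $ 2}"
  by (auto simp: box_def Basis_real2 inner_axis)

lemma vec2_measurable [measurable]:
  "(\<lambda>p. vector [fst p, snd p] :: real^2) \<in> borel_measurable (lborel \<Otimes>\<^sub>M lborel)"
proof -
  have "(\<lambda>p. vector [fst p, snd p] :: real^2) = (\<lambda>p. fst p *\<^sub>R axis 1 1 + snd p *\<^sub>R axis 2 1)"
    by (auto simp: fun_eq_iff vec_eq_iff forall_2 axis_def)
  also have "\<dots> \<in> borel_measurable (lborel \<Otimes>\<^sub>M lborel)" by measurable
  finally show ?thesis .
qed

lemma lborel_real2: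
  "lborel = distr (lborel \<Otimes>\<^sub>M lborel) borel (\<lambda>p. vector [fst p, snd p] :: real^2)"
proof (rule lborel_eqI)
  fix l u :: "real^2" assume le: "\<And>b. b \<in> Basis \<Longrightarrow> l \<bullet> b \<le> u \<bullet> b"
  have le': "l $ 1 \<le> u $ 1" "l $ 2 \<le> u $ 2"
    using le[of "axis 1 1"] le[of "axis 2 1"] by (auto simp: Basis_real2 inner_axis)
  have "(\<lambda>p. vector [fst p, snd p] :: real^2) -` box l u \<inter> space (lborel \<Otimes>\<^sub>M lborel)
      = {l $ 1<..<u $ 1} \<times> {l $ 2<..<u $ 2}"
    by (auto simp: box_real2 space_pair_measure)
  then show "emeasure (distr (lborel \<Otimes>\<^sub>M lborel) borel (\<lambda>p. vector [fst p, snd p] :: real^2)) (box l u)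
      = ennreal (\<Prod>b\<in>Basis. (u - l) \<bullet> b)"
    using le' by (subst emeasure_distr)
      (auto simp: lborel.emeasure_pair_measure_Times Basis_real2 axis_2_neq inner_axis ennreal_mult)
qed simp

lemma nn_integral_real2:
  assumes [measurable]: "f \<in> borel_measurable borel"
  shows "(\<integral>\<^sup>+x. f x \<partial>(lborel :: (real^2) measure)) =
    (\<integral>\<^sup>+p. f (vector [fst p, snd p]) \<partial>(lborel \<Otimes>\<^sub>M lborel))"
  by (subst lborel_real2, subst nn_integral_distr) auto

lemma integrable_real2:
  fixes f :: "real^2 \<Rightarrow> real"
  assumes "integrable lborel f"
  shows "integrable (lborel \<Otimes>\<^sub>M lborel) (\<lambda>p. f (vector [fst p, snd p]))"
    and "(LINT x|lborel. f x) = (LINT p|(lborel \<Otimes>\<^sub>M lborel). f (vector [fst p, snd p]))"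
proof -
  have [measurable]: "f \<in> borel_measurable borel" using assms by auto
  show "integrable (lborel \<Otimes>\<^sub>M lborel) (\<lambda>p. f (vector [fst p, snd p]))"
    using assms by (subst (asm) lborel_real2, subst (asm) integrable_distr_eq) auto
  show "(LINT x|lborel. f x) = (LINT p|(lborel \<Otimes>\<^sub>M lborel). f (vector [fst p, snd p]))"
    by (subst lborel_real2, subst integral_distr) auto
qed

text \<open>By Fubini's theorem the integral may be taken first along lines in the direction of
  \<open>axis j 1\<close>. On each line it is a difference of two values of \<open>f\<close> beyond
  the support.\<close>

lemma integral_partial_derivative_zero:
  fixes f :: "real^2 \<Rightarrow> real"
  assumes f: "smooth f" and supp: "compact (closure {x. f x \<noteq> 0})"
  shows "integrable lborel (\<lambda>x. frechet_derivative f (at x) (axis j 1))"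
    and "(LINT x|lborel. frechet_derivative f (at x) (axis j 1)) = 0"
proof -
  define F where "F x = frechet_derivative f (at x) (axis j 1)" for x
  have contF: "continuous_on S F" for S
    unfolding F_def by (intro smooth_continuous_on smooth_partial f)
  obtain R where R: "R > 0" "\<And>x. f x \<noteq> 0 \<Longrightarrow> norm x \<le> R"
    using compact_imp_bounded[OF supp] bounded_pos closure_subset by (metis (mono_tags, lifting) mem_Collect_eq subsetD)
  have F0: "F x = 0" if "norm x > R" for x
  proof -
    have "(f has_derivative (\<lambda>h. 0)) (at x)"
      by (rule has_derivative_transform_within_open[where f = "\<lambda>_. 0" and s = "{x. norm x > R}"])
         (use that R(2) in \<open>force simp: open_Collect_less continuous_on_norm_id\<close>)+
    then have "frechet_derivative f (at x) = (\<lambda>h. 0)"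
      using frechet_derivative_at by metis
    then show ?thesis by (simp add: F_def)
  qed
  have int: "integrable lborel F"
  proof -
    have "set_integrable lborel (cball 0 R) F"
      unfolding set_integrable_def by (rule borel_integrable_compact) (auto intro: contF)
    moreover have "(\<lambda>x. indicator (cball 0 R) x *\<^sub>R F x) = F"
      using F0 by (auto simp: fun_eq_iff indicator_def)
    ultimately show ?thesis by (simp add: set_integrable_def)
  qed
  then show "integrable lborel (\<lambda>x. frechet_derivative f (at x) (axis j 1))" unfolding F_def .
  \<comment> \<open>The normalisation \<open>c $ j = 0\<close> makes the modulus of \<open>t\<close>
    a lower bound for the norm of the point with parameter \<open>t\<close>. Leaving the interval of
    radius \<open>R + 1\<close> therefore means leaving the support.\<close>
  have line: "(LINT t|lborel. F (c + t *\<^sub>R axis j 1)) = 0" if "c $ j = 0" for c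
  proof -
    have "(LINT t|lborel. F (c + t *\<^sub>R axis j 1)) =
        (LINT t|lborel. F (c + t *\<^sub>R axis j 1) * indicator {- (R + 1)..R + 1} t)"
    proof (rule Bochner_Integration.integral_cong)
      fix t
      have "\<bar>(c + t *\<^sub>R axis j 1) $ j\<bar> \<le> norm (c + t *\<^sub>R axis j 1)" by (rule component_le_norm_cart)
      then have "\<bar>t\<bar> \<le> norm (c + t *\<^sub>R axis j 1)" using that by simp
      then show "F (c + t *\<^sub>R axis j 1) = F (c + t *\<^sub>R axis j 1) * indicator {- (R + 1)..R + 1} t"
        using F0[of "c + t *\<^sub>R axis j 1"] R(1)
        by (cases "norm (c + t *\<^sub>R axis j 1) > R") (auto simp: indicator_def)
    qed simp
    also have "\<dots> = f (c + (R + 1) *\<^sub>R axis j 1) - f (c + (- (R + 1)) *\<^sub>R axis j 1)"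
    proof (rule integral_FTC_Icc_real)
      show "- (R + 1) \<le> R + 1" using R by simp
      fix t
      have "((\<lambda>t. c + t *\<^sub>R axis j 1) has_derivative (\<lambda>h. h *\<^sub>R axis j 1)) (at t)"
        by (auto intro!: derivative_eq_intros)
      from has_derivative_compose[OF this smooth_has_derivative[OF f]]
      have d: "((\<lambda>t. f (c + t *\<^sub>R axis j 1)) has_derivative
          (\<lambda>h. frechet_derivative f (at (c + t *\<^sub>R axis j 1)) (h *\<^sub>R axis j 1))) (at t)" .
      have "linear (frechet_derivative f (at (c + t *\<^sub>R axis j 1)))"
        using smooth_has_derivative[OF f] has_derivative_linear by blast
      with d show "((\<lambda>t. f (c + t *\<^sub>R axis j 1)) has_real_derivative F (c + t *\<^sub>R axis j 1)) (at t)"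
        by (simp add: has_field_derivative_def F_def linear_cmul mult.commute[of _ "frechet_derivative _ _ _"])
      show "isCont (\<lambda>t. F (c + t *\<^sub>R axis j 1)) t"
        by (rule continuous_on_interior[of UNIV]) (auto intro!: continuous_on_compose2[OF contF] continuous_intros)
    qed
    also have "\<dots> = 0"
    proof -
      have *: "f (c + t *\<^sub>R axis j 1) = 0" if "\<bar>t\<bar> > R" for t
      proof -
        have "\<bar>(c + t *\<^sub>R axis j 1) $ j\<bar> \<le> norm (c + t *\<^sub>R axis j 1)" by (rule component_le_norm_cart)
        then have "norm (c + t *\<^sub>R axis j 1) > R" using that \<open>c $ j = 0\<close> by simp
        then show ?thesis using R(2) by force
      qed
      show ?thesis using *[of "R + 1"] *[of "- (R + 1)"] R(1) by auto
    qed
    finally show ?thesis .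
  qed
  have "(LINT x|lborel. F x) = (LINT p|(lborel \<Otimes>\<^sub>M lborel). F (vector [fst p, snd p]))"
    by (rule integrable_real2(2)[OF int])
  also have "\<dots> = 0"
  proof -
    have I: "integrable (lborel \<Otimes>\<^sub>M lborel) (\<lambda>(x, y). F (vector [x, y]))"
      using integrable_real2(1)[OF int] by (simp add: case_prod_beta')
    have e1: "vector [x, y] = vector [0, y] + x *\<^sub>R (axis 1 1 :: real^2)" for x y :: real
      by (auto simp: vec_eq_iff forall_2 axis_def)
    have e2: "vector [x, y] = vector [x, 0] + y *\<^sub>R (axis 2 1 :: real^2)" for x y :: real
      by (auto simp: vec_eq_iff forall_2 axis_def)
    consider "j = 1" | "j = 2" using exhaust_2 by blast
    then show ?thesis
    proof cases
      case 1
      have "(LINT x|lborel. F (vector [x, y])) = 0" for y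
        using line[of "vector [0, y]"] 1 by (simp flip: e1)
      then show ?thesis
        using lborel_pair.integral_snd[OF I] by (simp add: case_prod_beta')
    next
      case 2
      have "(LINT y|lborel. F (vector [x, y])) = 0" for x
        using line[of "vector [x, 0]"] 2 by (simp flip: e2)
      then show ?thesis
        using lborel_pair.integral_fst[OF I] by (simp add: case_prod_beta')
    qed
  qed
  finally show "(LINT x|lborel. frechet_derivative f (at x) (axis j 1)) = 0" unfolding F_def .
qed

section \<open>Polar coordinates with the squared radius as first coordinate\<close>

definition perp :: "real^2 \<Rightarrow> real^2" where
  "perp x = vector [- x $ 2, x $ 1]"

lemma perp_nth [simp]: "perp x $ 1 = - x $ 2" "perp x $ 2 = x $ 1"
  by (simp_all add: perp_def)

lemma er_nth [simp]: "e\<^sub>r \<theta> $ 1 = cos \<theta>" "e\<^sub>r \<theta> $ 2 = sin \<theta>"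
  by (simp_all add: e\<^sub>r_def)

lemma bounded_linear_perp: "bounded_linear perp"
  unfolding linear_conv_bounded_linear[symmetric] by (auto intro!: linearI simp: vec_eq_iff forall_2)

lemma norm_er [simp]: "norm (e\<^sub>r \<theta>) = 1"
  by (simp add: norm_eq_sqrt_inner inner_real2 flip: power2_eq_square)

lemma norm_real2: "(norm (x::real^2))\<^sup>2 = (x $ 1)\<^sup>2 + (x $ 2)\<^sup>2"
  unfolding power2_norm_eq_inner inner_real2 by (simp add: power2_eq_square)

text \<open>The first argument is the square of the radius. In these coordinates the Jacobian is the
  constant 1/2, which removes the weight r from all integrals.\<close>

definition polar :: "real \<Rightarrow> real \<Rightarrow> real^2" where
  "polar s \<theta> = sqrt s *\<^sub>R e\<^sub>r \<theta>"

lemma polar_nth: "polar s \<theta> $ 1 = sqrt s * cos \<theta>" "polar s \<theta> $ 2 = sqrt s * sin \<theta>"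
  by (simp_all add: polar_def)

lemma norm_polar: "0 \<le> s \<Longrightarrow> (norm (polar s \<theta>))\<^sup>2 = s"
  by (simp add: polar_def)

lemma polar_annulus: "0 < a \<Longrightarrow> s \<in> {a\<^sup>2<..<b\<^sup>2} \<Longrightarrow> 0 < b \<Longrightarrow> polar s \<theta> \<in> annulus a b"
  using real_less_rsqrt[of a s] real_sqrt_less_mono[of s "b\<^sup>2"] order.strict_trans[of 0 "a\<^sup>2" s]
  by (auto simp: polar_def annulus_def)

lemma open_annulus: "open (annulus a b)"
proof -
  have "annulus a b = {x. a < norm x} \<inter> {x. norm x < b}" by (auto simp: annulus_def)
  then show ?thesis by (auto intro!: open_Int open_Collect_less continuous_intros)
qed

lemma annulus_sets [measurable]: "annulus a b \<in> sets borel" "annulus a b \<in> sets lebesgue"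
  using open_annulus by auto

lemma emeasure_annulus_finite: "emeasure lborel (annulus a b) < \<infinity>"
proof -
  have "annulus a b \<subseteq> ball 0 b" by (auto simp: annulus_def)
  then have "emeasure lborel (annulus a b) \<le> emeasure lborel (ball (0::real^2) b)"
    by (intro emeasure_mono) auto
  then show ?thesis using emeasure_lborel_ball_finite le_less_trans by blast
qed

lemma er_alt: "e\<^sub>r \<theta> = cos \<theta> *\<^sub>R axis 1 1 + sin \<theta> *\<^sub>R axis 2 1"
  by (auto simp: vec_eq_iff forall_2 axis_def)

lemma continuous_on_er [continuous_intros]:
  fixes f :: "'a::t2_space \<Rightarrow> real"
  shows "continuous_on S f \<Longrightarrow> continuous_on S (\<lambda>x. e\<^sub>r (f x))"
  unfolding er_alt by (intro continuous_intros)

lemma continuous_on_polar [continuous_intros]: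
  fixes f :: "'a::t2_space \<Rightarrow> real"
  shows "continuous_on S f \<Longrightarrow> continuous_on S g \<Longrightarrow> continuous_on S (\<lambda>x. polar (f x) (g x))"
  unfolding polar_def by (intro continuous_intros)

lemma polar_measurable [measurable]:
  "(\<lambda>p. polar (fst p) (snd p)) \<in> borel_measurable (lborel \<Otimes>\<^sub>M lborel)"
  by (simp add: lborel_prod borel_measurable_continuous_onI continuous_intros)

lemma er_surj:
  assumes "norm x = 1"
  obtains \<theta> where "0 \<le> \<theta>" "\<theta> < 2 * pi" "x = e\<^sub>r \<theta>"
proof -
  have "(x $ 1)\<^sup>2 + (x $ 2)\<^sup>2 = 1" using assms norm_real2[of x] by simp
  then obtain t where "0 \<le> t" "t < 2 * pi" "x $ 1 = cos t" "x $ 2 = sin t"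
    by (rule sincos_total_2pi)
  then show ?thesis by (intro that[of t]) (auto simp: vec_eq_iff forall_2)
qed

lemma polar_surj:
  obtains \<theta> where "0 \<le> \<theta>" "\<theta> < 2 * pi" "x = norm x *\<^sub>R e\<^sub>r \<theta>"
proof (cases "x = 0")
  case True
  then show ?thesis by (intro that[of 0]) auto
next
  case False
  then have "norm (x /\<^sub>R norm x) = 1" by simp
  then obtain \<theta> where "0 \<le> \<theta>" "\<theta> < 2 * pi" "x /\<^sub>R norm x = e\<^sub>r \<theta>"
    by (rule er_surj)
  then show ?thesis using False
    by (intro that[of \<theta>]) (auto simp flip: \<open>x /\<^sub>R norm x = e\<^sub>r \<theta>\<close>)
qed

text \<open>The open rectangle of parameters makes the coordinate map injective; its image misses
  only the ray at angle 0, which is contained in a line and hence null.\<close>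

lemma nn_integral_polar:
  assumes ab: "0 < a" "a < b" and f[measurable]: "f \<in> borel_measurable borel"
  shows "(\<integral>\<^sup>+x\<in>annulus a b. f x \<partial>lborel) = ennreal (1 / 2) *
    (\<integral>\<^sup>+p. f (polar (fst p) (snd p)) * indicator ({a\<^sup>2<..<b\<^sup>2} \<times> {0<..<2 * pi}) p \<partial>(lborel \<Otimes>\<^sub>M lborel))"
proof -
  define g where "g x = polar (x $ 1) (x $ 2)" for x :: "real^2"
  define S :: "(real^2) set" where "S = box (vector [a\<^sup>2, 0]) (vector [b\<^sup>2, 2 * pi])"
  define g' where "g' x h = (h $ 1 / (2 * sqrt (x $ 1))) *\<^sub>R e\<^sub>r (x $ 2) + (sqrt (x $ 1) * h $ 2) *\<^sub>R perp (e\<^sub>r (x $ 2))"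
    for x h :: "real^2"
  define ray where "ray = {x :: real^2. x $ 2 = 0 \<and> 0 \<le> x $ 1}"
  have S_iff: "x \<in> S \<longleftrightarrow> a\<^sup>2 < x $ 1 \<and> x $ 1 < b\<^sup>2 \<and> 0 < x $ 2 \<and> x $ 2 < 2 * pi" for x :: "real^2"
    by (auto simp: S_def box_real2)
  have Spos: "0 < x $ 1" if "x \<in> S" for x :: "real^2"
    using that ab unfolding S_iff by (smt (verit) zero_le_power2)
  have der: "(g has_derivative g' x) (at x)" if "x \<in> S" for x
  proof -
    have [derivative_intros]: "((\<lambda>x::real^2. x $ i) has_derivative (\<lambda>h. h $ i)) (at x)" for i
      by (rule bounded_linear_imp_has_derivative) (rule bounded_linear_vec_nth)
    have [simp]: "sqrt (x $ 1) * (sqrt (x $ 1) * z) = x $ 1 * z" for z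
      using Spos[OF that] by (simp flip: mult.assoc)
    show ?thesis
      unfolding g_def polar_def er_alt using Spos[OF that]
      by (auto intro!: derivative_eq_intros simp: fun_eq_iff g'_def vec_eq_iff forall_2 axis_def field_simps)
  qed
  have det: "det (matrix (g' x)) = 1 / 2" if "x \<in> S" for x
  proof -
    have "det (matrix (g' x)) = ((cos (x $ 2))\<^sup>2 + (sin (x $ 2))\<^sup>2) / 2"
      using Spos[OF that] by (simp add: det_2 matrix_def g'_def axis_def field_simps power2_eq_square)
    then show ?thesis by simp
  qed
  have inj: "inj_on g S"
  proof (rule inj_onI)
    fix x y assume xy: "x \<in> S" "y \<in> S" "g x = g y"
    have "(norm (g x))\<^sup>2 = (norm (g y))\<^sup>2" using xy by simp
    then have 1: "x $ 1 = y $ 1" using Spos xy by (simp add: g_def norm_polar less_imp_le)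
    then have "e\<^sub>r (x $ 2) = e\<^sub>r (y $ 2)" using xy Spos[of x] by (simp add: g_def polar_def)
    then have "sin (x $ 2) = sin (y $ 2) \<and> cos (x $ 2) = cos (y $ 2)"
      using er_nth by metis
    then obtain n :: int where n: "x $ 2 = y $ 2 + 2 * pi * n"
      using sin_cos_eq_iff by blast
    have "\<bar>2 * pi * real_of_int n\<bar> < 2 * pi * 1" using n xy unfolding S_iff by auto
    then have "\<bar>real_of_int n\<bar> < 1" by (simp add: abs_mult)
    then have "n = 0" by linarith
    then show "x = y" using 1 n by (auto simp: vec_eq_iff forall_2)
  qed
  have img: "g ` S = annulus a b - ray"
  proof
    show "g ` S \<subseteq> annulus a b - ray"
    proof
      fix y assume "y \<in> g ` S"
      then obtain x where x: "x \<in> S" "y = g x" by auto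
      then have "y \<in> annulus a b" using polar_annulus[of a "x $ 1" b "x $ 2"] ab
        by (auto simp: g_def S_iff)
      moreover have "y \<notin> ray"
      proof
        assume "y \<in> ray"
        then have *: "sin (x $ 2) = 0" "0 \<le> cos (x $ 2)"
          using x Spos[of x] by (auto simp: ray_def g_def polar_nth zero_le_mult_iff)
        have "\<bar>x $ 2 - pi\<bar> < pi" using x by (auto simp: S_iff)
        moreover have "sin (x $ 2 - pi) = 0" using * by (simp add: sin_diff)
        ultimately have "x $ 2 = pi" using sin_zero_pi_iff by fastforce
        then show False using * by simp
      qed
      ultimately show "y \<in> annulus a b - ray" by blast
    qed
    show "annulus a b - ray \<subseteq> g ` S"
    proof
      fix y assume y: "y \<in> annulus a b - ray"
      obtain \<theta> where t: "0 \<le> \<theta>" "\<theta> < 2 * pi" "y = norm y *\<^sub>R e\<^sub>r \<theta>" by (rule polar_surj)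
      have "\<theta> \<noteq> 0"
      proof
        assume "\<theta> = 0"
        then have "y $ 1 = norm y" "y $ 2 = 0"
          using arg_cong[OF t(3), of "\<lambda>v :: real^2. v $ 1"] arg_cong[OF t(3), of "\<lambda>v :: real^2. v $ 2"] by auto
        then show False using y by (auto simp: ray_def)
      qed
      then have "vector [(norm y)\<^sup>2, \<theta>] \<in> S"
        using t y ab by (auto simp: S_iff annulus_def intro!: power_strict_mono)
      moreover have "y = g (vector [(norm y)\<^sup>2, \<theta>])"
        using t(3) by (simp add: g_def polar_def)
      ultimately show "y \<in> g ` S" by blast
    qed
  qed
  have ray: "closed ray"
  proof -
    have "ray = {x. x $ 2 = 0} \<inter> {x. 0 \<le> x $ 1}" by (auto simp: ray_def)
    then show ?thesis by (auto intro!: closed_Int closed_Collect_eq closed_Collect_le continuous_intros)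
  qed
  have "negligible {x :: real^2. x \<bullet> axis 2 1 = 0}"
    by (rule negligible_standard_hyperplane) (simp add: Basis_real2)
  then have "AE x in lebesgue. x \<notin> {x :: real^2. x \<bullet> axis 2 1 = 0}"
    by (intro AE_not_in) (simp add: negligible_iff_null_sets)
  then have AEray: "AE x in lborel. x \<notin> ray"
    by (auto simp: AE_completion_iff ray_def inner_axis elim: AE_mp)
  have "(\<integral>\<^sup>+x\<in>annulus a b. f x \<partial>lborel) = (\<integral>\<^sup>+x\<in>g ` S. f x \<partial>lborel)"
    by (rule nn_integral_cong_AE) (use AEray in eventually_elim, auto simp: img indicator_def)
  also have "\<dots> = (\<integral>\<^sup>+x\<in>S. f (g x) * ennreal \<bar>det (matrix (g' x))\<bar> \<partial>lborel)"
  proof (rule nn_integral_change_of_variables[OF _ der inj])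
    show "g ` S \<in> sets borel" unfolding img using ray by simp
    have "emeasure lborel (g ` S) \<le> emeasure lborel (annulus a b)"
      unfolding img by (intro emeasure_mono) auto
    then show "emeasure lborel (g ` S) < \<infinity>" using emeasure_annulus_finite le_less_trans by blast
    show "continuous_on S (\<lambda>x. det (matrix (g' x)))"
      by (rule continuous_on_eq[OF continuous_on_const]) (rule det[symmetric])
  qed (auto simp: S_def open_box)
  also have "\<dots> = (\<integral>\<^sup>+x. ennreal (1 / 2) * (f (polar (x $ 1) (x $ 2)) * indicator S x) \<partial>lborel)"
    by (intro nn_integral_cong) (auto simp: indicator_def det g_def mult.commute)
  also have "\<dots> = (\<integral>\<^sup>+p. ennreal (1 / 2) * (f (polar (fst p) (snd p)) * indicator S (vector [fst p, snd p])) \<partial>(lborel \<Otimes>\<^sub>M lborel))"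
  proof (subst nn_integral_real2)
    have "(\<lambda>x::real^2. polar (x $ 1) (x $ 2)) \<in> borel_measurable borel"
      by (intro borel_measurable_continuous_onI continuous_intros)
    then show "(\<lambda>x. ennreal (1 / 2) * (f (polar (x $ 1) (x $ 2)) * indicator S x)) \<in> borel_measurable borel"
      using open_box by (auto simp: S_def)
  qed simp
  also have "\<dots> = (\<integral>\<^sup>+p. ennreal (1 / 2) * (f (polar (fst p) (snd p)) * indicator ({a\<^sup>2<..<b\<^sup>2} \<times> {0<..<2 * pi}) p) \<partial>(lborel \<Otimes>\<^sub>M lborel))"
    by (intro nn_integral_cong) (auto simp: indicator_def S_iff)
  also have "\<dots> = ennreal (1 / 2) * (\<integral>\<^sup>+p. (f (polar (fst p) (snd p)) * indicator ({a\<^sup>2<..<b\<^sup>2} \<times> {0<..<2 * pi}) p) \<partial>(lborel \<Otimes>\<^sub>M lborel))"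
    by (rule nn_integral_cmult) measurable
  finally show ?thesis .
qed

text \<open>Null sets are carried over through the integral of their indicator: the exceptional set
  is enlarged to a Borel null set \<open>N\<close>, whose indicator has integral 0 in either
  coordinate system. The same device is used below for radial functions and for twists.\<close>

lemma AE_polar:
  assumes ab: "0 < a" "a < b" and ae: "AE x in lborel. x \<in> annulus a b \<longrightarrow> Q x"
  shows "AE p in lborel \<Otimes>\<^sub>M lborel. p \<in> {a\<^sup>2<..<b\<^sup>2} \<times> {0<..<2 * pi} \<longrightarrow> Q (polar (fst p) (snd p))"
proof -
  obtain N where N: "N \<in> sets lborel" "emeasure lborel N = 0" "{x. \<not> (x \<in> annulus a b \<longrightarrow> Q x)} \<subseteq> N"
    using AE_E[OF ae] by auto
  have [measurable]: "N \<in> sets borel" using N by simp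
  have "(\<integral>\<^sup>+x\<in>annulus a b. indicator N x \<partial>lborel) \<le> (\<integral>\<^sup>+x. indicator N x \<partial>lborel)"
    by (intro nn_integral_mono) (auto simp: indicator_def)
  then have "(\<integral>\<^sup>+x\<in>annulus a b. indicator N x \<partial>lborel) = 0" using N by simp
  then have "(\<integral>\<^sup>+p. indicator N (polar (fst p) (snd p)) * indicator ({a\<^sup>2<..<b\<^sup>2} \<times> {0<..<2 * pi}) p \<partial>(lborel \<Otimes>\<^sub>M lborel)) = (0::ennreal)"
    by (subst (asm) nn_integral_polar[OF ab]) auto
  then have "AE p in lborel \<Otimes>\<^sub>M lborel. indicator N (polar (fst p) (snd p)) * indicator ({a\<^sup>2<..<b\<^sup>2} \<times> {0<..<2 * pi}) p = (0::ennreal)"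
    by (subst (asm) nn_integral_0_iff_AE) measurable
  then show ?thesis
  proof eventually_elim
    case (elim p)
    show ?case
    proof
      assume p: "p \<in> {a\<^sup>2<..<b\<^sup>2} \<times> {0<..<2 * pi}"
      then have "polar (fst p) (snd p) \<notin> N" using elim by (auto simp: indicator_def)
      moreover have "polar (fst p) (snd p) \<in> annulus a b" using p ab by (intro polar_annulus) auto
      ultimately show "Q (polar (fst p) (snd p))" using N(3) by blast
    qed
  qed
qed

text \<open>The order of the quantifiers is the point: for almost every ray, the property holds at
  almost every point of that ray. The factors of the product measure are swapped to obtain
  it.\<close>

lemma AE_polar_theta:
  assumes ab: "0 < a" "a < b" and ae: "AE x in lborel. x \<in> annulus a b \<longrightarrow> Q x"
  shows "AE \<theta> in lborel. AE s in lborel. \<theta> \<in> {0<..<2 * pi} \<and> s \<in> {a\<^sup>2<..<b\<^sup>2} \<longrightarrow> Q (polar s \<theta>)"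
proof -
  have "AE p in distr (lborel \<Otimes>\<^sub>M lborel) (lborel \<Otimes>\<^sub>M lborel) (\<lambda>(x, y). (y, x)).
      p \<in> {a\<^sup>2<..<b\<^sup>2} \<times> {0<..<2 * pi} \<longrightarrow> Q (polar (fst p) (snd p))"
    using AE_polar[OF ab ae] by (subst (asm) lborel_pair.distr_pair_swap)
  from AE_distrD[OF _ this]
  have "AE p in lborel \<Otimes>\<^sub>M lborel. (snd p, fst p) \<in> {a\<^sup>2<..<b\<^sup>2} \<times> {0<..<2 * pi} \<longrightarrow> Q (polar (snd p) (fst p))"
    by (simp add: case_prod_beta')
  from lborel_pair.AE_pair[OF this] show ?thesis
    by (auto elim!: AE_mp)
qed

lemma nn_integral_radial:
  assumes ab: "0 < a" "a < b" and f[measurable]: "f \<in> borel_measurable borel"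
  shows "(\<integral>\<^sup>+x\<in>annulus a b. f ((norm x)\<^sup>2) \<partial>lborel) = ennreal pi * (\<integral>\<^sup>+s\<in>{a\<^sup>2<..<b\<^sup>2}. f s \<partial>lborel)"
proof -
  have pos: "0 \<le> s" if "s \<in> {a\<^sup>2<..<b\<^sup>2}" for s
    using that by (smt (verit) greaterThanLessThan_iff zero_le_power2)
  have "(\<integral>\<^sup>+x\<in>annulus a b. f ((norm x)\<^sup>2) \<partial>lborel) = ennreal (1 / 2) *
    (\<integral>\<^sup>+p. f ((norm (polar (fst p) (snd p)))\<^sup>2) * indicator ({a\<^sup>2<..<b\<^sup>2} \<times> {0<..<2 * pi}) p \<partial>(lborel \<Otimes>\<^sub>M lborel))"
    by (rule nn_integral_polar[OF ab]) measurable
  also have "(\<integral>\<^sup>+p. f ((norm (polar (fst p) (snd p)))\<^sup>2) * indicator ({a\<^sup>2<..<b\<^sup>2} \<times> {0<..<2 * pi}) p \<partial>(lborel \<Otimes>\<^sub>M lborel))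
     = (\<integral>\<^sup>+p. (\<lambda>(s, \<theta>). (f s * indicator {a\<^sup>2<..<b\<^sup>2} s) * indicator {0<..<2 * pi} \<theta>) p \<partial>(lborel \<Otimes>\<^sub>M lborel))"
    by (intro nn_integral_cong) (auto simp: indicator_def norm_polar pos)
  also have "\<dots> = (\<integral>\<^sup>+s. \<integral>\<^sup>+\<theta>. (f s * indicator {a\<^sup>2<..<b\<^sup>2} s) * indicator {0<..<2 * pi} \<theta> \<partial>lborel \<partial>lborel)"
    by (subst lborel.nn_integral_fst[symmetric]) auto
  also have "\<dots> = (\<integral>\<^sup>+s. (f s * indicator {a\<^sup>2<..<b\<^sup>2} s) * ennreal (2 * pi) \<partial>lborel)"
    by (simp add: nn_integral_cmult)
  also have "\<dots> = (\<integral>\<^sup>+s\<in>{a\<^sup>2<..<b\<^sup>2}. f s \<partial>lborel) * ennreal (2 * pi)"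
    by (rule nn_integral_multc) measurable
  also have "ennreal (1 / 2) * \<dots> = (ennreal (1 / 2) * ennreal (2 * pi)) * (\<integral>\<^sup>+s\<in>{a\<^sup>2<..<b\<^sup>2}. f s \<partial>lborel)"
    by (simp only: ac_simps)
  also have "ennreal (1 / 2) * ennreal (2 * pi) = ennreal pi"
    by (subst ennreal_mult[symmetric]) auto
  finally show ?thesis .
qed

lemma AE_radialI:
  assumes ab: "0 < a" "a < b" and ae: "AE s in lborel. s \<in> {a\<^sup>2<..<b\<^sup>2} \<longrightarrow> P s"
  shows "AE x in lborel. x \<in> annulus a b \<longrightarrow> P ((norm x)\<^sup>2)"
proof -
  obtain N where N: "N \<in> sets lborel" "emeasure lborel N = 0" "{s. \<not> (s \<in> {a\<^sup>2<..<b\<^sup>2} \<longrightarrow> P s)} \<subseteq> N"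
    using AE_E[OF ae] by auto
  have [measurable]: "N \<in> sets borel" using N by simp
  have "(\<integral>\<^sup>+s\<in>{a\<^sup>2<..<b\<^sup>2}. indicator N s \<partial>lborel) \<le> (\<integral>\<^sup>+s. indicator N s \<partial>lborel)"
    by (intro nn_integral_mono) (auto simp: indicator_def)
  then have "(\<integral>\<^sup>+s\<in>{a\<^sup>2<..<b\<^sup>2}. indicator N s \<partial>lborel) = 0" using N by simp
  then have "(\<integral>\<^sup>+x\<in>annulus a b. indicator N ((norm x)\<^sup>2) \<partial>lborel) = (0::ennreal)"
    by (subst nn_integral_radial[OF ab]) auto
  then have "AE x in lborel. indicator N ((norm x)\<^sup>2) * indicator (annulus a b) x = (0::ennreal)"
    by (subst (asm) nn_integral_0_iff_AE) measurable
  then show ?thesis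
  proof eventually_elim
    case (elim x)
    show ?case
    proof
      assume x: "x \<in> annulus a b"
      then have "(norm x)\<^sup>2 \<notin> N" using elim by (auto simp: indicator_def)
      moreover have "(norm x)\<^sup>2 \<in> {a\<^sup>2<..<b\<^sup>2}"
        using x ab by (auto simp: annulus_def intro!: power_strict_mono)
      ultimately show "P ((norm x)\<^sup>2)" using N(3) by blast
    qed
  qed
qed

section \<open>Weak gradients\<close>

lemma borel_measurable_vec_nth [measurable (raw)]:
  fixes f :: "'a \<Rightarrow> 'b::real_normed_vector ^ 'n"
  assumes "f \<in> borel_measurable M"
  shows "(\<lambda>x. f x $ i) \<in> borel_measurable M"
  by (rule measurable_compose[OF assms]) (auto intro!: borel_measurable_continuous_onI continuous_intros)

text \<open>The notions of the theorem live on \<open>lebesgue\<close>, while composition and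
  Fubini's theorem are used for Borel functions on \<open>lborel\<close>. Each coordinate is
  replaced by a Borel function equal to it almost everywhere.\<close>

lemma borel_representative:
  fixes f :: "real^2 \<Rightarrow> 'b::euclidean_space"
  assumes "set_borel_measurable lebesgue S f"
  obtains f' where "f' \<in> borel_measurable borel" "AE x in lborel. x \<in> S \<longrightarrow> f x = f' x"
proof -
  have "\<exists>g. g \<in> borel_measurable borel \<and> (AE x in lborel. (indicator S x *\<^sub>R f x) \<bullet> b = g x)" for b
  proof -
    have "(\<lambda>x. (indicator S x *\<^sub>R f x) \<bullet> b) \<in> borel_measurable lebesgue"
      using assms unfolding set_borel_measurable_def by measurable
    from completion_ex_borel_measurable_real[OF this] show ?thesis by auto
  qed
  then have "\<forall>b. \<exists>g. g \<in> borel_measurable borel \<and> (AE x in lborel. (indicator S x *\<^sub>R f x) \<bullet> b = g x)"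
    by (rule allI)
  from choice[OF this] obtain g where
    "\<forall>b. g b \<in> borel_measurable borel \<and> (AE x in lborel. (indicator S x *\<^sub>R f x) \<bullet> b = g b x)" ..
  then have g: "\<And>b. g b \<in> borel_measurable borel"
    "\<And>b. AE x in lborel. (indicator S x *\<^sub>R f x) \<bullet> b = g b x" by simp_all
  have "AE x in lborel. \<forall>b\<in>Basis. (indicator S x *\<^sub>R f x) \<bullet> b = g b x"
    by (rule AE_finite_allI[OF finite_Basis g(2)])
  then have "AE x in lborel. x \<in> S \<longrightarrow> f x = (\<Sum>b\<in>Basis. g b x *\<^sub>R b)"
  proof eventually_elim
    case (elim x)
    show ?case
    proof
      assume "x \<in> S"
      then have "g b x = f x \<bullet> b" if "b \<in> Basis" for b using elim that by auto
      then show "f x = (\<Sum>b\<in>Basis. g b x *\<^sub>R b)" by (simp add: euclidean_representation)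
    qed
  qed
  moreover have "(\<lambda>x. \<Sum>b\<in>Basis. g b x *\<^sub>R b) \<in> borel_measurable borel"
    using g(1) by measurable
  ultimately show ?thesis using that by blast
qed

lemma L2_onI:
  fixes f :: "real^2 \<Rightarrow> 'b::euclidean_space"
  assumes [measurable]: "f' \<in> borel_measurable borel" "S \<in> sets borel"
    and ae: "AE x in lborel. x \<in> S \<longrightarrow> f x = f' x"
    and fin: "(\<integral>\<^sup>+x\<in>S. ennreal ((norm (f' x))\<^sup>2) \<partial>lborel) < \<infinity>"
  shows "L2_on S f"
proof -
  have ae': "AE x in lebesgue. indicator S x *\<^sub>R f' x = indicator S x *\<^sub>R f x"
    using ae by (elim AE_completion[THEN eventually_mono]) (auto simp: indicator_def)
  have "(\<lambda>x. indicator S x *\<^sub>R f' x) \<in> borel_measurable lebesgue"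
    by (intro measurable_completion) measurable
  then have m: "(\<lambda>x. indicator S x *\<^sub>R f x) \<in> borel_measurable lebesgue"
    using ae' by (rule borel_measurable_AE)
  have "(\<lambda>x. (norm (indicator S x *\<^sub>R f x))\<^sup>2) \<in> borel_measurable lebesgue"
    using m by measurable
  moreover have "(\<lambda>x. (norm (indicator S x *\<^sub>R f x))\<^sup>2) = (\<lambda>x. indicator S x *\<^sub>R (norm (f x))\<^sup>2)"
    by (auto simp: indicator_def)
  ultimately have m2: "(\<lambda>x. indicator S x *\<^sub>R (norm (f x))\<^sup>2) \<in> borel_measurable lebesgue" by simp
  have "(\<integral>\<^sup>+x. ennreal (norm (indicator S x *\<^sub>R (norm (f x))\<^sup>2)) \<partial>lebesgue)
      = (\<integral>\<^sup>+x\<in>S. ennreal ((norm (f' x))\<^sup>2) \<partial>lborel)"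
    unfolding nn_integral_completion
    by (rule nn_integral_cong_AE) (use ae in eventually_elim, auto simp: indicator_def)
  then show ?thesis
    using m m2 fin unfolding L2_on_def set_borel_measurable_def set_integrable_def
    by (auto intro!: integrableI_bounded)
qed

lemma L2_onD:
  fixes f :: "real^2 \<Rightarrow> 'b::euclidean_space"
  assumes "L2_on S f" and ae: "AE x in lborel. x \<in> S \<longrightarrow> f x = f' x"
  shows "(\<integral>\<^sup>+x\<in>S. ennreal ((norm (f' x))\<^sup>2) \<partial>lborel) < \<infinity>"
proof -
  have "integrable lebesgue (\<lambda>x. indicator S x *\<^sub>R (norm (f x))\<^sup>2)"
    using assms by (simp add: L2_on_def set_integrable_def)
  then have "(\<integral>\<^sup>+x. ennreal (norm (indicator S x *\<^sub>R (norm (f x))\<^sup>2)) \<partial>lebesgue) < \<infinity>"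
    by (simp add: integrable_iff_bounded)
  also have "(\<integral>\<^sup>+x. ennreal (norm (indicator S x *\<^sub>R (norm (f x))\<^sup>2)) \<partial>lebesgue)
      = (\<integral>\<^sup>+x\<in>S. ennreal ((norm (f' x))\<^sup>2) \<partial>lborel)"
    unfolding nn_integral_completion
    by (rule nn_integral_cong_AE) (use ae in eventually_elim, auto simp: indicator_def)
  finally show ?thesis .
qed

text \<open>Cauchy-Schwarz against the constant 1 on a set of finite measure. Convergence in L^1
  suffices for all limits of integrals below.\<close>

lemma L1_tendsto_of_L2:
  fixes f :: "nat \<Rightarrow> 'a \<Rightarrow> 'b::euclidean_space"
  assumes [measurable]: "\<And>n. f n \<in> borel_measurable M" "S \<in> sets M"
    and fin: "emeasure M S < \<infinity>"
    and lim: "(\<lambda>n. \<integral>\<^sup>+x\<in>S. ennreal ((norm (f n x))\<^sup>2) \<partial>M) \<longlonglongrightarrow> 0"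
  shows "(\<lambda>n. \<integral>\<^sup>+x\<in>S. ennreal (norm (f n x)) \<partial>M) \<longlonglongrightarrow> 0"
proof -
  define A where "A n = (\<integral>\<^sup>+x\<in>S. ennreal ((norm (f n x))\<^sup>2) \<partial>M)" for n
  define B where "B n = (\<integral>\<^sup>+x\<in>S. ennreal (norm (f n x)) \<partial>M)" for n
  have bound: "(B n)\<^sup>2 \<le> emeasure M S * A n" for n
  proof -
    have "(B n)\<^sup>2 = (\<integral>\<^sup>+x. ennreal (norm (f n x)) * indicator S x * indicator S x \<partial>M)\<^sup>2"
      unfolding B_def by (intro arg_cong[of _ _ "\<lambda>x. x\<^sup>2"] nn_integral_cong) (auto simp: indicator_def)
    also have "\<dots> \<le> (\<integral>\<^sup>+x. (ennreal (norm (f n x)) * indicator S x)\<^sup>2 \<partial>M) * (\<integral>\<^sup>+x. (indicator S x)\<^sup>2 \<partial>M)"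
      by (rule Cauchy_Schwarz_nn_integral) measurable
    also have "(\<integral>\<^sup>+x. (ennreal (norm (f n x)) * indicator S x)\<^sup>2 \<partial>M) = A n"
      unfolding A_def by (intro nn_integral_cong) (auto simp: indicator_def ennreal_power)
    also have "(\<integral>\<^sup>+x. (indicator S x)\<^sup>2 \<partial>M) = (\<integral>\<^sup>+x. indicator S x \<partial>M)"
      by (intro nn_integral_cong) (auto simp: indicator_def)
    finally show ?thesis by (simp add: mult.commute)
  qed
  have "(\<lambda>n. emeasure M S * A n) \<longlonglongrightarrow> emeasure M S * 0"
    by (rule ennreal_tendsto_cmult) (use fin lim in \<open>auto simp: A_def\<close>)
  then have z: "(\<lambda>n. emeasure M S * A n) \<longlonglongrightarrow> 0" by simp
  have "B \<longlonglongrightarrow> 0"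
  proof (rule order_tendstoI)
    fix e :: ennreal assume e: "0 < e"
    then have "0 < e\<^sup>2" by (simp add: power2_eq_square ennreal_zero_less_mult_iff)
    then have "\<forall>\<^sub>F n in sequentially. emeasure M S * A n < e\<^sup>2"
      using z by (auto dest: order_tendstoD)
    then show "\<forall>\<^sub>F n in sequentially. B n < e"
    proof eventually_elim
      case (elim n)
      then have "(B n)\<^sup>2 < e\<^sup>2" using bound[of n] by (rule le_less_trans[rotated])
      then show ?case by (metis linorder_not_less power_mono zero_le)
    qed
  qed simp
  then show ?thesis unfolding B_def .
qed

lemma set_integrable_of_L2:
  fixes f :: "'a \<Rightarrow> 'b::euclidean_space"
  assumes [measurable]: "f \<in> borel_measurable M" "S \<in> sets M" and fin: "emeasure M S < \<infinity>"
    and L2: "(\<integral>\<^sup>+x\<in>S. ennreal ((norm (f x))\<^sup>2) \<partial>M) < \<infinity>"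
  shows "set_integrable M S f"
  unfolding set_integrable_def
proof (rule integrableI_bounded)
  have "(\<integral>\<^sup>+x. ennreal (norm (indicator S x *\<^sub>R f x)) \<partial>M) \<le>
      (\<integral>\<^sup>+x. indicator S x + ennreal ((norm (f x))\<^sup>2) * indicator S x \<partial>M)"
  proof (intro nn_integral_mono)
    fix x
    have "norm (f x) \<le> 1 + (norm (f x))\<^sup>2"
      using sum_squares_bound[of 1 "norm (f x)"] norm_ge_zero[of "f x"] by (simp, linarith)
    then have "ennreal (norm (f x)) \<le> 1 + ennreal ((norm (f x))\<^sup>2)"
      by (metis ennreal_1 ennreal_leI ennreal_plus zero_le_one zero_le_power2)
    then show "ennreal (norm (indicator S x *\<^sub>R f x)) \<le> indicator S x + ennreal ((norm (f x))\<^sup>2) * indicator S x"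
      by (auto simp: indicator_def)
  qed
  also have "\<dots> = emeasure M S + (\<integral>\<^sup>+x\<in>S. ennreal ((norm (f x))\<^sup>2) \<partial>M)"
    by (subst nn_integral_add) auto
  also have "\<dots> < \<infinity>" using fin L2 by simp
  finally show "(\<integral>\<^sup>+x. ennreal (norm (indicator S x *\<^sub>R f x)) \<partial>M) < \<infinity>" .
qed measurable

lemma test_function_zero:
  assumes "\<phi> \<in> test_functions S" "x \<notin> closure {x. \<phi> x \<noteq> 0}"
  shows "\<phi> x = 0" "frechet_derivative \<phi> (at x) v = 0"
proof -
  show "\<phi> x = 0" using assms(2) closure_subset[of "{x. \<phi> x \<noteq> 0}"] by auto
  have "(\<phi> has_derivative (\<lambda>h. 0)) (at x)"
  proof (rule has_derivative_transform_within_open[where f = "\<lambda>_. 0" and s = "- closure {x. \<phi> x \<noteq> 0}"])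
    show "0 = \<phi> y" if "y \<in> - closure {x. \<phi> x \<noteq> 0}" for y
      using that closure_subset[of "{x. \<phi> x \<noteq> 0}"] by auto
  qed (use assms in auto)
  then have "frechet_derivative \<phi> (at x) = (\<lambda>h. 0)"
    using frechet_derivative_at by metis
  then show "frechet_derivative \<phi> (at x) v = 0" by simp
qed

lemma integrable_mult_compact_support:
  fixes g h :: "real^2 \<Rightarrow> real"
  assumes "continuous_on UNIV g" "continuous_on UNIV h" "compact K" "\<And>x. x \<notin> K \<Longrightarrow> h x = 0"
  shows "integrable lborel (\<lambda>x. g x * h x)"
proof -
  have "integrable lborel (\<lambda>x. indicator K x *\<^sub>R (g x * h x))"
    by (rule borel_integrable_compact)
      (use assms in \<open>auto intro!: continuous_on_mult intro: continuous_on_subset\<close>)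
  moreover have "(\<lambda>x. indicator K x *\<^sub>R (g x * h x)) = (\<lambda>x. g x * h x)"
    using assms(4) by (auto simp: fun_eq_iff indicator_def)
  ultimately show ?thesis by simp
qed

text \<open>The product of a component of \<open>V\<close> with \<phi> has compact support, so its
  partial derivative integrates to 0 over the whole plane; the product rule splits this integral in
  two. Both integrands vanish outside \<open>S\<close>, which allows the restriction of the
  integrals to \<open>S\<close>.\<close>

lemma test_function_parts:
  fixes V :: "real^2 \<Rightarrow> real^2"
  assumes V: "smooth V" and \<phi>: "\<phi> \<in> test_functions S"
  shows "(LINT x:S|lborel. V x $ i * frechet_derivative \<phi> (at x) (axis j 1)) =
    - (LINT x:S|lborel. matrix (frechet_derivative V (at x)) $ i $ j * \<phi> x)"
proof -
  have sm: "smooth \<phi>" and comp: "compact (closure {x. \<phi> x \<noteq> 0})" and sub: "closure {x. \<phi> x \<noteq> 0} \<subseteq> S"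
    using \<phi> by (auto simp: test_functions_def)
  let ?K = "closure {x. \<phi> x \<noteq> 0}"
  define f where "f x = V x $ i * \<phi> x" for x
  have smVi: "smooth (\<lambda>x. V x $ i)"
    by (rule smooth_compose_bounded_linear[OF bounded_linear_vec_nth V])
  have smf: "smooth f" unfolding f_def by (rule smooth_mult[OF smVi sm])
  have "closure {x. f x \<noteq> 0} \<subseteq> ?K"
    by (rule closure_mono) (auto simp: f_def)
  then have compf: "compact (closure {x. f x \<noteq> 0})"
    using comp by (meson closed_closure compact_eq_bounded_closed bounded_subset)
  define P where "P x = V x $ i * frechet_derivative \<phi> (at x) (axis j 1)" for x
  define Q where "Q x = matrix (frechet_derivative V (at x)) $ i $ j * \<phi> x" for x
  have Qe: "Q x = frechet_derivative V (at x) (axis j 1) $ i * \<phi> x" for x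
    by (simp add: Q_def matrix_def)
  have "frechet_derivative f (at x) (axis j 1) = P x + Q x" for x
  proof -
    have "((\<lambda>x. V x $ i) has_derivative (\<lambda>h. frechet_derivative V (at x) h $ i)) (at x)"
      by (rule bounded_linear.has_derivative[OF bounded_linear_vec_nth smooth_has_derivative[OF V]])
    from has_derivative_mult[OF this smooth_has_derivative[OF sm]]
    have "(f has_derivative (\<lambda>h. V x $ i * frechet_derivative \<phi> (at x) h + frechet_derivative V (at x) h $ i * \<phi> x)) (at x)"
      unfolding f_def .
    from frechet_derivative_at[OF this, symmetric] show ?thesis by (simp add: P_def Qe)
  qed
  then have zero: "(LINT x|lborel. P x + Q x) = 0"
    using integral_partial_derivative_zero(2)[OF smf compf, of j] by simp
  have smDVi: "smooth (\<lambda>x. frechet_derivative V (at x) (axis j 1) $ i)"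
    by (rule smooth_compose_bounded_linear[OF bounded_linear_vec_nth smooth_partial[OF V]])
  have iP: "integrable lborel P" unfolding P_def
    by (rule integrable_mult_compact_support[OF smooth_continuous_on[OF smVi]
          smooth_continuous_on[OF smooth_partial[OF sm]] comp test_function_zero(2)[OF \<phi>]])
  have iQ: "integrable lborel Q" unfolding Qe
    by (rule integrable_mult_compact_support[OF smooth_continuous_on[OF smDVi]
          smooth_continuous_on[OF sm] comp test_function_zero(1)[OF \<phi>]])
  have 0: "x \<in> S" if "P x \<noteq> 0 \<or> Q x \<noteq> 0" for x
    using that test_function_zero[OF \<phi>, of x] sub by (auto simp: P_def Q_def)
  have "(LINT x:S|lborel. P x) = (LINT x|lborel. P x)" "(LINT x:S|lborel. Q x) = (LINT x|lborel. Q x)"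
    unfolding set_lebesgue_integral_def
    by (intro Bochner_Integration.integral_cong, simp, use 0 in \<open>force simp: indicator_def\<close>)+
  then show ?thesis
    using zero iP iQ unfolding P_def[symmetric] Q_def[symmetric] by (simp add: eq_neg_iff_add_eq_0)
qed

lemma set_integral_tendsto_L1:
  fixes f :: "nat \<Rightarrow> 'a \<Rightarrow> real"
  assumes [measurable]: "h \<in> borel_measurable M" "S \<in> sets M" and h: "\<And>x. \<bar>h x\<bar> \<le> C"
    and int: "\<And>n. set_integrable M S (f n)" "set_integrable M S g"
    and [measurable]: "\<And>n. f n \<in> borel_measurable M" "g \<in> borel_measurable M"
    and lim: "(\<lambda>n. \<integral>\<^sup>+x\<in>S. ennreal \<bar>f n x - g x\<bar> \<partial>M) \<longlonglongrightarrow> 0"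
  shows "(\<lambda>n. LINT x:S|M. f n x * h x) \<longlonglongrightarrow> (LINT x:S|M. g x * h x)"
  unfolding set_lebesgue_integral_def
proof (rule tendsto_L1_int)
  have C: "0 \<le> C" using h[of undefined] abs_ge_zero order_trans by blast
  have *: "integrable M (\<lambda>x. indicator S x *\<^sub>R (k x * h x))" if k: "set_integrable M S k" "k \<in> borel_measurable M" for k
  proof (rule Bochner_Integration.integrable_bound)
    show "integrable M (\<lambda>x. C * (indicator S x *\<^sub>R k x))"
      using k by (simp add: set_integrable_def)
    show "AE x in M. norm (indicator S x *\<^sub>R (k x * h x)) \<le> norm (C * (indicator S x *\<^sub>R k x))"
      using h C by (intro AE_I2) (auto simp: abs_mult indicator_def mult.commute[of _ "\<bar>h _\<bar>"] intro!: mult_right_mono)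
  qed (use k in measurable)
  show "integrable M (\<lambda>x. indicator S x *\<^sub>R (f n x * h x))" for n using * int by auto
  show "integrable M (\<lambda>x. indicator S x *\<^sub>R (g x * h x))" using * int by auto
  have "(\<lambda>n. ennreal C * (\<integral>\<^sup>+x\<in>S. ennreal \<bar>f n x - g x\<bar> \<partial>M)) \<longlonglongrightarrow> ennreal C * 0"
    by (rule ennreal_tendsto_cmult) (use lim in auto)
  then have z: "(\<lambda>n. ennreal C * (\<integral>\<^sup>+x\<in>S. ennreal \<bar>f n x - g x\<bar> \<partial>M)) \<longlonglongrightarrow> 0" by simp
  show "(\<lambda>n. \<integral>\<^sup>+x. ennreal (norm (indicator S x *\<^sub>R (f n x * h x) - indicator S x *\<^sub>R (g x * h x))) \<partial>M) \<longlonglongrightarrow> 0"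
  proof (rule tendsto_sandwich[OF _ _ tendsto_const z])
    show "\<forall>\<^sub>F n in sequentially. (\<integral>\<^sup>+x. ennreal (norm (indicator S x *\<^sub>R (f n x * h x) - indicator S x *\<^sub>R (g x * h x))) \<partial>M)
       \<le> ennreal C * (\<integral>\<^sup>+x\<in>S. ennreal \<bar>f n x - g x\<bar> \<partial>M)"
    proof (rule always_eventually, rule allI)
      fix n
      have "(\<integral>\<^sup>+x. ennreal (norm (indicator S x *\<^sub>R (f n x * h x) - indicator S x *\<^sub>R (g x * h x))) \<partial>M)
         \<le> (\<integral>\<^sup>+x. ennreal C * (ennreal \<bar>f n x - g x\<bar> * indicator S x) \<partial>M)"
      proof (rule nn_integral_mono)
        fix x
        have "\<bar>f n x * h x - g x * h x\<bar> \<le> C * \<bar>f n x - g x\<bar>"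
          using mult_right_mono[OF h abs_ge_zero, of x "f n x - g x"]
          by (simp add: abs_mult[symmetric] left_diff_distrib mult.commute right_diff_distrib)
        then have "ennreal \<bar>f n x * h x - g x * h x\<bar> \<le> ennreal C * ennreal \<bar>f n x - g x\<bar>"
          using C by (metis abs_ge_zero ennreal_leI ennreal_mult)
        then show "ennreal (norm (indicator S x *\<^sub>R (f n x * h x) - indicator S x *\<^sub>R (g x * h x)))
            \<le> ennreal C * (ennreal \<bar>f n x - g x\<bar> * indicator S x)"
          by (auto simp: indicator_def)
      qed
      also have "\<dots> = ennreal C * (\<integral>\<^sup>+x\<in>S. ennreal \<bar>f n x - g x\<bar> \<partial>M)"
        by (rule nn_integral_cmult) measurable
      finally show "(\<integral>\<^sup>+x. ennreal (norm (indicator S x *\<^sub>R (f n x * h x) - indicator S x *\<^sub>R (g x * h x))) \<partial>M)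
         \<le> ennreal C * (\<integral>\<^sup>+x\<in>S. ennreal \<bar>f n x - g x\<bar> \<partial>M)" .
    qed
  qed simp
qed

lemma set_lint_lebesgue_eq:
  fixes f :: "real^2 \<Rightarrow> real"
  assumes [measurable]: "f \<in> borel_measurable borel" "S \<in> sets borel"
  shows "(LINT x:S|lebesgue. f x) = (LINT x:S|lborel. f x)"
  unfolding set_lebesgue_integral_def by (rule integral_completion) measurable

text \<open>Measurability is not assumed. The measure is complete, so either both functions are
  measurable or neither is, and in the latter case both integrals have the default value 0.\<close>

lemma lebesgue_integral_cong_AE:
  fixes f g :: "'a::euclidean_space \<Rightarrow> real"
  assumes ae: "AE x in lebesgue. f x = g x"
  shows "integral\<^sup>L lebesgue f = integral\<^sup>L lebesgue g"
proof (cases "f \<in> borel_measurable lebesgue")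
  case True
  then show ?thesis using borel_measurable_AE[OF True ae] ae by (intro integral_cong_AE)
next
  case False
  have "AE x in lebesgue. g x = f x" using ae by eventually_elim simp
  then have "g \<notin> borel_measurable lebesgue" using False borel_measurable_AE by blast
  then show ?thesis
    using False by (metis borel_measurable_integrable not_integrable_integral_eq)
qed

lemma is_weak_gradient_cong:
  assumes "AE x in lborel. x \<in> S \<longrightarrow> u x = u' x" "AE x in lborel. x \<in> S \<longrightarrow> G x = G' x"
  shows "is_weak_gradient S u G \<longleftrightarrow> is_weak_gradient S u' G'"
proof -
  have "(LINT x:S|lebesgue. u x $ i * k x) = (LINT x:S|lebesgue. u' x $ i * k x)" for i k
    unfolding set_lebesgue_integral_def using assms(1)
    by (intro lebesgue_integral_cong_AE, elim AE_completion[THEN eventually_mono]) (simp add: indicator_def)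
  moreover have "(LINT x:S|lebesgue. G x $ i $ j * k x) = (LINT x:S|lebesgue. G' x $ i $ j * k x)" for i j k
    unfolding set_lebesgue_integral_def using assms(2)
    by (intro lebesgue_integral_cong_AE, elim AE_completion[THEN eventually_mono]) (simp add: indicator_def)
  ultimately show ?thesis unfolding is_weak_gradient_def by simp
qed

lemma test_function_bounded:
  assumes \<phi>: "\<phi> \<in> test_functions S"
  shows "\<exists>C. \<forall>x. \<bar>\<phi> x\<bar> \<le> C \<and> \<bar>frechet_derivative \<phi> (at x) v\<bar> \<le> C"
proof -
  have sm: "smooth \<phi>" and comp: "compact (closure {x. \<phi> x \<noteq> 0})"
    using \<phi> by (auto simp: test_functions_def)
  have *: "\<exists>C. \<forall>x. \<bar>f x\<bar> \<le> C" if f: "smooth f" "\<And>x. x \<notin> closure {x. \<phi> x \<noteq> 0} \<Longrightarrow> f x = 0" for f :: "real^2 \<Rightarrow> real"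
  proof -
    have "bounded (f ` closure {x. \<phi> x \<noteq> 0})"
      by (intro compact_imp_bounded compact_continuous_image comp smooth_continuous_on f)
    then obtain C where C: "\<And>x. x \<in> closure {x. \<phi> x \<noteq> 0} \<Longrightarrow> \<bar>f x\<bar> \<le> C" "C > 0"
      unfolding bounded_pos by auto
    then have "\<bar>f x\<bar> \<le> C" for x using f(2)[of x] by (cases "x \<in> closure {x. \<phi> x \<noteq> 0}") auto
    then show ?thesis by blast
  qed
  obtain C1 where C1: "\<forall>x. \<bar>\<phi> x\<bar> \<le> C1" using *[OF sm] test_function_zero(1)[OF \<phi>] by blast
  obtain C2 where C2: "\<forall>x. \<bar>frechet_derivative \<phi> (at x) v\<bar> \<le> C2"
    using *[OF smooth_partial[OF sm, of v]] test_function_zero(2)[OF \<phi>] by blast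
  show ?thesis by (rule exI[of _ "max C1 C2"]) (use C1 C2 in \<open>auto simp: le_max_iff_disj\<close>)
qed

text \<open>For fixed \<phi> both sides of the integration by parts formula are continuous under
  convergence in L^1, because \<phi> and its partial derivatives are bounded. Boundedness of
  \<open>S\<close> makes the smooth maps integrable there.\<close>

lemma weak_gradient_limit:
  fixes V :: "nat \<Rightarrow> real^2 \<Rightarrow> real^2"
  assumes S[measurable]: "S \<in> sets borel" and bdd: "bounded S"
    and V: "\<And>n. smooth (V n)"
    and [measurable]: "v \<in> borel_measurable borel" "H \<in> borel_measurable borel"
    and int: "set_integrable lborel S v" "set_integrable lborel S H"
    and lim: "(\<lambda>n. \<integral>\<^sup>+x\<in>S. ennreal (norm (V n x - v x)) \<partial>lborel) \<longlonglongrightarrow> 0"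
      "(\<lambda>n. \<integral>\<^sup>+x\<in>S. ennreal (norm (matrix (frechet_derivative (V n) (at x)) - H x)) \<partial>lborel) \<longlonglongrightarrow> 0"
  shows "is_weak_gradient S v H"
  unfolding is_weak_gradient_def
proof (intro ballI allI)
  fix \<phi> i j assume \<phi>: "\<phi> \<in> test_functions S"
  have sm: "smooth \<phi>" using \<phi> by (auto simp: test_functions_def)
  obtain C where C: "\<And>x. \<bar>\<phi> x\<bar> \<le> C" "\<And>x. \<bar>frechet_derivative \<phi> (at x) (axis j 1)\<bar> \<le> C"
    using test_function_bounded[OF \<phi>, where v = "axis j 1"] by auto
  have [measurable]: "\<phi> \<in> borel_measurable borel" "(\<lambda>x. frechet_derivative \<phi> (at x) (axis j 1)) \<in> borel_measurable borel"
    by (intro smooth_borel_measurable sm smooth_partial)+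
  have smDV: "smooth (\<lambda>x. matrix (frechet_derivative (V n) (at x)) $ i $ j)" for n
  proof -
    have "smooth (\<lambda>x. frechet_derivative (V n) (at x) (axis j 1) $ i)"
      by (rule smooth_compose_bounded_linear[OF bounded_linear_vec_nth smooth_partial[OF V]])
    then show ?thesis by (simp add: matrix_def)
  qed
  have smV: "smooth (\<lambda>x. V n x $ i)" for n
    by (rule smooth_compose_bounded_linear[OF bounded_linear_vec_nth V])
  have mDV: "(\<lambda>x. matrix (frechet_derivative (V n) (at x)) $ i $ j) \<in> borel_measurable lborel" for n
    using smooth_borel_measurable[OF smDV, of n] by simp
  have mH: "(\<lambda>x. H x $ i $ j) \<in> borel_measurable lborel" by measurable
  have [measurable]: "(\<lambda>x. V n x $ i) \<in> borel_measurable borel" for n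
    by (intro smooth_borel_measurable smV)
  have smint: "set_integrable lborel S f" if "smooth f" for f :: "real^2 \<Rightarrow> real"
  proof -
    have "integrable lborel (\<lambda>x. indicator (closure S) x *\<^sub>R f x)"
      by (rule borel_integrable_compact) (use bdd that in \<open>auto intro: smooth_continuous_on\<close>)
    then show ?thesis
      using set_integrable_subset[of lborel "closure S" f S] closure_subset[of S] by (auto simp: set_integrable_def)
  qed
  have comp: "set_integrable lborel S (\<lambda>x. L (f x))" if "bounded_linear L" "set_integrable lborel S f"
    for L :: "'x::{banach,second_countable_topology} \<Rightarrow> real" and f
  proof -
    interpret L: bounded_linear L by fact
    have "integrable lborel (\<lambda>x. L (indicator S x *\<^sub>R f x))"
      by (rule integrable_bounded_linear[OF that(1) that(2)[unfolded set_integrable_def]])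
    then show ?thesis by (simp add: set_integrable_def L.scaleR)
  qed
  have z1: "(\<lambda>n. \<integral>\<^sup>+x\<in>S. ennreal \<bar>V n x $ i - v x $ i\<bar> \<partial>lborel) \<longlonglongrightarrow> 0"
  proof (rule tendsto_sandwich[OF _ _ tendsto_const lim(1)])
    show "\<forall>\<^sub>F n in sequentially. (\<integral>\<^sup>+x\<in>S. ennreal \<bar>V n x $ i - v x $ i\<bar> \<partial>lborel)
        \<le> (\<integral>\<^sup>+x\<in>S. ennreal (norm (V n x - v x)) \<partial>lborel)"
    proof (intro always_eventually allI nn_integral_mono mult_right_mono ennreal_leI)
      show "\<bar>V n x $ i - v x $ i\<bar> \<le> norm (V n x - v x)" for n x
        using component_le_norm_cart[of "V n x - v x" i] by simp
    qed simp
  qed simp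
  have z2: "(\<lambda>n. \<integral>\<^sup>+x\<in>S. ennreal \<bar>matrix (frechet_derivative (V n) (at x)) $ i $ j - H x $ i $ j\<bar> \<partial>lborel) \<longlonglongrightarrow> 0"
  proof (rule tendsto_sandwich[OF _ _ tendsto_const lim(2)])
    have le: "\<bar>B $ i $ j\<bar> \<le> norm B" for B :: "real^2^2"
      using component_le_norm_cart[of "B $ i" j] Finite_Cartesian_Product.norm_nth_le by (rule order_trans)
    show "\<forall>\<^sub>F n in sequentially. (\<integral>\<^sup>+x\<in>S. ennreal \<bar>matrix (frechet_derivative (V n) (at x)) $ i $ j - H x $ i $ j\<bar> \<partial>lborel)
        \<le> (\<integral>\<^sup>+x\<in>S. ennreal (norm (matrix (frechet_derivative (V n) (at x)) - H x)) \<partial>lborel)"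
    proof (intro always_eventually allI nn_integral_mono mult_right_mono ennreal_leI)
      show "\<bar>matrix (frechet_derivative (V n) (at x)) $ i $ j - H x $ i $ j\<bar>
          \<le> norm (matrix (frechet_derivative (V n) (at x)) - H x)" for n x
        using le[of "matrix (frechet_derivative (V n) (at x)) - H x"] by simp
    qed simp
  qed simp
  have blij: "bounded_linear (\<lambda>B :: real^2^2. B $ i $ j)"
    by (rule bounded_linear_compose[OF bounded_linear_vec_nth bounded_linear_vec_nth])
  have "(\<lambda>n. LINT x:S|lborel. V n x $ i * frechet_derivative \<phi> (at x) (axis j 1))
      \<longlonglongrightarrow> (LINT x:S|lborel. v x $ i * frechet_derivative \<phi> (at x) (axis j 1))"
    by (rule set_integral_tendsto_L1[where C = C, OF _ _ C(2) smint[OF smV]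
          comp[OF bounded_linear_vec_nth int(1)] _ _ z1]) measurable
  moreover have "(\<lambda>n. LINT x:S|lborel. matrix (frechet_derivative (V n) (at x)) $ i $ j * \<phi> x)
      \<longlonglongrightarrow> (LINT x:S|lborel. H x $ i $ j * \<phi> x)"
  proof (rule set_integral_tendsto_L1)
    show "\<phi> \<in> borel_measurable lborel" by simp
    show "S \<in> sets lborel" by simp
    show "\<bar>\<phi> x\<bar> \<le> C" for x by (rule C)
    show "set_integrable lborel S (\<lambda>x. matrix (frechet_derivative (V n) (at x)) $ i $ j)" for n
      by (rule smint[OF smDV])
    show "set_integrable lborel S (\<lambda>x. H x $ i $ j)" by (rule comp[OF blij int(2)])
    show "(\<lambda>x. matrix (frechet_derivative (V n) (at x)) $ i $ j) \<in> borel_measurable lborel" for n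
      by (rule mDV)
    show "(\<lambda>x. H x $ i $ j) \<in> borel_measurable lborel" by (rule mH)
    show "(\<lambda>n. \<integral>\<^sup>+x\<in>S. ennreal \<bar>matrix (frechet_derivative (V n) (at x)) $ i $ j - H x $ i $ j\<bar> \<partial>lborel) \<longlonglongrightarrow> 0"
      by (rule z2)
  qed
  ultimately have "(LINT x:S|lborel. v x $ i * frechet_derivative \<phi> (at x) (axis j 1))
      = - (LINT x:S|lborel. H x $ i $ j * \<phi> x)"
    unfolding test_function_parts[OF V \<phi>] by (rule LIMSEQ_unique[OF _ tendsto_minus])
  then show "(LINT x:S|lebesgue. v x $ i * frechet_derivative \<phi> (at x) (axis j 1))
      = - (LINT x:S|lebesgue. H x $ i $ j * \<phi> x)"
    by (subst (1 2) set_lint_lebesgue_eq) auto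
qed

text \<open>The difference of two candidates has zero integral against every test function, so the
  fundamental lemma applies to each matrix entry.\<close>

lemma weak_gradient_unique:
  assumes S: "open S" "emeasure lborel S < \<infinity>"
    and G: "L2_on S G" "is_weak_gradient S u G" and H: "L2_on S H" "is_weak_gradient S u H"
  shows "AE x in lborel. x \<in> S \<longrightarrow> G x = H x"
proof -
  have [measurable]: "S \<in> sets borel" using S by simp
  obtain G' where G'[measurable]: "G' \<in> borel_measurable borel" and G'e: "AE x in lborel. x \<in> S \<longrightarrow> G x = G' x"
    using G(1) unfolding L2_on_def by (blast elim: borel_representative)
  obtain H' where H'[measurable]: "H' \<in> borel_measurable borel" and H'e: "AE x in lborel. x \<in> S \<longrightarrow> H x = H' x"
    using H(1) unfolding L2_on_def by (blast elim: borel_representative)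
  have iG: "set_integrable lborel S G'"
    by (rule set_integrable_of_L2[OF _ _ _ L2_onD[OF G(1) G'e]]) (use S in auto)
  have iH: "set_integrable lborel S H'"
    by (rule set_integrable_of_L2[OF _ _ _ L2_onD[OF H(1) H'e]]) (use S in auto)
  have wG: "is_weak_gradient S u G'" using G(2) is_weak_gradient_cong[OF _ G'e, of u u] by simp
  have wH: "is_weak_gradient S u H'" using H(2) is_weak_gradient_cong[OF _ H'e, of u u] by simp
  have "AE x in lborel. x \<in> S \<longrightarrow> G' x $ i $ j - H' x $ i $ j = 0" for i j
  proof (rule AE_zero_if_test_integrals_zero)
    have comp: "set_integrable lborel S (\<lambda>x. f x $ i $ j)" if "set_integrable lborel S f" for f :: "real^2 \<Rightarrow> real^2^2"
    proof -
      have "bounded_linear (\<lambda>B :: real^2^2. B $ i $ j)"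
        by (rule bounded_linear_compose[OF bounded_linear_vec_nth bounded_linear_vec_nth])
      then have "integrable lborel (\<lambda>x. (indicator S x *\<^sub>R f x) $ i $ j)"
        by (rule integrable_bounded_linear[OF _ that[unfolded set_integrable_def]])
      then show ?thesis by (simp add: set_integrable_def)
    qed
    show I: "set_integrable lborel S (\<lambda>x. G' x $ i $ j - H' x $ i $ j)"
      by (intro set_integral_diff comp iG iH)
    show "open S" by fact
    fix \<phi> :: "real^2 \<Rightarrow> real"
    assume "smooth \<phi>" "compact (closure {x. \<phi> x \<noteq> 0})" "closure {x. \<phi> x \<noteq> 0} \<subseteq> S"
    then have \<phi>: "\<phi> \<in> test_functions S" by (simp add: test_functions_def)
    have [measurable]: "\<phi> \<in> borel_measurable borel" by (rule smooth_borel_measurable) fact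
    obtain C where C: "\<And>x. \<bar>\<phi> x\<bar> \<le> C" using test_function_bounded[OF \<phi>, where v = 0] by auto
    have prod: "set_integrable lborel S (\<lambda>x. f x $ i $ j * \<phi> x)"
      if "set_integrable lborel S f" "f \<in> borel_measurable borel" for f :: "real^2 \<Rightarrow> real^2^2"
    proof -
      note [measurable] = that(2)
      show ?thesis
      unfolding set_integrable_def
    proof (rule Bochner_Integration.integrable_bound)
      show "integrable lborel (\<lambda>x. C * (indicator S x *\<^sub>R (f x $ i $ j)))"
        using comp[OF that(1)] by (simp add: set_integrable_def)
      have "0 \<le> C" using C[of 0] by simp
      then show "AE x in lborel. norm (indicator S x *\<^sub>R (f x $ i $ j * \<phi> x)) \<le> norm (C * (indicator S x *\<^sub>R (f x $ i $ j)))"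
        using C by (intro AE_I2) (auto simp: abs_mult indicator_def mult.commute[of _ "\<bar>\<phi> _\<bar>"] intro!: mult_right_mono)
    qed measurable
    qed
    have "(LINT x:S|lborel. G' x $ i $ j * \<phi> x) = (LINT x:S|lborel. H' x $ i $ j * \<phi> x)"
    proof -
      have "(LINT x:S|lebesgue. u x $ i * frechet_derivative \<phi> (at x) (axis j 1))
          = - (LINT x:S|lebesgue. G' x $ i $ j * \<phi> x)"
        "(LINT x:S|lebesgue. u x $ i * frechet_derivative \<phi> (at x) (axis j 1))
          = - (LINT x:S|lebesgue. H' x $ i $ j * \<phi> x)"
        using wG wH \<phi> unfolding is_weak_gradient_def by blast+
      moreover have "(LINT x:S|lebesgue. G' x $ i $ j * \<phi> x) = (LINT x:S|lborel. G' x $ i $ j * \<phi> x)"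
        by (rule set_lint_lebesgue_eq) measurable
      moreover have "(LINT x:S|lebesgue. H' x $ i $ j * \<phi> x) = (LINT x:S|lborel. H' x $ i $ j * \<phi> x)"
        by (rule set_lint_lebesgue_eq) measurable
      ultimately show ?thesis by linarith
    qed
    moreover have "(LINT x:S|lborel. G' x $ i $ j * \<phi> x - H' x $ i $ j * \<phi> x)
        = (LINT x:S|lborel. G' x $ i $ j * \<phi> x) - (LINT x:S|lborel. H' x $ i $ j * \<phi> x)"
      by (rule set_integral_diff(2)[OF prod[OF iG G'] prod[OF iH H']])
    ultimately have "(LINT x:S|lborel. G' x $ i $ j * \<phi> x - H' x $ i $ j * \<phi> x) = 0"
      by linarith
    then show "(LINT x:S|lborel. (G' x $ i $ j - H' x $ i $ j) * \<phi> x) = 0"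
      by (simp only: left_diff_distrib)
  qed measurable
  then have "AE x in lborel. \<forall>i\<in>UNIV. \<forall>j\<in>UNIV. x \<in> S \<longrightarrow> G' x $ i $ j - H' x $ i $ j = 0"
    by (intro AE_finite_allI finite)
  with G'e H'e show ?thesis
    by eventually_elim (auto simp: vec_eq_iff)
qed

text \<open>\<open>weak_grad\<close> is an arbitrary choice among the weak gradients; this is the
  way its value is computed once some weak gradient is known.\<close>

lemma weak_grad_AE_eq:
  assumes S: "open S" "emeasure lborel S < \<infinity>" and G: "L2_on S G" "is_weak_gradient S u G"
  shows "AE x in lborel. x \<in> S \<longrightarrow> weak_grad S u x = G x"
proof (rule weak_gradient_unique[OF S _ _ G])
  show "L2_on S (weak_grad S u)" "is_weak_gradient S u (weak_grad S u)"
    unfolding weak_grad_def using someI[of "\<lambda>G. L2_on S G \<and> is_weak_gradient S u G", OF conjI, OF G] by auto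
qed

lemma weak_grad_props:
  assumes "u \<in> W12 S"
  shows "L2_on S (weak_grad S u)" "is_weak_gradient S u (weak_grad S u)"
  using assms someI_ex[of "\<lambda>G. L2_on S G \<and> is_weak_gradient S u G"]
  unfolding weak_grad_def W12_def by auto

section \<open>Equivariant diffeomorphisms of the annulus\<close>

definition rot :: "real \<Rightarrow> real^2 \<Rightarrow> real^2" where
  "rot \<phi> x = cos \<phi> *\<^sub>R x + sin \<phi> *\<^sub>R perp x"

lemma rot_nth [simp]:
  "rot \<phi> x $ 1 = cos \<phi> * x $ 1 - sin \<phi> * x $ 2" "rot \<phi> x $ 2 = cos \<phi> * x $ 2 + sin \<phi> * x $ 1"
  by (simp_all add: rot_def)

lemma rot_rot: "rot \<phi> (rot \<psi> x) = rot (\<phi> + \<psi>) x"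
  by (simp add: vec_eq_iff forall_2 cos_add sin_add algebra_simps)

lemma rot_0 [simp]: "rot 0 x = x"
  by (simp add: vec_eq_iff forall_2)

lemma rot_scaleR: "rot \<phi> (c *\<^sub>R x) = c *\<^sub>R rot \<phi> x"
  by (simp add: vec_eq_iff forall_2 algebra_simps)

lemma rot_er: "rot \<phi> (e\<^sub>r \<theta>) = e\<^sub>r (\<theta> + \<phi>)"
  by (simp add: vec_eq_iff forall_2 cos_add sin_add algebra_simps)

lemma rot_perp: "rot \<phi> (perp x) = perp (rot \<phi> x)"
  by (simp add: vec_eq_iff forall_2 algebra_simps)

lemma inner_rot: "rot \<phi> x \<bullet> rot \<phi> y = x \<bullet> y"
proof -
  have "(c * x1 - s * x2) * (c * y1 - s * y2) + (c * x2 + s * x1) * (c * y2 + s * y1)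
      = (c\<^sup>2 + s\<^sup>2) * (x1 * y1 + x2 * y2)" for c s x1 x2 y1 y2 :: real
    by (simp add: algebra_simps power2_eq_square)
  from this[of "cos \<phi>" "x $ 1" "sin \<phi>" "x $ 2" "y $ 1" "y $ 2"]
  show ?thesis by (simp add: inner_real2)
qed

lemma norm_rot [simp]: "norm (rot \<phi> x) = norm x"
  by (simp add: norm_eq_sqrt_inner inner_rot)

lemma bounded_linear_rot: "bounded_linear (rot \<phi>)"
  unfolding linear_conv_bounded_linear[symmetric]
  by (auto intro!: linearI simp: vec_eq_iff forall_2 algebra_simps)

lemma rot_cancel: "rot (- \<phi>) (rot \<phi> x) = x"
  by (simp add: rot_rot)

lemma er_periodic: "e\<^sub>r (\<theta> + 2 * pi * of_int n) = e\<^sub>r \<theta>"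
proof -
  have e: "2 * pi * real_of_int n = real_of_int n * (2 * pi)" by simp
  show ?thesis
    unfolding e vec_eq_iff forall_2 er_nth using sin.plus_of_int[of \<theta> n] cos.plus_of_int[of \<theta> n] by simp
qed

text \<open>In polar coordinates the point with radius r and angle \<theta> goes to radius r A(r^2)
  and angle \<theta> + \<eta>(r^2). Writing the coefficients as functions of |x|^2 avoids the square
  root, which is singular at the origin.\<close>

definition twist :: "(real \<Rightarrow> real) \<Rightarrow> (real \<Rightarrow> real) \<Rightarrow> real^2 \<Rightarrow> real^2" where
  "twist A \<eta> x = A (x \<bullet> x) *\<^sub>R rot (\<eta> (x \<bullet> x)) x"

definition twist_deriv :: "(real \<Rightarrow> real) \<Rightarrow> (real \<Rightarrow> real) \<Rightarrow> real^2 \<Rightarrow> real^2 \<Rightarrow> real^2" where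
  "twist_deriv A \<eta> x h = A (x \<bullet> x) *\<^sub>R rot (\<eta> (x \<bullet> x)) h
     + (2 * (x \<bullet> h)) *\<^sub>R rot (\<eta> (x \<bullet> x)) (deriv A (x \<bullet> x) *\<^sub>R x + (A (x \<bullet> x) * deriv \<eta> (x \<bullet> x)) *\<^sub>R perp x)"

lemma twist_has_derivative:
  assumes "smooth A" "smooth \<eta>"
  shows "(twist A \<eta> has_derivative twist_deriv A \<eta> x) (at x)"
proof -
  have i: "((\<lambda>x. x \<bullet> x) has_derivative (\<lambda>h. x \<bullet> h + h \<bullet> x)) (at x)"
    by (rule has_derivative_inner[OF has_derivative_ident has_derivative_ident])
  have dA: "((\<lambda>x. A (x \<bullet> x)) has_derivative (\<lambda>h. (x \<bullet> h + h \<bullet> x) * deriv A (x \<bullet> x))) (at x)"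
    by (rule DERIV_compose_FDERIV[OF smooth_DERIV(1)[OF assms(1)] i])
  have dc: "((\<lambda>x. cos (\<eta> (x \<bullet> x))) has_derivative (\<lambda>h. ((x \<bullet> h + h \<bullet> x) * deriv \<eta> (x \<bullet> x)) * - sin (\<eta> (x \<bullet> x)))) (at x)"
    by (rule DERIV_compose_FDERIV[OF DERIV_cos DERIV_compose_FDERIV[OF smooth_DERIV(1)[OF assms(2)] i]])
  have ds: "((\<lambda>x. sin (\<eta> (x \<bullet> x))) has_derivative (\<lambda>h. ((x \<bullet> h + h \<bullet> x) * deriv \<eta> (x \<bullet> x)) * cos (\<eta> (x \<bullet> x)))) (at x)"
    by (rule DERIV_compose_FDERIV[OF DERIV_sin DERIV_compose_FDERIV[OF smooth_DERIV(1)[OF assms(2)] i]])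
  have dp: "(perp has_derivative perp) (at x)"
    by (rule bounded_linear_imp_has_derivative[OF bounded_linear_perp])
  have "((\<lambda>x. A (x \<bullet> x) *\<^sub>R (cos (\<eta> (x \<bullet> x)) *\<^sub>R x + sin (\<eta> (x \<bullet> x)) *\<^sub>R perp x)) has_derivative
    (\<lambda>h. A (x \<bullet> x) *\<^sub>R ((cos (\<eta> (x \<bullet> x)) *\<^sub>R h + (((x \<bullet> h + h \<bullet> x) * deriv \<eta> (x \<bullet> x)) * - sin (\<eta> (x \<bullet> x))) *\<^sub>R x) +
        (sin (\<eta> (x \<bullet> x)) *\<^sub>R perp h + (((x \<bullet> h + h \<bullet> x) * deriv \<eta> (x \<bullet> x)) * cos (\<eta> (x \<bullet> x))) *\<^sub>R perp x))
      + ((x \<bullet> h + h \<bullet> x) * deriv A (x \<bullet> x)) *\<^sub>R (cos (\<eta> (x \<bullet> x)) *\<^sub>R x + sin (\<eta> (x \<bullet> x)) *\<^sub>R perp x))) (at x)"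
    by (intro has_derivative_scaleR has_derivative_add dA dc ds dp has_derivative_ident)
  then show ?thesis
    unfolding twist_def[abs_def] rot_def twist_deriv_def[abs_def]
    by (rule back_subst[of "\<lambda>f. (_ has_derivative f) (at x)"])
      (simp add: fun_eq_iff vec_eq_iff forall_2 inner_commute algebra_simps)
qed

lemma det_twist_deriv:
  "det (matrix (twist_deriv A \<eta> x)) = (A (x \<bullet> x))\<^sup>2 + 2 * (x \<bullet> x) * A (x \<bullet> x) * deriv A (x \<bullet> x)"
proof -
  define c s A0 A1 k where "c = cos (\<eta> (x \<bullet> x))" and "s = sin (\<eta> (x \<bullet> x))" and "A0 = A (x \<bullet> x)"
    and "A1 = deriv A (x \<bullet> x)" and "k = A (x \<bullet> x) * deriv \<eta> (x \<bullet> x)"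
  have ax: "x \<bullet> axis 1 1 = x $ 1" "x \<bullet> axis 2 1 = x $ 2" by (simp_all add: inner_axis)
  have ax2: "axis 1 (1::real) $ (1::2) = 1" "axis 1 (1::real) $ (2::2) = 0"
    "axis 2 (1::real) $ (1::2) = 0" "axis 2 (1::real) $ (2::2) = 1" by (simp_all add: axis_def)
  have "det (matrix (twist_deriv A \<eta> x)) = (c\<^sup>2 + s\<^sup>2) * (A0\<^sup>2 + 2 * A0 * A1 * ((x $ 1)\<^sup>2 + (x $ 2)\<^sup>2))"
    unfolding det_2 matrix_def twist_deriv_def
    by (simp add: ax ax2 flip: c_def s_def A0_def A1_def k_def) (simp add: algebra_simps power2_eq_square)
  moreover have "c\<^sup>2 + s\<^sup>2 = 1" by (simp add: c_def s_def)
  moreover have "(x $ 1)\<^sup>2 + (x $ 2)\<^sup>2 = x \<bullet> x" by (simp add: inner_real2 power2_eq_square)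
  ultimately show ?thesis by (simp add: A0_def A1_def algebra_simps)
qed

text \<open>Since \<open>x\<close> and \<open>perp x\<close> span the plane, this formula and the
  next one determine the derivative. Both images are expressed in the frame formed by the image
  point and its \<open>perp\<close>, which is how the gradient of the composed map is computed
  later.\<close>

lemma twist_deriv_self:
  assumes "A (x \<bullet> x) \<noteq> 0"
  shows "twist_deriv A \<eta> x x = (1 + 2 * (x \<bullet> x) * deriv A (x \<bullet> x) / A (x \<bullet> x)) *\<^sub>R twist A \<eta> x
    + (2 * (x \<bullet> x) * deriv \<eta> (x \<bullet> x)) *\<^sub>R perp (twist A \<eta> x)"
  using assms unfolding twist_deriv_def twist_def vec_eq_iff forall_2
  by (simp add: field_simps)

lemma twist_deriv_perp: "twist_deriv A \<eta> x (perp x) = perp (twist A \<eta> x)"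
proof -
  have "x \<bullet> perp x = 0" by (simp add: inner_real2)
  then show ?thesis unfolding twist_deriv_def twist_def vec_eq_iff forall_2 by (simp add: algebra_simps)
qed

lemma smooth_twist:
  assumes "smooth A" "smooth \<eta>"
  shows "smooth (twist A \<eta>)"
proof -
  have s: "smooth (\<lambda>x::real^2. x \<bullet> x)" by (rule smooth_inner[OF smooth_id smooth_id])
  show ?thesis
    unfolding twist_def[abs_def] rot_def
    by (intro smooth_scaleR smooth_add smooth_compose[OF assms(1) s] smooth_compose[OF smooth_sin_cos(1)]
        smooth_compose[OF smooth_sin_cos(2)] smooth_compose[OF assms(2) s] smooth_id
        smooth_bounded_linear[OF bounded_linear_perp])
qed

lemma twist_scaleR_er:
  "twist A \<eta> (r *\<^sub>R e\<^sub>r \<theta>) = (r * A (r\<^sup>2)) *\<^sub>R e\<^sub>r (\<theta> + \<eta> (r\<^sup>2))"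
proof -
  have "(r *\<^sub>R e\<^sub>r \<theta>) \<bullet> (r *\<^sub>R e\<^sub>r \<theta>) = r\<^sup>2"
    by (simp add: power2_norm_eq_inner[symmetric])
  then show ?thesis by (simp add: twist_def rot_scaleR rot_er mult.commute)
qed

lemma bounded_bilinear_matrix_mult: "bounded_bilinear ((**) :: real^2^2 \<Rightarrow> real^2^2 \<Rightarrow> real^2^2)"
  unfolding bilinear_conv_bounded_bilinear[symmetric] bilinear_def
  by (auto intro!: linearI simp: vec_eq_iff matrix_matrix_mult_def sum_2 algebra_simps)

lemma smooth_continuous_matrix:
  fixes V :: "real^2 \<Rightarrow> real^2"
  assumes "smooth V"
  shows "continuous_on S (\<lambda>x. matrix (frechet_derivative V (at x)))"
proof -
  have "smooth (\<lambda>x. frechet_derivative V (at x) v $ i)" for v i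
    by (rule smooth_compose_bounded_linear[OF bounded_linear_vec_nth smooth_partial[OF assms]])
  then show ?thesis unfolding matrix_def
    by (intro continuous_on_vec_lambda smooth_continuous_on)
qed

text \<open>Near both boundary circles the twist is the identity, and \<open>M\<close> counts the
  full turns made in between. \<open>J_pos\<close> is positivity of the Jacobian, equivalently of
  the derivative of the map induced on squared radii. The interval between \<open>p\<close> and
  \<open>q\<close> keeps the support of the perturbation away from the boundary.\<close>

locale twist_map =
  fixes a b p q :: real and A \<eta> :: "real \<Rightarrow> real" and M :: int
  assumes ab: "0 < a" "a < b" and pq: "a\<^sup>2 < p" "q < b\<^sup>2"
    and smA: "smooth A" and sm\<eta>: "smooth \<eta>" and Apos: "0 < A s"
    and A1: "s \<le> p \<or> q \<le> s \<Longrightarrow> A s = 1"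
    and \<eta>0: "s \<le> p \<Longrightarrow> \<eta> s = 0" and \<eta>M: "q \<le> s \<Longrightarrow> \<eta> s = 2 * pi * of_int M"
    and J_pos: "s \<in> {a\<^sup>2..b\<^sup>2} \<Longrightarrow> 0 < (A s)\<^sup>2 + 2 * s * A s * deriv A s"
begin

abbreviation "ann \<equiv> annulus a b"
text \<open>On squared radii the twist acts as the one-dimensional map \<open>m\<close>. Its
  derivative \<open>J\<close> is at the same time the Jacobian determinant in the plane, because
  area is proportional to the length of the interval of squared radii.\<close>

definition "m s = s * (A s)\<^sup>2"
definition "J s = (A s)\<^sup>2 + 2 * s * A s * deriv A s"
abbreviation "tw \<equiv> twist A \<eta>"
abbreviation "tw' \<equiv> twist_deriv A \<eta>"

lemma tw_der: "(tw has_derivative tw' x) (at x)"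
  by (rule twist_has_derivative[OF smA sm\<eta>])

lemma det_tw: "det (matrix (tw' x)) = J (x \<bullet> x)"
  by (simp add: det_twist_deriv J_def)

lemma m_DERIV: "(m has_real_derivative J s) (at s)"
  unfolding m_def[abs_def] J_def
  by (auto intro!: derivative_eq_intros smooth_DERIV(1)[OF smA] simp: power2_eq_square algebra_simps)

lemma m_mono: "a\<^sup>2 \<le> s \<Longrightarrow> s < t \<Longrightarrow> t \<le> b\<^sup>2 \<Longrightarrow> m s < m t"
  by (rule DERIV_pos_imp_increasing) (use m_DERIV J_pos in \<open>force simp: J_def\<close>)+

lemma m_a: "m (a\<^sup>2) = a\<^sup>2" and m_b: "m (b\<^sup>2) = b\<^sup>2"
  using pq by (auto simp: m_def A1)

lemma m_in: "s \<in> {a\<^sup>2<..<b\<^sup>2} \<Longrightarrow> m s \<in> {a\<^sup>2<..<b\<^sup>2}"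
  using m_mono[of "a\<^sup>2" s] m_mono[of s "b\<^sup>2"] m_a m_b by auto

lemma m_inj: "inj_on m {a\<^sup>2<..<b\<^sup>2}"
proof (rule inj_onI)
  fix s t assume "s \<in> {a\<^sup>2<..<b\<^sup>2}" "t \<in> {a\<^sup>2<..<b\<^sup>2}" "m s = m t"
  then show "s = t" using m_mono[of s t] m_mono[of t s] by (cases s t rule: linorder_cases) auto
qed

lemma a2b2: "a\<^sup>2 < b\<^sup>2" using ab by (intro power_strict_mono) auto

lemma m_surj:
  assumes t: "t \<in> {a\<^sup>2<..<b\<^sup>2}"
  obtains s where "s \<in> {a\<^sup>2<..<b\<^sup>2}" "m s = t"
proof -
  have "\<exists>s\<ge>a\<^sup>2. s \<le> b\<^sup>2 \<and> m s = t"
    using t m_a m_b a2b2 by (intro IVT') (auto intro!: DERIV_isCont m_DERIV continuous_at_imp_continuous_on)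
  then obtain s where s: "a\<^sup>2 \<le> s" "s \<le> b\<^sup>2" "m s = t" by blast
  then have "s \<noteq> a\<^sup>2" "s \<noteq> b\<^sup>2" using t m_a m_b by auto
  then show ?thesis using s that[of s] by auto
qed

lemma m_image: "m ` {a\<^sup>2<..<b\<^sup>2} = {a\<^sup>2<..<b\<^sup>2}"
proof
  show "m ` {a\<^sup>2<..<b\<^sup>2} \<subseteq> {a\<^sup>2<..<b\<^sup>2}" using m_in by blast
  show "{a\<^sup>2<..<b\<^sup>2} \<subseteq> m ` {a\<^sup>2<..<b\<^sup>2}"
  proof
    fix t assume "t \<in> {a\<^sup>2<..<b\<^sup>2}"
    then obtain s where "s \<in> {a\<^sup>2<..<b\<^sup>2}" "m s = t" by (rule m_surj)
    then show "t \<in> m ` {a\<^sup>2<..<b\<^sup>2}" by blast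
  qed
qed

lemma norm_tw: "(norm (tw x))\<^sup>2 = m ((norm x)\<^sup>2)"
  by (simp add: twist_def m_def power_mult_distrib power2_norm_eq_inner)

lemma ann_iff: "x \<in> ann \<longleftrightarrow> (norm x)\<^sup>2 \<in> {a\<^sup>2<..<b\<^sup>2}"
proof -
  have "a < norm x \<longleftrightarrow> a\<^sup>2 < (norm x)\<^sup>2" using ab power2_less_imp_less power_strict_mono
    by (metis less_eq_real_def norm_ge_zero pos2)
  moreover have "norm x < b \<longleftrightarrow> (norm x)\<^sup>2 < b\<^sup>2" using ab power2_less_imp_less power_strict_mono
    by (metis less_eq_real_def norm_ge_zero order.strict_trans pos2)
  ultimately show ?thesis by (simp add: annulus_def)
qed

lemma tw_in: "x \<in> ann \<Longrightarrow> tw x \<in> ann"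
  using m_in by (simp add: ann_iff norm_tw)

lemma tw_inj: "inj_on tw ann"
proof (rule inj_onI)
  fix x y assume xy: "x \<in> ann" "y \<in> ann" "tw x = tw y"
  have "m ((norm x)\<^sup>2) = m ((norm y)\<^sup>2)" using xy(3) norm_tw by metis
  then have "(norm x)\<^sup>2 = (norm y)\<^sup>2" using xy m_inj by (simp add: ann_iff inj_on_def)
  then have e: "x \<bullet> x = y \<bullet> y" by (simp add: power2_norm_eq_inner)
  then have "rot (\<eta> (x \<bullet> x)) x = rot (\<eta> (x \<bullet> x)) y"
    using xy(3) Apos[of "x \<bullet> x"] by (simp add: twist_def)
  then show "x = y" using rot_cancel by metis
qed

lemma tw_polar: "0 \<le> s \<Longrightarrow> tw (polar s \<theta>) = polar (m s) (\<theta> + \<eta> s)"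
  using Apos[of s] by (simp add: polar_def twist_scaleR_er m_def real_sqrt_mult)

lemma tw_image: "tw ` ann = ann"
proof
  show "tw ` ann \<subseteq> ann" using tw_in by blast
  show "ann \<subseteq> tw ` ann"
  proof
    fix y assume y: "y \<in> ann"
    then obtain s where s: "s \<in> {a\<^sup>2<..<b\<^sup>2}" "m s = (norm y)\<^sup>2"
      using m_surj[of "(norm y)\<^sup>2"] by (auto simp: ann_iff)
    obtain \<phi> where \<phi>: "y = norm y *\<^sub>R e\<^sub>r \<phi>" by (rule polar_surj)
    have s0: "0 \<le> s" using s by (smt (verit) greaterThanLessThan_iff zero_le_power2)
    have "tw (polar s (\<phi> - \<eta> s)) = norm y *\<^sub>R e\<^sub>r \<phi>"
      using tw_polar[OF s0, of "\<phi> - \<eta> s"] s(2) by (simp add: polar_def)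
    then have "tw (polar s (\<phi> - \<eta> s)) = y" using \<phi> by simp
    moreover have "polar s (\<phi> - \<eta> s) \<in> ann" using s0 s by (simp add: ann_iff norm_polar)
    ultimately show "y \<in> tw ` ann" by blast
  qed
qed

lemma smooth_tw: "smooth tw"
  by (rule smooth_twist[OF smA sm\<eta>])

lemma tw_measurable [measurable]: "tw \<in> borel_measurable borel"
  by (rule smooth_borel_measurable[OF smooth_tw])

lemma continuous_J: "continuous_on S J"
  unfolding J_def[abs_def]
  by (intro continuous_intros smooth_continuous_on smA smooth_DERIV(2)[OF smA])

lemma J_measurable [measurable]: "J \<in> borel_measurable borel"
  by (rule borel_measurable_continuous_onI) (rule continuous_J)

lemma nn_integral_tw:
  assumes f[measurable]: "f \<in> borel_measurable borel"
  shows "(\<integral>\<^sup>+y\<in>ann. f y \<partial>lborel) = (\<integral>\<^sup>+x\<in>ann. f (tw x) * ennreal (J (x \<bullet> x)) \<partial>lborel)"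
proof -
  have "(\<integral>\<^sup>+y\<in>tw ` ann. f y \<partial>lborel) = (\<integral>\<^sup>+x\<in>ann. f (tw x) * ennreal \<bar>det (matrix (tw' x))\<bar> \<partial>lborel)"
  proof (rule nn_integral_change_of_variables[OF open_annulus tw_der tw_inj])
    show "tw ` ann \<in> sets borel" "emeasure lborel (tw ` ann) < \<infinity>"
      unfolding tw_image using emeasure_annulus_finite by auto
    show "continuous_on ann (\<lambda>x. det (matrix (tw' x)))"
      unfolding det_tw by (rule continuous_on_compose2[OF continuous_J]) (auto intro!: continuous_intros)
  qed fact
  also have "\<dots> = (\<integral>\<^sup>+x\<in>ann. f (tw x) * ennreal (J (x \<bullet> x)) \<partial>lborel)"
  proof (rule nn_integral_cong)
    fix x
    have "0 < J (x \<bullet> x)" if "x \<in> ann"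
      using J_pos[of "x \<bullet> x"] that by (simp add: J_def ann_iff power2_norm_eq_inner)
    then show "f (tw x) * ennreal \<bar>det (matrix (tw' x))\<bar> * indicator ann x = f (tw x) * ennreal (J (x \<bullet> x)) * indicator ann x"
      by (cases "x \<in> ann") (auto simp: det_tw)
  qed
  finally show ?thesis by (simp add: tw_image)
qed

lemma J_ann_pos: "x \<in> ann \<Longrightarrow> 0 < J (x \<bullet> x)"
  using J_pos[of "x \<bullet> x"] by (simp add: J_def ann_iff power2_norm_eq_inner)

lemma AE_tw:
  assumes ae: "AE x in lborel. x \<in> ann \<longrightarrow> Q x"
  shows "AE x in lborel. x \<in> ann \<longrightarrow> Q (tw x)"
proof -
  obtain N where N': "{x \<in> space lborel. \<not> (x \<in> ann \<longrightarrow> Q x)} \<subseteq> N" "emeasure lborel N = 0" "N \<in> sets lborel"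
    by (rule AE_E[OF ae])
  then have N: "emeasure lborel N = 0" "\<And>x. x \<in> ann \<Longrightarrow> x \<notin> N \<Longrightarrow> Q x" by auto
  have [measurable]: "N \<in> sets borel" using N'(3) by simp
  have "(\<integral>\<^sup>+x\<in>ann. indicator N x \<partial>lborel) \<le> (\<integral>\<^sup>+x. indicator N x \<partial>lborel)"
    by (intro nn_integral_mono) (auto simp: indicator_def)
  then have "(\<integral>\<^sup>+x\<in>ann. indicator N x \<partial>lborel) = 0" using N(1) by simp
  then have "(\<integral>\<^sup>+x\<in>ann. indicator N (tw x) * ennreal (J (x \<bullet> x)) \<partial>lborel) = 0"
    by (subst (asm) nn_integral_tw) auto
  then have "AE x in lborel. indicator N (tw x) * ennreal (J (x \<bullet> x)) * indicator ann x = 0"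
    by (subst (asm) nn_integral_0_iff_AE) auto
  then show ?thesis
  proof eventually_elim
    case (elim x)
    show ?case
    proof
      assume x: "x \<in> ann"
      then have "tw x \<notin> N" using elim J_ann_pos[OF x] by (auto simp: indicator_def)
      then show "Q (tw x)" using N(2) tw_in[OF x] by blast
    qed
  qed
qed

text \<open>The constant is the reciprocal of the minimum of \<open>J\<close> on the compact
  interval of squared radii. It does not depend on \<open>f\<close>, so convergence in L^2 survives
  composition with the twist.\<close>

lemma nn_integral_tw_bound:
  "\<exists>C. \<forall>f \<in> borel_measurable borel. (\<integral>\<^sup>+x\<in>ann. f (tw x) \<partial>lborel) \<le> ennreal C * (\<integral>\<^sup>+x\<in>ann. f x \<partial>lborel)"
proof -
  have "\<exists>s\<in>{a\<^sup>2..b\<^sup>2}. \<forall>t\<in>{a\<^sup>2..b\<^sup>2}. J s \<le> J t"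
    by (rule continuous_attains_inf) (use a2b2 continuous_J in auto)
  then obtain s0 where s0: "s0 \<in> {a\<^sup>2..b\<^sup>2}" "\<And>t. t \<in> {a\<^sup>2..b\<^sup>2} \<Longrightarrow> J s0 \<le> J t" by blast
  have c: "0 < J s0" using J_pos[OF s0(1)] by (simp add: J_def)
  show ?thesis
  proof (intro exI ballI)
    fix f :: "real^2 \<Rightarrow> ennreal" assume [measurable]: "f \<in> borel_measurable borel"
    have "(\<integral>\<^sup>+x\<in>ann. f (tw x) \<partial>lborel) \<le> (\<integral>\<^sup>+x. ennreal (1 / J s0) * (f (tw x) * ennreal (J (x \<bullet> x)) * indicator ann x) \<partial>lborel)"
    proof (rule nn_integral_mono)
      fix x
      show "f (tw x) * indicator ann x \<le> ennreal (1 / J s0) * (f (tw x) * ennreal (J (x \<bullet> x)) * indicator ann x)"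
      proof (cases "x \<in> ann")
        case True
        then have "J s0 \<le> J (x \<bullet> x)" by (intro s0) (simp add: ann_iff power2_norm_eq_inner)
        then have "1 \<le> 1 / J s0 * J (x \<bullet> x)" using c by (simp add: field_simps)
        then have "1 \<le> ennreal (1 / J s0 * J (x \<bullet> x))" by (simp flip: ennreal_1)
        also have "\<dots> = ennreal (1 / J s0) * ennreal (J (x \<bullet> x))"
          using c J_ann_pos[OF True] by (intro ennreal_mult) auto
        finally have "f (tw x) * 1 \<le> f (tw x) * (ennreal (1 / J s0) * ennreal (J (x \<bullet> x)))"
          by (intro mult_left_mono) auto
        then show ?thesis using True by (simp add: ac_simps)
      qed simp
    qed
    also have "\<dots> = ennreal (1 / J s0) * (\<integral>\<^sup>+x\<in>ann. f (tw x) * ennreal (J (x \<bullet> x)) \<partial>lborel)"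
      by (rule nn_integral_cmult) measurable
    finally show "(\<integral>\<^sup>+x\<in>ann. f (tw x) \<partial>lborel) \<le> ennreal (1 / J s0) * (\<integral>\<^sup>+x\<in>ann. f x \<partial>lborel)"
      using nn_integral_tw[of f] by simp
  qed
qed

lemma frechet_tw: "frechet_derivative tw (at x) = tw' x"
  using frechet_derivative_at[OF tw_der] by simp

lemma continuous_matrix_tw: "continuous_on S (\<lambda>x. matrix (tw' x))"
proof -
  have "smooth (\<lambda>x. tw' x v $ i)" for v i
    using smooth_compose_bounded_linear[OF bounded_linear_vec_nth smooth_partial[OF smooth_tw]]
    by (simp add: frechet_tw)
  then show ?thesis unfolding matrix_def
    by (intro continuous_on_vec_lambda smooth_continuous_on)
qed

lemma matrix_tw_bounded: "\<exists>K. \<forall>x\<in>ann. norm (matrix (tw' x)) \<le> K"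
proof -
  have "compact ((\<lambda>x. matrix (tw' x)) ` cball 0 b)"
    by (intro compact_continuous_image continuous_matrix_tw compact_cball)
  from compact_imp_bounded[OF this] obtain K where "\<forall>y\<in>(\<lambda>x. matrix (tw' x)) ` cball 0 b. norm y \<le> K"
    unfolding bounded_iff ..
  then have "norm (matrix (tw' x)) \<le> K" if "x \<in> ann" for x
    using that by (auto simp: annulus_def)
  then show ?thesis by blast
qed

lemma matrix_tw_measurable [measurable]: "(\<lambda>x. matrix (tw' x)) \<in> borel_measurable borel"
  by (rule borel_measurable_continuous_onI) (rule continuous_matrix_tw)

lemma tw_boundary: "R \<in> {a, b} \<Longrightarrow> tw (R *\<^sub>R e\<^sub>r \<theta>) = R *\<^sub>R e\<^sub>r \<theta>"
  using pq er_periodic[of \<theta> M] by (auto simp: twist_scaleR_er A1 \<eta>0 \<eta>M)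

lemma matrix_frechet_comp:
  fixes V :: "real^2 \<Rightarrow> real^2"
  assumes "smooth V"
  shows "matrix (frechet_derivative (\<lambda>x. V (tw x)) (at x)) = matrix (frechet_derivative V (at (tw x))) ** matrix (tw' x)"
proof -
  have "((\<lambda>x. V (tw x)) has_derivative (\<lambda>h. frechet_derivative V (at (tw x)) (tw' x h))) (at x)"
    by (rule has_derivative_compose[OF tw_der smooth_has_derivative[OF assms]])
  from frechet_derivative_at[OF this, symmetric]
  have "frechet_derivative (\<lambda>x. V (tw x)) (at x) = frechet_derivative V (at (tw x)) \<circ> tw' x"
    by (simp add: o_def)
  then show ?thesis
    by (simp only: matrix_compose[OF has_derivative_linear[OF tw_der]
          has_derivative_linear[OF smooth_has_derivative[OF assms]]])
qed

text \<open>The smooth maps that witness the trace of \<open>u\<close>, composed with the twist,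
  converge to the composed map. This one sequence serves for everything: its gradients obey the
  classical chain rule and converge in L^2, which identifies the weak gradient, and its boundary
  values are those of the original sequence since the twist fixes both circles pointwise.\<close>

lemma sobolev_tw:
  assumes u: "u \<in> W12 ann" and tr: "has_trace a b u (\<lambda>x. x)"
  shows "(\<lambda>x. u (tw x)) \<in> W12 ann" and "has_trace a b (\<lambda>x. u (tw x)) (\<lambda>x. x)"
    and "AE x in lborel. x \<in> ann \<longrightarrow> weak_grad ann (\<lambda>x. u (tw x)) x = weak_grad ann u (tw x) ** matrix (tw' x)"
proof -
  note fin = emeasure_annulus_finite[of a b]
  note gL2 = weak_grad_props(1)[OF u]
  have uL2: "L2_on ann u" using u by (simp add: W12_def)
  obtain u' where u'[measurable]: "u' \<in> borel_measurable borel" and uu': "AE x in lborel. x \<in> ann \<longrightarrow> u x = u' x"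
    using uL2 unfolding L2_on_def by (blast elim: borel_representative)
  obtain G where G[measurable]: "G \<in> borel_measurable borel" and GG: "AE x in lborel. x \<in> ann \<longrightarrow> weak_grad ann u x = G x"
    using gL2 unfolding L2_on_def by (blast elim: borel_representative)
  obtain U where smU: "\<And>n. smooth (U n)"
    and U1: "(\<lambda>n. \<integral>\<^sup>+x\<in>ann. ennreal ((norm (U n x - u x))\<^sup>2) \<partial>lebesgue) \<longlonglongrightarrow> 0"
    and U2: "(\<lambda>n. \<integral>\<^sup>+x\<in>ann. ennreal ((norm (matrix (frechet_derivative (U n) (at x)) - weak_grad ann u x))\<^sup>2) \<partial>lebesgue) \<longlonglongrightarrow> 0"
    and U3: "\<And>R. R \<in> {a, b} \<Longrightarrow> (\<lambda>n. \<integral>\<^sup>+\<theta>\<in>{0..2*pi}. ennreal ((norm (U n (R *\<^sub>R e\<^sub>r \<theta>) - R *\<^sub>R e\<^sub>r \<theta>))\<^sup>2) \<partial>lebesgue) \<longlonglongrightarrow> 0"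
    using tr unfolding has_trace_def by blast
  define V where "V n x = U n (tw x)" for n x
  define v where "v x = u' (tw x)" for x
  define H where "H x = G (tw x) ** matrix (tw' x)" for x
  have smV: "smooth (V n)" for n unfolding V_def by (rule smooth_compose[OF smU smooth_tw])
  have [measurable]: "U n \<in> borel_measurable borel" "V n \<in> borel_measurable borel" for n
    by (intro smooth_borel_measurable smU smV)+
  have [measurable]: "(\<lambda>x. matrix (frechet_derivative (U n) (at x))) \<in> borel_measurable borel"
    "(\<lambda>x. matrix (frechet_derivative (V n) (at x))) \<in> borel_measurable borel" for n
    by (intro borel_measurable_continuous_onI smooth_continuous_matrix smU smV)+
  have [measurable]: "v \<in> borel_measurable borel" unfolding v_def by measurable
  have [measurable]: "H \<in> borel_measurable borel"
    unfolding H_def by (rule borel_measurable_continuous_Pair[OF _ _ bounded_bilinear.continuous_on[OF bounded_bilinear_matrix_mult]])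
      (auto intro!: continuous_intros)
  have vu: "AE x in lborel. x \<in> ann \<longrightarrow> u (tw x) = v x"
    using AE_tw[OF uu'] by (simp add: v_def)
  have HG: "AE x in lborel. x \<in> ann \<longrightarrow> weak_grad ann u (tw x) ** matrix (tw' x) = H x"
    using AE_tw[OF GG] by eventually_elim (simp add: H_def)
  obtain C where C: "\<And>f. f \<in> borel_measurable borel \<Longrightarrow> (\<integral>\<^sup>+x\<in>ann. f (tw x) \<partial>lborel) \<le> ennreal C * (\<integral>\<^sup>+x\<in>ann. f x \<partial>lborel)"
    using nn_integral_tw_bound by blast
  obtain K0 where K0: "\<And>x. x \<in> ann \<Longrightarrow> norm (matrix (tw' x)) \<le> K0" using matrix_tw_bounded by blast
  obtain K1 where K1: "\<And>(B::real^2^2) (D::real^2^2). norm (B ** D) \<le> norm B * norm D * K1" "0 \<le> K1"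
  proof -
    from bounded_bilinear.nonneg_bounded[OF bounded_bilinear_matrix_mult]
    obtain K1 where k: "K1 \<ge> 0 \<and> (\<forall>(B::real^2^2) (D::real^2^2). norm (B ** D) \<le> norm B * norm D * K1)" ..
    show thesis by (rule that[of K1]) (use k in blast)+
  qed
  define K where "K = max K0 0 * K1"
  have K: "norm (B ** matrix (tw' x)) \<le> K * norm B" if "x \<in> ann" for x and B :: "real^2^2"
  proof -
    have "norm (B ** matrix (tw' x)) \<le> norm B * norm (matrix (tw' x)) * K1" by (rule K1)
    also have "\<dots> \<le> norm B * max K0 0 * K1"
      using K0[OF that] K1(2) by (intro mult_right_mono mult_left_mono) auto
    finally show ?thesis by (simp add: K_def ac_simps)
  qed
  \<comment> \<open>Applied to \<open>G\<close>, this bound shows that the candidate gradient is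
    square integrable; applied to the differences of gradients, it shows convergence. The bound on
    the derivative of the twist comes from compactness of the disc of radius
    \<open>b\<close>.\<close>
  have bnd: "(\<integral>\<^sup>+x\<in>ann. ennreal ((norm (B (tw x) ** matrix (tw' x)))\<^sup>2) \<partial>lborel)
      \<le> ennreal (K\<^sup>2) * (ennreal C * (\<integral>\<^sup>+x\<in>ann. ennreal ((norm (B x))\<^sup>2) \<partial>lborel))"
    if [measurable]: "B \<in> borel_measurable borel" for B :: "real^2 \<Rightarrow> real^2^2"
  proof -
    have "(\<integral>\<^sup>+x\<in>ann. ennreal ((norm (B (tw x) ** matrix (tw' x)))\<^sup>2) \<partial>lborel)
      \<le> (\<integral>\<^sup>+x. ennreal (K\<^sup>2) * (ennreal ((norm (B (tw x)))\<^sup>2) * indicator ann x) \<partial>lborel)"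
    proof (rule nn_integral_mono)
      fix x
      show "ennreal ((norm (B (tw x) ** matrix (tw' x)))\<^sup>2) * indicator ann x \<le> ennreal (K\<^sup>2) * (ennreal ((norm (B (tw x)))\<^sup>2) * indicator ann x)"
      proof (cases "x \<in> ann")
        case True
        have "(norm (B (tw x) ** matrix (tw' x)))\<^sup>2 \<le> (K * norm (B (tw x)))\<^sup>2"
          by (rule power_mono[OF K[OF True]]) simp
        then have "ennreal ((norm (B (tw x) ** matrix (tw' x)))\<^sup>2) \<le> ennreal (K\<^sup>2 * (norm (B (tw x)))\<^sup>2)"
          by (simp add: power_mult_distrib ennreal_leI)
        then show ?thesis using True by (simp add: ennreal_mult)
      qed simp
    qed
    also have "\<dots> = ennreal (K\<^sup>2) * (\<integral>\<^sup>+x\<in>ann. ennreal ((norm (B (tw x)))\<^sup>2) \<partial>lborel)"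
      by (rule nn_integral_cmult) measurable
    also have "\<dots> \<le> ennreal (K\<^sup>2) * (ennreal C * (\<integral>\<^sup>+x\<in>ann. ennreal ((norm (B x))\<^sup>2) \<partial>lborel))"
      by (intro mult_left_mono C) auto
    finally show ?thesis .
  qed
  have vL2: "(\<integral>\<^sup>+x\<in>ann. ennreal ((norm (v x))\<^sup>2) \<partial>lborel) < \<infinity>"
  proof -
    have "(\<integral>\<^sup>+x\<in>ann. ennreal ((norm (v x))\<^sup>2) \<partial>lborel) \<le> ennreal C * (\<integral>\<^sup>+x\<in>ann. ennreal ((norm (u' x))\<^sup>2) \<partial>lborel)"
      unfolding v_def by (rule C[of "\<lambda>x. ennreal ((norm (u' x))\<^sup>2)"]) measurable
    also have "\<dots> < \<infinity>" using L2_onD[OF uL2 uu'] by (simp add: ennreal_mult_less_top)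
    finally show ?thesis .
  qed
  have HL2: "(\<integral>\<^sup>+x\<in>ann. ennreal ((norm (H x))\<^sup>2) \<partial>lborel) < \<infinity>"
  proof -
    have "(\<integral>\<^sup>+x\<in>ann. ennreal ((norm (H x))\<^sup>2) \<partial>lborel) \<le> ennreal (K\<^sup>2) * (ennreal C * (\<integral>\<^sup>+x\<in>ann. ennreal ((norm (G x))\<^sup>2) \<partial>lborel))"
      unfolding H_def by (rule bnd) measurable
    also have "\<dots> < \<infinity>" using L2_onD[OF gL2 GG] by (simp add: ennreal_mult_less_top)
    finally show ?thesis .
  qed
  have U1': "(\<lambda>n. \<integral>\<^sup>+x\<in>ann. ennreal ((norm (U n x - u' x))\<^sup>2) \<partial>lborel) \<longlonglongrightarrow> 0"
  proof -
    have "(\<integral>\<^sup>+x\<in>ann. ennreal ((norm (U n x - u x))\<^sup>2) \<partial>lebesgue) = (\<integral>\<^sup>+x\<in>ann. ennreal ((norm (U n x - u' x))\<^sup>2) \<partial>lborel)" for n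
      unfolding nn_integral_completion by (rule nn_integral_cong_AE) (use uu' in eventually_elim, auto simp: indicator_def)
    then show ?thesis using U1 by simp
  qed
  have U2': "(\<lambda>n. \<integral>\<^sup>+x\<in>ann. ennreal ((norm (matrix (frechet_derivative (U n) (at x)) - G x))\<^sup>2) \<partial>lborel) \<longlonglongrightarrow> 0"
  proof -
    have "(\<integral>\<^sup>+x\<in>ann. ennreal ((norm (matrix (frechet_derivative (U n) (at x)) - weak_grad ann u x))\<^sup>2) \<partial>lebesgue)
        = (\<integral>\<^sup>+x\<in>ann. ennreal ((norm (matrix (frechet_derivative (U n) (at x)) - G x))\<^sup>2) \<partial>lborel)" for n
      unfolding nn_integral_completion by (rule nn_integral_cong_AE) (use GG in eventually_elim, auto simp: indicator_def)
    then show ?thesis using U2 by simp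
  qed
  have V1: "(\<lambda>n. \<integral>\<^sup>+x\<in>ann. ennreal ((norm (V n x - v x))\<^sup>2) \<partial>lborel) \<longlonglongrightarrow> 0"
  proof (rule tendsto_sandwich[OF _ _ tendsto_const])
    show "\<forall>\<^sub>F n in sequentially. (\<integral>\<^sup>+x\<in>ann. ennreal ((norm (V n x - v x))\<^sup>2) \<partial>lborel)
        \<le> ennreal C * (\<integral>\<^sup>+x\<in>ann. ennreal ((norm (U n x - u' x))\<^sup>2) \<partial>lborel)"
    proof (rule always_eventually, rule allI)
      show "(\<integral>\<^sup>+x\<in>ann. ennreal ((norm (V n x - v x))\<^sup>2) \<partial>lborel)
        \<le> ennreal C * (\<integral>\<^sup>+x\<in>ann. ennreal ((norm (U n x - u' x))\<^sup>2) \<partial>lborel)" for n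
        unfolding V_def v_def by (rule C[of "\<lambda>x. ennreal ((norm (U n x - u' x))\<^sup>2)"]) measurable
    qed
    show "(\<lambda>n. ennreal C * (\<integral>\<^sup>+x\<in>ann. ennreal ((norm (U n x - u' x))\<^sup>2) \<partial>lborel)) \<longlonglongrightarrow> 0"
      using ennreal_tendsto_cmult[OF _ U1', of "ennreal C"] by simp
  qed simp
  have V2: "(\<lambda>n. \<integral>\<^sup>+x\<in>ann. ennreal ((norm (matrix (frechet_derivative (V n) (at x)) - H x))\<^sup>2) \<partial>lborel) \<longlonglongrightarrow> 0"
  proof (rule tendsto_sandwich[OF _ _ tendsto_const])
    have e: "matrix (frechet_derivative (V n) (at x)) - H x = (matrix (frechet_derivative (U n) (at (tw x))) - G (tw x)) ** matrix (tw' x)" for n x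
      unfolding V_def H_def matrix_frechet_comp[OF smU]
      by (rule bounded_bilinear.diff_left[OF bounded_bilinear_matrix_mult, symmetric])
    show "\<forall>\<^sub>F n in sequentially. (\<integral>\<^sup>+x\<in>ann. ennreal ((norm (matrix (frechet_derivative (V n) (at x)) - H x))\<^sup>2) \<partial>lborel)
        \<le> ennreal (K\<^sup>2) * (ennreal C * (\<integral>\<^sup>+x\<in>ann. ennreal ((norm (matrix (frechet_derivative (U n) (at x)) - G x))\<^sup>2) \<partial>lborel))"
    proof (rule always_eventually, rule allI)
      show "(\<integral>\<^sup>+x\<in>ann. ennreal ((norm (matrix (frechet_derivative (V n) (at x)) - H x))\<^sup>2) \<partial>lborel)
        \<le> ennreal (K\<^sup>2) * (ennreal C * (\<integral>\<^sup>+x\<in>ann. ennreal ((norm (matrix (frechet_derivative (U n) (at x)) - G x))\<^sup>2) \<partial>lborel))" for n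
        unfolding e by (rule bnd[of "\<lambda>x. matrix (frechet_derivative (U n) (at x)) - G x"]) measurable
    qed
    have "(\<lambda>n. ennreal (K\<^sup>2) * (ennreal C * (\<integral>\<^sup>+x\<in>ann. ennreal ((norm (matrix (frechet_derivative (U n) (at x)) - G x))\<^sup>2) \<partial>lborel))) \<longlonglongrightarrow> ennreal (K\<^sup>2) * (ennreal C * 0)"
      by (intro ennreal_tendsto_cmult U2') auto
    then show "(\<lambda>n. ennreal (K\<^sup>2) * (ennreal C * (\<integral>\<^sup>+x\<in>ann. ennreal ((norm (matrix (frechet_derivative (U n) (at x)) - G x))\<^sup>2) \<partial>lborel))) \<longlonglongrightarrow> 0"
      by simp
  qed simp
  have "is_weak_gradient ann v H"
  proof (rule weak_gradient_limit[where V = V])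
    show "bounded ann" by (rule bounded_subset[OF bounded_cball[of 0 b]]) (auto simp: annulus_def)
    show "set_integrable lborel ann v" by (rule set_integrable_of_L2[OF _ _ _ vL2]) (use fin in auto)
    show "set_integrable lborel ann H" by (rule set_integrable_of_L2[OF _ _ _ HL2]) (use fin in auto)
    show "(\<lambda>n. \<integral>\<^sup>+x\<in>ann. ennreal (norm (V n x - v x)) \<partial>lborel) \<longlonglongrightarrow> 0"
      by (rule L1_tendsto_of_L2[OF _ _ _ V1]) (use fin in auto)
    show "(\<lambda>n. \<integral>\<^sup>+x\<in>ann. ennreal (norm (matrix (frechet_derivative (V n) (at x)) - H x)) \<partial>lborel) \<longlonglongrightarrow> 0"
      by (rule L1_tendsto_of_L2[OF _ _ _ V2]) (use fin in auto)
  qed (use smV in auto)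
  then have wg: "is_weak_gradient ann (\<lambda>x. u (tw x)) H"
    using is_weak_gradient_cong[OF vu, of H H] by simp
  have L2H: "L2_on ann H" by (rule L2_onI[OF _ _ _ HL2]) auto
  have L2v: "L2_on ann (\<lambda>x. u (tw x))" by (rule L2_onI[OF _ _ vu vL2]) auto
  show "(\<lambda>x. u (tw x)) \<in> W12 ann" unfolding W12_def using L2v L2H wg by blast
  have gr: "AE x in lborel. x \<in> ann \<longrightarrow> weak_grad ann (\<lambda>x. u (tw x)) x = H x"
    by (rule weak_grad_AE_eq[OF open_annulus fin L2H wg])
  then show "AE x in lborel. x \<in> ann \<longrightarrow> weak_grad ann (\<lambda>x. u (tw x)) x = weak_grad ann u (tw x) ** matrix (tw' x)"
    using HG by eventually_elim simp
  show "has_trace a b (\<lambda>x. u (tw x)) (\<lambda>x. x)"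
    unfolding has_trace_def
  proof (intro exI[of _ V] conjI allI ballI)
    show "smooth (V n)" for n by (rule smV)
    have "(\<integral>\<^sup>+x\<in>ann. ennreal ((norm (V n x - u (tw x)))\<^sup>2) \<partial>lebesgue) = (\<integral>\<^sup>+x\<in>ann. ennreal ((norm (V n x - v x))\<^sup>2) \<partial>lborel)" for n
      unfolding nn_integral_completion by (rule nn_integral_cong_AE) (use vu in eventually_elim, auto simp: indicator_def)
    then show "(\<lambda>n. \<integral>\<^sup>+x\<in>ann. ennreal ((norm (V n x - u (tw x)))\<^sup>2) \<partial>lebesgue) \<longlonglongrightarrow> 0"
      using V1 by simp
    have "(\<integral>\<^sup>+x\<in>ann. ennreal ((norm (matrix (frechet_derivative (V n) (at x)) - weak_grad ann (\<lambda>x. u (tw x)) x))\<^sup>2) \<partial>lebesgue)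
        = (\<integral>\<^sup>+x\<in>ann. ennreal ((norm (matrix (frechet_derivative (V n) (at x)) - H x))\<^sup>2) \<partial>lborel)" for n
      unfolding nn_integral_completion by (rule nn_integral_cong_AE) (use gr in eventually_elim, auto simp: indicator_def)
    then show "(\<lambda>n. \<integral>\<^sup>+x\<in>ann. ennreal ((norm (matrix (frechet_derivative (V n) (at x)) - weak_grad ann (\<lambda>x. u (tw x)) x))\<^sup>2) \<partial>lebesgue) \<longlonglongrightarrow> 0"
      using V2 by simp
    show "(\<lambda>n. \<integral>\<^sup>+\<theta>\<in>{0..2*pi}. ennreal ((norm (V n (R *\<^sub>R e\<^sub>r \<theta>) - R *\<^sub>R e\<^sub>r \<theta>))\<^sup>2) \<partial>lebesgue) \<longlonglongrightarrow> 0"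
      if "R \<in> {a, b}" for R
      unfolding V_def using U3[OF that] by (simp add: tw_boundary[OF that])
  qed
qed

end

section \<open>Maps in polar form\<close>

text \<open>The polar form is written with a rotation of \<open>x\<close> itself, so that no angle
  has to be chosen for \<open>x\<close> and Borel measurability is immediate for continuous \<rho>
  and \<psi>.\<close>

definition polar_map :: "(real \<Rightarrow> real) \<Rightarrow> (real \<Rightarrow> real) \<Rightarrow> real^2 \<Rightarrow> real^2" where
  "polar_map \<rho> \<psi> x = (\<rho> (norm x) / norm x) *\<^sub>R rot (\<psi> (norm x)) x"

lemma polar_map_er: "0 < r \<Longrightarrow> polar_map \<rho> \<psi> (r *\<^sub>R e\<^sub>r \<theta>) = \<rho> r *\<^sub>R e\<^sub>r (\<theta> + \<psi> r)"
  by (simp add: polar_map_def rot_scaleR rot_er)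

lemma polar_map_rot: "polar_map \<rho> \<psi> (rot \<phi> x) = rot \<phi> (polar_map \<rho> \<psi> x)"
  by (simp add: polar_map_def rot_scaleR rot_rot add.commute)

text \<open>Every point has an angle, and all its angles give the same value of the polar form, so
  quantifying over all angles amounts to evaluating one function.\<close>

lemma polar_form_iff:
  assumes "0 < a"
  shows "(AE x in lebesgue. x \<in> annulus a b \<longrightarrow>
      (\<forall>\<theta>. x = norm x *\<^sub>R e\<^sub>r \<theta> \<longrightarrow> u x = \<rho> (norm x) *\<^sub>R e\<^sub>r (\<theta> + \<psi> (norm x))))
    \<longleftrightarrow> (AE x in lborel. x \<in> annulus a b \<longrightarrow> u x = polar_map \<rho> \<psi> x)"
proof -
  have "(\<forall>\<theta>. x = norm x *\<^sub>R e\<^sub>r \<theta> \<longrightarrow> u x = \<rho> (norm x) *\<^sub>R e\<^sub>r (\<theta> + \<psi> (norm x)))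
      \<longleftrightarrow> u x = polar_map \<rho> \<psi> x" if "x \<in> annulus a b" for x
  proof -
    have pos: "0 < norm x" using that assms by (auto simp: annulus_def)
    have *: "polar_map \<rho> \<psi> x = \<rho> (norm x) *\<^sub>R e\<^sub>r (\<theta> + \<psi> (norm x))" if "x = norm x *\<^sub>R e\<^sub>r \<theta>" for \<theta>
      using polar_map_er[OF pos, of \<rho> \<psi> \<theta>] that by simp
    obtain \<theta> where "x = norm x *\<^sub>R e\<^sub>r \<theta>" by (rule polar_surj)
    then show ?thesis using * by metis
  qed
  then have "(x \<in> annulus a b \<longrightarrow> (\<forall>\<theta>. x = norm x *\<^sub>R e\<^sub>r \<theta> \<longrightarrow> u x = \<rho> (norm x) *\<^sub>R e\<^sub>r (\<theta> + \<psi> (norm x))))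
      \<longleftrightarrow> (x \<in> annulus a b \<longrightarrow> u x = polar_map \<rho> \<psi> x)" for x by blast
  then show ?thesis by (simp only: AE_completion_iff)
qed

section \<open>Winding numbers of the radial curves\<close>

lemma continuous_AE_zero:
  fixes h :: "real \<Rightarrow> 'b::real_normed_vector"
  assumes pq: "p < q" and cont: "continuous_on {p..q} h"
    and ae: "AE s in lborel. s \<in> {p<..<q} \<longrightarrow> h s = 0" and s: "s \<in> {p..q}"
  shows "h s = 0"
proof -
  have cont': "continuous_on {p<..<q} h" by (rule continuous_on_subset[OF cont]) auto
  have in0: "h x = 0" if x: "x \<in> {p<..<q}" for x
  proof (rule ccontr)
    assume "h x \<noteq> 0"
    \<comment> \<open>Inside the interval the set where \<open>h\<close> is nonzero is open, and a
      nonempty open set is not null. The endpoints follow by taking the closure.\<close>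
    define S where "S = {p<..<q} \<inter> h -` (- {0})"
    have "open S" unfolding S_def
      by (rule continuous_open_preimage[OF cont']) auto
    moreover have "x \<in> S" using x \<open>h x \<noteq> 0\<close> by (auto simp: S_def)
    ultimately have "\<not> negligible S" using open_not_negligible by blast
    moreover have "AE s in lebesgue. s \<notin> S"
      using ae unfolding AE_completion_iff by eventually_elim (auto simp: S_def)
    then have "S \<in> null_sets lebesgue"
      using completion.null_sets_iff_AE[of S lborel] by simp
    then have "negligible S" by (simp add: negligible_iff_null_sets)
    ultimately show False by simp
  qed
  have "continuous_on (closure {p<..<q}) h" using cont pq by simp
  then show ?thesis
    by (rule continuous_constant_on_closure[where S = "{p<..<q}"]) (use in0 s pq in auto)
qed

lemma AE_theta_witness:
  assumes "AE \<theta> in lborel. P \<theta>"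
  obtains \<theta> where "0 < \<theta>" "\<theta> < 2 * pi" "P \<theta>"
proof -
  have "\<exists>\<theta>\<in>{0<..<2 * pi}. P \<theta>"
  proof (rule ccontr)
    assume "\<not> ?thesis"
    \<comment> \<open>If no angle had the property, the constant function 1 would vanish almost
      everywhere on the interval, contradicting the preceding lemma.\<close>
    then have "AE \<theta> in lborel. \<theta> \<in> {0<..<2 * pi} \<longrightarrow> (1::real) = 0"
      using assms by (auto elim!: eventually_mono)
    from continuous_AE_zero[OF _ _ this, of pi] show False by auto
  qed
  then show ?thesis using that by auto
qed

text \<open>The normalised curve is the exponential of the continuous path \<open>p\<close> on the
  imaginary axis, so its winding number about 0 is the increment of \<open>p\<close> divided by 2 pi
  i. As \<psi> is a lift of the angle, no integrality is involved here.\<close>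

lemma winding_radial_curve:
  assumes ab: "a < b" and cont: "continuous_on {a..b} \<psi>" and pos: "\<And>r. r \<in> {a..b} \<Longrightarrow> 0 < \<rho> r"
    and w: "\<And>r. r \<in> {a..b} \<Longrightarrow> w (r *\<^sub>R e\<^sub>r \<theta>) = \<rho> r *\<^sub>R e\<^sub>r (\<theta> + \<psi> r)"
  shows "winding_number (radial_curve a b w \<theta>) 0 = of_real ((\<psi> b - \<psi> a) / (2 * pi))"
proof -
  define p where "p t = \<i> * of_real (\<theta> + \<psi> (a + (b - a) * t))" for t
  have in_ab: "a + (b - a) * t \<in> {a..b}" if "0 \<le> t" "t \<le> 1" for t
  proof -
    have "(b - a) * t \<le> b - a" "0 \<le> (b - a) * t"
      using that ab mult_left_mono[of t 1 "b - a"] by simp_all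
    then show ?thesis unfolding atLeastAtMost_iff by linarith
  qed
  have "path p"
    unfolding path_def p_def
    by (intro continuous_intros continuous_on_compose2[OF cont]) (use in_ab in auto)
  have "winding_number (radial_curve a b w \<theta>) 0 = winding_number (exp \<circ> p) 0"
  proof (rule winding_number_cong)
    fix t :: real assume t: "0 \<le> t" "t \<le> 1"
    define r where "r = a + (b - a) * t"
    have r: "r \<in> {a..b}" unfolding r_def by (rule in_ab[OF t])
    have "radial_curve a b w \<theta> t = to_complex (e\<^sub>r (\<theta> + \<psi> r))"
      using w[OF r] pos[OF r] by (simp add: radial_curve_def Let_def flip: r_def)
    also have "\<dots> = cis (\<theta> + \<psi> r)" by (simp add: to_complex_def cis.code)
    also have "\<dots> = (exp \<circ> p) t" by (simp add: p_def r_def cis_conv_exp)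
    finally show "radial_curve a b w \<theta> t = (exp \<circ> p) t" .
  qed
  also have "\<dots> = (pathfinish p - pathstart p) / (2 * of_real pi * \<i>)"
    by (rule winding_number_compose_exp[OF \<open>path p\<close>])
  also have "pathfinish p - pathstart p = \<i> * of_real (\<psi> b - \<psi> a)"
    by (simp add: p_def pathfinish_def pathstart_def algebra_simps)
  also have "\<i> * of_real (\<psi> b - \<psi> a) / (2 * of_real pi * \<i>) = of_real ((\<psi> b - \<psi> a) / (2 * pi))"
    by simp
  finally show ?thesis .
qed

lemma has_radial_windingI:
  assumes ab: "0 < a" "a < b" and cont: "continuous_on {a..b} \<rho>" "continuous_on {a..b} \<psi>"
    and pos: "\<And>r. r \<in> {a..b} \<Longrightarrow> 0 < \<rho> r"
    and u: "AE x in lborel. x \<in> annulus a b \<longrightarrow> u x = polar_map \<rho> \<psi> x"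
    and N: "\<psi> b - \<psi> a = 2 * pi * of_int N"
  shows "has_radial_winding a b N u"
  unfolding has_radial_winding_def
proof (intro exI[of _ "polar_map \<rho> \<psi>"] conjI)
  show "AE x in lebesgue. x \<in> annulus a b \<longrightarrow> polar_map \<rho> \<psi> x = u x"
    using u unfolding AE_completion_iff by eventually_elim simp
  show "AE \<theta> in lebesgue. \<theta> \<in> {0..2*pi} \<longrightarrow>
        continuous_on {a..b} (\<lambda>r. polar_map \<rho> \<psi> (r *\<^sub>R e\<^sub>r \<theta>)) \<and>
        (\<forall>r\<in>{a..b}. polar_map \<rho> \<psi> (r *\<^sub>R e\<^sub>r \<theta>) \<noteq> 0) \<and>
        winding_number (radial_curve a b (polar_map \<rho> \<psi>) \<theta>) 0 = of_int N"
  proof (intro AE_I2 impI conjI ballI)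
  fix \<theta>
  have e: "polar_map \<rho> \<psi> (r *\<^sub>R e\<^sub>r \<theta>) = \<rho> r *\<^sub>R e\<^sub>r (\<theta> + \<psi> r)" if "r \<in> {a..b}" for r
    using that ab by (intro polar_map_er) auto
  have "continuous_on {a..b} (\<lambda>r. \<rho> r *\<^sub>R e\<^sub>r (\<theta> + \<psi> r))"
    by (intro continuous_intros cont)
  then show "continuous_on {a..b} (\<lambda>r. polar_map \<rho> \<psi> (r *\<^sub>R e\<^sub>r \<theta>))"
    by (rule continuous_on_eq) (simp add: e)
  show "polar_map \<rho> \<psi> (r *\<^sub>R e\<^sub>r \<theta>) \<noteq> 0" if r: "r \<in> {a..b}" for r
  proof -
    have "norm (polar_map \<rho> \<psi> (r *\<^sub>R e\<^sub>r \<theta>)) = \<rho> r" using pos[OF r] by (simp add: e[OF r])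
    then show ?thesis using pos[OF r] by auto
  qed
  show "winding_number (radial_curve a b (polar_map \<rho> \<psi>) \<theta>) 0 = of_int N"
    using winding_radial_curve[OF ab(2) cont(2) pos e] N by simp
  qed
qed

text \<open>The representative \<open>w\<close> and the polar form agree almost everywhere. On a
  typical ray both are continuous up to the boundary and therefore agree at every point, including
  the endpoints. Nonvanishing of \<open>w\<close> then upgrades the nonnegativity of \<rho> to
  positivity, and its winding number is the increment of \<psi>.\<close>

lemma has_radial_windingD:
  assumes ab: "0 < a" "a < b" and cont: "continuous_on {a..b} \<rho>" "continuous_on {a..b} \<psi>"
    and nonneg: "\<And>r. r \<in> {a..b} \<Longrightarrow> 0 \<le> \<rho> r"
    and u: "AE x in lborel. x \<in> annulus a b \<longrightarrow> u x = polar_map \<rho> \<psi> x"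
    and wind: "has_radial_winding a b N u"
  shows "\<And>r. r \<in> {a..b} \<Longrightarrow> 0 < \<rho> r" and "\<psi> b - \<psi> a = 2 * pi * of_int N"
proof -
  obtain w where w1: "AE x in lebesgue. x \<in> annulus a b \<longrightarrow> w x = u x"
    and w2: "AE \<theta> in lebesgue. \<theta> \<in> {0..2*pi} \<longrightarrow>
        continuous_on {a..b} (\<lambda>r. w (r *\<^sub>R e\<^sub>r \<theta>)) \<and>
        (\<forall>r\<in>{a..b}. w (r *\<^sub>R e\<^sub>r \<theta>) \<noteq> 0) \<and>
        winding_number (radial_curve a b w \<theta>) 0 = of_int N"
    using wind unfolding has_radial_winding_def by blast
  have "AE x in lborel. x \<in> annulus a b \<longrightarrow> w x = polar_map \<rho> \<psi> x"
    using w1[unfolded AE_completion_iff] u by eventually_elim simp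
  from AE_polar_theta[OF ab this] w2[unfolded AE_completion_iff]
  have "AE \<theta> in lborel. (AE s in lborel. \<theta> \<in> {0<..<2 * pi} \<and> s \<in> {a\<^sup>2<..<b\<^sup>2} \<longrightarrow>
        w (polar s \<theta>) = polar_map \<rho> \<psi> (polar s \<theta>)) \<and> (\<theta> \<in> {0..2*pi} \<longrightarrow>
        continuous_on {a..b} (\<lambda>r. w (r *\<^sub>R e\<^sub>r \<theta>)) \<and>
        (\<forall>r\<in>{a..b}. w (r *\<^sub>R e\<^sub>r \<theta>) \<noteq> 0) \<and>
        winding_number (radial_curve a b w \<theta>) 0 = of_int N)"
    by eventually_elim simp
  then obtain \<theta> where \<theta>: "0 < \<theta>" "\<theta> < 2 * pi"
    and ae: "AE s in lborel. \<theta> \<in> {0<..<2 * pi} \<and> s \<in> {a\<^sup>2<..<b\<^sup>2} \<longrightarrow>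
        w (polar s \<theta>) = polar_map \<rho> \<psi> (polar s \<theta>)"
    and "\<theta> \<in> {0..2*pi} \<longrightarrow> continuous_on {a..b} (\<lambda>r. w (r *\<^sub>R e\<^sub>r \<theta>)) \<and>
        (\<forall>r\<in>{a..b}. w (r *\<^sub>R e\<^sub>r \<theta>) \<noteq> 0) \<and>
        winding_number (radial_curve a b w \<theta>) 0 = of_int N"
    by (rule AE_theta_witness) blast
  then have cw: "continuous_on {a..b} (\<lambda>r. w (r *\<^sub>R e\<^sub>r \<theta>))"
    and w0: "\<And>r. r \<in> {a..b} \<Longrightarrow> w (r *\<^sub>R e\<^sub>r \<theta>) \<noteq> 0"
    and wn: "winding_number (radial_curve a b w \<theta>) 0 = of_int N" by auto
  have a2b2: "a\<^sup>2 < b\<^sup>2" using ab by (intro power_strict_mono) auto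
  have sq: "sqrt s \<in> {a..b}" if "s \<in> {a\<^sup>2..b\<^sup>2}" for s
    using that ab real_sqrt_le_mono[of "a\<^sup>2" s] real_sqrt_le_mono[of s "b\<^sup>2"] by simp
  define h where "h s = w (polar s \<theta>) - \<rho> (sqrt s) *\<^sub>R e\<^sub>r (\<theta> + \<psi> (sqrt s))" for s
  have h0: "h s = 0" if "s \<in> {a\<^sup>2..b\<^sup>2}" for s
  proof (rule continuous_AE_zero[OF a2b2 _ _ that])
    show "continuous_on {a\<^sup>2..b\<^sup>2} h"
      unfolding h_def polar_def
      by (intro continuous_intros continuous_on_compose2[OF cw] continuous_on_compose2[OF cont(1)]
          continuous_on_compose2[OF cont(2)]) (use sq in auto)
    show "AE s in lborel. s \<in> {a\<^sup>2<..<b\<^sup>2} \<longrightarrow> h s = 0"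
      using ae
    proof eventually_elim
      case (elim s)
      show ?case
      proof
        assume s: "s \<in> {a\<^sup>2<..<b\<^sup>2}"
        have "a \<le> sqrt s" using sq[of s] s by auto
        then have "0 < sqrt s" using ab by linarith
        then show "h s = 0"
          using elim s \<theta> by (simp add: h_def polar_def polar_map_er)
      qed
    qed
  qed
  have e: "w (r *\<^sub>R e\<^sub>r \<theta>) = \<rho> r *\<^sub>R e\<^sub>r (\<theta> + \<psi> r)" if "r \<in> {a..b}" for r
  proof -
    have "r\<^sup>2 \<in> {a\<^sup>2..b\<^sup>2}" using that ab by (auto intro!: power_mono)
    from h0[OF this] show ?thesis using that ab by (simp add: h_def polar_def)
  qed
  show pos: "0 < \<rho> r" if "r \<in> {a..b}" for r
    using w0[OF that] e[OF that] nonneg[OF that] by (cases "\<rho> r = 0") auto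
  have "complex_of_real ((\<psi> b - \<psi> a) / (2 * pi)) = of_int N"
    using winding_radial_curve[OF ab(2) cont(2) pos e] wn by simp
  then have "(\<psi> b - \<psi> a) / (2 * pi) = of_int N"
    by (metis of_real_eq_iff of_real_of_int_eq)
  then show "\<psi> b - \<psi> a = 2 * pi * of_int N" by (simp add: field_simps)
qed

section \<open>Rotational symmetry and admissibility of composed maps\<close>

lemma rotation_matrix_rot:
  fixes Q :: "real^2^2"
  assumes "rotation_matrix Q"
  shows "\<exists>\<phi>. \<forall>x. Q *v x = rot \<phi> x"
proof -
  have o: "transpose Q ** Q = mat 1" and d: "det Q = 1"
    using assms by (auto simp: rotation_matrix_def orthogonal_matrix)
  have 1: "Q $ 1 $ 1 * Q $ 1 $ 1 + Q $ 2 $ 1 * Q $ 2 $ 1 = 1"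
    "Q $ 1 $ 2 * Q $ 1 $ 2 + Q $ 2 $ 2 * Q $ 2 $ 2 = 1"
    using arg_cong[OF o, of "\<lambda>B :: real^2^2. B $ 1 $ 1"] arg_cong[OF o, of "\<lambda>B :: real^2^2. B $ 2 $ 2"]
    by (simp_all add: matrix_matrix_mult_def transpose_def sum_2 mat_def)
  have 2: "Q $ 1 $ 1 * Q $ 2 $ 2 - Q $ 1 $ 2 * Q $ 2 $ 1 = 1" using d by (simp add: det_2)
  \<comment> \<open>The sum of these squares is the squared norm of \<open>Q\<close> minus twice its
    determinant, that is 2 - 2.\<close>
  have "(Q $ 1 $ 1 - Q $ 2 $ 2)\<^sup>2 + (Q $ 1 $ 2 + Q $ 2 $ 1)\<^sup>2 = 0"
    using 1 2 by (simp add: power2_eq_square algebra_simps)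
  then have e: "Q $ 2 $ 2 = Q $ 1 $ 1" "Q $ 1 $ 2 = - Q $ 2 $ 1"
    by (simp_all add: sum_power2_eq_zero_iff)
  have "(Q $ 1 $ 1)\<^sup>2 + (Q $ 2 $ 1)\<^sup>2 = 1" using 1 by (simp add: power2_eq_square)
  then obtain \<phi> where \<phi>: "Q $ 1 $ 1 = cos \<phi>" "Q $ 2 $ 1 = sin \<phi>" by (rule sincos_total_2pi)
  have "Q *v x = rot \<phi> x" for x
    by (simp add: vec_eq_iff forall_2 matrix_vector_mult_def sum_2 e \<phi>)
  then show ?thesis by blast
qed

text \<open>A linear map sends null sets to null sets, so the exceptional set is rotated
  back.\<close>

lemma AE_rot:
  assumes "AE x in lborel. P x"
  shows "AE x in lborel. P (rot \<phi> x)"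
proof -
  have "AE x in lebesgue. P x" using assms by (simp add: AE_completion_iff)
  then obtain N where N': "{x \<in> space lebesgue. \<not> P x} \<subseteq> N" "emeasure lebesgue N = 0" "N \<in> sets lebesgue"
    by (rule AE_E)
  then have N: "\<And>x. x \<notin> N \<Longrightarrow> P x" "N \<in> null_sets lebesgue" by auto
  have "negligible (rot (- \<phi>) ` N)"
    by (rule negligible_differentiable_image_negligible)
      (use N bounded_linear_rot in \<open>auto simp: negligible_iff_null_sets intro: linear_imp_differentiable_on bounded_linear.linear\<close>)
  then have "AE x in lebesgue. x \<notin> rot (- \<phi>) ` N"
    by (intro AE_not_in) (simp add: negligible_iff_null_sets)
  then have "AE x in lborel. x \<notin> rot (- \<phi>) ` N" by (simp add: AE_completion_iff)
  then show ?thesis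
  proof eventually_elim
    case (elim x)
    have "rot \<phi> x \<notin> N"
    proof
      assume "rot \<phi> x \<in> N"
      then have "rot (- \<phi>) (rot \<phi> x) \<in> rot (- \<phi>) ` N" by (rule imageI)
      then show False using elim by (simp add: rot_cancel)
    qed
    then show ?case using N(1) by auto
  qed
qed

lemma polar_map_symmetric:
  assumes u: "AE x in lborel. x \<in> annulus a b \<longrightarrow> u x = polar_map \<rho> \<psi> x"
    and Q: "rotation_matrix Q"
  shows "AE x in lebesgue. x \<in> annulus a b \<longrightarrow> u x = transpose Q *v u (Q *v x)"
proof -
  obtain \<phi> where \<phi>: "\<And>x. Q *v x = rot \<phi> x" using rotation_matrix_rot[OF Q] by blast
  have o: "transpose Q ** Q = mat 1" using Q by (auto simp: rotation_matrix_def orthogonal_matrix)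
  have "AE x in lborel. rot \<phi> x \<in> annulus a b \<longrightarrow> u (rot \<phi> x) = polar_map \<rho> \<psi> (rot \<phi> x)"
    by (rule AE_rot[OF u])
  with u show ?thesis unfolding AE_completion_iff
  proof eventually_elim
    case (elim x)
    show ?case
    proof
      assume x: "x \<in> annulus a b"
      then have "u (Q *v x) = Q *v u x"
        using elim by (simp add: \<phi> annulus_def polar_map_rot)
      then show "u x = transpose Q *v u (Q *v x)"
        by (simp add: matrix_vector_mul_assoc o)
    qed
  qed
qed

context twist_map
begin

lemma phi_in: "r \<in> {a..b} \<Longrightarrow> r * A (r\<^sup>2) \<in> {a..b}"
proof -
  assume r: "r \<in> {a..b}"
  then have r2: "r\<^sup>2 \<in> {a\<^sup>2..b\<^sup>2}" using ab by (auto intro!: power_mono)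
  have "m (r\<^sup>2) \<in> {a\<^sup>2..b\<^sup>2}"
    using m_mono[of "a\<^sup>2" "r\<^sup>2"] m_mono[of "r\<^sup>2" "b\<^sup>2"] m_a m_b r2
    by (cases "r\<^sup>2 = a\<^sup>2"; cases "r\<^sup>2 = b\<^sup>2") (auto simp: less_le)
  moreover have "(r * A (r\<^sup>2))\<^sup>2 = m (r\<^sup>2)" by (simp add: m_def power_mult_distrib)
  moreover have "0 \<le> r * A (r\<^sup>2)" using r ab Apos[of "r\<^sup>2"] by (intro mult_nonneg_nonneg) auto
  ultimately show "r * A (r\<^sup>2) \<in> {a..b}"
    using ab power2_le_imp_le[of a "r * A (r\<^sup>2)"] power2_le_imp_le[of "r * A (r\<^sup>2)" b] by auto
qed

lemma polar_map_tw:
  assumes "x \<noteq> 0"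
  shows "polar_map \<rho> \<psi> (tw x) = polar_map (\<lambda>r. \<rho> (r * A (r\<^sup>2))) (\<lambda>r. \<psi> (r * A (r\<^sup>2)) + \<eta> (r\<^sup>2)) x"
proof -
  obtain \<theta> where \<theta>: "x = norm x *\<^sub>R e\<^sub>r \<theta>" by (rule polar_surj)
  define r where "r = norm x"
  have r: "0 < r" using assms by (simp add: r_def)
  have x: "x = r *\<^sub>R e\<^sub>r \<theta>" using \<theta> by (simp add: r_def)
  have "0 < r * A (r\<^sup>2)" using r Apos by simp
  then have "polar_map \<rho> \<psi> (tw x) = \<rho> (r * A (r\<^sup>2)) *\<^sub>R e\<^sub>r (\<theta> + \<eta> (r\<^sup>2) + \<psi> (r * A (r\<^sup>2)))"
    unfolding x twist_scaleR_er by (rule polar_map_er)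
  also have "\<dots> = polar_map (\<lambda>r. \<rho> (r * A (r\<^sup>2))) (\<lambda>r. \<psi> (r * A (r\<^sup>2)) + \<eta> (r\<^sup>2)) x"
    unfolding x polar_map_er[OF r] by (simp add: ac_simps)
  finally show ?thesis .
qed

text \<open>Radially the composition reparametrises \<rho> and \<psi> and adds \<eta> to the angle,
  whence the winding numbers add. With \<open>M = 0\<close> this gives the competitors used in the
  variations; with \<open>u\<close> the identity and \<open>N = 0\<close> it gives a map of
  prescribed winding number. The determinant is multiplied by the positive Jacobian and keeps its
  sign.\<close>

lemma admissible_tw:
  assumes u: "u \<in> W12 ann" "has_trace a b u (\<lambda>x. x)"
    and det: "AE x in lborel. x \<in> ann \<longrightarrow> 0 \<le> det (weak_grad ann u x)"
    and pol: "AE x in lborel. x \<in> ann \<longrightarrow> u x = polar_map \<rho> \<psi> x"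
    and cont: "continuous_on {a..b} \<rho>" "continuous_on {a..b} \<psi>"
    and pos: "\<And>r. r \<in> {a..b} \<Longrightarrow> 0 < \<rho> r"
    and N: "\<psi> b - \<psi> a = 2 * pi * of_int N"
  shows "(\<lambda>x. u (tw x)) \<in> admissible_sym a b (N + M)"
proof -
  define \<rho>' where "\<rho>' r = \<rho> (r * A (r\<^sup>2))" for r
  define \<psi>' where "\<psi>' r = \<psi> (r * A (r\<^sup>2)) + \<eta> (r\<^sup>2)" for r
  note sob = sobolev_tw[OF u]
  have pol': "AE x in lborel. x \<in> ann \<longrightarrow> u (tw x) = polar_map \<rho>' \<psi>' x"
    using AE_tw[OF pol]
  proof eventually_elim
    case (elim x)
    show ?case
    proof
      assume x: "x \<in> ann"
      then have "x \<noteq> 0" using ab by (auto simp: annulus_def)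
      then show "u (tw x) = polar_map \<rho>' \<psi>' x"
        using elim x polar_map_tw unfolding \<rho>'_def \<psi>'_def by simp
    qed
  qed
  have cphi: "continuous_on {a..b} (\<lambda>r. r * A (r\<^sup>2))"
    by (intro continuous_intros continuous_on_compose2[OF smooth_continuous_on[OF smA, of UNIV]]) auto
  have "continuous_on {a..b} \<rho>'"
    unfolding \<rho>'_def by (rule continuous_on_compose2[OF cont(1) cphi]) (use phi_in in auto)
  moreover have "continuous_on {a..b} \<psi>'"
    unfolding \<psi>'_def
    by (intro continuous_on_add continuous_on_compose2[OF cont(2) cphi]
        continuous_on_compose2[OF smooth_continuous_on[OF sm\<eta>, of UNIV]] continuous_intros) (use phi_in in auto)
  moreover have "0 < \<rho>' r" if "r \<in> {a..b}" for r
    unfolding \<rho>'_def by (rule pos[OF phi_in[OF that]])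
  moreover have "\<psi>' b - \<psi>' a = 2 * pi * of_int (N + M)"
  proof -
    have "\<eta> (a\<^sup>2) = 0" "\<eta> (b\<^sup>2) = 2 * pi * of_int M" "A (a\<^sup>2) = 1" "A (b\<^sup>2) = 1"
      using pq by (auto intro: \<eta>0 \<eta>M A1)
    then show ?thesis using N by (simp add: \<psi>'_def algebra_simps)
  qed
  ultimately have wind: "has_radial_winding a b (N + M) (\<lambda>x. u (tw x))"
    by (intro has_radial_windingI[OF ab _ _ _ pol'])
  have det': "AE x in lborel. x \<in> ann \<longrightarrow> 0 \<le> det (weak_grad ann (\<lambda>x. u (tw x)) x)"
    using sob(3) AE_tw[OF det]
  proof eventually_elim
    case (elim x)
    then show ?case using J_ann_pos[of x] by (auto simp: det_mul det_tw intro!: mult_nonneg_nonneg)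
  qed
  show ?thesis
    unfolding admissible_sym_def admissible_def
    using sob(1,2) det' wind polar_map_symmetric[OF pol'] by (simp add: AE_completion_iff)
qed

end

section \<open>A competitor of finite energy\<close>

lemma smooth_primitive:
  fixes f :: "real \<Rightarrow> real"
  assumes f: "smooth f" and z: "\<And>x. x \<le> p \<Longrightarrow> f x = 0"
  shows "\<exists>F. smooth F \<and> (\<forall>x. (F has_real_derivative f x) (at x)) \<and> (\<forall>x\<le>p. F x = 0)"
proof -
  \<comment> \<open>The lower limit lies strictly below \<open>p\<close>, so that every point from
    \<open>p\<close> on is interior to an interval of integration and the one-sided derivative there
    is two-sided.\<close>
  define F where "F x = integral {p - 1..x} f" for x
  have F0: "F x = 0" if "x \<le> p" for x
  proof -
    have "F x = integral {p - 1..x} (\<lambda>_. 0)" unfolding F_def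
      by (rule integral_cong) (use that z in auto)
    then show ?thesis by simp
  qed
  have d: "(F has_real_derivative f x) (at x)" for x
  proof (cases "x < p")
    case True
    have "(F has_real_derivative 0) (at x)"
      by (rule has_field_derivative_transform_within_open[where f = "\<lambda>_. 0" and S = "{..<p}"])
        (use True F0 in auto)
    then show ?thesis using True z[of x] by simp
  next
    case False
    have "(F has_real_derivative f x) (at x within {p - 1..x + 1})"
      unfolding F_def
      by (rule integral_has_real_derivative) (use False f in \<open>auto intro: smooth_continuous_on\<close>)
    moreover have "at x within {p - 1..x + 1} = at x"
      by (rule at_within_interior) (use False in auto)
    ultimately show ?thesis by simp
  qed
  show ?thesis using smooth_realI[OF d f] d F0 by blast
qed

text \<open>A primitive of a bump, scaled to the prescribed final value; the mean value theorem
  shows that its total increment is positive.\<close>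

lemma smooth_step:
  fixes p q c :: real
  assumes pq: "p < q"
  shows "\<exists>\<eta>. smooth \<eta> \<and> (\<forall>s\<le>p. \<eta> s = 0) \<and> (\<forall>s\<ge>q. \<eta> s = c)"
proof -
  obtain F where F: "smooth F" "\<And>x. (F has_real_derivative bump p q 0 x) (at x)" "\<And>x. x \<le> p \<Longrightarrow> F x = 0"
    using smooth_primitive[OF smooth_bump[of p q 0], where p = p] by (auto simp: bump_zero)
  have "\<exists>z. p < z \<and> z < q \<and> F q - F p = (q - p) * bump p q 0 z"
    by (rule MVT2[OF pq]) (use F(2) in auto)
  then obtain z where "p < z" "z < q" "F q - F p = (q - p) * bump p q 0 z" by blast
  then have Fq: "0 < F q" using bump_pos[of z p q 0] F(3)[of p] pq by simp
  have const: "F s = F q" if "q \<le> s" for s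
  proof (cases "q = s")
    case False
    then have "q < s" using that by simp
    then have "\<exists>z. q < z \<and> z < s \<and> F s - F q = (s - q) * bump p q 0 z"
      by (rule MVT2) (use F(2) in auto)
    then show ?thesis by (auto simp: bump_zero)
  qed simp
  show ?thesis
  proof (intro exI[of _ "\<lambda>s. (c / F q) * F s"] conjI)
    show "smooth (\<lambda>s. (c / F q) * F s)" by (rule smooth_mult[OF smooth_const F(1)])
    show "\<forall>s\<le>p. c / F q * F s = 0" using F(3) by simp
    show "\<forall>s\<ge>q. c / F q * F s = c"
    proof (intro allI impI)
      fix s assume "q \<le> s"
      from const[OF this] show "c / F q * F s = c" using Fq by simp
    qed
  qed
qed

lemma identity_sobolev:
  assumes ab: "0 < a" "a < b"
  shows "(\<lambda>x. x) \<in> W12 (annulus a b)" "has_trace a b (\<lambda>x. x) (\<lambda>x. x)"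
    "AE x in lborel. x \<in> annulus a b \<longrightarrow> weak_grad (annulus a b) (\<lambda>x. x) x = mat 1"
proof -
  let ?S = "annulus a b"
  note fin = emeasure_annulus_finite[of a b]
  have fd: "matrix (frechet_derivative (\<lambda>x. x) (at x)) = (mat 1 :: real^2^2)" for x :: "real^2"
  proof -
    have "frechet_derivative (\<lambda>x. x) (at x) = (\<lambda>h. h)"
      by (rule frechet_derivative_at[OF has_derivative_ident, symmetric])
    then show ?thesis by (simp add: matrix_id_mat_1[unfolded id_def])
  qed
  have mx: "matrix (\<lambda>x. x) = (mat 1 :: real^2^2)"
    by (rule matrix_id_mat_1[unfolded id_def])
  have L1: "(\<integral>\<^sup>+x\<in>?S. ennreal ((norm x)\<^sup>2) \<partial>lborel) < \<infinity>"
  proof -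
    have "(\<integral>\<^sup>+x\<in>?S. ennreal ((norm x)\<^sup>2) \<partial>lborel) \<le> (\<integral>\<^sup>+x. ennreal (b\<^sup>2) * indicator ?S x \<partial>lborel)"
      using ab by (intro nn_integral_mono) (auto simp: indicator_def annulus_def intro!: ennreal_leI power_mono)
    also have "\<dots> = ennreal (b\<^sup>2) * emeasure lborel ?S" by (rule nn_integral_cmult_indicator) simp
    also have "\<dots> < \<infinity>" using fin by (simp add: ennreal_mult_less_top)
    finally show ?thesis .
  qed
  have L2: "(\<integral>\<^sup>+x\<in>?S. ennreal ((norm (mat 1 :: real^2^2))\<^sup>2) \<partial>lborel) < \<infinity>"
    using fin by (subst nn_integral_cmult_indicator) (auto simp: ennreal_mult_less_top)
  have wg: "is_weak_gradient ?S (\<lambda>x. x) (\<lambda>x. mat 1)"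
  proof (rule weak_gradient_limit[where V = "\<lambda>n x. x"])
    show "bounded ?S" by (rule bounded_subset[OF bounded_cball[of 0 b]]) (auto simp: annulus_def)
    show "set_integrable lborel ?S (\<lambda>x. x)" by (rule set_integrable_of_L2[OF _ _ _ L1]) (use fin in auto)
    show "set_integrable lborel ?S (\<lambda>x. mat 1 :: real^2^2)" by (rule set_integrable_of_L2[OF _ _ _ L2]) (use fin in auto)
  qed (auto simp: mx smooth_id)
  have 1: "L2_on ?S (\<lambda>x. x)" by (rule L2_onI[OF _ _ _ L1]) auto
  have 2: "L2_on ?S (\<lambda>x. mat 1 :: real^2^2)" by (rule L2_onI[OF _ _ _ L2]) auto
  show "(\<lambda>x. x) \<in> W12 ?S" unfolding W12_def using 1 2 wg by blast
  show gr: "AE x in lborel. x \<in> ?S \<longrightarrow> weak_grad ?S (\<lambda>x. x) x = mat 1"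
    by (rule weak_grad_AE_eq[OF open_annulus fin 2 wg])
  have "(\<integral>\<^sup>+x\<in>?S. ennreal ((norm (mat 1 - weak_grad ?S (\<lambda>x. x) x))\<^sup>2) \<partial>lebesgue) = (\<integral>\<^sup>+x. 0 \<partial>(lborel :: (real^2) measure))"
    unfolding nn_integral_completion by (rule nn_integral_cong_AE) (use gr in eventually_elim, auto simp: indicator_def)
  then show "has_trace a b (\<lambda>x. x) (\<lambda>x. x)"
    unfolding has_trace_def by (intro exI[of _ "\<lambda>n x. x"]) (simp add: mx smooth_id)
qed

text \<open>Twisting the identity by \<open>N\<close> full turns without changing radii preserves
  area. The determinant is therefore 1 almost everywhere and the gradient is bounded, so finiteness
  of \<open>h 1\<close> bounds the energy density.\<close>

lemma finite_energy_competitor: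
  assumes ab: "0 < a" "a < b" and h: "\<bar>h 1\<bar> \<noteq> (\<infinity>::ereal)"
  shows "\<exists>v \<in> admissible_sym a b N. energy a b h v < \<infinity>"
proof -
  have a2b2: "a\<^sup>2 < b\<^sup>2" using ab by (intro power_strict_mono) auto
  \<comment> \<open>The turn takes place in the middle third of the interval of squared
    radii.\<close>
  define p q where "p = (2 * a\<^sup>2 + b\<^sup>2) / 3" and "q = (a\<^sup>2 + 2 * b\<^sup>2) / 3"
  have pq: "a\<^sup>2 < p" "p < q" "q < b\<^sup>2" using a2b2 by (auto simp: p_def q_def field_simps)
  obtain \<eta> where \<eta>: "smooth \<eta>" "\<And>s. s \<le> p \<Longrightarrow> \<eta> s = 0" "\<And>s. q \<le> s \<Longrightarrow> \<eta> s = 2 * pi * of_int N"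
    using smooth_step[OF pq(2), of "2 * pi * of_int N"] by blast
  interpret twist_map a b p q "\<lambda>_. 1" \<eta> N
    by unfold_locales (use ab pq \<eta> in \<open>auto simp: smooth_const\<close>)
  note id = identity_sobolev[OF ab]
  let ?v = "\<lambda>x. tw x"
  have "?v \<in> admissible_sym a b (0 + N)"
  proof (rule admissible_tw[where u = "\<lambda>x. x" and \<rho> = "\<lambda>r. r" and \<psi> = "\<lambda>_. 0", OF id(1,2)])
    show "AE x in lborel. x \<in> ann \<longrightarrow> 0 \<le> det (weak_grad ann (\<lambda>x. x) x)"
      using id(3) by eventually_elim simp
    show "AE x in lborel. x \<in> ann \<longrightarrow> x = polar_map (\<lambda>r. r) (\<lambda>_. 0) x"
      using ab by (intro AE_I2) (auto simp: polar_map_def annulus_def)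
  qed (use ab in \<open>auto intro!: continuous_intros\<close>)
  moreover have "energy a b h ?v < \<infinity>"
  proof -
    obtain K where K: "\<And>x. x \<in> ann \<Longrightarrow> norm (matrix (tw' x)) \<le> K" using matrix_tw_bounded by blast
    have J1: "J s = 1" for s by (simp add: J_def)
    have ae: "AE x in lborel. x \<in> ann \<longrightarrow> weak_grad ann ?v x = matrix (tw' x)"
      using sobolev_tw(3)[OF id(1,2)] AE_tw[OF id(3)] by eventually_elim simp
    have "energy a b h ?v \<le> (\<integral>\<^sup>+x. (ennreal (K\<^sup>2 / 2) + e2ennreal (h 1)) * indicator ann x \<partial>lborel)"
      unfolding energy_def nn_integral_completion
    proof (rule nn_integral_mono_AE)
      show "AE x in lborel. (ennreal ((norm (weak_grad ann ?v x))\<^sup>2 / 2) + e2ennreal (h (det (weak_grad ann ?v x)))) * indicator ann x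
          \<le> (ennreal (K\<^sup>2 / 2) + e2ennreal (h 1)) * indicator ann x"
        using ae
      proof eventually_elim
        case (elim x)
        show ?case
        proof (cases "x \<in> ann")
          case True
          have "(norm (matrix (tw' x)))\<^sup>2 \<le> K\<^sup>2" by (rule power_mono[OF K[OF True]]) simp
          then show ?thesis using elim True
            by (auto simp: det_tw J1 intro!: add_mono ennreal_leI)
        qed simp
      qed
    qed
    also have "\<dots> = (ennreal (K\<^sup>2 / 2) + e2ennreal (h 1)) * emeasure lborel ann"
      by (rule nn_integral_cmult_indicator) simp
    also have "\<dots> < \<infinity>"
      using emeasure_annulus_finite[of a b] h by (cases "h 1") (auto simp: ennreal_mult_less_top)
    finally show ?thesis .
  qed
  ultimately show ?thesis by auto
qed

section \<open>Absolute continuity along rays and circles\<close>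

text \<open>Truncation at 1, after finitely many terms are dropped, yields integrable real functions
  tending to 0 in L^1, which have an almost everywhere convergent subsequence. Where the truncated
  values tend to 0 the truncation is eventually inactive.\<close>

lemma nn_integral_tendsto_zero_AE_subseq:
  fixes A :: "nat \<Rightarrow> 'a \<Rightarrow> ennreal"
  assumes [measurable]: "\<And>n. A n \<in> borel_measurable M"
    and lim: "(\<lambda>n. \<integral>\<^sup>+x. A n x \<partial>M) \<longlonglongrightarrow> 0"
  shows "\<exists>r::nat \<Rightarrow> nat. strict_mono r \<and> (AE x in M. (\<lambda>n. A (r n) x) \<longlonglongrightarrow> 0)"
proof -
  have "\<forall>\<^sub>F n in sequentially. (\<integral>\<^sup>+x. A n x \<partial>M) < 1"
    using lim by (rule order_tendstoD) simp
  then obtain N where N: "\<And>n. n \<ge> N \<Longrightarrow> (\<integral>\<^sup>+x. A n x \<partial>M) < 1"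
    unfolding eventually_sequentially by blast
  define u where "u n x = enn2real (min 1 (A (n + N) x))" for n x
  have [measurable]: "u n \<in> borel_measurable M" for n unfolding u_def by measurable
  have eu: "ennreal (u n x) = min 1 (A (n + N) x)" for n x
    unfolding u_def by (rule ennreal_enn2real) (simp add: min_less_iff_disj)
  have u0: "0 \<le> u n x" for n x by (simp add: u_def)
  have le: "(\<integral>\<^sup>+x. ennreal (u n x) \<partial>M) \<le> (\<integral>\<^sup>+x. A (n + N) x \<partial>M)" for n
    unfolding eu by (intro nn_integral_mono) simp
  have int: "integrable M (u n)" for n
  proof (rule integrableI_bounded)
    have "(\<integral>\<^sup>+x. ennreal (norm (u n x)) \<partial>M) = (\<integral>\<^sup>+x. ennreal (u n x) \<partial>M)" using u0 by simp
    also have "\<dots> \<le> (\<integral>\<^sup>+x. A (n + N) x \<partial>M)" by (rule le)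
    also have "\<dots> < 1" by (rule N) simp
    finally show "(\<integral>\<^sup>+x. ennreal (norm (u n x)) \<partial>M) < \<infinity>" using less_trans ennreal_one_less_top by fastforce
  qed simp
  have "(\<lambda>n. \<integral>\<^sup>+x. ennreal (u n x) \<partial>M) \<longlonglongrightarrow> 0"
    by (rule tendsto_sandwich[OF _ _ tendsto_const LIMSEQ_ignore_initial_segment[OF lim, of N]]) (use le in auto)
  moreover have "(\<integral>\<^sup>+x. ennreal (u n x) \<partial>M) = ennreal (LINT x|M. norm (u n x))" for n
    using nn_integral_eq_integral[OF int[of n]] u0 by simp
  ultimately have "(\<lambda>n. ennreal (LINT x|M. norm (u n x))) \<longlonglongrightarrow> ennreal 0" by simp
  then have "(\<lambda>n. LINT x|M. norm (u n x)) \<longlonglongrightarrow> 0"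
    by (subst (asm) tendsto_ennreal_iff) auto
  from tendsto_L1_AE_subseq[OF int this]
  obtain r :: "nat \<Rightarrow> nat" where r: "strict_mono r" and ae: "AE x in M. (\<lambda>n. u (r n) x) \<longlonglongrightarrow> 0" by blast
  have "strict_mono (\<lambda>n. r n + N)" using r by (simp add: strict_mono_def)
  moreover have "AE x in M. (\<lambda>n. A (r n + N) x) \<longlonglongrightarrow> 0"
    using ae
  proof eventually_elim
    case (elim x)
    have "(\<lambda>n. ennreal (u (r n) x)) \<longlonglongrightarrow> ennreal 0" by (rule tendsto_ennrealI[OF elim])
    then have l: "(\<lambda>n. min 1 (A (r n + N) x)) \<longlonglongrightarrow> 0" by (simp add: eu)
    then have "\<forall>\<^sub>F n in sequentially. min 1 (A (r n + N) x) < 1" by (rule order_tendstoD) simp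
    then have "\<forall>\<^sub>F n in sequentially. min 1 (A (r n + N) x) = A (r n + N) x"
      by eventually_elim (auto simp: min_def)
    then show ?case using l by (rule Lim_transform_eventually[rotated])
  qed
  ultimately show ?thesis by blast
qed

lemma AE_interval_witness:
  fixes p q :: real
  assumes "p < q" "AE s in lborel. s \<in> {p<..<q} \<longrightarrow> P s"
  obtains s where "s \<in> {p<..<q}" "P s"
proof -
  have "\<exists>s\<in>{p<..<q}. P s"
  proof (rule ccontr)
    assume "\<not> ?thesis"
    then have "AE s in lborel. s \<in> {p<..<q} \<longrightarrow> (1::real) = 0"
      using assms(2) by (auto elim!: eventually_mono)
    from continuous_AE_zero[OF assms(1) _ this, of "p"] show False using assms(1) by auto
  qed
  then show ?thesis using that by blast
qed

text \<open>The fundamental theorem of calculus holds for each \<open>F n\<close> and passes to the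
  limit between any two points at which a subsequence converges. Almost every point is of this kind,
  and continuity of \<open>f\<close> extends the identity to the closed interval.\<close>

lemma L1_limit_primitive:
  fixes F F' :: "nat \<Rightarrow> real \<Rightarrow> 'b::euclidean_space"
  assumes pq: "p < q"
    and der: "\<And>n s. s \<in> {p<..<q} \<Longrightarrow> (F n has_vector_derivative F' n s) (at s)"
    and contF': "\<And>n. continuous_on {p<..<q} (F' n)"
    and [measurable]: "\<And>n. F n \<in> borel_measurable borel" "\<And>n. F' n \<in> borel_measurable borel"
      "f \<in> borel_measurable borel" "g \<in> borel_measurable borel"
    and contf: "continuous_on {p..q} f"
    and g: "set_integrable lborel {p<..<q} g"
    and lim: "(\<lambda>n. \<integral>\<^sup>+s\<in>{p<..<q}. ennreal (norm (F n s - f s)) \<partial>lborel) \<longlonglongrightarrow> 0"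
      "(\<lambda>n. \<integral>\<^sup>+s\<in>{p<..<q}. ennreal (norm (F' n s - g s)) \<partial>lborel) \<longlonglongrightarrow> 0"
  shows "\<exists>C. \<forall>s\<in>{p..q}. f s = C + integral {p..s} (\<lambda>s. indicator {p<..<q} s *\<^sub>R g s)"
proof -
  \<comment> \<open>Cutting \<open>g\<close> off outside the open interval makes its integral over
    every \<open>{x..y}\<close> meaningful, in particular over intervals starting at
    \<open>p\<close>.\<close>
  define gI where "gI s = indicator {p<..<q} s *\<^sub>R g s" for s
  have igI: "set_integrable lborel S gI" if "S \<in> sets borel" for S
  proof -
    have "integrable lborel gI" using g by (simp add: set_integrable_def gI_def[abs_def])
    then show ?thesis unfolding set_integrable_def
      using that by (intro integrable_mult_indicator) auto
  qed
  have HK: "gI integrable_on {x..y}" for x y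
    using set_borel_integral_eq_integral(1)[OF igI, of "{x..y}"] by simp
  obtain r :: "nat \<Rightarrow> nat" where r: "strict_mono r"
    and ae: "AE s in lborel. (\<lambda>n. ennreal (norm (F (r n) s - f s)) * indicator {p<..<q} s) \<longlonglongrightarrow> 0"
    using nn_integral_tendsto_zero_AE_subseq[OF _ lim(1)] by auto
  have ae': "AE s in lborel. s \<in> {p<..<q} \<longrightarrow> (\<lambda>n. F (r n) s) \<longlonglongrightarrow> f s"
    using ae
  proof eventually_elim
    case (elim s)
    show ?case
    proof
      assume "s \<in> {p<..<q}"
      then have "(\<lambda>n. ennreal (norm (F (r n) s - f s))) \<longlonglongrightarrow> ennreal 0" using elim by simp
      then have "(\<lambda>n. norm (F (r n) s - f s)) \<longlonglongrightarrow> 0" by (subst (asm) tendsto_ennreal_iff) auto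
      then show "(\<lambda>n. F (r n) s) \<longlonglongrightarrow> f s" using LIM_zero_cancel tendsto_norm_zero_iff by blast
    qed
  qed
  have b: "(\<lambda>n. \<integral>\<^sup>+s\<in>{p<..<q}. ennreal (norm (F' (r n) s - g s)) \<partial>lborel) \<longlonglongrightarrow> 0"
    using LIMSEQ_subseq_LIMSEQ[OF lim(2) r] by (simp add: o_def)
  have incr: "f y - f x = integral {x..y} gI"
    if xy: "x \<in> {p<..<q}" "y \<in> {p<..<q}" "x \<le> y" and lx: "(\<lambda>n. F (r n) x) \<longlonglongrightarrow> f x" and ly: "(\<lambda>n. F (r n) y) \<longlonglongrightarrow> f y" for x y
  proof -
    have sub: "{x..y} \<subseteq> {p<..<q}" using xy by auto
    have bound: "ennreal (norm (F n y - F n x - integral {x..y} gI)) \<le> (\<integral>\<^sup>+s\<in>{p<..<q}. ennreal (norm (F' n s - g s)) \<partial>lborel)" for n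
    proof -
      have cF: "continuous_on {x..y} (F' n)" by (rule continuous_on_subset[OF contF' sub])
      have iF: "set_integrable lborel {x..y} (F' n)"
        by (rule borel_integrable_atLeastAtMost') (rule cF)
      have "(F' n has_integral (F n y - F n x)) {x..y}"
      proof (rule fundamental_theorem_of_calculus[OF xy(3)])
        fix z assume "z \<in> {x..y}"
        then have "z \<in> {p<..<q}" using sub by blast
        then show "(F n has_vector_derivative F' n z) (at z within {x..y})"
          by (rule has_vector_derivative_at_within[OF der])
      qed
      then have "integral {x..y} (F' n) = F n y - F n x" by (rule integral_unique)
      then have "(LINT s:{x..y}|lborel. F' n s) = F n y - F n x"
        using set_borel_integral_eq_integral(2)[OF iF] by simp
      moreover have "(LINT s:{x..y}|lborel. gI s) = integral {x..y} gI"
        by (rule set_borel_integral_eq_integral(2)[OF igI]) simp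
      ultimately have "F n y - F n x - integral {x..y} gI = (LINT s:{x..y}|lborel. F' n s - gI s)"
        using set_integral_diff(2)[OF iF igI[of "{x..y}"]] by simp
      also have "ennreal (norm \<dots>) \<le> (\<integral>\<^sup>+s. ennreal (norm (indicator {x..y} s *\<^sub>R (F' n s - gI s))) \<partial>lborel)"
        unfolding set_lebesgue_integral_def
        by (rule integral_norm_bound_ennreal) (use set_integral_diff(1)[OF iF igI[of "{x..y}"]] in \<open>simp add: set_integrable_def\<close>)
      also have "\<dots> \<le> (\<integral>\<^sup>+s\<in>{p<..<q}. ennreal (norm (F' n s - g s)) \<partial>lborel)"
      proof (rule nn_integral_mono)
        fix s
        show "ennreal (norm (indicator {x..y} s *\<^sub>R (F' n s - gI s))) \<le> ennreal (norm (F' n s - g s)) * indicator {p<..<q} s"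
          using sub by (cases "s \<in> {x..y}") (auto simp: gI_def subset_iff)
      qed
      finally show ?thesis .
    qed
    have "(\<lambda>n. norm (F (r n) y - F (r n) x - integral {x..y} gI)) \<longlonglongrightarrow> norm (f y - f x - integral {x..y} gI)"
      by (intro tendsto_intros lx ly)
    then have "(\<lambda>n. ennreal (norm (F (r n) y - F (r n) x - integral {x..y} gI))) \<longlonglongrightarrow> ennreal (norm (f y - f x - integral {x..y} gI))"
      by (rule tendsto_ennrealI)
    moreover have "(\<lambda>n. ennreal (norm (F (r n) y - F (r n) x - integral {x..y} gI))) \<longlonglongrightarrow> 0"
      by (rule tendsto_sandwich[OF _ _ tendsto_const b]) (use bound in auto)
    ultimately have "ennreal (norm (f y - f x - integral {x..y} gI)) = 0" by (rule LIMSEQ_unique)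
    then show ?thesis by simp
  qed
  \<comment> \<open>One point of convergence fixes the constant of integration; every other point is
    compared with it, from the left or from the right.\<close>
  obtain s0 where s0: "s0 \<in> {p<..<q}" "(\<lambda>n. F (r n) s0) \<longlonglongrightarrow> f s0"
    by (rule AE_interval_witness[OF pq ae'])
  define H where "H s = f s - f s0 - (integral {p..s} gI - integral {p..s0} gI)" for s
  have comb: "integral {p..x} gI + integral {x..y} gI = integral {p..y} gI" if "p \<le> x" "x \<le> y" for x y
    by (rule Henstock_Kurzweil_Integration.integral_combine[OF that HK])
  have "H s = 0" if "s \<in> {p..q}" for s
  proof (rule continuous_AE_zero[OF pq _ _ that])
    show "continuous_on {p..q} H"
      unfolding H_def by (intro continuous_intros contf indefinite_integral_continuous_1 HK)
    show "AE s in lborel. s \<in> {p<..<q} \<longrightarrow> H s = 0"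
      using ae'
    proof eventually_elim
      case (elim s)
      show ?case
      proof
        assume s: "s \<in> {p<..<q}"
        then have l: "(\<lambda>n. F (r n) s) \<longlonglongrightarrow> f s" using elim by simp
        show "H s = 0"
        proof (cases "s0 \<le> s")
          case True
          then show ?thesis using incr[OF s0(1) s True s0(2) l] comb[of s0 s] s0(1) by (simp add: H_def algebra_simps)
        next
          case False
          then have le: "s \<le> s0" by simp
          show ?thesis using incr[OF s s0(1) le l s0(2)] comb[of s s0] s le by (simp add: H_def algebra_simps)
        qed
      qed
    qed
  qed
  then show ?thesis
    by (intro exI[of _ "f s0 - integral {p..s0} gI"]) (simp add: H_def gI_def[abs_def] algebra_simps)
qed

text \<open>If the iterated integral of nonnegative functions tends to 0, then along a subsequence
  the inner integrals tend to 0 for almost every parameter. The one-dimensional lemma applies on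
  each such slice.\<close>

lemma slice_limit_primitive:
  fixes F F' :: "nat \<Rightarrow> real \<Rightarrow> real \<Rightarrow> 'b::euclidean_space"
  assumes pq: "p < q"
    and der: "\<And>n s t. s \<in> {p<..<q} \<Longrightarrow> t \<in> T \<Longrightarrow> ((\<lambda>s. F n s t) has_vector_derivative F' n s t) (at s)"
    and contF': "\<And>n t. t \<in> T \<Longrightarrow> continuous_on {p<..<q} (\<lambda>s. F' n s t)"
    and m[measurable]: "\<And>n. (\<lambda>z. F n (snd z) (fst z)) \<in> borel_measurable (lborel \<Otimes>\<^sub>M lborel)"
      "\<And>n. (\<lambda>z. F' n (snd z) (fst z)) \<in> borel_measurable (lborel \<Otimes>\<^sub>M lborel)"
      "(\<lambda>z. f (snd z) (fst z)) \<in> borel_measurable (lborel \<Otimes>\<^sub>M lborel)"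
      "(\<lambda>z. g (snd z) (fst z)) \<in> borel_measurable (lborel \<Otimes>\<^sub>M lborel)"
      "T \<in> sets borel"
    and contf: "\<And>t. t \<in> T \<Longrightarrow> continuous_on {p..q} (\<lambda>s. f s t)"
    and g: "(\<integral>\<^sup>+t\<in>T. (\<integral>\<^sup>+s\<in>{p<..<q}. ennreal (norm (g s t)) \<partial>lborel) \<partial>lborel) < \<infinity>"
    and lim: "(\<lambda>n. \<integral>\<^sup>+t\<in>T. (\<integral>\<^sup>+s\<in>{p<..<q}. ennreal (norm (F n s t - f s t)) \<partial>lborel) \<partial>lborel) \<longlonglongrightarrow> 0"
      "(\<lambda>n. \<integral>\<^sup>+t\<in>T. (\<integral>\<^sup>+s\<in>{p<..<q}. ennreal (norm (F' n s t - g s t)) \<partial>lborel) \<partial>lborel) \<longlonglongrightarrow> 0"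
  shows "AE t in lborel. t \<in> T \<longrightarrow> set_integrable lborel {p<..<q} (\<lambda>s. g s t) \<and>
    (\<exists>C. \<forall>s\<in>{p..q}. f s t = C + integral {p..s} (\<lambda>s. indicator {p<..<q} s *\<^sub>R g s t))"
proof -
  have sl: "(\<lambda>s. k s t) \<in> borel_measurable borel"
    if "(\<lambda>z. k (snd z) (fst z)) \<in> borel_measurable (lborel \<Otimes>\<^sub>M lborel)" for k :: "real \<Rightarrow> real \<Rightarrow> 'b" and t
    using measurable_compose[OF measurable_Pair1' that, of t] by simp
  define a where "a n t = (\<integral>\<^sup>+s\<in>{p<..<q}. ennreal (norm (F n s t - f s t)) \<partial>lborel)" for n t
  define b where "b n t = (\<integral>\<^sup>+s\<in>{p<..<q}. ennreal (norm (F' n s t - g s t)) \<partial>lborel)" for n t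
  define c where "c t = (\<integral>\<^sup>+s\<in>{p<..<q}. ennreal (norm (g s t)) \<partial>lborel)" for t
  have mk: "(\<lambda>t. \<integral>\<^sup>+s\<in>{p<..<q}. ennreal (norm (k s t)) \<partial>lborel) \<in> borel_measurable borel"
    if [measurable]: "(\<lambda>z. k (snd z) (fst z)) \<in> borel_measurable (lborel \<Otimes>\<^sub>M lborel)" for k :: "real \<Rightarrow> real \<Rightarrow> 'b"
  proof -
    have "(\<lambda>z. ennreal (norm (k (snd z) (fst z))) * indicator {p<..<q} (snd z)) \<in> borel_measurable (lborel \<Otimes>\<^sub>M lborel)"
      by measurable
    from lborel.borel_measurable_nn_integral_fst[OF this] show ?thesis by simp
  qed
  have [measurable]: "a n \<in> borel_measurable borel" for n unfolding a_def by (rule mk[of "\<lambda>s t. F n s t - f s t"]) measurable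
  have [measurable]: "b n \<in> borel_measurable borel" for n unfolding b_def by (rule mk[of "\<lambda>s t. F' n s t - g s t"]) measurable
  have [measurable]: "c \<in> borel_measurable borel" unfolding c_def by (rule mk) measurable
  \<comment> \<open>Taking the sum of the two inner integrals produces a common subsequence for the
    functions and for their derivatives.\<close>
  have "(\<lambda>n. \<integral>\<^sup>+t. (a n t + b n t) * indicator T t \<partial>lborel) \<longlonglongrightarrow> 0"
  proof -
    have "(\<integral>\<^sup>+t. (a n t + b n t) * indicator T t \<partial>lborel) = (\<integral>\<^sup>+t\<in>T. a n t \<partial>lborel) + (\<integral>\<^sup>+t\<in>T. b n t \<partial>lborel)" for n
      unfolding distrib_right by (rule nn_integral_add) measurable
    moreover have "(\<lambda>n. (\<integral>\<^sup>+t\<in>T. a n t \<partial>lborel) + (\<integral>\<^sup>+t\<in>T. b n t \<partial>lborel)) \<longlonglongrightarrow> 0 + 0"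
      by (intro tendsto_add) (use lim in \<open>simp_all add: a_def b_def\<close>)
    ultimately show ?thesis by simp
  qed
  then obtain r :: "nat \<Rightarrow> nat" where r: "strict_mono r"
    and ae: "AE t in lborel. (\<lambda>n. (a (r n) t + b (r n) t) * indicator T t) \<longlonglongrightarrow> 0"
    using nn_integral_tendsto_zero_AE_subseq[of "\<lambda>n t. (a n t + b n t) * indicator T t" lborel] by auto
  have "AE t in lborel. c t * indicator T t \<noteq> \<infinity>"
    by (rule nn_integral_PInf_AE) (use g in \<open>simp_all add: c_def\<close>)
  with ae show ?thesis
  proof eventually_elim
    case (elim t)
    show ?case
    proof
      assume t: "t \<in> T"
      note sm = sl[OF m(1)] sl[OF m(2)] sl[OF m(3)] sl[OF m(4)]
      have int: "set_integrable lborel {p<..<q} (\<lambda>s. g s t)"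
        unfolding set_integrable_def
      proof (rule integrableI_bounded)
        have "(\<integral>\<^sup>+s. ennreal (norm (indicator {p<..<q} s *\<^sub>R g s t)) \<partial>lborel) = c t"
          unfolding c_def by (intro nn_integral_cong) (auto simp: indicator_def)
        then show "(\<integral>\<^sup>+s. ennreal (norm (indicator {p<..<q} s *\<^sub>R g s t)) \<partial>lborel) < \<infinity>"
          using elim(2) t by (simp add: less_top)
      qed (use sm in measurable)
      have s: "(\<lambda>n. a (r n) t + b (r n) t) \<longlonglongrightarrow> 0" using elim(1) t by simp
      have za: "(\<lambda>n. a (r n) t) \<longlonglongrightarrow> 0" by (rule tendsto_sandwich[OF _ _ tendsto_const s]) auto
      have zb: "(\<lambda>n. b (r n) t) \<longlonglongrightarrow> 0" by (rule tendsto_sandwich[OF _ _ tendsto_const s]) auto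
      have "\<exists>C. \<forall>s\<in>{p..q}. f s t = C + integral {p..s} (\<lambda>s. indicator {p<..<q} s *\<^sub>R g s t)"
        by (rule L1_limit_primitive[OF pq der[OF _ t] contF'[OF t] sm contf[OF t] int za[unfolded a_def] zb[unfolded b_def]])
      with int show "set_integrable lborel {p<..<q} (\<lambda>s. g s t) \<and>
        (\<exists>C. \<forall>s\<in>{p..q}. f s t = C + integral {p..s} (\<lambda>s. indicator {p<..<q} s *\<^sub>R g s t))" by blast
    qed
  qed
qed

text \<open>Integrals over subintervals are differences of the primitive and hence vanish; the box
  version of the fundamental lemma is applied to each coordinate. This serves to identify two
  densities that have the same primitive up to a constant.\<close>

lemma primitive_const_AE_zero:
  fixes k :: "real \<Rightarrow> 'b::euclidean_space"
  assumes [measurable]: "k \<in> borel_measurable borel" and k: "set_integrable lborel {p<..<q} k"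
    and const: "\<And>s. s \<in> {p..q} \<Longrightarrow> integral {p..s} (\<lambda>s. indicator {p<..<q} s *\<^sub>R k s) = C"
  shows "AE s in lborel. s \<in> {p<..<q} \<longrightarrow> k s = 0"
proof -
  define kI where "kI s = indicator {p<..<q} s *\<^sub>R k s" for s
  have igI: "set_integrable lborel S kI" if "S \<in> sets borel" for S
  proof -
    have "integrable lborel kI" using k by (simp add: set_integrable_def kI_def[abs_def])
    then show ?thesis unfolding set_integrable_def
      using that by (intro integrable_mult_indicator) auto
  qed
  have HK: "kI integrable_on {x..y}" for x y
    using set_borel_integral_eq_integral(1)[OF igI, of "{x..y}"] by simp
  have "AE s in lborel. s \<in> {p<..<q} \<longrightarrow> k s \<bullet> i = 0" for i
  proof (rule AE_zero_if_box_integrals_zero)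
    show "(\<lambda>s. k s \<bullet> i) \<in> borel_measurable borel" by measurable
    show "open {p<..<q}" by simp
    fix l u :: real assume lu: "cbox l u \<subseteq> {p<..<q}"
    then have sub: "box l u \<subseteq> {p<..<q}" using box_subset_cbox by blast
    have "integrable lborel (\<lambda>s. (indicator (box l u) s *\<^sub>R k s) \<bullet> i)"
      using set_integrable_subset[OF k _ sub] by (intro integrable_inner_left) (simp add: set_integrable_def)
    then show int: "set_integrable lborel (box l u) (\<lambda>s. k s \<bullet> i)" by (simp add: set_integrable_def)
    show "(LINT s:box l u|lborel. k s \<bullet> i) = 0"
    proof (cases "l < u")
      case True
      then have "l \<in> cbox l u" "u \<in> cbox l u" by auto
      then have "l \<in> {p<..<q}" "u \<in> {p<..<q}" using lu by blast+
      then have lu': "p < l" "u < q" by auto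
      have "integral {p..l} kI + integral {l..u} kI = integral {p..u} kI"
        by (rule Henstock_Kurzweil_Integration.integral_combine[OF _ _ HK]) (use True lu' in auto)
      moreover have "integral {p..l} kI = C" "integral {p..u} kI = C"
        using const[of l] const[of u] True lu' by (auto simp: kI_def[abs_def])
      ultimately have "integral {l..u} kI = 0" by simp
      then have "(LINT s:{l..u}|lborel. kI s) = 0"
        using set_borel_integral_eq_integral(2)[OF igI, of "{l..u}"] by simp
      then have "(LINT s|lborel. (indicator {l..u} s *\<^sub>R kI s) \<bullet> i) = 0"
        using integral_inner_left[of i lborel "\<lambda>s. indicator {l..u} s *\<^sub>R kI s"] igI[of "{l..u}"]
        by (simp add: set_lebesgue_integral_def set_integrable_def)
      moreover have "(LINT s|lborel. (indicator {l..u} s *\<^sub>R kI s) \<bullet> i) = (LINT s:box l u|lborel. k s \<bullet> i)"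
        unfolding set_lebesgue_integral_def
      proof (rule integral_cong_AE)
        have "AE s in lborel. s \<noteq> l" "AE s in lborel. s \<noteq> u" by (rule AE_lborel_singleton)+
        then show "AE s in lborel. (indicator {l..u} s *\<^sub>R kI s) \<bullet> i = indicator (box l u) s *\<^sub>R (k s \<bullet> i)"
          by eventually_elim (use lu' in \<open>auto simp: kI_def indicator_def\<close>)
      qed (unfold kI_def, measurable)
      ultimately show ?thesis by simp
    qed (simp add: set_lebesgue_integral_def)
  qed
  then have "AE s in lborel. \<forall>i\<in>Basis. s \<in> {p<..<q} \<longrightarrow> k s \<bullet> i = 0"
    by (intro AE_finite_allI finite_Basis)
  then show ?thesis by eventually_elim (use euclidean_all_zero_iff in blast)
qed

section \<open>Derivatives of a Sobolev map along rays and circles\<close>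

lemma bounded_bilinear_matrix_vector: "bounded_bilinear ((*v) :: real^2^2 \<Rightarrow> real^2 \<Rightarrow> real^2)"
  unfolding bilinear_conv_bounded_bilinear[symmetric] bilinear_def
  by (auto intro!: linearI simp: vec_eq_iff matrix_vector_mult_def sum_2 algebra_simps)

lemma measurable_matrix_vector [measurable (raw)]:
  fixes B :: "'a \<Rightarrow> real^2^2" and v :: "'a \<Rightarrow> real^2"
  assumes "B \<in> borel_measurable M" "v \<in> borel_measurable M"
  shows "(\<lambda>x. B x *v v x) \<in> borel_measurable M"
proof (rule borel_measurable_continuous_Pair[OF assms])
  show "continuous_on UNIV (\<lambda>z. fst z *v (snd z :: real^2) :: real^2)"
    by (rule bounded_bilinear.continuous_on[OF bounded_bilinear_matrix_vector]) (intro continuous_intros)+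
qed

lemma continuous_on_perp [continuous_intros]:
  "continuous_on S f \<Longrightarrow> continuous_on S (\<lambda>x. perp (f x))"
  by (rule bounded_linear.continuous_on[OF bounded_linear_perp])

lemma measurable_perp [measurable (raw)]:
  assumes "f \<in> borel_measurable M"
  shows "(\<lambda>x. perp (f x)) \<in> borel_measurable M"
  by (rule borel_measurable_continuous_on[OF linear_continuous_on[OF bounded_linear_perp] assms])

lemma measurable_polar [measurable (raw)]:
  assumes "f \<in> borel_measurable M" "g \<in> borel_measurable M"
  shows "(\<lambda>x. polar (f x) (g x)) \<in> borel_measurable M"
  by (rule borel_measurable_continuous_Pair[OF assms, where H = polar])
    (intro continuous_intros)

lemma nn_integral_polar_iterated:
  assumes ab: "0 < a" "a < b" and f[measurable]: "f \<in> borel_measurable borel"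
  shows "(\<integral>\<^sup>+t\<in>{0<..<2 * pi}. (\<integral>\<^sup>+s\<in>{a\<^sup>2<..<b\<^sup>2}. f (polar s t) \<partial>lborel) \<partial>lborel) = ennreal 2 * (\<integral>\<^sup>+x\<in>annulus a b. f x \<partial>lborel)"
    and "(\<integral>\<^sup>+s\<in>{a\<^sup>2<..<b\<^sup>2}. (\<integral>\<^sup>+t\<in>{0<..<2 * pi}. f (polar s t) \<partial>lborel) \<partial>lborel) = ennreal 2 * (\<integral>\<^sup>+x\<in>annulus a b. f x \<partial>lborel)"
proof -
  define h where "h p = f (polar (fst p) (snd p)) * indicator ({a\<^sup>2<..<b\<^sup>2} \<times> {0<..<2 * pi}) p" for p
  have hm: "h \<in> borel_measurable (lborel \<Otimes>\<^sub>M lborel)" unfolding h_def by measurable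
  have "ennreal 2 * (\<integral>\<^sup>+x\<in>annulus a b. f x \<partial>lborel) = (ennreal 2 * ennreal (1 / 2)) * (\<integral>\<^sup>+p. h p \<partial>(lborel \<Otimes>\<^sub>M lborel))"
    unfolding nn_integral_polar[OF ab f] h_def by (simp only: mult.assoc)
  also have "ennreal 2 * ennreal (1 / 2) = 1" by (subst ennreal_mult[symmetric]) auto
  finally have e: "ennreal 2 * (\<integral>\<^sup>+x\<in>annulus a b. f x \<partial>lborel) = (\<integral>\<^sup>+p. h p \<partial>(lborel \<Otimes>\<^sub>M lborel))" by simp
  have "(\<integral>\<^sup>+t\<in>{0<..<2 * pi}. (\<integral>\<^sup>+s\<in>{a\<^sup>2<..<b\<^sup>2}. f (polar s t) \<partial>lborel) \<partial>lborel) = (\<integral>\<^sup>+t. (\<integral>\<^sup>+s. h (s, t) \<partial>lborel) \<partial>lborel)"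
    by (intro nn_integral_cong) (auto simp: h_def indicator_def intro!: nn_integral_cong)
  also have "\<dots> = (\<integral>\<^sup>+p. h p \<partial>(lborel \<Otimes>\<^sub>M lborel))" by (rule lborel_pair.nn_integral_snd[OF hm])
  finally show "(\<integral>\<^sup>+t\<in>{0<..<2 * pi}. (\<integral>\<^sup>+s\<in>{a\<^sup>2<..<b\<^sup>2}. f (polar s t) \<partial>lborel) \<partial>lborel) = ennreal 2 * (\<integral>\<^sup>+x\<in>annulus a b. f x \<partial>lborel)"
    by (simp only: e)
  have "(\<integral>\<^sup>+s\<in>{a\<^sup>2<..<b\<^sup>2}. (\<integral>\<^sup>+t\<in>{0<..<2 * pi}. f (polar s t) \<partial>lborel) \<partial>lborel) = (\<integral>\<^sup>+s. (\<integral>\<^sup>+t. h (s, t) \<partial>lborel) \<partial>lborel)"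
    by (intro nn_integral_cong) (auto simp: h_def indicator_def intro!: nn_integral_cong)
  also have "\<dots> = (\<integral>\<^sup>+p. h p \<partial>(lborel \<Otimes>\<^sub>M lborel))" by (rule lborel.nn_integral_fst[OF hm])
  finally show "(\<integral>\<^sup>+s\<in>{a\<^sup>2<..<b\<^sup>2}. (\<integral>\<^sup>+t\<in>{0<..<2 * pi}. f (polar s t) \<partial>lborel) \<partial>lborel) = ennreal 2 * (\<integral>\<^sup>+x\<in>annulus a b. f x \<partial>lborel)"
    by (simp only: e)
qed

text \<open>The two alternatives correspond to the two ways of slicing: the radial derivative is
  controlled on almost every ray, the angular derivative on almost every circle.\<close>

lemma AE_polarI:
  assumes ab: "0 < a" "a < b" and Q[measurable]: "{x. Q x} \<in> sets borel"
    and ae: "(AE t in lborel. t \<in> {0<..<2 * pi} \<longrightarrow> (AE s in lborel. s \<in> {a\<^sup>2<..<b\<^sup>2} \<longrightarrow> Q (polar s t))) \<or>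
      (AE s in lborel. s \<in> {a\<^sup>2<..<b\<^sup>2} \<longrightarrow> (AE t in lborel. t \<in> {0<..<2 * pi} \<longrightarrow> Q (polar s t)))"
  shows "AE x in lborel. x \<in> annulus a b \<longrightarrow> Q x"
proof -
  define f :: "real^2 \<Rightarrow> ennreal" where "f x = indicator (- {x. Q x}) x" for x
  have f[measurable]: "f \<in> borel_measurable borel" unfolding f_def using Q by measurable
  have inner: "(\<integral>\<^sup>+s. h s * indicator S s \<partial>lborel) = 0"
    if "AE s in lborel. s \<in> S \<longrightarrow> h s = 0" for h :: "real \<Rightarrow> ennreal" and S
  proof -
    have "(\<integral>\<^sup>+s. h s * indicator S s \<partial>lborel) = (\<integral>\<^sup>+s. 0 \<partial>(lborel :: real measure))"
      by (rule nn_integral_cong_AE) (use that in eventually_elim, auto simp: indicator_def)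
    then show ?thesis by simp
  qed
  have q0: "f x = 0" if "Q x" for x using that by (simp add: f_def)
  have "ennreal 2 * (\<integral>\<^sup>+x\<in>annulus a b. f x \<partial>lborel) = 0"
    using ae
  proof
    assume 1: "AE t in lborel. t \<in> {0<..<2 * pi} \<longrightarrow> (AE s in lborel. s \<in> {a\<^sup>2<..<b\<^sup>2} \<longrightarrow> Q (polar s t))"
    have "AE t in lborel. t \<in> {0<..<2 * pi} \<longrightarrow> (\<integral>\<^sup>+s\<in>{a\<^sup>2<..<b\<^sup>2}. f (polar s t) \<partial>lborel) = 0"
      using 1
    proof eventually_elim
      case (elim t)
      show ?case
      proof
        assume "t \<in> {0<..<2 * pi}"
        then have "AE s in lborel. s \<in> {a\<^sup>2<..<b\<^sup>2} \<longrightarrow> f (polar s t) = 0"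
          using elim q0 by (auto elim!: eventually_mono)
        then show "(\<integral>\<^sup>+s\<in>{a\<^sup>2<..<b\<^sup>2}. f (polar s t) \<partial>lborel) = 0" by (rule inner)
      qed
    qed
    from inner[OF this] show ?thesis by (simp only: nn_integral_polar_iterated(1)[OF ab f])
  next
    assume 1: "AE s in lborel. s \<in> {a\<^sup>2<..<b\<^sup>2} \<longrightarrow> (AE t in lborel. t \<in> {0<..<2 * pi} \<longrightarrow> Q (polar s t))"
    have "AE s in lborel. s \<in> {a\<^sup>2<..<b\<^sup>2} \<longrightarrow> (\<integral>\<^sup>+t\<in>{0<..<2 * pi}. f (polar s t) \<partial>lborel) = 0"
      using 1
    proof eventually_elim
      case (elim s)
      show ?case
      proof
        assume "s \<in> {a\<^sup>2<..<b\<^sup>2}"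
        then have "AE t in lborel. t \<in> {0<..<2 * pi} \<longrightarrow> f (polar s t) = 0"
          using elim q0 by (auto elim!: eventually_mono)
        then show "(\<integral>\<^sup>+t\<in>{0<..<2 * pi}. f (polar s t) \<partial>lborel) = 0" by (rule inner)
      qed
    qed
    from inner[OF this] show ?thesis by (simp only: nn_integral_polar_iterated(2)[OF ab f])
  qed
  then have "(\<integral>\<^sup>+x\<in>annulus a b. f x \<partial>lborel) = 0" by simp
  then have "AE x in lborel. f x * indicator (annulus a b) x = 0"
    by (subst (asm) nn_integral_0_iff_AE) measurable
  then show ?thesis by eventually_elim (auto simp: f_def indicator_def)
qed

lemma smooth_chain_vector:
  fixes V :: "real^2 \<Rightarrow> real^2"
  assumes "smooth V" "(\<gamma> has_vector_derivative d) (at s)"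
  shows "((\<lambda>s. V (\<gamma> s)) has_vector_derivative matrix (frechet_derivative V (at (\<gamma> s))) *v d) (at s)"
proof -
  have lin: "linear (frechet_derivative V (at (\<gamma> s)))"
    using smooth_has_derivative[OF assms(1)] by (rule has_derivative_linear)
  have "((\<lambda>s. V (\<gamma> s)) has_derivative (\<lambda>h. frechet_derivative V (at (\<gamma> s)) (h *\<^sub>R d))) (at s)"
    by (rule has_derivative_compose[OF assms(2)[unfolded has_vector_derivative_def] smooth_has_derivative[OF assms(1)]])
  then show ?thesis
    by (simp add: has_vector_derivative_def linear_cmul[OF lin] fun_cong[OF matrix_vector_mul(2)[OF lin]])
qed

lemma er_vector_derivative: "(e\<^sub>r has_vector_derivative perp (e\<^sub>r t)) (at t)"
proof -
  have "((\<lambda>t. cos t *\<^sub>R axis 1 1 + sin t *\<^sub>R axis 2 1 :: real^2) has_vector_derivative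
      (- sin t) *\<^sub>R axis 1 1 + cos t *\<^sub>R axis 2 1) (at t)"
    by (auto intro!: derivative_eq_intros)
  moreover have "e\<^sub>r = (\<lambda>t. cos t *\<^sub>R axis 1 1 + sin t *\<^sub>R axis 2 1)"
    by (simp add: fun_eq_iff er_alt)
  moreover have "perp (e\<^sub>r t) = (- sin t) *\<^sub>R axis 1 1 + cos t *\<^sub>R axis 2 1"
    by (simp add: vec_eq_iff forall_2 axis_def)
  ultimately show ?thesis by simp
qed

lemma polar_vector_derivative_radius:
  assumes "0 < s"
  shows "((\<lambda>s. polar s t) has_vector_derivative (1 / (2 * s)) *\<^sub>R polar s t) (at s)"
proof -
  have "(sqrt has_real_derivative 1 / (2 * s) * sqrt s) (at s)"
    using assms by (auto intro!: derivative_eq_intros simp: field_simps)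
  then have "(sqrt has_vector_derivative 1 / (2 * s) * sqrt s) (at s)"
    by (simp add: has_real_derivative_iff_has_vector_derivative)
  from bounded_linear.has_vector_derivative[OF bounded_linear_scaleR_left this, of "e\<^sub>r t"]
  show ?thesis by (simp add: polar_def)
qed

lemma polar_vector_derivative_angle: "((\<lambda>t. polar s t) has_vector_derivative perp (polar s t)) (at t)"
proof -
  have "((\<lambda>t. sqrt s *\<^sub>R e\<^sub>r t) has_vector_derivative sqrt s *\<^sub>R perp (e\<^sub>r t)) (at t)"
    by (rule bounded_linear.has_vector_derivative[OF bounded_linear_scaleR_right er_vector_derivative])
  moreover have "perp (polar s t) = sqrt s *\<^sub>R perp (e\<^sub>r t)"
    by (simp add: polar_def vec_eq_iff forall_2)
  ultimately show ?thesis by (simp add: polar_def)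
qed

lemma polar_map_polar: "0 < s \<Longrightarrow> polar_map \<rho> \<psi> (polar s t) = \<rho> (sqrt s) *\<^sub>R e\<^sub>r (t + \<psi> (sqrt s))"
  by (simp add: polar_def polar_map_er)

lemma norm_perp [simp]: "norm (perp x) = norm x"
  by (simp add: norm_eq_sqrt_inner inner_real2)

lemma er_shift: "e\<^sub>r (t + \<phi>) = rot t (e\<^sub>r \<phi>)"
  by (simp add: rot_er add.commute)

text \<open>On almost every circle the map is a rotating vector of constant length, whose derivative
  is its \<open>perp\<close>; this gives the gradient on \<open>perp x\<close>. On the ray at angle
  t the map is the curve \<open>w\<close> rotated by t, so a single good ray shows that
  \<open>w\<close> is a primitive of some \<open>k\<close>, and on almost every other ray the radial
  derivative must be \<open>k\<close> rotated by t. The gradient on \<open>x\<close> is recorded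
  through inner products with the value of the map and its \<open>perp\<close>, because these are
  invariant under the common rotation and depend on the squared radius only.\<close>

lemma polar_sobolev_structure:
  assumes ab: "0 < a" "a < b"
    and u: "u \<in> W12 (annulus a b)" and tr: "has_trace a b u g0"
    and cont: "continuous_on UNIV \<rho>" "continuous_on UNIV \<psi>"
    and pol: "AE x in lborel. x \<in> annulus a b \<longrightarrow> u x = polar_map \<rho> \<psi> x"
  defines "w \<equiv> \<lambda>s. \<rho> (sqrt s) *\<^sub>R e\<^sub>r (\<psi> (sqrt s))"
  shows "\<exists>k C. k \<in> borel_measurable borel \<and> set_integrable lborel {a\<^sup>2<..<b\<^sup>2} k \<and>
    (\<forall>s\<in>{a\<^sup>2..b\<^sup>2}. w s = C + integral {a\<^sup>2..s} (\<lambda>s. indicator {a\<^sup>2<..<b\<^sup>2} s *\<^sub>R k s)) \<and>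
    (AE x in lborel. x \<in> annulus a b \<longrightarrow>
      weak_grad (annulus a b) u x *v perp x = perp (polar_map \<rho> \<psi> x) \<and>
      (weak_grad (annulus a b) u x *v x) \<bullet> polar_map \<rho> \<psi> x = 2 * (norm x)\<^sup>2 * (k ((norm x)\<^sup>2) \<bullet> w ((norm x)\<^sup>2)) \<and>
      (weak_grad (annulus a b) u x *v x) \<bullet> perp (polar_map \<rho> \<psi> x) = 2 * (norm x)\<^sup>2 * (k ((norm x)\<^sup>2) \<bullet> perp (w ((norm x)\<^sup>2))))"
proof -
  let ?A = "annulus a b"
  define S where "S = {a\<^sup>2<..<b\<^sup>2}"
  define \<Theta> where "\<Theta> = {0<..<2 * pi}"
  define P where "P = polar_map \<rho> \<psi>"
  note fin = emeasure_annulus_finite[of a b]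
  note gL2 = weak_grad_props(1)[OF u]
  have a2b2: "a\<^sup>2 < b\<^sup>2" using ab by (intro power_strict_mono) auto
  have Spos: "0 < s" if "s \<in> S" for s
    using that ab by (smt (verit) S_def greaterThanLessThan_iff zero_le_power2)
  have Sa: "a \<le> sqrt s" if "s \<in> S" for s
    using that ab real_sqrt_le_mono[of "a\<^sup>2" s] by (simp add: S_def)
  have uL2: "L2_on ?A u" using u by (simp add: W12_def)
  have m1: "(\<lambda>x::real^2. \<rho> (norm x) / norm x) \<in> borel_measurable borel"
    using borel_measurable_continuous_on[OF cont(1), of norm borel] by measurable
  have m2: "(\<lambda>x::real^2. cos (\<psi> (norm x))) \<in> borel_measurable borel" "(\<lambda>x::real^2. sin (\<psi> (norm x))) \<in> borel_measurable borel"
    using borel_measurable_continuous_on[OF cont(2), of norm borel] by measurable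
  have P[measurable]: "P \<in> borel_measurable borel"
    unfolding P_def polar_map_def[abs_def] rot_def using m1 m2 by measurable
  obtain G where G[measurable]: "G \<in> borel_measurable borel" and GG: "AE x in lborel. x \<in> ?A \<longrightarrow> weak_grad ?A u x = G x"
    using gL2 unfolding L2_on_def by (blast elim: borel_representative)
  obtain U where smU: "\<And>n. smooth (U n)"
    and U1: "(\<lambda>n. \<integral>\<^sup>+x\<in>?A. ennreal ((norm (U n x - u x))\<^sup>2) \<partial>lebesgue) \<longlonglongrightarrow> 0"
    and U2: "(\<lambda>n. \<integral>\<^sup>+x\<in>?A. ennreal ((norm (matrix (frechet_derivative (U n) (at x)) - weak_grad ?A u x))\<^sup>2) \<partial>lebesgue) \<longlonglongrightarrow> 0"
    using tr unfolding has_trace_def by blast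
  define D where "D n x = matrix (frechet_derivative (U n) (at x))" for n x
  have [measurable]: "U n \<in> borel_measurable borel" for n by (rule smooth_borel_measurable[OF smU])
  have Dcont: "continuous_on T (D n)" for n T unfolding D_def by (rule smooth_continuous_matrix[OF smU])
  have [measurable]: "D n \<in> borel_measurable borel" for n by (rule borel_measurable_continuous_onI[OF Dcont])
  have U1': "(\<lambda>n. \<integral>\<^sup>+x\<in>?A. ennreal (norm (U n x - P x)) \<partial>lborel) \<longlonglongrightarrow> 0"
  proof (rule L1_tendsto_of_L2)
    have "(\<integral>\<^sup>+x\<in>?A. ennreal ((norm (U n x - u x))\<^sup>2) \<partial>lebesgue) = (\<integral>\<^sup>+x\<in>?A. ennreal ((norm (U n x - P x))\<^sup>2) \<partial>lborel)" for n
      unfolding nn_integral_completion P_def by (rule nn_integral_cong_AE) (use pol in eventually_elim, auto simp: indicator_def)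
    then show "(\<lambda>n. \<integral>\<^sup>+x\<in>?A. ennreal ((norm (U n x - P x))\<^sup>2) \<partial>lborel) \<longlonglongrightarrow> 0" using U1 by simp
  qed (use fin in auto)
  have U2': "(\<lambda>n. \<integral>\<^sup>+x\<in>?A. ennreal (norm (D n x - G x)) \<partial>lborel) \<longlonglongrightarrow> 0"
  proof (rule L1_tendsto_of_L2)
    have "(\<integral>\<^sup>+x\<in>?A. ennreal ((norm (D n x - weak_grad ?A u x))\<^sup>2) \<partial>lebesgue) = (\<integral>\<^sup>+x\<in>?A. ennreal ((norm (D n x - G x))\<^sup>2) \<partial>lborel)" for n
      unfolding nn_integral_completion by (rule nn_integral_cong_AE) (use GG in eventually_elim, auto simp: indicator_def)
    then show "(\<lambda>n. \<integral>\<^sup>+x\<in>?A. ennreal ((norm (D n x - G x))\<^sup>2) \<partial>lborel) \<longlonglongrightarrow> 0" using U2 by (simp add: D_def)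
  qed (use fin in auto)
  have GL1: "(\<integral>\<^sup>+x\<in>?A. ennreal (norm (G x)) \<partial>lborel) < \<infinity>"
  proof -
    have "set_integrable lborel ?A G" by (rule set_integrable_of_L2[OF _ _ _ L2_onD[OF gL2 GG]]) (use fin in auto)
    then have "(\<integral>\<^sup>+x. ennreal (norm (indicator ?A x *\<^sub>R G x)) \<partial>lborel) < \<infinity>"
      by (simp add: set_integrable_def integrable_iff_bounded)
    also have "(\<integral>\<^sup>+x. ennreal (norm (indicator ?A x *\<^sub>R G x)) \<partial>lborel) = (\<integral>\<^sup>+x\<in>?A. ennreal (norm (G x)) \<partial>lborel)"
      by (intro nn_integral_cong) (auto simp: indicator_def)
    finally show ?thesis .
  qed
  obtain K where K: "\<And>(B::real^2^2) v. norm (B *v v) \<le> norm B * norm v * K" "0 \<le> K"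
    using bounded_bilinear.nonneg_bounded[OF bounded_bilinear_matrix_vector] by blast
  \<comment> \<open>The coordinate velocities of \<open>polar\<close> have norm at most 1/(2a) in
    the direction of the squared radius and at most b in the angular direction; \<open>K\<close>
    bounds matrix-vector multiplication.\<close>
  define L where "L = K * max (1 / (2 * a)) b"
  have L: "0 \<le> L" using K(2) ab by (simp add: L_def)
  have d1: "norm ((1 / (2 * s)) *\<^sub>R polar s t) \<le> max (1 / (2 * a)) b" if s: "s \<in> S" for s t
  proof -
    have "norm ((1 / (2 * s)) *\<^sub>R polar s t) = sqrt s / (2 * s)" using Spos[OF s] by (simp add: polar_def)
    also have "\<dots> = 1 / (2 * sqrt s)" using Spos[OF s] by (simp add: field_simps)
    also have "\<dots> \<le> 1 / (2 * a)" using Sa[OF s] ab Spos[OF s] by (intro divide_left_mono mult_pos_pos) auto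
    finally show ?thesis by simp
  qed
  have d2: "norm (perp (polar s t)) \<le> max (1 / (2 * a)) b" if s: "s \<in> S" for s t
  proof -
    have "sqrt s \<le> b" using s ab real_sqrt_le_mono[of s "b\<^sup>2"] by (simp add: S_def)
    then show ?thesis using Spos[OF s] by (simp add: polar_def)
  qed
  have bnd: "ennreal (norm (B *v d)) \<le> ennreal L * ennreal (norm B)" if "norm d \<le> max (1 / (2 * a)) b" for B :: "real^2^2" and d
  proof -
    have "norm (B *v d) \<le> norm B * norm d * K" by (rule K)
    also have "\<dots> \<le> norm B * max (1 / (2 * a)) b * K"
      using that K(2) by (intro mult_right_mono mult_left_mono) auto
    also have "\<dots> = L * norm B" by (simp add: L_def ac_simps)
    finally show ?thesis using L by (simp add: ennreal_leI flip: ennreal_mult)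
  qed
  have bI: "(\<integral>\<^sup>+x\<in>?A. ennreal L * ennreal (norm (B x)) \<partial>lborel) = ennreal L * (\<integral>\<^sup>+x\<in>?A. ennreal (norm (B x)) \<partial>lborel)"
    if [measurable]: "B \<in> borel_measurable borel" for B :: "real^2 \<Rightarrow> real^2^2"
    by (subst nn_integral_cmult[symmetric]) (auto simp: mult.assoc)
  have it1: "(\<integral>\<^sup>+t\<in>\<Theta>. (\<integral>\<^sup>+s\<in>S. ennreal (norm (B (polar s t) *v ((1 / (2 * s)) *\<^sub>R polar s t))) \<partial>lborel) \<partial>lborel)
      \<le> ennreal 2 * (ennreal L * (\<integral>\<^sup>+x\<in>?A. ennreal (norm (B x)) \<partial>lborel))"
    if [measurable]: "B \<in> borel_measurable borel" for B :: "real^2 \<Rightarrow> real^2^2"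
  proof -
    have "(\<integral>\<^sup>+t\<in>\<Theta>. (\<integral>\<^sup>+s\<in>S. ennreal (norm (B (polar s t) *v ((1 / (2 * s)) *\<^sub>R polar s t))) \<partial>lborel) \<partial>lborel)
        \<le> (\<integral>\<^sup>+t\<in>\<Theta>. (\<integral>\<^sup>+s\<in>S. ennreal L * ennreal (norm (B (polar s t))) \<partial>lborel) \<partial>lborel)"
    proof (rule nn_integral_mono)
      fix t :: real
      have "(\<integral>\<^sup>+s\<in>S. ennreal (norm (B (polar s t) *v ((1 / (2 * s)) *\<^sub>R polar s t))) \<partial>lborel)
          \<le> (\<integral>\<^sup>+s\<in>S. ennreal L * ennreal (norm (B (polar s t))) \<partial>lborel)"
      proof (rule nn_integral_mono)
        fix s :: real
        show "ennreal (norm (B (polar s t) *v ((1 / (2 * s)) *\<^sub>R polar s t))) * indicator S s \<le> ennreal L * ennreal (norm (B (polar s t))) * indicator S s"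
          using bnd[OF d1, of s "B (polar s t)" t] by (cases "s \<in> S") auto
      qed
      then show "(\<integral>\<^sup>+s\<in>S. ennreal (norm (B (polar s t) *v ((1 / (2 * s)) *\<^sub>R polar s t))) \<partial>lborel) * indicator \<Theta> t
          \<le> (\<integral>\<^sup>+s\<in>S. ennreal L * ennreal (norm (B (polar s t))) \<partial>lborel) * indicator \<Theta> t"
        by (rule mult_right_mono) simp
    qed
    also have "\<dots> = ennreal 2 * (\<integral>\<^sup>+x\<in>?A. ennreal L * ennreal (norm (B x)) \<partial>lborel)"
      unfolding S_def \<Theta>_def by (rule nn_integral_polar_iterated(1)[OF ab]) measurable
    finally show ?thesis by (simp only: bI[OF that])
  qed
  have it2: "(\<integral>\<^sup>+s\<in>S. (\<integral>\<^sup>+t\<in>\<Theta>. ennreal (norm (B (polar s t) *v perp (polar s t))) \<partial>lborel) \<partial>lborel)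
      \<le> ennreal 2 * (ennreal L * (\<integral>\<^sup>+x\<in>?A. ennreal (norm (B x)) \<partial>lborel))"
    if [measurable]: "B \<in> borel_measurable borel" for B :: "real^2 \<Rightarrow> real^2^2"
  proof -
    have "(\<integral>\<^sup>+s\<in>S. (\<integral>\<^sup>+t\<in>\<Theta>. ennreal (norm (B (polar s t) *v perp (polar s t))) \<partial>lborel) \<partial>lborel)
        \<le> (\<integral>\<^sup>+s\<in>S. (\<integral>\<^sup>+t\<in>\<Theta>. ennreal L * ennreal (norm (B (polar s t))) \<partial>lborel) \<partial>lborel)"
    proof (intro nn_integral_mono)
      fix s :: real
      show "(\<integral>\<^sup>+t\<in>\<Theta>. ennreal (norm (B (polar s t) *v perp (polar s t))) \<partial>lborel) * indicator S s
          \<le> (\<integral>\<^sup>+t\<in>\<Theta>. ennreal L * ennreal (norm (B (polar s t))) \<partial>lborel) * indicator S s"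
      proof (cases "s \<in> S")
        case True
        show ?thesis
          by (intro mult_right_mono nn_integral_mono bnd d2 True) simp_all
      qed simp
    qed
    also have "\<dots> = ennreal 2 * (\<integral>\<^sup>+x\<in>?A. ennreal L * ennreal (norm (B x)) \<partial>lborel)"
      unfolding S_def \<Theta>_def by (rule nn_integral_polar_iterated(2)[OF ab]) measurable
    finally show ?thesis by (simp only: bI[OF that])
  qed
  have lim0: "(\<lambda>n. ennreal 2 * (ennreal L * (\<integral>\<^sup>+x\<in>?A. ennreal (norm (D n x - G x)) \<partial>lborel))) \<longlonglongrightarrow> 0"
  proof -
    have "(\<lambda>n. ennreal 2 * (ennreal L * (\<integral>\<^sup>+x\<in>?A. ennreal (norm (D n x - G x)) \<partial>lborel))) \<longlonglongrightarrow> ennreal 2 * (ennreal L * 0)"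
      by (intro ennreal_tendsto_cmult U2') auto
    then show ?thesis by simp
  qed
  have limU: "(\<lambda>n. ennreal 2 * (\<integral>\<^sup>+x\<in>?A. ennreal (norm (U n x - P x)) \<partial>lborel)) \<longlonglongrightarrow> 0"
    using ennreal_tendsto_cmult[OF _ U1', of "ennreal 2"] by simp
  define f where "f s t = \<rho> (sqrt s) *\<^sub>R e\<^sub>r (t + \<psi> (sqrt s))" for s t
  have fP: "P (polar s t) = f s t" if "s \<in> S" for s t
    using Spos[OF that] by (simp add: P_def f_def polar_map_polar)
  have fw: "f s t = rot t (w s)" for s t
    by (simp add: f_def w_def er_shift rot_scaleR)
  have cf: "continuous_on UNIV (\<lambda>z. f (fst z) (snd z))"
    unfolding f_def by (intro continuous_intros continuous_on_compose2[OF cont(1)] continuous_on_compose2[OF cont(2)]) auto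
  have cf1: "continuous_on X (\<lambda>s. f s t)" and cf2: "continuous_on X (\<lambda>t. f s t)" for X s t
    by (rule continuous_on_compose2[OF cf, of _ "\<lambda>s. (s, t)", simplified], intro continuous_intros)
      (rule continuous_on_compose2[OF cf, of _ "\<lambda>t. (s, t)", simplified], intro continuous_intros)
  have mf: "(\<lambda>z. f (fst z) (snd z)) \<in> borel_measurable (lborel \<Otimes>\<^sub>M lborel)" "(\<lambda>z. f (snd z) (fst z)) \<in> borel_measurable (lborel \<Otimes>\<^sub>M lborel)"
    by (rule borel_measurable_continuous_Pair[where H = f, OF _ _ cf]; measurable)+
  have cw: "continuous_on UNIV w" unfolding w_def
    by (intro continuous_intros continuous_on_compose2[OF cont(1)] continuous_on_compose2[OF cont(2)]) auto
  have w[measurable]: "w \<in> borel_measurable borel" by (rule borel_measurable_continuous_onI[OF cw])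
  define g1 where "g1 s t = G (polar s t) *v ((1 / (2 * s)) *\<^sub>R polar s t)" for s t
  define g2 where "g2 s t = G (polar s t) *v perp (polar s t)" for s t
  have limf: "(\<integral>\<^sup>+t\<in>\<Theta>. (\<integral>\<^sup>+s\<in>S. ennreal (norm (U n (polar s t) - f s t)) \<partial>lborel) \<partial>lborel) = ennreal 2 * (\<integral>\<^sup>+x\<in>?A. ennreal (norm (U n x - P x)) \<partial>lborel)"
    "(\<integral>\<^sup>+s\<in>S. (\<integral>\<^sup>+t\<in>\<Theta>. ennreal (norm (U n (polar s t) - f s t)) \<partial>lborel) \<partial>lborel) = ennreal 2 * (\<integral>\<^sup>+x\<in>?A. ennreal (norm (U n x - P x)) \<partial>lborel)" for n
  proof -
    have "(\<integral>\<^sup>+t\<in>\<Theta>. (\<integral>\<^sup>+s\<in>S. ennreal (norm (U n (polar s t) - f s t)) \<partial>lborel) \<partial>lborel) = (\<integral>\<^sup>+t\<in>\<Theta>. (\<integral>\<^sup>+s\<in>S. ennreal (norm (U n (polar s t) - P (polar s t))) \<partial>lborel) \<partial>lborel)"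
    proof -
      have "(\<integral>\<^sup>+s\<in>S. ennreal (norm (U n (polar s t) - f s t)) \<partial>lborel) = (\<integral>\<^sup>+s\<in>S. ennreal (norm (U n (polar s t) - P (polar s t))) \<partial>lborel)" for t
        by (intro nn_integral_cong) (auto simp: indicator_def fP)
      then show ?thesis by simp
    qed
    also have "\<dots> = ennreal 2 * (\<integral>\<^sup>+x\<in>?A. ennreal (norm (U n x - P x)) \<partial>lborel)"
      unfolding S_def \<Theta>_def by (rule nn_integral_polar_iterated(1)[OF ab]) measurable
    finally show "(\<integral>\<^sup>+t\<in>\<Theta>. (\<integral>\<^sup>+s\<in>S. ennreal (norm (U n (polar s t) - f s t)) \<partial>lborel) \<partial>lborel) = ennreal 2 * (\<integral>\<^sup>+x\<in>?A. ennreal (norm (U n x - P x)) \<partial>lborel)" .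
    have "(\<integral>\<^sup>+s\<in>S. (\<integral>\<^sup>+t\<in>\<Theta>. ennreal (norm (U n (polar s t) - f s t)) \<partial>lborel) \<partial>lborel) = (\<integral>\<^sup>+s\<in>S. (\<integral>\<^sup>+t\<in>\<Theta>. ennreal (norm (U n (polar s t) - P (polar s t))) \<partial>lborel) \<partial>lborel)"
    proof (rule nn_integral_cong)
      fix s
      show "(\<integral>\<^sup>+t\<in>\<Theta>. ennreal (norm (U n (polar s t) - f s t)) \<partial>lborel) * indicator S s
          = (\<integral>\<^sup>+t\<in>\<Theta>. ennreal (norm (U n (polar s t) - P (polar s t))) \<partial>lborel) * indicator S s"
        by (cases "s \<in> S") (simp_all add: fP)
    qed
    also have "\<dots> = ennreal 2 * (\<integral>\<^sup>+x\<in>?A. ennreal (norm (U n x - P x)) \<partial>lborel)"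
      unfolding S_def \<Theta>_def by (rule nn_integral_polar_iterated(2)[OF ab]) measurable
    finally show "(\<integral>\<^sup>+s\<in>S. (\<integral>\<^sup>+t\<in>\<Theta>. ennreal (norm (U n (polar s t) - f s t)) \<partial>lborel) \<partial>lborel) = ennreal 2 * (\<integral>\<^sup>+x\<in>?A. ennreal (norm (U n x - P x)) \<partial>lborel)" .
  qed
  have diff: "D n x *v d - G x *v d = (D n x - G x) *v d" for n x d
    by (rule bounded_bilinear.diff_left[OF bounded_bilinear_matrix_vector, symmetric])
  have contDv: "continuous_on X (\<lambda>s. D n (\<gamma> s) *v d s)" if "continuous_on X \<gamma>" "continuous_on X d" for n X and \<gamma> d :: "real \<Rightarrow> real^2"
    by (rule bounded_bilinear.continuous_on[OF bounded_bilinear_matrix_vector continuous_on_compose2[OF Dcont[of UNIV]] that(2)])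
      (use that in auto)
  have R1: "AE t in lborel. t \<in> \<Theta> \<longrightarrow> set_integrable lborel {a\<^sup>2<..<b\<^sup>2} (\<lambda>s. g1 s t) \<and>
    (\<exists>C. \<forall>s\<in>{a\<^sup>2..b\<^sup>2}. f s t = C + integral {a\<^sup>2..s} (\<lambda>s. indicator {a\<^sup>2<..<b\<^sup>2} s *\<^sub>R g1 s t))"
  proof (rule slice_limit_primitive[where F = "\<lambda>n s t. U n (polar s t)" and F' = "\<lambda>n s t. D n (polar s t) *v ((1 / (2 * s)) *\<^sub>R polar s t)", OF a2b2])
    fix n s t assume s: "s \<in> {a\<^sup>2<..<b\<^sup>2}"
    show "((\<lambda>s. U n (polar s t)) has_vector_derivative D n (polar s t) *v ((1 / (2 * s)) *\<^sub>R polar s t)) (at s)"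
      unfolding D_def by (rule smooth_chain_vector[OF smU polar_vector_derivative_radius]) (use Spos s S_def in auto)
  next
    fix n t
    show "continuous_on {a\<^sup>2<..<b\<^sup>2} (\<lambda>s. D n (polar s t) *v ((1 / (2 * s)) *\<^sub>R polar s t))"
      by (intro contDv continuous_intros) (use Spos S_def in force)
  next
    show "(\<integral>\<^sup>+t\<in>\<Theta>. (\<integral>\<^sup>+s\<in>{a\<^sup>2<..<b\<^sup>2}. ennreal (norm (g1 s t)) \<partial>lborel) \<partial>lborel) < \<infinity>"
      unfolding g1_def S_def[symmetric]
      by (rule le_less_trans[OF it1[OF G]]) (use GL1 in \<open>simp add: ennreal_mult_less_top\<close>)
    show "(\<lambda>n. \<integral>\<^sup>+t\<in>\<Theta>. (\<integral>\<^sup>+s\<in>{a\<^sup>2<..<b\<^sup>2}. ennreal (norm (U n (polar s t) - f s t)) \<partial>lborel) \<partial>lborel) \<longlonglongrightarrow> 0"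
      unfolding S_def[symmetric] limf by (rule limU)
    show "(\<lambda>n. \<integral>\<^sup>+t\<in>\<Theta>. (\<integral>\<^sup>+s\<in>{a\<^sup>2<..<b\<^sup>2}. ennreal (norm (D n (polar s t) *v ((1 / (2 * s)) *\<^sub>R polar s t) - g1 s t)) \<partial>lborel) \<partial>lborel) \<longlonglongrightarrow> 0"
      unfolding g1_def S_def[symmetric] diff
    proof (rule tendsto_sandwich[OF _ always_eventually tendsto_const lim0])
      show "\<forall>n. (\<integral>\<^sup>+t\<in>\<Theta>. (\<integral>\<^sup>+s\<in>S. ennreal (norm ((D n (polar s t) - G (polar s t)) *v ((1 / (2 * s)) *\<^sub>R polar s t))) \<partial>lborel) \<partial>lborel)
          \<le> ennreal 2 * (ennreal L * (\<integral>\<^sup>+x\<in>?A. ennreal (norm (D n x - G x)) \<partial>lborel))"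
        by (intro allI it1[of "\<lambda>x. D _ x - G x"]) measurable
    qed simp
    show "(\<lambda>z. f (snd z) (fst z)) \<in> borel_measurable (lborel \<Otimes>\<^sub>M lborel)" by (rule mf)
    show "(\<lambda>z. g1 (snd z) (fst z)) \<in> borel_measurable (lborel \<Otimes>\<^sub>M lborel)" unfolding g1_def by measurable
    show "\<Theta> \<in> sets borel" by (simp add: \<Theta>_def)
    show "continuous_on {a\<^sup>2..b\<^sup>2} (\<lambda>s. f s t)" for t by (rule cf1)
  qed measurable
  have R2: "AE s in lborel. s \<in> S \<longrightarrow> set_integrable lborel {0<..<2 * pi} (\<lambda>t. g2 s t) \<and>
    (\<exists>C. \<forall>t\<in>{0..2 * pi}. f s t = C + integral {0..t} (\<lambda>t. indicator {0<..<2 * pi} t *\<^sub>R g2 s t))"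
  proof (rule slice_limit_primitive[where F = "\<lambda>n t s. U n (polar s t)" and F' = "\<lambda>n t s. D n (polar s t) *v perp (polar s t)" and f = "\<lambda>t s. f s t" and g = "\<lambda>t s. g2 s t"])
    show "0 < 2 * pi" by simp
    fix n t s
    show "((\<lambda>t. U n (polar s t)) has_vector_derivative D n (polar s t) *v perp (polar s t)) (at t)"
      unfolding D_def by (rule smooth_chain_vector[OF smU polar_vector_derivative_angle])
  next
    fix n s
    show "continuous_on {0<..<2 * pi} (\<lambda>t. D n (polar s t) *v perp (polar s t))"
      by (intro contDv continuous_intros)
  next
    show "(\<integral>\<^sup>+s\<in>S. (\<integral>\<^sup>+t\<in>{0<..<2 * pi}. ennreal (norm (g2 s t)) \<partial>lborel) \<partial>lborel) < \<infinity>"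
      unfolding g2_def \<Theta>_def[symmetric]
      by (rule le_less_trans[OF it2[OF G]]) (use GL1 in \<open>simp add: ennreal_mult_less_top\<close>)
    show "(\<lambda>n. \<integral>\<^sup>+s\<in>S. (\<integral>\<^sup>+t\<in>{0<..<2 * pi}. ennreal (norm (U n (polar s t) - f s t)) \<partial>lborel) \<partial>lborel) \<longlonglongrightarrow> 0"
      unfolding \<Theta>_def[symmetric] limf by (rule limU)
    show "(\<lambda>n. \<integral>\<^sup>+s\<in>S. (\<integral>\<^sup>+t\<in>{0<..<2 * pi}. ennreal (norm (D n (polar s t) *v perp (polar s t) - g2 s t)) \<partial>lborel) \<partial>lborel) \<longlonglongrightarrow> 0"
      unfolding g2_def \<Theta>_def[symmetric] diff
    proof (rule tendsto_sandwich[OF _ always_eventually tendsto_const lim0])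
      show "\<forall>n. (\<integral>\<^sup>+s\<in>S. (\<integral>\<^sup>+t\<in>\<Theta>. ennreal (norm ((D n (polar s t) - G (polar s t)) *v perp (polar s t))) \<partial>lborel) \<partial>lborel)
          \<le> ennreal 2 * (ennreal L * (\<integral>\<^sup>+x\<in>?A. ennreal (norm (D n x - G x)) \<partial>lborel))"
        by (intro allI it2[of "\<lambda>x. D _ x - G x"]) measurable
    qed simp
    show "(\<lambda>z. f (fst z) (snd z)) \<in> borel_measurable (lborel \<Otimes>\<^sub>M lborel)" by (rule mf)
    show "(\<lambda>z. g2 (fst z) (snd z)) \<in> borel_measurable (lborel \<Otimes>\<^sub>M lborel)" unfolding g2_def by measurable
    show "S \<in> sets borel" by (simp add: S_def)
    show "continuous_on {0..2 * pi} (\<lambda>t. f s t)" for s by (rule cf2)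
  qed measurable
  have g1m: "(\<lambda>s. g1 s t) \<in> borel_measurable borel" for t unfolding g1_def by measurable
  have g2m: "(\<lambda>t. g2 s t) \<in> borel_measurable borel" for s unfolding g2_def by measurable
  have HKg: "(\<lambda>s. indicator {p<..<q} s *\<^sub>R h s) integrable_on {p..x}" if "set_integrable lborel {p<..<q} h"
    for h :: "real \<Rightarrow> real^2" and p q x
  proof -
    have "set_integrable lborel {p..x} (\<lambda>s. indicator {p<..<q} s *\<^sub>R h s)"
      unfolding set_integrable_def by (rule integrable_mult_indicator[OF _ that[unfolded set_integrable_def]]) simp
    from set_borel_integral_eq_integral(1)[OF this] show ?thesis .
  qed
  have Q2: "AE x in lborel. x \<in> ?A \<longrightarrow> G x *v perp x = perp (P x)"
  proof (rule AE_polarI[OF ab])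
    show "{x. G x *v perp x = perp (P x)} \<in> sets borel" by measurable
    have "AE s in lborel. s \<in> {a\<^sup>2<..<b\<^sup>2} \<longrightarrow> (AE t in lborel. t \<in> {0<..<2 * pi} \<longrightarrow> G (polar s t) *v perp (polar s t) = perp (P (polar s t)))"
      using R2
    proof eventually_elim
      case (elim s)
      show ?case
      proof
        assume "s \<in> {a\<^sup>2<..<b\<^sup>2}"
        then have s: "s \<in> S" by (simp add: S_def)
        then obtain C where i2: "set_integrable lborel {0<..<2 * pi} (\<lambda>t. g2 s t)"
          and C: "\<And>t. t \<in> {0..2 * pi} \<Longrightarrow> f s t = C + integral {0..t} (\<lambda>t. indicator {0<..<2 * pi} t *\<^sub>R g2 s t)"
          using elim by blast
        \<comment> \<open>\<open>g2\<close> is the weak and \<open>perp (f s t)\<close> the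
          classical derivative of the same function of \<open>t\<close>; the primitive of their
          difference is constant, so the difference vanishes almost everywhere.\<close>
        define \<kappa> where "\<kappa> t = g2 s t - perp (f s t)" for t
        have ip: "set_integrable lborel {0<..<2 * pi} (\<lambda>t. perp (f s t))"
          by (rule set_integrable_subset[OF borel_integrable_atLeastAtMost'[of 0 "2 * pi"]]) (auto intro!: continuous_intros cf2)
        have fd: "((\<lambda>t. f s t) has_vector_derivative perp (f s t)) (at t)" for t
        proof -
          have "((\<lambda>t. \<rho> (sqrt s) *\<^sub>R rot (\<psi> (sqrt s)) (e\<^sub>r t)) has_vector_derivative \<rho> (sqrt s) *\<^sub>R rot (\<psi> (sqrt s)) (perp (e\<^sub>r t))) (at t)"
            by (rule bounded_linear.has_vector_derivative[OF bounded_linear_scaleR_right bounded_linear.has_vector_derivative[OF bounded_linear_rot er_vector_derivative]])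
          moreover have "(\<lambda>t. \<rho> (sqrt s) *\<^sub>R rot (\<psi> (sqrt s)) (e\<^sub>r t)) = (\<lambda>t. f s t)"
            by (simp add: fun_eq_iff f_def rot_er)
          moreover have "\<rho> (sqrt s) *\<^sub>R rot (\<psi> (sqrt s)) (perp (e\<^sub>r t)) = perp (f s t)"
            by (simp add: f_def rot_perp rot_er vec_eq_iff forall_2)
          ultimately show ?thesis by simp
        qed
        have "AE t in lborel. t \<in> {0<..<2 * pi} \<longrightarrow> \<kappa> t = 0"
        proof (rule primitive_const_AE_zero)
          have "(\<lambda>t. f s t) \<in> borel_measurable borel" by (rule borel_measurable_continuous_onI[OF cf2])
          then show "\<kappa> \<in> borel_measurable borel" unfolding \<kappa>_def using g2m by measurable
          show "set_integrable lborel {0<..<2 * pi} \<kappa>" unfolding \<kappa>_def by (rule set_integral_diff(1)[OF i2 ip])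
          fix t assume t: "t \<in> {0..2 * pi}"
          have "integral {0..t} (\<lambda>t. indicator {0<..<2 * pi} t *\<^sub>R \<kappa> t) =
              integral {0..t} (\<lambda>t. indicator {0<..<2 * pi} t *\<^sub>R g2 s t - indicator {0<..<2 * pi} t *\<^sub>R perp (f s t))"
            by (simp add: \<kappa>_def scaleR_diff_right)
          also have "\<dots> = integral {0..t} (\<lambda>t. indicator {0<..<2 * pi} t *\<^sub>R g2 s t) - integral {0..t} (\<lambda>t. indicator {0<..<2 * pi} t *\<^sub>R perp (f s t))"
            by (rule Henstock_Kurzweil_Integration.integral_diff[OF HKg[OF i2] HKg[OF ip]])
          also have "integral {0..t} (\<lambda>t. indicator {0<..<2 * pi} t *\<^sub>R perp (f s t)) = integral {0..t} (\<lambda>t. perp (f s t))"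
            by (rule integral_spike[of "{0, 2 * pi}"]) (use t in auto)
          also have "\<dots> = f s t - f s 0"
            by (rule integral_unique[OF fundamental_theorem_of_calculus]) (use t fd in \<open>auto intro: has_vector_derivative_at_within\<close>)
          also have "integral {0..t} (\<lambda>t. indicator {0<..<2 * pi} t *\<^sub>R g2 s t) = f s t - C" using C[OF t] by simp
          finally show "integral {0..t} (\<lambda>t. indicator {0<..<2 * pi} t *\<^sub>R \<kappa> t) = f s 0 - C" by simp
        qed
        then show "AE t in lborel. t \<in> {0<..<2 * pi} \<longrightarrow> G (polar s t) *v perp (polar s t) = perp (P (polar s t))"
          by eventually_elim (simp add: \<kappa>_def g2_def fP[OF s])
      qed
    qed
    then show "(AE t in lborel. t \<in> {0<..<2 * pi} \<longrightarrow> (AE s in lborel. s \<in> {a\<^sup>2<..<b\<^sup>2} \<longrightarrow> G (polar s t) *v perp (polar s t) = perp (P (polar s t)))) \<or>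
      (AE s in lborel. s \<in> {a\<^sup>2<..<b\<^sup>2} \<longrightarrow> (AE t in lborel. t \<in> {0<..<2 * pi} \<longrightarrow> G (polar s t) *v perp (polar s t) = perp (P (polar s t))))" by blast
  qed
  \<comment> \<open>Any ray on which the slicing lemma holds may define \<open>k\<close>; its
    derivative is rotated back by \<open>t0\<close> to refer to \<open>w\<close>.\<close>
  obtain t0 where t0: "0 < t0" "t0 < 2 * pi" and t0R: "t0 \<in> \<Theta> \<longrightarrow> set_integrable lborel {a\<^sup>2<..<b\<^sup>2} (\<lambda>s. g1 s t0) \<and>
    (\<exists>C. \<forall>s\<in>{a\<^sup>2..b\<^sup>2}. f s t0 = C + integral {a\<^sup>2..s} (\<lambda>s. indicator {a\<^sup>2<..<b\<^sup>2} s *\<^sub>R g1 s t0))"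
    by (rule AE_theta_witness[OF R1])
  then obtain C0 where i0: "set_integrable lborel {a\<^sup>2<..<b\<^sup>2} (\<lambda>s. g1 s t0)"
    and C0: "\<And>s. s \<in> {a\<^sup>2..b\<^sup>2} \<Longrightarrow> f s t0 = C0 + integral {a\<^sup>2..s} (\<lambda>s. indicator {a\<^sup>2<..<b\<^sup>2} s *\<^sub>R g1 s t0)"
    unfolding \<Theta>_def by auto
  have rotint: "integral {a\<^sup>2..s} (\<lambda>s. indicator {a\<^sup>2<..<b\<^sup>2} s *\<^sub>R rot \<phi> (h s)) = rot \<phi> (integral {a\<^sup>2..s} (\<lambda>s. indicator {a\<^sup>2<..<b\<^sup>2} s *\<^sub>R h s))"
    if "set_integrable lborel {a\<^sup>2<..<b\<^sup>2} h" for h :: "real \<Rightarrow> real^2" and \<phi> s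
    using integral_linear[OF HKg[OF that, of s] bounded_linear_rot, of \<phi>] by (simp add: o_def rot_scaleR)
  have rotset: "set_integrable lborel {a\<^sup>2<..<b\<^sup>2} (\<lambda>s. rot \<phi> (h s))" if "set_integrable lborel {a\<^sup>2<..<b\<^sup>2} h" for h :: "real \<Rightarrow> real^2" and \<phi>
    using integrable_bounded_linear[OF bounded_linear_rot that[unfolded set_integrable_def], of \<phi>]
    by (simp add: set_integrable_def rot_scaleR)
  have rotm: "(\<lambda>s. rot \<phi> (h s)) \<in> borel_measurable borel" if "h \<in> borel_measurable borel" for h :: "real \<Rightarrow> real^2" and \<phi>
    by (rule borel_measurable_continuous_on[OF linear_continuous_on[OF bounded_linear_rot] that])
  define k where "k s = rot (- t0) (g1 s t0)" for s
  have km[measurable]: "k \<in> borel_measurable borel" unfolding k_def by (rule rotm[OF g1m])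
  have ki: "set_integrable lborel {a\<^sup>2<..<b\<^sup>2} k" unfolding k_def by (rule rotset[OF i0])
  have wk: "w s = rot (- t0) C0 + integral {a\<^sup>2..s} (\<lambda>s. indicator {a\<^sup>2<..<b\<^sup>2} s *\<^sub>R k s)" if "s \<in> {a\<^sup>2..b\<^sup>2}" for s
  proof -
    have "w s = rot (- t0) (f s t0)" by (simp add: fw rot_rot)
    also have "\<dots> = rot (- t0) C0 + rot (- t0) (integral {a\<^sup>2..s} (\<lambda>s. indicator {a\<^sup>2<..<b\<^sup>2} s *\<^sub>R g1 s t0))"
      unfolding C0[OF that] by (rule linear_add) (rule bounded_linear.linear[OF bounded_linear_rot])
    finally show ?thesis unfolding k_def rotint[OF i0] .
  qed
  define Q where "Q x \<longleftrightarrow> (G x *v x) \<bullet> P x = 2 * (norm x)\<^sup>2 * (k ((norm x)\<^sup>2) \<bullet> w ((norm x)\<^sup>2)) \<and>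
      (G x *v x) \<bullet> perp (P x) = 2 * (norm x)\<^sup>2 * (k ((norm x)\<^sup>2) \<bullet> perp (w ((norm x)\<^sup>2)))" for x
  have Q1: "AE x in lborel. x \<in> ?A \<longrightarrow> Q x"
  proof (rule AE_polarI[OF ab])
    show "{x. Q x} \<in> sets borel" unfolding Q_def by measurable
    have "AE t in lborel. t \<in> {0<..<2 * pi} \<longrightarrow> (AE s in lborel. s \<in> {a\<^sup>2<..<b\<^sup>2} \<longrightarrow> Q (polar s t))"
      using R1
    proof eventually_elim
      case (elim t)
      show ?case
      proof
        assume "t \<in> {0<..<2 * pi}"
        then obtain C where i1: "set_integrable lborel {a\<^sup>2<..<b\<^sup>2} (\<lambda>s. g1 s t)"
          and C: "\<And>s. s \<in> {a\<^sup>2..b\<^sup>2} \<Longrightarrow> f s t = C + integral {a\<^sup>2..s} (\<lambda>s. indicator {a\<^sup>2<..<b\<^sup>2} s *\<^sub>R g1 s t)"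
          using elim unfolding \<Theta>_def by blast
        have "AE s in lborel. s \<in> {a\<^sup>2<..<b\<^sup>2} \<longrightarrow> g1 s t - rot t (k s) = 0"
        proof (rule primitive_const_AE_zero)
          show "(\<lambda>s. g1 s t - rot t (k s)) \<in> borel_measurable borel" using g1m rotm[OF km] by measurable
          show "set_integrable lborel {a\<^sup>2<..<b\<^sup>2} (\<lambda>s. g1 s t - rot t (k s))" by (rule set_integral_diff(1)[OF i1 rotset[OF ki]])
          fix s assume s: "s \<in> {a\<^sup>2..b\<^sup>2}"
          have "integral {a\<^sup>2..s} (\<lambda>s. indicator {a\<^sup>2<..<b\<^sup>2} s *\<^sub>R (g1 s t - rot t (k s))) =
              integral {a\<^sup>2..s} (\<lambda>s. indicator {a\<^sup>2<..<b\<^sup>2} s *\<^sub>R g1 s t - indicator {a\<^sup>2<..<b\<^sup>2} s *\<^sub>R rot t (k s))"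
            by (simp add: scaleR_diff_right)
          also have "\<dots> = integral {a\<^sup>2..s} (\<lambda>s. indicator {a\<^sup>2<..<b\<^sup>2} s *\<^sub>R g1 s t) - integral {a\<^sup>2..s} (\<lambda>s. indicator {a\<^sup>2<..<b\<^sup>2} s *\<^sub>R rot t (k s))"
            by (rule Henstock_Kurzweil_Integration.integral_diff[OF HKg[OF i1] HKg[OF rotset[OF ki]]])
          also have "\<dots> = (f s t - C) - rot t (w s - rot (- t0) C0)"
            unfolding rotint[OF ki] using C[OF s] wk[OF s] by simp
          also have "rot t (w s - rot (- t0) C0) = rot t (w s) - rot t (rot (- t0) C0)"
            by (rule linear_diff) (rule bounded_linear.linear[OF bounded_linear_rot])
          finally show "integral {a\<^sup>2..s} (\<lambda>s. indicator {a\<^sup>2<..<b\<^sup>2} s *\<^sub>R (g1 s t - rot t (k s))) = rot t (rot (- t0) C0) - C"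
            by (simp add: fw)
        qed
        then show "AE s in lborel. s \<in> {a\<^sup>2<..<b\<^sup>2} \<longrightarrow> Q (polar s t)"
        proof eventually_elim
          case (elim s)
          show ?case
          proof
            assume s: "s \<in> {a\<^sup>2<..<b\<^sup>2}"
            then have sS: "s \<in> S" by (simp add: S_def)
            note sp = Spos[OF sS]
            have g: "g1 s t = rot t (k s)" using elim s by simp
            \<comment> \<open>The velocity of \<open>polar\<close> in \<open>s\<close> is the
              position divided by 2s, so the gradient applied to the position vector is 2s times the
              derivative in \<open>s\<close>.\<close>
            have "polar s t = (2 * s) *\<^sub>R ((1 / (2 * s)) *\<^sub>R polar s t)" using sp by simp
            then have "G (polar s t) *v polar s t = G (polar s t) *v ((2 * s) *\<^sub>R ((1 / (2 * s)) *\<^sub>R polar s t))" by simp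
            also have "\<dots> = (2 * s) *\<^sub>R g1 s t"
              unfolding g1_def by (rule bounded_bilinear.scaleR_right[OF bounded_bilinear_matrix_vector])
            finally have e: "G (polar s t) *v polar s t = (2 * s) *\<^sub>R rot t (k s)" by (simp add: g)
            have p: "P (polar s t) = rot t (w s)" using fP[OF sS] fw by simp
            have n: "(norm (polar s t))\<^sup>2 = s" using sp by (simp add: norm_polar)
            show "Q (polar s t)"
              unfolding Q_def e p n rot_perp[symmetric] by (simp add: inner_rot)
          qed
        qed
      qed
    qed
    then show "(AE t in lborel. t \<in> {0<..<2 * pi} \<longrightarrow> (AE s in lborel. s \<in> {a\<^sup>2<..<b\<^sup>2} \<longrightarrow> Q (polar s t))) \<or>
      (AE s in lborel. s \<in> {a\<^sup>2<..<b\<^sup>2} \<longrightarrow> (AE t in lborel. t \<in> {0<..<2 * pi} \<longrightarrow> Q (polar s t)))" by blast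
  qed
  have "AE x in lborel. x \<in> ?A \<longrightarrow>
      weak_grad ?A u x *v perp x = perp (polar_map \<rho> \<psi> x) \<and>
      (weak_grad ?A u x *v x) \<bullet> polar_map \<rho> \<psi> x = 2 * (norm x)\<^sup>2 * (k ((norm x)\<^sup>2) \<bullet> w ((norm x)\<^sup>2)) \<and>
      (weak_grad ?A u x *v x) \<bullet> perp (polar_map \<rho> \<psi> x) = 2 * (norm x)\<^sup>2 * (k ((norm x)\<^sup>2) \<bullet> perp (w ((norm x)\<^sup>2)))"
    using GG Q1 Q2 by eventually_elim (simp add: Q_def P_def)
  then show ?thesis using km ki wk by blast
qed

section \<open>The stored energy\<close>

text \<open>The doubling property is where the two-sided bounds in (H2) and (H4) enter.\<close>

locale stored_energy =
  fixes h h' :: "real \<Rightarrow> real" and C :: real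
  assumes h_nonneg: "0 < t \<Longrightarrow> 0 \<le> h t"
    and h_DERIV: "0 < t \<Longrightarrow> (h has_real_derivative h' t) (at t)"
    and continuous_h': "continuous_on {0<..} h'"
    and h_convex: "convex_on {0<..} h"
    and doubling: "0 < t \<Longrightarrow> h (2 * t) \<le> C * (1 + t + h t)" "0 < t \<Longrightarrow> h (t / 2) \<le> C * (1 + t + h t)"
    and blow_up: "\<exists>d>0. B \<le> h d \<and> h' d \<le> 0"

text \<open>Three regimes. Near 0 the two-sided power bounds compare h(l t) with h(t) directly; on a
  compact interval h(l t) is bounded; for large t only the second derivative is controlled, and a
  multiple of h(t) minus h(l t) is convex there, hence above a tangent line. The affine error of
  that tangent is the reason for the term 1 + t.\<close>

lemma dilation_growth:
  fixes h h' h'' :: "real \<Rightarrow> real" and l :: real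
  assumes nn: "\<And>t. 0 < t \<Longrightarrow> 0 \<le> h t"
    and d1: "\<And>t. 0 < t \<Longrightarrow> (h has_real_derivative h' t) (at t)"
    and d2: "\<And>t. 0 < t \<Longrightarrow> (h' has_real_derivative h'' t) (at t)"
    and small: "0 < c1" "0 < c2" "0 < d0" "\<And>t. 0 < t \<Longrightarrow> t < d0 \<Longrightarrow> c1 * t powr (- s) \<le> h t \<and> h t \<le> c2 * t powr (- s)"
    and large: "0 < c3" "0 < c4" "0 < e" "\<And>t. e \<le> t \<Longrightarrow> c3 * t powr \<tau> \<le> h'' t \<and> h'' t \<le> c4 * t powr \<tau>"
    and l: "1 / 2 \<le> l" "l \<le> 2"
  shows "\<exists>C\<ge>0. \<forall>t>0. h (l * t) \<le> C * (1 + t + h t)"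
proof -
  \<comment> \<open>For l between 1/2 and 2, the choice of \<open>d\<close> keeps l t below
    \<open>d0\<close> when t is below \<open>d\<close>, and \<open>T\<close> at least 2e keeps l t
    above \<open>e\<close> when t is above \<open>T\<close>.\<close>
  define d T where "d = d0 / 4" and "T = max (2 * e) d"
  have l0: "0 < l" using l by simp
  have T: "0 < T" "2 * e \<le> T" and d: "0 < d" using small large by (auto simp: T_def d_def)
  obtain B where B: "\<And>t. d \<le> t \<Longrightarrow> t \<le> T \<Longrightarrow> h (l * t) \<le> B"
  proof -
    have "continuous_on {d..T} (\<lambda>t. h (l * t))"
    proof (intro continuous_at_imp_continuous_on ballI)
      fix t assume "t \<in> {d..T}"
      then have "0 < l * t" using d l0 by simp
      then have "isCont h (l * t)" using d1 DERIV_isCont by blast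
      then show "isCont (\<lambda>t. h (l * t)) t" by (rule isCont_o2[where f = "\<lambda>t. l * t" and g = h, rotated]) simp
    qed
    then have "compact ((\<lambda>t. h (l * t)) ` {d..T})" by (rule compact_continuous_image) simp
    from compact_imp_bounded[OF this] obtain B where "\<forall>y\<in>(\<lambda>t. h (l * t)) ` {d..T}. norm y \<le> B"
      unfolding bounded_iff ..
    then show ?thesis by (intro that[of B]) force
  qed
  \<comment> \<open>This is the factor for which the upper power bound for the second derivative of
    h(l t) equals \<open>K\<close> times the lower power bound for that of h(t); it makes
    \<open>f''\<close> nonnegative beyond \<open>T\<close> whatever the sign of the
    exponent.\<close>
  define K where "K = l powr (2 + \<tau>) * c4 / c3"
  have K0: "0 \<le> K" using large by (simp add: K_def)
  define f where "f t = K * h t - h (l * t)" for t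
  define f' where "f' t = K * h' t - l * h' (l * t)" for t
  define f'' where "f'' t = K * h'' t - l * (l * h'' (l * t))" for t
  have df: "(f has_real_derivative f' t) (at t)" "(f' has_real_derivative f'' t) (at t)" if "0 < t" for t
  proof -
    have lt: "0 < l * t" using that l0 by simp
    have "((\<lambda>t. h (l * t)) has_real_derivative h' (l * t) * l) (at t)"
      by (rule DERIV_chain2[where g = "\<lambda>t. l * t", OF d1[OF lt]]) (auto intro!: derivative_eq_intros)
    then show "(f has_real_derivative f' t) (at t)"
      unfolding f_def[abs_def] f'_def using d1[OF that]
      by (auto intro!: derivative_eq_intros simp: mult.commute)
    have "((\<lambda>t. h' (l * t)) has_real_derivative h'' (l * t) * l) (at t)"
      by (rule DERIV_chain2[where g = "\<lambda>t. l * t", OF d2[OF lt]]) (auto intro!: derivative_eq_intros)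
    then show "(f' has_real_derivative f'' t) (at t)"
      unfolding f'_def[abs_def] f''_def using d2[OF that]
      by (auto intro!: derivative_eq_intros simp: mult.commute)
  qed
  have f''0: "0 \<le> f'' t" if t: "T \<le> t" for t
  proof -
    have t0: "0 < t" using t T by simp
    have "e \<le> (1 / 2) * t" using t T by simp
    also have "\<dots> \<le> l * t" using l t0 by (intro mult_right_mono) auto
    finally have "h'' (l * t) \<le> c4 * (l * t) powr \<tau>" using large(4) by blast
    then have "l * (l * h'' (l * t)) \<le> l * (l * (c4 * (l * t) powr \<tau>))" using l0 by simp
    also have "\<dots> = K * (c3 * t powr \<tau>)"
      using l0 t0 large(1) by (simp add: K_def powr_mult powr_add field_simps power2_eq_square)
    also have "\<dots> \<le> K * h'' t"
      using K0 large(4)[of t] t T large(3) by (intro mult_left_mono) auto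
    finally show ?thesis by (simp add: f''_def)
  qed
  \<comment> \<open>Convexity beyond \<open>T\<close> is used only in the form that \<open>f\<close>
    lies above its tangent at \<open>T\<close>; two applications of the mean value theorem give
    it.\<close>
  have tang: "f T + f' T * (t - T) \<le> f t" if t: "T \<le> t" for t
  proof (cases "t = T")
    case False
    then have Tt: "T < t" using t by simp
    have "\<exists>z. T < z \<and> z < t \<and> f t - f T = (t - T) * f' z"
      by (rule MVT2[OF Tt]) (use df T in auto)
    then obtain z where z: "T < z" "z < t" "f t - f T = (t - T) * f' z" by blast
    have "\<exists>y. T < y \<and> y < z \<and> f' z - f' T = (z - T) * f'' y"
      by (rule MVT2[OF z(1)]) (use df T z in auto)
    then obtain y where "T < y" "y < z" "f' z - f' T = (z - T) * f'' y" by blast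
    then have "f' T \<le> f' z" using f''0[of y] z(1) mult_nonneg_nonneg[of "z - T" "f'' y"] by linarith
    then have "(t - T) * f' T \<le> (t - T) * f' z" using t by (intro mult_left_mono) auto
    then show ?thesis using z(3) by (simp add: mult.commute)
  qed simp
  define C where "C = max (c2 / c1 * l powr (- s)) (max B (K + \<bar>f T\<bar> + \<bar>f' T\<bar> * (1 + T)))"
  have C: "c2 / c1 * l powr (- s) \<le> C" "B \<le> C" "K + \<bar>f T\<bar> + \<bar>f' T\<bar> * (1 + T) \<le> C" by (auto simp: C_def)
  have C0: "0 \<le> C" using C(1) small(1,2) by (smt (verit) divide_nonneg_nonneg mult_nonneg_nonneg powr_ge_zero)
  have "h (l * t) \<le> C * (1 + t + h t)" if t: "0 < t" for t
  proof (cases "t < d \<or> t \<le> T")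
    case False
    then have t2: "T \<le> t" by simp
    have "h (l * t) = K * h t - f t" by (simp add: f_def)
    also have "\<dots> \<le> K * h t - f T - f' T * (t - T)" using tang[OF t2] by simp
    also have "\<dots> \<le> K * h t + \<bar>f T\<bar> + \<bar>f' T\<bar> * (t + T)"
    proof -
      have "- f' T * (t - T) \<le> \<bar>f' T\<bar> * (t + T)" using t2 t T by (intro mult_mono) auto
      then show ?thesis by simp
    qed
    also have "\<dots> \<le> (K + \<bar>f T\<bar> + \<bar>f' T\<bar> * (1 + T)) * (1 + t + h t)"
    proof -
      have le: "K * h t \<le> K * (1 + t + h t)" "\<bar>f T\<bar> * 1 \<le> \<bar>f T\<bar> * (1 + t + h t)"
        using K0 t nn[OF t] by (intro mult_left_mono; simp)+
      moreover have "t + T \<le> (1 + T) * (1 + t)" using t T by (simp add: algebra_simps)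
      moreover have "\<dots> \<le> (1 + T) * (1 + t + h t)" using T(1) nn[OF t] by (intro mult_left_mono) auto
      ultimately have "\<bar>f' T\<bar> * (t + T) \<le> \<bar>f' T\<bar> * ((1 + T) * (1 + t + h t))" by (intro mult_left_mono) auto
      moreover have "(K + \<bar>f T\<bar> + \<bar>f' T\<bar> * (1 + T)) * Y = K * Y + \<bar>f T\<bar> * Y + \<bar>f' T\<bar> * ((1 + T) * Y)" for Y
        by (simp add: algebra_simps)
      ultimately show ?thesis using le by simp
    qed
    also have "\<dots> \<le> C * (1 + t + h t)" using C(3) t nn[OF t] by (intro mult_right_mono) auto
    finally show ?thesis .
  next
    case True
    show ?thesis
    proof (cases "t < d")
      case True
      have "l * t \<le> 2 * t" using l t by simp
      then have "l * t < d0" using True t unfolding d_def by linarith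
      then have lt: "0 < l * t" "l * t < d0" "t < d0" using l0 t True d by (auto simp: d_def)
      have "h (l * t) \<le> c2 * (l * t) powr (- s)" using small(4)[OF lt(1,2)] by simp
      also have "\<dots> = (c2 / c1 * l powr (- s)) * (c1 * t powr (- s))" using small(1) l0 t by (simp add: powr_mult)
      also have "\<dots> \<le> (c2 / c1 * l powr (- s)) * h t" using small t lt by (intro mult_left_mono) auto
      also have "\<dots> \<le> C * (1 + t + h t)" using C(1) C0 nn[OF t] t by (intro mult_mono) auto
      finally show ?thesis .
    next
      case False
      then have "h (l * t) \<le> B" using True B by simp
      also have "\<dots> \<le> C * 1" using C by simp
      also have "\<dots> \<le> C * (1 + t + h t)" using C0 t nn[OF t] by (intro mult_left_mono) auto
      finally show ?thesis .
    qed
  qed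
  then show ?thesis using C0 by blast
qed

lemma stored_energyI:
  assumes H1: "hyp_H1 h0" and H2: "hyp_H2 h0" and H4: "hyp_H4 h0"
  defines "h \<equiv> \<lambda>t. real_of_ereal (h0 t)"
  shows "\<exists>C. stored_energy h (deriv h) C" and "\<And>t. 0 < t \<Longrightarrow> h0 t = ereal (h t)"
proof -
  show e: "h0 t = ereal (h t)" if "0 < t" for t
    using H2 that by (simp add: hyp_H2_def h_def ereal_real')
  have nn: "0 \<le> h t" for t
    using H1 by (simp add: hyp_H1_def h_def real_of_ereal_pos)
  have fd: "(deriv ^^ j) h field_differentiable at t" if "j < 3" "0 < t" for j t
    using H2 that unfolding hyp_H2_def h_def by blast
  have d1: "(h has_real_derivative deriv h t) (at t)" if "0 < t" for t
    using fd[of 0 t] that by (simp add: DERIV_deriv_iff_field_differentiable)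
  have d2: "(deriv h has_real_derivative deriv (deriv h) t) (at t)" if "0 < t" for t
    using fd[of 1 t] that by (simp add: DERIV_deriv_iff_field_differentiable)
  obtain s c1 c2 d0 where s: "0 < s" "0 < c1" "0 < c2" "0 < d0" and
    near0: "\<forall>t. 0 < t \<and> t < d0 \<longrightarrow> (\<forall>j\<in>{0,1,2}. c1 * t powr (- s - real j) \<le> (-1) ^ j * (deriv ^^ j) h t \<and>
        (-1) ^ j * (deriv ^^ j) h t \<le> c2 * t powr (- s - real j))"
    using H2 unfolding hyp_H2_def h_def by blast
  obtain \<tau> c3 c4 e where e4: "0 < c3" "0 < c4" "0 < e" and
    far: "\<forall>t\<ge>e. c3 * t powr \<tau> \<le> (deriv ^^ 2) h t \<and> (deriv ^^ 2) h t \<le> c4 * t powr \<tau>"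
    using H4 unfolding hyp_H4_def h_def by blast
  have dd: "deriv (deriv h) t = (deriv ^^ 2) h t" for t by (simp add: numeral_2_eq_2)
  have near: "c1 * t powr (- s) \<le> h t \<and> h t \<le> c2 * t powr (- s)" if "0 < t" "t < d0" for t
    using near0[rule_format, of t 0] that by simp
  have far': "c3 * t powr \<tau> \<le> deriv (deriv h) t \<and> deriv (deriv h) t \<le> c4 * t powr \<tau>" if "e \<le> t" for t
    using far that by (simp add: dd)
  have dil: "\<exists>C\<ge>0. \<forall>t>0. h (l * t) \<le> C * (1 + t + h t)" if l: "1 / 2 \<le> l" "l \<le> 2" for l
    by (rule dilation_growth[where h' = "deriv h" and h'' = "deriv (deriv h)", OF nn d1 d2 s(2-4) near e4 far' l])
  obtain C1 where C1: "0 \<le> C1" "\<And>t. 0 < t \<Longrightarrow> h (2 * t) \<le> C1 * (1 + t + h t)" using dil[of 2] by auto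
  obtain C2 where C2: "0 \<le> C2" "\<And>t. 0 < t \<Longrightarrow> h (1 / 2 * t) \<le> C2 * (1 + t + h t)" using dil[of "1 / 2"] by auto
  have le: "C1 * (1 + t + h t) \<le> (C1 + C2) * (1 + t + h t)" "C2 * (1 + t + h t) \<le> (C1 + C2) * (1 + t + h t)" if "0 < t" for t
    using C1(1) C2(1) that nn[of t] by (auto intro!: mult_right_mono)
  have "stored_energy h (deriv h) (C1 + C2)"
  proof
    show "continuous_on {0<..} (deriv h)"
      by (intro continuous_at_imp_continuous_on ballI DERIV_isCont[OF d2]) simp
    show "convex_on {0<..} h"
    proof (rule convex_onI)
      fix t x y :: real assume t: "0 < t" "t < 1" and xy: "x \<in> {0<..}" "y \<in> {0<..}"
      have p: "0 < (1 - t) * x + t * y" using t xy by (simp add: add_pos_pos)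
      have "h0 ((1 - t) * x + t * y) \<le> ereal (1 - t) * h0 x + ereal t * h0 y"
        using H1 t unfolding hyp_H1_def by (metis atLeastAtMost_iff less_eq_real_def)
      then show "h ((1 - t) *\<^sub>R x + t *\<^sub>R y) \<le> (1 - t) * h x + t * h y"
        using e[OF p] e[of x] e[of y] xy by simp
    qed simp
    show "\<exists>d>0. B \<le> h d \<and> deriv h d \<le> 0" for B
    proof -
      \<comment> \<open>The second entry solves c1 d^(-s) = max B 1; the first keeps
        \<open>d\<close> inside the range of the power bounds, where also the derivative is
        negative.\<close>
      define d where "d = min (d0 / 2) ((max B 1 / c1) powr (- 1 / s))"
      have d: "0 < d" "d < d0" using s by (auto simp: d_def)
      have "max B 1 / c1 = ((max B 1 / c1) powr (- 1 / s)) powr (- s)"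
        using s by (simp add: powr_powr)
      also have "\<dots> \<le> d powr (- s)"
        using d s by (intro powr_mono2') (auto simp: d_def)
      finally have "max B 1 \<le> c1 * d powr (- s)" using s by (simp add: field_simps)
      also have "\<dots> \<le> h d" using near d by simp
      finally have "B \<le> h d" by simp
      moreover have "c1 * d powr (- s - 1) \<le> - deriv h d"
        using near0[rule_format, of d 1] d by simp
      moreover have "0 \<le> c1 * d powr (- s - 1)" using s by simp
      ultimately show ?thesis using d by (intro exI[of _ d]) linarith
    qed
    show "h (2 * t) \<le> (C1 + C2) * (1 + t + h t)" "h (t / 2) \<le> (C1 + C2) * (1 + t + h t)" if "0 < t" for t
      using C1(2)[OF that] C2(2)[OF that] le[OF that] by auto
  qed (use nn d1 in auto)
  then show "\<exists>C. stored_energy h (deriv h) C" by blast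
qed

section \<open>Consequences of convexity and of the doubling property\<close>

context stored_energy
begin

text \<open>\<open>H\<close> is the derivative of h(J t) / J with respect to J at J = 1, so it
  measures the response of the stored energy to a dilation. It is also the Legendre transform of
  \<open>h\<close> at the slope h'(t).\<close>

definition "H t = t * h' t - h t"

lemma C_nonneg: "0 \<le> C"
proof -
  have "0 < 1 + 1 + h 1" using h_nonneg[of 1] by simp
  moreover have "0 \<le> C * (1 + 1 + h 1)" using doubling(1)[of 1] h_nonneg[of 2] by simp
  ultimately show ?thesis by (simp add: zero_le_mult_iff)
qed

lemma tangent: "0 < x \<Longrightarrow> 0 < y \<Longrightarrow> h x + h' x * (y - x) \<le> h y"
  using convex_on_imp_above_tangent[OF h_convex, where c = x and x = y and f' = "h' x"]
    has_field_derivative_at_within[OF h_DERIV] by (auto simp: algebra_simps interior_open)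

lemma h'_mono:
  assumes "0 < x" "x \<le> y"
  shows "h' x \<le> h' y"
proof (cases "x = y")
  case False
  have "0 \<le> (h' y - h' x) * (y - x)"
    using tangent[of x y] tangent[of y x] assms by (simp add: algebra_simps)
  then show ?thesis using False assms by (simp add: zero_le_mult_iff)
qed simp

text \<open>The increment of \<open>H\<close> splits into x (h'(y) - h'(x)) and the height of
  \<open>h x\<close> above the tangent at \<open>y\<close>; both are nonnegative, so monotonicity
  needs convexity and first derivatives only.\<close>

lemma H_mono:
  assumes "0 < x" "x \<le> y"
  shows "H x \<le> H y"
proof -
  have "x * h' x \<le> x * h' y" using assms h'_mono by (intro mult_left_mono) auto
  moreover have "y * h' y - h y - (x * h' y - h x) = h x - (h y + h' y * (x - y))" by (simp add: algebra_simps)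
  ultimately show ?thesis using tangent[of y x] assms unfolding H_def by linarith
qed

lemma continuous_h: "continuous_on {0<..} h"
  by (intro continuous_at_imp_continuous_on ballI) (use h_DERIV DERIV_isCont in auto)

lemma continuous_H: "continuous_on {0<..} H"
  unfolding H_def[abs_def] by (intro continuous_intros continuous_h continuous_h')

text \<open>Where \<open>h\<close> is large with nonpositive slope, \<open>H\<close> is at most
  \<open>- h\<close>. This is what keeps the determinant away from 0 in the end.\<close>

lemma H_unbounded_below: "\<exists>d>0. H d \<le> B"
proof -
  obtain d where d: "0 < d" "- B \<le> h d" "h' d \<le> 0" using blow_up by blast
  have "d * h' d \<le> 0" using d by (simp add: mult_nonneg_nonpos)
  then show ?thesis using d by (intro exI[of _ d]) (simp add: H_def)
qed

text \<open>As a function of J, the value h(J d) lies above the tangent at d and below the chord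
  from d to 2d or to d/2, so it differs from h(d) by a multiple of |J - 1|. Doubling then replaces
  the values at 2d and d/2 by 1 + d + h(d). No bound on h'(d) beyond the one by these values
  enters.\<close>

lemma scaled_bound:
  assumes J: "1 / 2 \<le> J" "J \<le> 2" and d: "0 < d"
  shows "\<bar>h (J * d) / J - h d\<bar> \<le> \<bar>J - 1\<bar> * ((12 * C + 2) * (1 + d + h d))"
proof -
  have Jd: "0 < J * d" using J d by simp
  define S where "S = h (2 * d) + h (d / 2)"
  have hn: "0 \<le> h (2 * d)" "0 \<le> h (d / 2)" "0 \<le> h d" using d h_nonneg by auto
  have dh: "d * h' d \<le> 2 * S" "- (2 * S) \<le> d * h' d"
    using tangent[of d "2 * d"] tangent[of d "d / 2"] d hn by (auto simp: S_def algebra_simps)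
  have low: "- (\<bar>J - 1\<bar> * (2 * S)) \<le> h (J * d) - h d"
  proof -
    have "\<bar>(J - 1) * (d * h' d)\<bar> \<le> \<bar>J - 1\<bar> * (2 * S)" unfolding abs_mult[of "J - 1"] using dh by (intro mult_left_mono) auto
    moreover have "h d + (J - 1) * (d * h' d) \<le> h (J * d)" using tangent[OF d Jd] by (simp add: algebra_simps)
    ultimately show ?thesis by linarith
  qed
  have up: "h (J * d) - h d \<le> \<bar>J - 1\<bar> * (2 * S)"
  proof (cases "1 \<le> J")
    case True
    have "h ((1 - (J - 1)) *\<^sub>R d + (J - 1) *\<^sub>R (2 * d)) \<le> (1 - (J - 1)) * h d + (J - 1) * h (2 * d)"
      by (rule convex_onD[OF h_convex]) (use True J d in auto)
    moreover have "(1 - (J - 1)) *\<^sub>R d + (J - 1) *\<^sub>R (2 * d) = J * d" by (simp add: algebra_simps)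
    ultimately have "h (J * d) - h d \<le> (J - 1) * (h (2 * d) - h d)" by (simp add: algebra_simps)
    also have "\<dots> \<le> (J - 1) * (2 * S)" using True hn by (intro mult_left_mono) (auto simp: S_def)
    finally show ?thesis using True by simp
  next
    case False
    \<comment> \<open>The point J d lies on the segment from d to d/2, which has length d/2, so the
      weight of the far end is 2 (1 - J); it is at most 1 because J is at least 1/2.\<close>
    have "h ((1 - 2 * (1 - J)) *\<^sub>R d + (2 * (1 - J)) *\<^sub>R (d / 2)) \<le> (1 - 2 * (1 - J)) * h d + 2 * (1 - J) * h (d / 2)"
      by (rule convex_onD[OF h_convex]) (use False J d in auto)
    moreover have "(1 - 2 * (1 - J)) *\<^sub>R d + (2 * (1 - J)) *\<^sub>R (d / 2) = J * d" by (simp add: algebra_simps)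
    ultimately have "h (J * d) - h d \<le> (1 - J) * (2 * (h (d / 2) - h d))" by (simp add: algebra_simps)
    also have "\<dots> \<le> (1 - J) * (2 * S)" using False hn by (intro mult_left_mono) (auto simp: S_def)
    finally show ?thesis using False by simp
  qed
  have "h (J * d) / J - h d = (1 / J) * ((h (J * d) - h d) + (1 - J) * h d)" using J by (simp add: field_simps)
  also have "\<bar>\<dots>\<bar> \<le> 2 * (\<bar>J - 1\<bar> * (2 * S) + \<bar>J - 1\<bar> * h d)"
    unfolding abs_mult[of "1 / J"]
  proof (rule mult_mono)
    show "\<bar>1 / J\<bar> \<le> 2" using J by (simp add: field_simps)
    have "\<bar>(1 - J) * h d\<bar> = \<bar>J - 1\<bar> * h d" using hn by (simp add: abs_mult abs_minus_commute)
    then show "\<bar>h (J * d) - h d + (1 - J) * h d\<bar> \<le> \<bar>J - 1\<bar> * (2 * S) + \<bar>J - 1\<bar> * h d" using low up by linarith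
  qed auto
  also have "\<dots> = \<bar>J - 1\<bar> * (4 * S + 2 * h d)" by (simp add: algebra_simps)
  \<comment> \<open>Doubling gives 4 S at most 8 C (1 + d + h d); the constant 12 leaves
    room.\<close>
  also have "\<dots> \<le> \<bar>J - 1\<bar> * ((12 * C + 2) * (1 + d + h d))"
  proof (rule mult_left_mono)
    have "S \<le> 2 * (C * (1 + d + h d))" using doubling[OF d] by (simp add: S_def)
    moreover have "0 \<le> C * (1 + d + h d)" using C_nonneg d hn by simp
    moreover have "(12 * C + 2) * (1 + d + h d) = 12 * (C * (1 + d + h d)) + 2 + 2 * d + 2 * h d" by (simp add: algebra_simps)
    ultimately show "4 * S + 2 * h d \<le> (12 * C + 2) * (1 + d + h d)" using d hn by linarith
  qed simp
  finally show ?thesis .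
qed

text \<open>The tangent at d, tested at 2d and at d/2, bounds d h'(d) from both sides by values of
  \<open>h\<close>. Integrability of \<open>H\<close> along the minimiser thus follows from that of
  d and h(d).\<close>

lemma H_bound:
  assumes d: "0 < d"
  shows "\<bar>H d\<bar> \<le> (4 * C + 1) * (1 + d + h d)"
proof -
  have hn: "0 \<le> h (2 * d)" "0 \<le> h (d / 2)" "0 \<le> h d" using d h_nonneg by auto
  have "d * h' d - h d \<le> h (2 * d)" "- (2 * h (d / 2) + h d) \<le> d * h' d - h d"
    using tangent[of d "2 * d"] tangent[of d "d / 2"] d hn by (auto simp: algebra_simps)
  moreover have "h (2 * d) \<le> C * (1 + d + h d)" "h (d / 2) \<le> C * (1 + d + h d)" using doubling[OF d] by auto
  moreover have "0 \<le> C * (1 + d + h d)" using C_nonneg d hn by simp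
  moreover have "(4 * C + 1) * (1 + d + h d) = 4 * (C * (1 + d + h d)) + (1 + d + h d)" by (simp add: algebra_simps)
  ultimately show ?thesis unfolding H_def using d hn by linarith
qed

lemma scaled_DERIV:
  assumes d: "0 < d"
  shows "((\<lambda>J. h (J * d) / J) has_real_derivative H d) (at 1)"
proof -
  have "((\<lambda>J. h (J * d)) has_real_derivative h' (1 * d) * d) (at 1)"
    by (rule DERIV_chain2[where g = "\<lambda>J. J * d", OF h_DERIV]) (use d in \<open>auto intro!: derivative_eq_intros\<close>)
  then show ?thesis by (auto intro!: derivative_eq_intros simp: H_def)
qed

text \<open>Here \<open>M\<close> plays the role of the right-hand side of the integrated Euler-Lagrange equation and
  \<open>c\<close> that of the coefficient of the square of the determinant.\<close>

lemma continuous_root: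
  fixes S :: "real set"
  assumes c: "continuous_on S c" "\<And>t. t \<in> S \<Longrightarrow> 0 < c t" and M: "continuous_on S M"
  shows "\<exists>\<delta>. continuous_on S \<delta> \<and> (\<forall>t\<in>S. 0 < \<delta> t) \<and>
    (\<forall>t\<in>S. \<forall>d>0. c t * d\<^sup>2 + H d = M t \<longrightarrow> d = \<delta> t)"
proof -
  define F where "F t d = c t * d\<^sup>2 + H d" for t d
  have F_mono: "F t x < F t y" if "t \<in> S" "0 < x" "x < y" for t x y
    unfolding F_def using that c(2)[of t] H_mono[of x y] power_strict_mono[of x y 2]
    by (intro add_less_le_mono) auto
  have ex: "\<exists>d>0. F t d = M t" if t: "t \<in> S" for t
  proof -
    have ct: "0 < c t" using c(2) t by simp
    \<comment> \<open>A lower starting point for the intermediate value theorem: \<open>H\<close> is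
      made so negative that adding \<open>c t\<close> still stays below \<open>M t\<close>. Capping
      the point at 1 ensures that the quadratic term is at most \<open>c t\<close>.\<close>
    obtain x where x: "0 < x" "H x \<le> M t - c t" using H_unbounded_below by blast
    define x1 where "x1 = min x 1"
    have x1: "0 < x1" "x1 \<le> 1" "H x1 \<le> M t - c t" using x H_mono[of x1 x] by (auto simp: x1_def)
    have "x1\<^sup>2 \<le> 1" using x1 by (simp add: power_le_one)
    then have "c t * x1\<^sup>2 \<le> c t" using ct by simp
    then have lo: "F t x1 \<le> M t" using x1 by (simp add: F_def)
    \<comment> \<open>An upper end point: beyond 1 the square dominates the linear term and
      \<open>H\<close> is at least \<open>H 1\<close>, so c y + H 1 reaching \<open>M t\<close> is
      enough.\<close>
    define y where "y = max 1 ((M t - H 1) / c t)"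
    have y: "1 \<le> y" "(M t - H 1) / c t \<le> y" by (auto simp: y_def)
    have "M t - H 1 \<le> c t * y" using y(2) ct by (simp add: field_simps)
    also have "\<dots> \<le> c t * y\<^sup>2" using y ct self_le_power[of y 2] by simp
    finally have hi: "M t \<le> F t y" using H_mono[of 1 y] y by (simp add: F_def)
    have "\<exists>d\<ge>x1. d \<le> y \<and> F t d = M t"
    proof (rule IVT'[where f = "F t", OF lo hi])
      show "x1 \<le> y" using x1 y by simp
      show "continuous_on {x1..y} (F t)" unfolding F_def
        by (intro continuous_intros continuous_on_subset[OF continuous_H]) (use x1 in auto)
    qed
    then obtain d where "x1 \<le> d" "F t d = M t" by blast
    then show ?thesis using x1 by (intro exI[of _ d]) auto
  qed
  define \<delta> where "\<delta> t = (SOME d. 0 < d \<and> F t d = M t)" for t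
  have \<delta>: "0 < \<delta> t" "F t (\<delta> t) = M t" if "t \<in> S" for t
    using someI_ex[of "\<lambda>d. 0 < d \<and> F t d = M t"] ex[OF that] unfolding \<delta>_def by auto
  have lower: "x < \<delta> t" if "t \<in> S" "0 < x" "F t x < M t" for t x
    using F_mono[of t "\<delta> t" x] \<delta>[of t] that by (cases x "\<delta> t" rule: linorder_cases) auto
  have upper: "\<delta> t < x" if "t \<in> S" "0 < x" "M t < F t x" for t x
    using F_mono[of t x "\<delta> t"] \<delta>[of t] that by (cases x "\<delta> t" rule: linorder_cases) auto
  have Fc: "continuous_on S (\<lambda>t. F t x)" for x unfolding F_def by (intro continuous_intros c)
  have "continuous_on S \<delta>"
    unfolding continuous_on_def
  proof (intro ballI order_tendstoI)
    fix t x assume t: "t \<in> S" and x: "x < \<delta> t"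
    \<comment> \<open>The comparison point must be positive to lie in the domain of
      \<open>H\<close>. At this fixed point \<open>F\<close> is strictly below \<open>M\<close>,
      which persists for nearby parameters, and monotonicity then places the root above it; the
      other inequality is symmetric.\<close>
    define z where "z = max x (\<delta> t / 2)"
    have z: "0 < z" "x \<le> z" "z < \<delta> t" using x \<delta>(1)[OF t] by (auto simp: z_def)
    have "((\<lambda>t. F t z - M t) \<longlongrightarrow> F t z - M t) (at t within S)"
      using Fc[of z] M t by (intro tendsto_diff) (auto simp: continuous_on_def)
    moreover have "F t z - M t < 0" using F_mono[OF t z(1,3)] \<delta>[OF t] by simp
    ultimately have "\<forall>\<^sub>F t in at t within S. F t z - M t < 0" by (rule order_tendstoD(2))
    moreover have "\<forall>\<^sub>F t in at t within S. t \<in> S" by (simp add: eventually_at_filter)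
    ultimately show "\<forall>\<^sub>F t in at t within S. x < \<delta> t"
    proof eventually_elim
      case (elim t)
      then have "z < \<delta> t" using lower z(1) by simp
      then show ?case using z(2) by simp
    qed
  next
    fix t x assume t: "t \<in> S" and x: "\<delta> t < x"
    have x0: "0 < x" using x \<delta>(1)[OF t] by simp
    have "((\<lambda>t. F t x - M t) \<longlongrightarrow> F t x - M t) (at t within S)"
      using Fc[of x] M t by (intro tendsto_diff) (auto simp: continuous_on_def)
    moreover have "0 < F t x - M t" using F_mono[OF t _ x] \<delta>[OF t] by simp
    ultimately have "\<forall>\<^sub>F t in at t within S. 0 < F t x - M t" by (rule order_tendstoD(1))
    moreover have "\<forall>\<^sub>F t in at t within S. t \<in> S" by (simp add: eventually_at_filter)
    ultimately show "\<forall>\<^sub>F t in at t within S. \<delta> t < x"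
    proof eventually_elim
      case (elim t)
      then show ?case using upper x0 by simp
    qed
  qed
  moreover have "d = \<delta> t" if "t \<in> S" "0 < d" "F t d = M t" for t d
    using F_mono[of t d "\<delta> t"] F_mono[of t "\<delta> t" d] \<delta>[of t] that by (cases d "\<delta> t" rule: linorder_cases) auto
  ultimately show ?thesis using \<delta>(1) unfolding F_def by blast
qed

end

section \<open>Weak derivatives on an interval\<close>

lemma deriv_zero_outside:
  fixes \<xi> :: "real \<Rightarrow> real"
  assumes z: "\<And>s. s \<le> p \<or> q \<le> s \<Longrightarrow> \<xi> s = 0" and t: "t \<notin> {p..q}"
  shows "deriv \<xi> t = 0"
proof (rule DERIV_imp_deriv)
  show "(\<xi> has_real_derivative 0) (at t)"
    by (rule has_field_derivative_transform_within_open[where f = "\<lambda>_. 0" and S = "- {p..q}"])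
      (use t z in \<open>auto simp: not_le\<close>)
qed

text \<open>Integration by parts with a factor that is merely integrable: \<xi> is written as minus
  the integral of its derivative from s onwards, and Fubini's theorem exchanges the integrals. The
  inner integral becomes the primitive of \<open>g\<close>.\<close>

lemma integral_smooth_mult_L1:
  fixes \<xi> g :: "real \<Rightarrow> real"
  assumes \<xi>: "smooth \<xi>" and z: "\<And>s. s \<le> p \<or> q \<le> s \<Longrightarrow> \<xi> s = 0"
    and gm: "g \<in> borel_measurable borel" and gi: "integrable lborel g"
  shows "integrable lborel (deriv \<xi>)"
    and "(LINT s|lborel. \<xi> s * g s) = - (LINT t|lborel. deriv \<xi> t * (LINT s|lborel. (if s \<le> t then g s else 0)))"
proof -
  note [measurable] = gm
  have [measurable]: "deriv \<xi> \<in> borel_measurable borel"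
    by (rule smooth_borel_measurable[OF smooth_DERIV(2)[OF \<xi>]])
  have d0: "deriv \<xi> t = 0" if "t \<notin> {p..q}" for t by (rule deriv_zero_outside[OF z that])
  have "set_integrable lborel {p..q} (deriv \<xi>)"
    by (intro borel_integrable_atLeastAtMost' smooth_continuous_on smooth_DERIV(2)[OF \<xi>])
  moreover have "(\<lambda>t. indicator {p..q} t *\<^sub>R deriv \<xi> t) = deriv \<xi>"
    using d0 by (auto simp: fun_eq_iff indicator_def)
  ultimately show di: "integrable lborel (deriv \<xi>)" by (simp add: set_integrable_def)
  have repr: "\<xi> s = - (LINT t|lborel. (if s \<le> t then deriv \<xi> t else 0))" for s
  proof -
    \<comment> \<open>The end point is chosen beyond both \<open>s\<close> and the support, so \<xi>
      vanishes there even when \<open>s\<close> itself exceeds \<open>q\<close>.\<close>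
    define r where "r = max s q"
    have "(\<integral>t. deriv \<xi> t * indicator {s..r} t \<partial>lborel) = \<xi> r - \<xi> s"
      by (rule integral_FTC_Icc_real)
        (use smooth_DERIV(1)[OF \<xi>] DERIV_isCont[OF smooth_DERIV(1)[OF smooth_DERIV(2)[OF \<xi>]]] in \<open>auto simp: r_def\<close>)
    moreover have "deriv \<xi> t * indicator {s..r} t = (if s \<le> t then deriv \<xi> t else 0)" for t
      using d0[of t] by (auto simp: indicator_def r_def max_def split: if_splits)
    moreover have "\<xi> r = 0" using z by (simp add: r_def)
    ultimately show ?thesis by simp
  qed
  define f where "f = (\<lambda>(s, t). if s \<le> t then g s * deriv \<xi> t else 0)"
  have [measurable]: "f \<in> borel_measurable (lborel \<Otimes>\<^sub>M lborel)" unfolding f_def by measurable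
  have fb: "norm (f (s, t)) \<le> \<bar>g s\<bar> * \<bar>deriv \<xi> t\<bar>" for s t by (simp add: f_def abs_mult)
  have i2: "integrable lborel (\<lambda>t. f (s, t))" for s
    by (rule Bochner_Integration.integrable_bound[where f = "\<lambda>t. \<bar>g s\<bar> * \<bar>deriv \<xi> t\<bar>"])
      (use di fb in \<open>auto intro!: integrable_mult_right\<close>)
  have "integrable lborel (\<lambda>s. LINT t|lborel. norm (f (s, t)))"
  proof (rule Bochner_Integration.integrable_bound[where f = "\<lambda>s. \<bar>g s\<bar> * (LINT t|lborel. \<bar>deriv \<xi> t\<bar>)"])
    show "integrable lborel (\<lambda>s. \<bar>g s\<bar> * (LINT t|lborel. \<bar>deriv \<xi> t\<bar>))" using gi by auto
    show "AE s in lborel. norm (LINT t|lborel. norm (f (s, t))) \<le> norm (\<bar>g s\<bar> * (LINT t|lborel. \<bar>deriv \<xi> t\<bar>))"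
    proof (intro AE_I2)
      fix s
      have "(LINT t|lborel. norm (f (s, t))) \<le> (LINT t|lborel. \<bar>g s\<bar> * \<bar>deriv \<xi> t\<bar>)"
        by (rule integral_mono) (use i2[of s] di fb in \<open>auto intro!: integrable_mult_right\<close>)
      then show "norm (LINT t|lborel. norm (f (s, t))) \<le> norm (\<bar>g s\<bar> * (LINT t|lborel. \<bar>deriv \<xi> t\<bar>))"
        by (simp add: abs_mult)
    qed
  qed measurable
  then have fi: "integrable (lborel \<Otimes>\<^sub>M lborel) f"
    by (intro lborel_pair.Fubini_integrable) (use i2 in auto)
  have "(LINT s|lborel. \<xi> s * g s) = - (LINT s|lborel. LINT t|lborel. f (s, t))"
  proof -
    have "\<xi> s * g s = - (LINT t|lborel. f (s, t))" for s
    proof -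
      have "(LINT t|lborel. f (s, t)) = (LINT t|lborel. g s * (if s \<le> t then deriv \<xi> t else 0))"
        by (intro Bochner_Integration.integral_cong) (auto simp: f_def)
      then show ?thesis using repr[of s] by simp
    qed
    then show ?thesis by simp
  qed
  also have "(LINT s|lborel. LINT t|lborel. f (s, t)) = (LINT t|lborel. LINT s|lborel. f (s, t))"
    by (rule lborel_pair.Fubini_integral[symmetric, where f = "\<lambda>s t. f (s, t)"]) (use fi in simp)
  also have "(\<lambda>t. LINT s|lborel. f (s, t)) = (\<lambda>t. deriv \<xi> t * (LINT s|lborel. (if s \<le> t then g s else 0)))"
  proof
    fix t
    have "(LINT s|lborel. f (s, t)) = (LINT s|lborel. deriv \<xi> t * (if s \<le> t then g s else 0))"
      by (intro Bochner_Integration.integral_cong) (auto simp: f_def)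
    then show "(LINT s|lborel. f (s, t)) = deriv \<xi> t * (LINT s|lborel. (if s \<le> t then g s else 0))" by simp
  qed
  finally show "(LINT s|lborel. \<xi> s * g s) = - (LINT t|lborel. deriv \<xi> t * (LINT s|lborel. (if s \<le> t then g s else 0)))" .
qed

text \<open>The du Bois-Reymond lemma. An arbitrary bump is the derivative of a test function once a
  multiple of one fixed bump with integral 1, here the derivative of \<eta>, is subtracted. Hence
  the integral of \<open>f\<close> against any bump is the mass of the bump times the constant
  \<open>L\<close>, and in the limit integrals over intervals equal length times
  \<open>L\<close>.\<close>

lemma weak_derivative_zero:
  fixes f :: "real \<Rightarrow> real"
  assumes PQ: "P < Q" and fm: "f \<in> borel_measurable borel" and fi: "set_integrable lborel {P<..<Q} f"
    and weak: "\<And>\<xi> p q. P < p \<Longrightarrow> p < q \<Longrightarrow> q < Q \<Longrightarrow> smooth \<xi> \<Longrightarrow> (\<And>s. s \<le> p \<or> q \<le> s \<Longrightarrow> \<xi> s = 0) \<Longrightarrow>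
      (LINT s:{P<..<Q}|lborel. deriv \<xi> s * f s) = 0"
  shows "\<exists>L. AE s in lborel. s \<in> {P<..<Q} \<longrightarrow> f s = L"
proof -
  note [measurable] = fm
  define p0 q0 where "p0 = (2 * P + Q) / 3" and "q0 = (P + 2 * Q) / 3"
  have pq0: "P < p0" "p0 < q0" "q0 < Q" using PQ by (auto simp: p0_def q0_def field_simps)
  obtain \<eta> :: "real \<Rightarrow> real" where \<eta>: "smooth \<eta>" "\<And>s. s \<le> p0 \<Longrightarrow> \<eta> s = 0" "\<And>s. q0 \<le> s \<Longrightarrow> \<eta> s = 1"
    using smooth_step[OF pq0(2), of 1] by blast
  define S where "S = {P<..<Q}"
  have fS: "integrable lborel (\<lambda>s. indicator S s * f s)" using fi by (simp add: set_integrable_def S_def)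
  have bi: "integrable lborel (\<lambda>s. indicator S s * f s * c s)"
    if c: "c \<in> borel_measurable borel" "\<And>s. s \<in> S \<Longrightarrow> \<bar>c s\<bar> \<le> B" for c B
  proof (rule Bochner_Integration.integrable_bound[where f = "\<lambda>s. \<bar>indicator S s * f s\<bar> * B"])
    show "integrable lborel (\<lambda>s. \<bar>indicator S s * f s\<bar> * B)" using fS by auto
    show "AE s in lborel. norm (indicator S s * f s * c s) \<le> norm (\<bar>indicator S s * f s\<bar> * B)"
    proof (intro AE_I2)
      fix s show "norm (indicator S s * f s * c s) \<le> norm (\<bar>indicator S s * f s\<bar> * B)"
      proof (cases "s \<in> S")
        case True
        then have "\<bar>c s\<bar> \<le> \<bar>B\<bar>" using c(2)[of s] by linarith
        then show ?thesis by (simp add: abs_mult mult_left_mono)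
      qed simp
    qed
    show "(\<lambda>s. indicator S s * f s * c s) \<in> borel_measurable lborel" using c(1) unfolding S_def by measurable
  qed
  have sm: "\<exists>B. \<forall>s\<in>S. \<bar>c s\<bar> \<le> B" if "smooth c" for c :: "real \<Rightarrow> real"
  proof -
    have "compact (c ` {P..Q})" by (intro compact_continuous_image smooth_continuous_on that compact_Icc)
    from compact_imp_bounded[OF this] obtain B where "\<forall>y\<in>c ` {P..Q}. norm y \<le> B" unfolding bounded_iff ..
    then show ?thesis by (intro exI[of _ B]) (auto simp: S_def)
  qed
  have smi: "integrable lborel (\<lambda>s. indicator S s * f s * c s)" if c: "smooth c" for c :: "real \<Rightarrow> real"
  proof -
    obtain B where "\<forall>s\<in>S. \<bar>c s\<bar> \<le> B" using sm[OF c] by blast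
    then show ?thesis by (intro bi[of _ B] smooth_borel_measurable[OF c]) auto
  qed
  define L where "L = (LINT s|lborel. indicator S s * f s * deriv \<eta> s)"
  have box: "(LINT s|lborel. indicator {l<..<r} s * f s) = (r - l) * L" if lr: "P < l" "l < r" "r < Q" for l r
  proof -
    have "\<forall>n. \<exists>F. smooth F \<and> (\<forall>x. (F has_real_derivative bump l r n x) (at x)) \<and> (\<forall>x\<le>l. F x = 0)"
      by (intro allI smooth_primitive smooth_bump) (simp add: bump_zero)
    then obtain F where F: "\<And>n. smooth (F n)" "\<And>n x. (F n has_real_derivative bump l r n x) (at x)"
      "\<And>n x. x \<le> l \<Longrightarrow> F n x = 0" by metis
    have Fr: "F n s = F n r" if "r \<le> s" for n s
    proof (cases "r = s")
      case False
      then have "r < s" using that by simp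
      then have "\<exists>z. r < z \<and> z < s \<and> F n s - F n r = (s - r) * bump l r n z"
        by (rule MVT2) (use F(2) in auto)
      then show ?thesis by (auto simp: bump_zero)
    qed simp
    have eq: "(LINT s|lborel. indicator S s * f s * bump l r n s) = F n r * L" for n
    proof -
      \<comment> \<open>The primitive of the bump does not vanish to the right of \<open>r\<close>;
        subtracting \<open>F n r\<close> times the step function cancels its constant final value
        and leaves compact support in the open interval.\<close>
      define \<xi> where "\<xi> s = F n s - F n r * \<eta> s" for s
      have \<xi>: "smooth \<xi>" unfolding \<xi>_def by (intro smooth_minus smooth_mult smooth_const F \<eta>)
      have d: "deriv \<xi> s = bump l r n s - F n r * deriv \<eta> s" for s
        unfolding \<xi>_def by (rule DERIV_imp_deriv) (auto intro!: derivative_eq_intros F(2) smooth_DERIV(1)[OF \<eta>(1)])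
      have "(LINT s:{P<..<Q}|lborel. deriv \<xi> s * f s) = 0"
      proof (rule weak[OF _ _ _ \<xi>])
        show "P < min l p0" "min l p0 < max r q0" "max r q0 < Q" using lr pq0 by auto
        show "\<xi> s = 0" if "s \<le> min l p0 \<or> max r q0 \<le> s" for s
          using that F(3)[of s n] Fr[of s n] \<eta>(2,3)[of s] by (auto simp: \<xi>_def)
      qed
      then have "(LINT s|lborel. indicator S s * f s * bump l r n s - F n r * (indicator S s * f s * deriv \<eta> s)) = 0"
        by (simp add: set_lebesgue_integral_def d S_def algebra_simps)
      moreover have "(LINT s|lborel. indicator S s * f s * bump l r n s - F n r * (indicator S s * f s * deriv \<eta> s))
          = (LINT s|lborel. indicator S s * f s * bump l r n s) - F n r * L"
        unfolding L_def
        by (subst Bochner_Integration.integral_diff[OF smi[OF smooth_bump] integrable_mult_right[OF smi[OF smooth_DERIV(2)[OF \<eta>(1)]]]]) simp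
      ultimately show ?thesis by simp
    qed
    have "(\<lambda>n. LINT s|lborel. indicator S s * f s * bump l r n s) \<longlonglongrightarrow> (LINT s|lborel. indicator S s * f s * indicator {l<..<r} s)"
    proof (rule integral_dominated_convergence[where w = "\<lambda>s. \<bar>indicator S s * f s\<bar>"])
      show "AE s in lborel. (\<lambda>n. indicator S s * f s * bump l r n s) \<longlonglongrightarrow> indicator S s * f s * indicator {l<..<r} s"
        by (intro AE_I2 tendsto_mult tendsto_const bump_tendsto)
      show "AE s in lborel. norm (indicator S s * f s * bump l r n s) \<le> \<bar>indicator S s * f s\<bar>" for n
        using bump_range[of l r n] by (intro AE_I2) (auto simp: abs_mult intro!: mult_right_le_one_le)
      show "(\<lambda>s. indicator S s * f s * bump l r n s) \<in> borel_measurable lborel" for n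
        using smi[OF smooth_bump] by auto
    qed (use fS in auto)
    moreover have "(\<lambda>n. F n r) \<longlonglongrightarrow> r - l"
    proof -
      have "F n r = (LINT s|lborel. bump l r n s * indicator {l..r} s)" for n
        by (subst integral_FTC_Icc_real[where F = "F n"])
          (use lr F DERIV_isCont[OF smooth_DERIV(1)[OF smooth_bump]] in auto)
      moreover have "(\<lambda>n. LINT s|lborel. bump l r n s * indicator {l..r} s) \<longlonglongrightarrow> (LINT s|lborel. indicator {l<..<r} s)"
      proof (rule integral_dominated_convergence[where w = "\<lambda>s. indicator {l..r} s"])
        show "AE s in lborel. (\<lambda>n. bump l r n s * indicator {l..r} s) \<longlonglongrightarrow> indicator {l<..<r} s"
        proof (intro AE_I2)
          fix s
          have "(\<lambda>n. bump l r n s * indicator {l..r} s) \<longlonglongrightarrow> indicator {l<..<r} s * indicator {l..r} s"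
            by (intro tendsto_mult tendsto_const bump_tendsto)
          moreover have "indicator {l<..<r} s * indicator {l..r} s = (indicator {l<..<r} s :: real)"
            by (auto simp: indicator_def)
          ultimately show "(\<lambda>n. bump l r n s * indicator {l..r} s) \<longlonglongrightarrow> indicator {l<..<r} s" by simp
        qed
        show "AE s in lborel. norm (bump l r n s * indicator {l..r} s) \<le> indicator {l..r} s" for n
          using bump_range[of l r n] by (intro AE_I2) (auto simp: indicator_def)
        show "(\<lambda>s. bump l r n s * indicator {l..r} s) \<in> borel_measurable lborel" for n
          using smooth_borel_measurable[OF smooth_bump[of l r n]] by measurable
      qed (auto intro!: integrable_real_indicator simp: emeasure_lborel_Icc_eq)
      ultimately show ?thesis using lr by simp
    qed
    then have "(\<lambda>n. F n r * L) \<longlonglongrightarrow> (r - l) * L" by (intro tendsto_mult tendsto_const)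
    ultimately have "(LINT s|lborel. indicator S s * f s * indicator {l<..<r} s) = (r - l) * L"
      unfolding eq by (rule LIMSEQ_unique)
    moreover have "indicator S s * f s * indicator {l<..<r} s = indicator {l<..<r} s * f s" for s
      using lr by (auto simp: indicator_def S_def)
    ultimately show ?thesis by simp
  qed
  have iI: "integrable lborel (indicat_real {l<..<r})" for l r :: real
    by (cases "l \<le> r") (auto intro!: integrable_real_indicator)
  have "AE s in lborel. s \<in> {P<..<Q} \<longrightarrow> f s - L = 0"
  proof (rule AE_zero_if_box_integrals_zero)
    show int: "set_integrable lborel (box l r) (\<lambda>s. f s - L)" if "cbox l r \<subseteq> {P<..<Q}" for l r
    proof -
      have "set_integrable lborel (box l r) f"
        by (rule set_integrable_subset[OF fi]) (use that box_subset_cbox in auto)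
      moreover have "set_integrable lborel (box l r) (\<lambda>_. L)"
        using iI by (auto simp: set_integrable_def box_real)
      ultimately show ?thesis by (rule set_integral_diff(1))
    qed
    show "(LINT s:box l r|lborel. f s - L) = 0" if lr: "cbox l r \<subseteq> {P<..<Q}" for l r
    proof (cases "l < r")
      case True
      have i: "set_integrable lborel (box l r) f" "set_integrable lborel (box l r) (\<lambda>_. L)"
        by (rule set_integrable_subset[OF fi]) (use lr iI box_subset_cbox in \<open>auto simp: set_integrable_def box_real\<close>)
      have "(LINT s:box l r|lborel. f s - L) = (LINT s:box l r|lborel. f s) - (LINT s:box l r|lborel. L)"
        by (rule set_integral_diff(2)[OF i])
      moreover have "(LINT s:box l r|lborel. f s) = (r - l) * L"
        using box[of l r] True lr subsetD[of "{l..r}" "{P<..<Q}" l] subsetD[of "{l..r}" "{P<..<Q}" r]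
        by (auto simp: set_lebesgue_integral_def box_real)
      moreover have "(LINT s:box l r|lborel. L) = (r - l) * L"
        using True by (simp add: set_lebesgue_integral_def box_real)
      ultimately show ?thesis by simp
    qed (simp add: box_real set_lebesgue_integral_def)
  qed auto
  then show ?thesis by (intro exI[of _ L]) simp
qed

text \<open>A function with weak derivative \<open>g\<close> is a primitive of \<open>g\<close>:
  integration by parts moves the term in \<open>g\<close> onto the primitive \<open>G\<close>, and
  \<open>f - G\<close> then falls under the preceding lemma. Integrability of \<open>g\<close> up to
  the ends makes \<open>G\<close> continuous on the closed interval, the source of all boundary
  regularity.\<close>

lemma weak_primitive:
  fixes f g :: "real \<Rightarrow> real"
  assumes PQ: "P < Q" and fm: "f \<in> borel_measurable borel" and gm: "g \<in> borel_measurable borel"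
    and fi: "set_integrable lborel {P<..<Q} f" and gi: "set_integrable lborel {P<..<Q} g"
    and weak: "\<And>\<xi> p q. P < p \<Longrightarrow> p < q \<Longrightarrow> q < Q \<Longrightarrow> smooth \<xi> \<Longrightarrow> (\<And>s. s \<le> p \<or> q \<le> s \<Longrightarrow> \<xi> s = 0) \<Longrightarrow>
      (LINT s:{P<..<Q}|lborel. deriv \<xi> s * f s + \<xi> s * g s) = 0"
  shows "\<exists>L G. continuous_on {P..Q} G \<and> (AE s in lborel. s \<in> {P<..<Q} \<longrightarrow> f s = L + G s)"
proof -
  note [measurable] = fm gm
  define gI where "gI s = indicator {P<..<Q} s * g s" for s
  have gIm[measurable]: "gI \<in> borel_measurable borel" unfolding gI_def by measurable
  have gIi: "integrable lborel gI" using gi by (simp add: set_integrable_def gI_def[abs_def])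
  define G where "G t = (LINT s|lborel. (if s \<le> t then gI s else 0))" for t
  have Gm[measurable]: "G \<in> borel_measurable borel" unfolding G_def by measurable
  have Gb: "\<bar>G t\<bar> \<le> (LINT s|lborel. \<bar>gI s\<bar>)" for t
  proof -
    have "\<bar>G t\<bar> \<le> (LINT s|lborel. \<bar>if s \<le> t then gI s else 0\<bar>)"
      unfolding G_def by (rule integral_abs_bound)
    also have "\<dots> \<le> (LINT s|lborel. \<bar>gI s\<bar>)"
      by (rule integral_mono_AE')  (use gIi in auto)
    finally show ?thesis .
  qed
  have Gc: "continuous_on {P..Q} G"
  proof (rule continuous_on_eq)
    have HK: "set_integrable lborel {P..t} gI" for t
      unfolding set_integrable_def by (rule integrable_mult_indicator[OF _ gIi]) simp
    show "continuous_on {P..Q} (\<lambda>t. integral {P..t} gI)"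
      by (rule indefinite_integral_continuous_1[OF set_borel_integral_eq_integral(1)[OF HK]])
    show "integral {P..t} gI = G t" if "t \<in> {P..Q}" for t
    proof -
      have "integral {P..t} gI = (LINT s:{P..t}|lborel. gI s)"
        using set_borel_integral_eq_integral(2)[OF HK] by simp
      also have "\<dots> = G t" unfolding set_lebesgue_integral_def G_def
        by (intro Bochner_Integration.integral_cong) (auto simp: gI_def indicator_def)
      finally show ?thesis .
    qed
  qed
  have Gi: "set_integrable lborel {P<..<Q} G"
    by (rule set_integrable_subset[OF borel_integrable_atLeastAtMost'[OF Gc]]) auto
  have "\<exists>L. AE s in lborel. s \<in> {P<..<Q} \<longrightarrow> f s - G s = L"
  proof (rule weak_derivative_zero[OF PQ])
    show "set_integrable lborel {P<..<Q} (\<lambda>s. f s - G s)" by (rule set_integral_diff(1)[OF fi Gi])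
    fix \<xi> :: "real \<Rightarrow> real" and p q assume pq: "P < p" "p < q" "q < Q" and \<xi>: "smooth \<xi>" and z: "\<And>s. s \<le> p \<or> q \<le> s \<Longrightarrow> \<xi> s = 0"
    note ibp = integral_smooth_mult_L1[OF \<xi> z gIm gIi]
    have [measurable]: "\<xi> \<in> borel_measurable borel" "deriv \<xi> \<in> borel_measurable borel"
      by (intro smooth_borel_measurable \<xi> smooth_DERIV(2)[OF \<xi>])+
    have bdd: "\<exists>B. \<forall>s\<in>{P<..<Q}. \<bar>c s\<bar> \<le> B" if "smooth c" for c :: "real \<Rightarrow> real"
    proof -
      have "compact (c ` {P..Q})" by (intro compact_continuous_image smooth_continuous_on that compact_Icc)
      from compact_imp_bounded[OF this] obtain B where "\<forall>y\<in>c ` {P..Q}. norm y \<le> B" unfolding bounded_iff ..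
      then show ?thesis by (intro exI[of _ B]) auto
    qed
    have mi: "set_integrable lborel {P<..<Q} (\<lambda>s. c s * k s)"
      if c: "smooth c" and k: "set_integrable lborel {P<..<Q} k" "k \<in> borel_measurable borel" for c k :: "real \<Rightarrow> real"
    proof -
      obtain B where B: "\<forall>s\<in>{P<..<Q}. \<bar>c s\<bar> \<le> B" using bdd[OF c] by blast
      have "set_integrable lborel {P<..<Q} (\<lambda>s. B * \<bar>k s\<bar>)"
        using set_integrable_abs[OF k(1)] by simp
      then show ?thesis
      proof (rule set_integrable_bound)
        show "set_borel_measurable lborel {P<..<Q} (\<lambda>s. c s * k s)"
          using k(2) smooth_borel_measurable[OF c] unfolding set_borel_measurable_def by measurable
        show "AE s in lborel. s \<in> {P<..<Q} \<longrightarrow> norm (c s * k s) \<le> norm (B * \<bar>k s\<bar>)"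
        proof (intro AE_I2 impI)
          fix s assume "s \<in> {P<..<Q}"
          then have "\<bar>c s\<bar> \<le> \<bar>B\<bar>" using B by fastforce
          then show "norm (c s * k s) \<le> norm (B * \<bar>k s\<bar>)" by (simp add: abs_mult mult_right_mono)
        qed
      qed
    qed
    have d0: "deriv \<xi> t = 0" if "t \<notin> {P<..<Q}" for t
      by (rule deriv_zero_outside[OF z]) (use that pq in auto)
    note d\<xi> = smooth_DERIV(2)[OF \<xi>]
    have "(LINT s:{P<..<Q}|lborel. deriv \<xi> s * (f s - G s)) =
      (LINT s:{P<..<Q}|lborel. deriv \<xi> s * f s) - (LINT s:{P<..<Q}|lborel. deriv \<xi> s * G s)"
      using set_integral_diff(2)[OF mi[OF d\<xi> fi fm] mi[OF d\<xi> Gi Gm]] by (simp add: right_diff_distrib)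
    also have "(LINT s:{P<..<Q}|lborel. deriv \<xi> s * G s) = (LINT s|lborel. deriv \<xi> s * G s)"
      unfolding set_lebesgue_integral_def
      by (intro Bochner_Integration.integral_cong) (use d0 in \<open>auto simp: indicator_def\<close>)
    also have "\<dots> = - (LINT s|lborel. \<xi> s * gI s)" using ibp(2) by (simp add: G_def)
    also have "(LINT s|lborel. \<xi> s * gI s) = (LINT s:{P<..<Q}|lborel. \<xi> s * g s)"
      unfolding set_lebesgue_integral_def gI_def by (intro Bochner_Integration.integral_cong) auto
    also have "(LINT s:{P<..<Q}|lborel. deriv \<xi> s * f s) - - (LINT s:{P<..<Q}|lborel. \<xi> s * g s)
        = (LINT s:{P<..<Q}|lborel. deriv \<xi> s * f s + \<xi> s * g s)"
      using set_integral_add(2)[OF mi[OF d\<xi> fi fm] mi[OF \<xi> gi gm]] by simp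
    also have "\<dots> = 0" by (rule weak[OF pq \<xi> z])
    finally show "(LINT s:{P<..<Q}|lborel. deriv \<xi> s * (f s - G s)) = 0" .
  qed measurable
  then obtain L where "AE s in lborel. s \<in> {P<..<Q} \<longrightarrow> f s - G s = L" by blast
  then have "AE s in lborel. s \<in> {P<..<Q} \<longrightarrow> f s = L + G s" by eventually_elim auto
  then show ?thesis using Gc by blast
qed

section \<open>The energy in the radial variable\<close>

text \<open>The norm and the determinant are computed in the orthogonal frames \<open>x\<close>,
  \<open>perp x\<close> and \<open>P\<close>, \<open>perp P\<close>. In the application
  \<open>X\<close> is the old gradient applied to the image point, \<mu> is the radial stretching
  and \<nu> the rate of rotation of the twist.\<close>

lemma twisted_gradient:
  fixes B :: "real^2^2" and x X P :: "real^2"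
  assumes x: "x \<noteq> 0" and P: "P \<noteq> 0" and Bx: "B *v x = \<mu> *\<^sub>R X + \<nu> *\<^sub>R perp P" and Bp: "B *v perp x = perp P"
  shows "(norm B)\<^sup>2 = ((\<mu>\<^sup>2 * (X \<bullet> P)\<^sup>2 + (\<mu> * (X \<bullet> perp P) + \<nu> * (P \<bullet> P))\<^sup>2) / (P \<bullet> P) + P \<bullet> P) / (x \<bullet> x)"
    and "det B = \<mu> * (X \<bullet> P) / (x \<bullet> x)"
proof -
  define Z where "Z = B *v x"
  have Z: "Z $ 1 = B $ 1 $ 1 * x $ 1 + B $ 1 $ 2 * x $ 2" "Z $ 2 = B $ 2 $ 1 * x $ 1 + B $ 2 $ 2 * x $ 2"
    by (simp_all add: Z_def matrix_vector_mult_def sum_2)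
  have "(B *v perp x) $ 1 = - P $ 2" "(B *v perp x) $ 2 = P $ 1" using Bp by simp_all
  then have Pc: "P $ 1 = B $ 2 $ 2 * x $ 1 - B $ 2 $ 1 * x $ 2" "P $ 2 = B $ 1 $ 1 * x $ 2 - B $ 1 $ 2 * x $ 1"
    by (simp_all add: matrix_vector_mult_def sum_2)
  have xx: "0 < x \<bullet> x" and PP: "0 < P \<bullet> P" using x P by simp_all
  have nB: "(norm B)\<^sup>2 = (B $ 1 $ 1)\<^sup>2 + (B $ 1 $ 2)\<^sup>2 + (B $ 2 $ 1)\<^sup>2 + (B $ 2 $ 2)\<^sup>2"
    by (simp add: power2_norm_eq_inner inner_vec_def sum_2) (simp add: power2_eq_square)
  have "(norm B)\<^sup>2 * (x \<bullet> x) = Z \<bullet> Z + P \<bullet> P"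
    unfolding nB inner_real2 Z Pc by (simp add: algebra_simps power2_eq_square)
  moreover have "Z \<bullet> Z = ((Z \<bullet> P)\<^sup>2 + (Z \<bullet> perp P)\<^sup>2) / (P \<bullet> P)"
  proof -
    have "(Z \<bullet> Z) * (P \<bullet> P) = (Z \<bullet> P)\<^sup>2 + (Z \<bullet> perp P)\<^sup>2"
      unfolding inner_real2 perp_nth by (simp add: algebra_simps power2_eq_square)
    then show ?thesis using PP by (simp add: field_simps)
  qed
  moreover have ZP: "Z \<bullet> P = \<mu> * (X \<bullet> P)"
    unfolding Z_def Bx inner_real2 by (simp add: algebra_simps)
  moreover have "Z \<bullet> perp P = \<mu> * (X \<bullet> perp P) + \<nu> * (P \<bullet> P)"
    unfolding Z_def Bx inner_real2 by (simp add: algebra_simps)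
  ultimately show "(norm B)\<^sup>2 = ((\<mu>\<^sup>2 * (X \<bullet> P)\<^sup>2 + (\<mu> * (X \<bullet> perp P) + \<nu> * (P \<bullet> P))\<^sup>2) / (P \<bullet> P) + P \<bullet> P) / (x \<bullet> x)"
    using xx by (simp add: field_simps)
  have "det B * (x \<bullet> x) = Z \<bullet> P"
    unfolding det_2 inner_real2 Z Pc by (simp add: algebra_simps)
  then show "det B = \<mu> * (X \<bullet> P) / (x \<bullet> x)" using xx ZP by (simp add: field_simps)
qed

text \<open>In the variable \<open>s = r\<^sup>2\<close> the map is determined by the curve \<open>w\<close>, whose derivative is \<open>k\<close>:
  \<open>R\<close>, \<open>c1 / s\<close> and \<open>c2\<close> are the paper's \<open>\<rho>\<^sup>2\<close>, \<open>d = \<rho> \<rho>' / r\<close> and \<open>r \<rho>\<^sup>2 \<psi>'\<close>.\<close>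

locale polar_sobolev =
  fixes a b :: real and u :: "real^2 \<Rightarrow> real^2" and \<rho> \<psi> :: "real \<Rightarrow> real" and k :: "real \<Rightarrow> real^2"
  assumes ab: "0 < a" "a < b"
    and u_W12: "u \<in> W12 (annulus a b)" and u_trace: "has_trace a b u (\<lambda>x. x)"
    and cont: "continuous_on UNIV \<rho>" "continuous_on UNIV \<psi>"
    and \<rho>_pos: "r \<in> {a..b} \<Longrightarrow> 0 < \<rho> r"
    and k_measurable [measurable]: "k \<in> borel_measurable borel"
    and k_integrable: "set_integrable lborel {a\<^sup>2<..<b\<^sup>2} k"
    and grad_perp: "AE x in lborel. x \<in> annulus a b \<longrightarrow>
      weak_grad (annulus a b) u x *v perp x = perp (polar_map \<rho> \<psi> x)"
    and grad_self: "AE x in lborel. x \<in> annulus a b \<longrightarrow>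
      (weak_grad (annulus a b) u x *v x) \<bullet> polar_map \<rho> \<psi> x =
        2 * (norm x)\<^sup>2 * (k ((norm x)\<^sup>2) \<bullet> (\<rho> (norm x) *\<^sub>R e\<^sub>r (\<psi> (norm x)))) \<and>
      (weak_grad (annulus a b) u x *v x) \<bullet> perp (polar_map \<rho> \<psi> x) =
        2 * (norm x)\<^sup>2 * (k ((norm x)\<^sup>2) \<bullet> perp (\<rho> (norm x) *\<^sub>R e\<^sub>r (\<psi> (norm x))))"
begin

definition "w s = \<rho> (sqrt s) *\<^sub>R e\<^sub>r (\<psi> (sqrt s))"
definition "R s = (\<rho> (sqrt s))\<^sup>2"
definition "c1 s = 2 * s * (k s \<bullet> w s)"
definition "c2 s = 2 * s * (k s \<bullet> perp (w s))"
text \<open>The energy density at squared radius \<open>s\<close> of a composed map whose twist has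
  radial stretching \<mu> and rate of rotation \<nu>; the old map is evaluated at squared radius
  \<open>t\<close>, the image of \<open>s\<close>.\<close>

definition "dens h0 \<mu> \<nu> t s = ennreal (((\<mu>\<^sup>2 * (c1 t)\<^sup>2 + (\<mu> * c2 t + \<nu> * R t)\<^sup>2) / R t + R t) / (2 * s)) + e2ennreal (h0 (\<mu> * c1 t / s))"

lemma continuous_w: "continuous_on S w"
  unfolding w_def[abs_def]
  by (intro continuous_intros continuous_on_er continuous_on_compose2[OF cont(1)] continuous_on_compose2[OF cont(2)]) auto

lemma continuous_R: "continuous_on S R"
  unfolding R_def[abs_def]
  by (intro continuous_intros continuous_on_compose2[OF cont(1)]) auto

lemma w_measurable [measurable]: "w \<in> borel_measurable borel"
  by (rule borel_measurable_continuous_onI[OF continuous_w])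

lemma R_measurable [measurable]: "R \<in> borel_measurable borel"
  by (rule borel_measurable_continuous_onI[OF continuous_R])

lemma c_measurable [measurable]: "c1 \<in> borel_measurable borel" "c2 \<in> borel_measurable borel"
  unfolding c1_def[abs_def] c2_def[abs_def] by measurable

lemma R_pos: "s \<in> {a\<^sup>2..b\<^sup>2} \<Longrightarrow> 0 < R s"
proof -
  assume s: "s \<in> {a\<^sup>2..b\<^sup>2}"
  then have "a \<le> sqrt s" "sqrt s \<le> b" using ab real_le_rsqrt[of a s] real_sqrt_le_mono[of s "b\<^sup>2"] by auto
  then show ?thesis using \<rho>_pos[of "sqrt s"] by (simp add: R_def)
qed

text \<open>The weak chain rule gives the new gradient as the old one at the image point times the
  derivative of the twist. On the frame \<open>x\<close>, \<open>perp x\<close> this product has the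
  form required by \<open>twisted_gradient\<close>, and the two structural identities for the old
  gradient, taken at the image point, make everything radial.\<close>

lemma energy_twist:
  assumes tm: "twist_map a b p q A \<eta> M"
  shows "energy a b h0 (\<lambda>x. u (twist A \<eta> x)) = (\<integral>\<^sup>+x\<in>annulus a b.
    (\<lambda>s. dens h0 (1 + 2 * s * deriv A s / A s) (2 * s * deriv \<eta> s) (s * (A s)\<^sup>2) s) ((norm x)\<^sup>2) \<partial>lborel)"
proof -
  interpret twist_map a b p q A \<eta> M by (rule tm)
  let ?G = "weak_grad ann u" and ?V = "weak_grad ann (\<lambda>x. u (tw x))"
  show ?thesis
    unfolding energy_def nn_integral_completion
  proof (rule nn_integral_cong_AE)
    show "AE x in lborel. (ennreal ((norm (?V x))\<^sup>2 / 2) + e2ennreal (h0 (det (?V x)))) * indicator ann x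
      = dens h0 (1 + 2 * (norm x)\<^sup>2 * deriv A ((norm x)\<^sup>2) / A ((norm x)\<^sup>2)) (2 * (norm x)\<^sup>2 * deriv \<eta> ((norm x)\<^sup>2))
         ((norm x)\<^sup>2 * (A ((norm x)\<^sup>2))\<^sup>2) ((norm x)\<^sup>2) * indicator ann x"
      using sobolev_tw(3)[OF u_W12 u_trace] AE_tw[OF grad_perp] AE_tw[OF grad_self]
    proof eventually_elim
      case (elim x)
      show ?case
      proof (cases "x \<in> ann")
        case True
        define y P X where "y = tw x" and "P = polar_map \<rho> \<psi> y" and "X = ?G y *v y"
        define s where "s = (norm x)\<^sup>2"
        define t where "t = s * (A s)\<^sup>2"
        have xx: "x \<bullet> x = s" by (simp add: s_def power2_norm_eq_inner)
        have ny: "(norm y)\<^sup>2 = t" using norm_tw[of x] by (simp add: y_def t_def s_def m_def)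
        have yann: "y \<in> ann" unfolding y_def by (rule tw_in[OF True])
        have x0: "x \<noteq> 0" and y0: "y \<noteq> 0" using True yann ab by (auto simp: annulus_def)
        have ny': "norm y = sqrt t" using ny by (metis norm_ge_zero real_sqrt_abs abs_of_nonneg)
        have PP: "P \<bullet> P = R t"
          using y0 by (simp add: P_def polar_map_def R_def ny'[symmetric] power2_norm_eq_inner[symmetric] power_mult_distrib power_divide)
        have yt: "t \<in> {a\<^sup>2..b\<^sup>2}" using yann by (simp add: ann_iff ny)
        have P0: "P \<noteq> 0" using PP R_pos[OF yt] by auto
        have V: "?V x = ?G y ** matrix (tw' x)" using elim True by (simp add: y_def)
        have lin: "linear (tw' x)" using tw_der has_derivative_linear by blast
        have Vv: "?V x *v v = ?G y *v tw' x v" for v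
          by (simp add: V matrix_vector_mul_assoc[symmetric] fun_cong[OF matrix_vector_mul(2)[OF lin], symmetric])
        have gp: "?G y *v perp y = perp P" using elim True by (simp add: y_def P_def)
        have XP: "X \<bullet> P = c1 t" "X \<bullet> perp P = c2 t"
          using elim True by (simp_all add: X_def P_def y_def[symmetric] c1_def c2_def w_def ny ny'[symmetric])
        have B1: "?V x *v x = (1 + 2 * s * deriv A s / A s) *\<^sub>R X + (2 * s * deriv \<eta> s) *\<^sub>R perp P"
          using Apos[of "x \<bullet> x"] twist_deriv_self[of A x \<eta>]
          by (simp add: Vv xx y_def[symmetric] matrix_vector_right_distrib matrix_vector_mult_scaleR gp X_def)
        have B2: "?V x *v perp x = perp P"
          by (simp add: Vv twist_deriv_perp y_def[symmetric] gp)
        note g = twisted_gradient[OF x0 P0 B1 B2]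
        show ?thesis using True
          by (simp add: dens_def g PP XP xx s_def[symmetric] t_def[symmetric] mult.commute[of s 2])
      qed simp
    qed
  qed
qed

end

section \<open>First variations\<close>

lemma dilation_difference:
  fixes t \<mu> Q R y z :: real
  assumes "0 < t" "0 < \<mu>"
  shows "(\<mu> * Q + R / \<mu>) / (2 * t) + y - ((Q + R) / (2 * t) + z) =
    (\<mu> - 1) * (Q / (2 * t)) + (1 / \<mu> - 1) * (R / (2 * t)) + (y - z)"
  using assms by (simp add: field_simps)

context stored_energy
begin

text \<open>The smallness 1/20 keeps A between 19/20 and 21/20, hence \<mu> within 3\<delta> and
  1/\<mu> within 4\<delta> of 1. The Jacobian A^2 \<mu> is then within 6\<delta>, at most 3/10, of
  1, inside the range where \<open>scaled_bound\<close> applies. The bound is linear in \<delta>, so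
  it dominates difference quotients.\<close>

lemma dilation_bound:
  assumes pos: "0 < d" "0 \<le> Q" "0 \<le> R" "0 < t" and \<delta>: "0 \<le> \<delta>" "\<delta> \<le> 1 / 20"
    and A: "\<bar>A - 1\<bar> \<le> \<delta>" and be: "\<bar>\<beta>\<bar> \<le> \<delta>" and \<mu>: "\<mu> = 1 + 2 * \<beta> / A"
  shows "0 < \<mu>" and "1 / 2 \<le> A\<^sup>2 * \<mu>" and "A\<^sup>2 * \<mu> \<le> 2"
    and "\<bar>((\<mu> * Q + R / \<mu>) / (2 * t) + h (A\<^sup>2 * \<mu> * d) / (A\<^sup>2 * \<mu>)) - ((Q + R) / (2 * t) + h d)\<bar>
      \<le> \<delta> * (2 * (Q / t) + 2 * (R / t) + 6 * ((12 * C + 2) * (1 + d + h d)))"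
proof -
  have A1: "19 / 20 \<le> A" "A \<le> 21 / 20" using A \<delta> by (simp_all add: abs_if split: if_splits)
  have "\<bar>\<mu> - 1\<bar> = 2 * \<bar>\<beta>\<bar> / A" using A1 by (simp add: \<mu> abs_mult)
  also have "\<dots> \<le> 3 * \<delta>" using A1 be \<delta> mult_mono[of "19 / 20" A "3 * \<delta>" "3 * \<delta>"]
    by (simp add: pos_divide_le_eq mult.commute)
  finally have m1: "\<bar>\<mu> - 1\<bar> \<le> 3 * \<delta>" .
  then have m2: "17 / 20 \<le> \<mu>" "\<mu> \<le> 23 / 20" using \<delta> by (simp_all add: abs_if split: if_splits)
  then show "0 < \<mu>" by simp
  have "\<bar>1 / \<mu> - 1\<bar> = \<bar>\<mu> - 1\<bar> / \<mu>" using m2 by (simp add: field_simps abs_if)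
  also have "\<dots> \<le> 4 * \<delta>"
  proof -
    have "4 * \<delta> * (17 / 20) \<le> 4 * \<delta> * \<mu>" using m2 \<delta> by (intro mult_left_mono) auto
    then have "\<bar>\<mu> - 1\<bar> \<le> 4 * \<delta> * \<mu>" using m1 \<delta> by linarith
    then show ?thesis using m2 by (simp add: pos_divide_le_eq)
  qed
  finally have m3: "\<bar>1 / \<mu> - 1\<bar> \<le> 4 * \<delta>" .
  have "A\<^sup>2 - 1 = (A - 1) * (A + 1)" by (simp add: power2_eq_square algebra_simps)
  then have "\<bar>A\<^sup>2 - 1\<bar> = \<bar>A - 1\<bar> * (A + 1)" using A1 by (simp add: abs_mult)
  also have "\<dots> \<le> \<delta> * (41 / 20)" using A A1 \<delta> by (intro mult_mono) auto
  finally have A2: "\<bar>A\<^sup>2 - 1\<bar> \<le> \<delta> * (41 / 20)" .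
  define J where "J = A\<^sup>2 * \<mu>"
  have "\<bar>(A\<^sup>2 - 1) * \<mu>\<bar> \<le> (\<delta> * (41 / 20)) * (23 / 20)"
    unfolding abs_mult using A2 m2 \<delta> by (intro mult_mono) auto
  moreover have "J - 1 = (A\<^sup>2 - 1) * \<mu> + (\<mu> - 1)" by (simp add: J_def algebra_simps)
  ultimately have J1: "\<bar>J - 1\<bar> \<le> 6 * \<delta>" using m1 \<delta> by linarith
  then have J: "1 / 2 \<le> J" "J \<le> 2" using \<delta> by (simp_all add: abs_if split: if_splits)
  then show "1 / 2 \<le> A\<^sup>2 * \<mu>" "A\<^sup>2 * \<mu> \<le> 2" by (simp_all add: J_def)
  have Cn: "0 \<le> (12 * C + 2) * (1 + d + h d)" using C_nonneg pos h_nonneg[of d] by simp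
  have e1: "\<bar>(\<mu> - 1) * (Q / (2 * t))\<bar> \<le> 4 * \<delta> * (Q / (2 * t))"
    unfolding abs_mult using m1 pos \<delta> by (intro mult_mono) auto
  have e2: "\<bar>(1 / \<mu> - 1) * (R / (2 * t))\<bar> \<le> 4 * \<delta> * (R / (2 * t))"
    unfolding abs_mult[of "1 / \<mu> - 1"] using m3 pos \<delta> by (intro mult_mono) auto
  have e3: "\<bar>h (J * d) / J - h d\<bar> \<le> 6 * \<delta> * ((12 * C + 2) * (1 + d + h d))"
    using scaled_bound[OF J pos(1)] mult_right_mono[OF J1 Cn] by linarith
  have "((\<mu> * Q + R / \<mu>) / (2 * t) + h (J * d) / J) - ((Q + R) / (2 * t) + h d) =
    (\<mu> - 1) * (Q / (2 * t)) + (1 / \<mu> - 1) * (R / (2 * t)) + (h (J * d) / J - h d)"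
    using pos m2 by (intro dilation_difference) auto
  also have "\<bar>\<dots>\<bar> \<le> 4 * \<delta> * (Q / (2 * t)) + 4 * \<delta> * (R / (2 * t)) + 6 * \<delta> * ((12 * C + 2) * (1 + d + h d))"
    using e1 e2 e3 by linarith
  also have "\<dots> = \<delta> * (2 * (Q / t) + 2 * (R / t) + 6 * ((12 * C + 2) * (1 + d + h d)))"
    using pos by (simp add: field_simps)
  finally show "\<bar>((\<mu> * Q + R / \<mu>) / (2 * t) + h (A\<^sup>2 * \<mu> * d) / (A\<^sup>2 * \<mu>)) - ((Q + R) / (2 * t) + h d)\<bar>
      \<le> \<delta> * (2 * (Q / t) + 2 * (R / t) + 6 * ((12 * C + 2) * (1 + d + h d)))"
    by (simp add: J_def)
qed

text \<open>The functions \<alpha> and \<beta> may vary with n because they will be evaluated at the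
  inverse image of a fixed point, which moves with the perturbation. Only their limits enter the
  derivative.\<close>

lemma dilation_limit:
  fixes \<epsilon> \<alpha> \<beta> A \<mu> :: "nat \<Rightarrow> real"
  assumes d: "0 < d" and t: "0 < t" and \<epsilon>: "\<epsilon> \<longlonglongrightarrow> 0" "\<And>n. \<epsilon> n \<noteq> 0" and \<alpha>: "\<alpha> \<longlonglongrightarrow> \<alpha>0" and \<beta>: "\<beta> \<longlonglongrightarrow> \<beta>0"
    and A: "\<And>n. A n = 1 + \<epsilon> n * \<alpha> n" "\<And>n. 0 < A n"
    and \<mu>: "\<And>n. \<mu> n = 1 + 2 * (\<epsilon> n * \<beta> n) / A n" "\<And>n. 0 < \<mu> n"
  shows "(\<lambda>n. (((\<mu> n * Q + R / \<mu> n) / (2 * t) + h ((A n)\<^sup>2 * \<mu> n * d) / ((A n)\<^sup>2 * \<mu> n)) - ((Q + R) / (2 * t) + h d)) / \<epsilon> n)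
    \<longlonglongrightarrow> (\<beta>0 / t) * (Q - R) + (2 * \<alpha>0 + 2 * \<beta>0) * H d"
proof -
  \<comment> \<open>Caratheodory's form of the derivative is used because J - 1 may vanish for some
    n, so dividing by it is not possible.\<close>
  obtain g where g: "\<forall>z. h (z * d) / z - h (1 * d) / 1 = g z * (z - 1)" "isCont g 1" "g 1 = H d"
    using scaled_DERIV[OF d] unfolding CARAT_DERIV by blast
  have "A = (\<lambda>n. 1 + \<epsilon> n * \<alpha> n)" using A(1) by auto
  then have Al: "A \<longlonglongrightarrow> 1" using tendsto_add[OF tendsto_const tendsto_mult[OF \<epsilon>(1) \<alpha>], of 1] by simp
  define m where "m n = 2 * \<beta> n / A n" for n
  have ml: "m \<longlonglongrightarrow> 2 * \<beta>0" unfolding m_def using tendsto_divide[OF tendsto_mult[OF tendsto_const \<beta>] Al, of 2] by simp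
  have \<mu>m: "\<mu> n - 1 = \<epsilon> n * m n" for n using \<mu>(1)[of n] by (simp add: m_def)
  have "\<mu> = (\<lambda>n. 1 + \<epsilon> n * m n)" using \<mu>m by (auto simp: fun_eq_iff algebra_simps)
  then have \<mu>l: "\<mu> \<longlonglongrightarrow> 1" using tendsto_add[OF tendsto_const tendsto_mult[OF \<epsilon>(1) ml], of 1] by simp
  define J where "J n = (A n)\<^sup>2 * \<mu> n" for n
  define j where "j n = (2 * \<alpha> n + \<epsilon> n * (\<alpha> n)\<^sup>2) * \<mu> n + m n" for n
  have Jl: "J \<longlonglongrightarrow> 1" unfolding J_def using tendsto_mult[OF tendsto_power[OF Al, of 2] \<mu>l] by simp
  have jl: "j \<longlonglongrightarrow> 2 * \<alpha>0 + 2 * \<beta>0"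
  proof -
    have "j \<longlonglongrightarrow> (2 * \<alpha>0 + 0 * \<alpha>0\<^sup>2) * 1 + 2 * \<beta>0"
      unfolding j_def by (intro tendsto_intros \<alpha> \<epsilon>(1) \<mu>l ml)
    then show ?thesis by simp
  qed
  have Jj: "J n - 1 = \<epsilon> n * j n" for n
  proof -
    have "J n - 1 = ((A n)\<^sup>2 - 1) * \<mu> n + (\<mu> n - 1)" by (simp add: J_def algebra_simps)
    also have "\<dots> = \<epsilon> n * j n" unfolding \<mu>m A(1) j_def by (simp add: power2_eq_square algebra_simps)
    finally show ?thesis .
  qed
  have eq: "(((\<mu> n * Q + R / \<mu> n) / (2 * t) + h (J n * d) / J n) - ((Q + R) / (2 * t) + h d)) / \<epsilon> n
      = m n * (Q / (2 * t)) - m n / \<mu> n * (R / (2 * t)) + g (J n) * j n" for n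
  proof -
    have h1: "h (J n * d) / J n - h d = \<epsilon> n * (g (J n) * j n)" using g(1)[rule_format, of "J n"] Jj[of n] by simp
    have h2: "1 / \<mu> n - 1 = - (\<epsilon> n * (m n / \<mu> n))" using \<mu>(2)[of n] \<mu>m[of n] by (simp add: field_simps)
    have "((\<mu> n * Q + R / \<mu> n) / (2 * t) + h (J n * d) / J n) - ((Q + R) / (2 * t) + h d) =
      \<epsilon> n * m n * (Q / (2 * t)) + - (\<epsilon> n * (m n / \<mu> n)) * (R / (2 * t)) + \<epsilon> n * (g (J n) * j n)"
      unfolding dilation_difference[OF t \<mu>(2)] \<mu>m h1 h2 ..
    also have "\<dots> = \<epsilon> n * (m n * (Q / (2 * t)) - m n / \<mu> n * (R / (2 * t)) + g (J n) * j n)"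
      by (simp add: algebra_simps)
    finally have "((\<mu> n * Q + R / \<mu> n) / (2 * t) + h (J n * d) / J n) - ((Q + R) / (2 * t) + h d) =
      \<epsilon> n * (m n * (Q / (2 * t)) - m n / \<mu> n * (R / (2 * t)) + g (J n) * j n)" .
    then show ?thesis using \<epsilon>(2)[of n] by simp
  qed
  have "(\<lambda>n. m n * (Q / (2 * t)) - m n / \<mu> n * (R / (2 * t)) + g (J n) * j n) \<longlonglongrightarrow>
      2 * \<beta>0 * (Q / (2 * t)) - 2 * \<beta>0 / 1 * (R / (2 * t)) + g 1 * (2 * \<alpha>0 + 2 * \<beta>0)"
    by (intro tendsto_intros ml \<mu>l jl isCont_tendsto_compose[OF g(2) Jl]) simp
  moreover have "2 * \<beta>0 * (Q / (2 * t)) - 2 * \<beta>0 / 1 * (R / (2 * t)) + g 1 * (2 * \<alpha>0 + 2 * \<beta>0) =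
      (\<beta>0 / t) * (Q - R) + (2 * \<alpha>0 + 2 * \<beta>0) * H d"
    using t by (simp add: g(3) field_simps)
  ultimately show ?thesis unfolding J_def[symmetric] eq by simp
qed

end

text \<open>Minimality is recorded only against twists with \<open>M = 0\<close>, which preserve the
  winding number. The separate function \<open>h\<close> is the real-valued restriction of
  \<open>h0\<close> to positive arguments.\<close>

locale polar_minimizer = polar_sobolev a b u \<rho> \<psi> k + stored_energy h h' C
  for a b :: real and u :: "real^2 \<Rightarrow> real^2" and \<rho> \<psi> :: "real \<Rightarrow> real" and k :: "real \<Rightarrow> real^2"
    and h h' :: "real \<Rightarrow> real" and C :: real +
  fixes h0 :: "real \<Rightarrow> ereal"
  assumes h0_pos: "0 < t \<Longrightarrow> h0 t = ereal (h t)" and h0_neg: "t \<le> 0 \<Longrightarrow> h0 t = \<infinity>"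
    and finite_energy: "energy a b h0 u < \<infinity>"
    and minimal: "twist_map a b p q A \<eta> 0 \<Longrightarrow> energy a b h0 u \<le> energy a b h0 (\<lambda>x. u (twist A \<eta> x))"
begin

abbreviation "S \<equiv> {a\<^sup>2<..<b\<^sup>2}"
text \<open>\<open>hI\<close> and \<open>HI\<close> extend \<open>h\<close> and \<open>H\<close> by
  0 to the nonpositive half-line. This makes them Borel on the whole line, while the values in use
  are at positive arguments, by \<open>c1_pos\<close>.\<close>

definition "hI t = indicator {0<..} t *\<^sub>R h t"
definition "HI t = indicator {0<..} t *\<^sub>R H t"
text \<open>In terms of the radius, \<open>Q\<close> is r^2 (\<rho>'^2 + \<rho>^2 \<psi>'^2) and
  \<open>R\<close> is the squared derivative in the angle, so (Q + R) / (2t) is half the squared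
  norm of the gradient.\<close>

definition "Q t = ((c1 t)\<^sup>2 + (c2 t)\<^sup>2) / R t"
definition "e0 t = (Q t + R t) / (2 * t) + hI (c1 t / t)"

lemma a2b2: "a\<^sup>2 < b\<^sup>2" using ab by (intro power_strict_mono) auto

lemma S_pos: "s \<in> S \<Longrightarrow> 0 < s"
  by (smt (verit) greaterThanLessThan_iff zero_le_power2)

lemma hI_measurable [measurable]: "hI \<in> borel_measurable borel"
  unfolding hI_def[abs_def] by (rule borel_measurable_continuous_on_indicator[OF _ continuous_h]) simp

lemma HI_measurable [measurable]: "HI \<in> borel_measurable borel"
  unfolding HI_def[abs_def] by (rule borel_measurable_continuous_on_indicator[OF _ continuous_H]) simp

lemma Q_measurable [measurable]: "Q \<in> borel_measurable borel"
  unfolding Q_def[abs_def] by measurable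

lemma e0_measurable [measurable]: "e0 \<in> borel_measurable borel"
  unfolding e0_def[abs_def] by measurable

lemma hI_nonneg: "0 \<le> hI t"
  using h_nonneg by (simp add: hI_def indicator_def)

lemma Q_nonneg: "s \<in> S \<Longrightarrow> 0 \<le> Q s"
  using R_pos[of s] by (simp add: Q_def)

lemma h0_eq: "e2ennreal (h0 t) = (if 0 < t then ennreal (hI t) else top)"
  using h0_pos[of t] h0_neg[of t] by (auto simp: hI_def)

lemma h0_measurable: "(\<lambda>t. e2ennreal (h0 t)) \<in> borel_measurable borel"
  unfolding h0_eq[abs_def] by measurable

lemma dens_measurable:
  assumes [measurable]: "f \<in> borel_measurable borel" "g \<in> borel_measurable borel" "p \<in> borel_measurable borel" "q \<in> borel_measurable borel"
  shows "(\<lambda>s. dens h0 (f s) (g s) (p s) (q s)) \<in> borel_measurable borel"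
  unfolding dens_def using measurable_compose[OF _ h0_measurable] by measurable

lemma energy_rotation:
  assumes tm: "twist_map a b p q (\<lambda>_. 1) \<eta> 0"
  shows "energy a b h0 (\<lambda>x. u (twist (\<lambda>_. 1) \<eta> x)) = ennreal pi * (\<integral>\<^sup>+s\<in>S. dens h0 1 (2 * s * deriv \<eta> s) s s \<partial>lborel)"
proof -
  have [measurable]: "deriv \<eta> \<in> borel_measurable borel"
    by (rule smooth_borel_measurable[OF smooth_DERIV(2)[OF twist_map.sm\<eta>[OF tm]]])
  have m: "(\<lambda>s. dens h0 1 (2 * s * deriv \<eta> s) s s) \<in> borel_measurable borel"
    by (rule dens_measurable) measurable
  show ?thesis unfolding energy_twist[OF tm] using nn_integral_radial[OF ab m] by simp
qed

lemma trivial_twist: "twist_map a b ((2 * a\<^sup>2 + b\<^sup>2) / 3) ((a\<^sup>2 + 2 * b\<^sup>2) / 3) (\<lambda>_. 1) (\<lambda>_. 0) 0"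
  by unfold_locales (use ab a2b2 in \<open>auto simp: smooth_const field_simps\<close>)

lemma base_energy: "energy a b h0 u = ennreal pi * (\<integral>\<^sup>+s\<in>S. dens h0 1 0 s s \<partial>lborel)"
  using energy_rotation[OF trivial_twist] by (simp add: twist_def)

lemma base_finite: "(\<integral>\<^sup>+s\<in>S. dens h0 1 0 s s \<partial>lborel) < \<infinity>"
  using finite_energy unfolding base_energy by (auto simp: ennreal_mult_less_top)

text \<open>The stored energy is infinite at nonpositive determinants, so finite total energy
  excludes them up to a null set.\<close>

lemma c1_pos: "AE s in lborel. s \<in> S \<longrightarrow> 0 < c1 s"
proof -
  have [measurable]: "(\<lambda>s. dens h0 1 0 s s) \<in> borel_measurable borel" by (rule dens_measurable) measurable
  have "AE s in lborel. dens h0 1 0 s s * indicator S s \<noteq> \<infinity>"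
    by (rule nn_integral_PInf_AE) (use base_finite in auto)
  then show ?thesis
  proof eventually_elim
    case (elim s)
    show ?case
    proof
      assume s: "s \<in> S"
      then have "0 < c1 s / s" using elim by (auto simp: dens_def h0_eq split: if_splits)
      then show "0 < c1 s" using S_pos[OF s] by (simp add: zero_less_divide_iff)
    qed
  qed
qed

lemma dens_base: "s \<in> S \<Longrightarrow> 0 < c1 s \<Longrightarrow> dens h0 1 0 s s = ennreal (e0 s)"
  using S_pos[of s] R_pos[of s] hI_nonneg[of "c1 s / s"]
  by (simp add: dens_def h0_eq e0_def Q_def ennreal_plus[symmetric] del: ennreal_plus)

lemma base_energy_e0: "energy a b h0 u = ennreal pi * (\<integral>\<^sup>+s\<in>S. ennreal (e0 s) \<partial>lborel)"
  unfolding base_energy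
  by (intro arg_cong[where f = "\<lambda>x. ennreal pi * x"] nn_integral_cong_AE)
    (use c1_pos in eventually_elim, auto simp: dens_base indicator_def)

lemma e0_nonneg: "s \<in> S \<Longrightarrow> 0 \<le> e0 s"
  using S_pos[of s] R_pos[of s] hI_nonneg[of "c1 s / s"] Q_nonneg[of s] by (simp add: e0_def)

lemma nn_integral_indicator_ennreal: "(\<integral>\<^sup>+s\<in>S. ennreal (f s) \<partial>lborel) = (\<integral>\<^sup>+s. ennreal (indicator S s * f s) \<partial>lborel)"
  by (intro nn_integral_cong) (auto simp: indicator_def)

lemma e0_integrable: "set_integrable lborel S e0"
  unfolding set_integrable_def real_scaleR_def
proof (rule integrableI_nonneg)
  show "(\<integral>\<^sup>+s. ennreal (indicator S s * e0 s) \<partial>lborel) < \<infinity>"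
    using finite_energy unfolding base_energy_e0 nn_integral_indicator_ennreal by (auto simp: ennreal_mult_less_top)
qed (use e0_nonneg in \<open>auto simp: indicator_def\<close>)

text \<open>Minimality is an inequality between extended nonnegative integrals; integrability of
  \<open>e0\<close> and of the difference permits passing to real integrals and subtracting.\<close>

lemma variation_nonneg:
  assumes e: "energy a b h0 u \<le> ennreal pi * (\<integral>\<^sup>+s\<in>S. ennreal (f s) \<partial>lborel)"
    and f: "set_integrable lborel S (\<lambda>s. f s - e0 s)" "AE s in lborel. s \<in> S \<longrightarrow> 0 \<le> f s"
  shows "0 \<le> (LINT s:S|lborel. f s - e0 s)"
proof -
  have fi: "set_integrable lborel S f" using set_integral_add(1)[OF f(1) e0_integrable] by simp
  have "(\<integral>\<^sup>+s\<in>S. ennreal (f s) \<partial>lborel) = ennreal (LINT s:S|lborel. f s)"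
    unfolding nn_integral_indicator_ennreal set_lebesgue_integral_def real_scaleR_def
    by (rule nn_integral_eq_integral) (use fi f(2) in \<open>auto simp: set_integrable_def indicator_def elim: eventually_mono\<close>)
  moreover have "(\<integral>\<^sup>+s\<in>S. ennreal (e0 s) \<partial>lborel) = ennreal (LINT s:S|lborel. e0 s)"
    unfolding nn_integral_indicator_ennreal set_lebesgue_integral_def real_scaleR_def
    by (rule nn_integral_eq_integral) (use e0_integrable e0_nonneg in \<open>auto simp: set_integrable_def indicator_def\<close>)
  ultimately have "ennreal (pi * (LINT s:S|lborel. e0 s)) \<le> ennreal (pi * (LINT s:S|lborel. f s))"
    using e unfolding base_energy_e0 by (simp add: ennreal_mult')
  moreover have "0 \<le> (LINT s:S|lborel. f s)"
    unfolding set_lebesgue_integral_def real_scaleR_def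
    by (rule integral_nonneg_AE) (use f(2) in \<open>auto simp: indicator_def elim: eventually_mono\<close>)
  ultimately have "pi * (LINT s:S|lborel. e0 s) \<le> pi * (LINT s:S|lborel. f s)" by simp
  then show ?thesis using set_integral_diff(2)[OF fi e0_integrable] by simp
qed

lemma k_bound:
  assumes f: "f \<in> borel_measurable borel" "\<And>s. s \<in> S \<Longrightarrow> \<bar>f s\<bar> \<le> B * norm (k s)"
  shows "set_integrable lborel S f"
proof -
  have "set_integrable lborel S (\<lambda>s. B * norm (k s))"
    using set_integrable_norm[OF k_integrable] by simp
  then show ?thesis
  proof (rule set_integrable_bound)
    show "set_borel_measurable lborel S f" using f(1) unfolding set_borel_measurable_def by measurable
    show "AE s in lborel. s \<in> S \<longrightarrow> norm (f s) \<le> norm (B * norm (k s))"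
      using f(2) by (intro AE_I2) (smt (verit) real_norm_def)
  qed
qed

lemma c_integrable: "set_integrable lborel S c1" "set_integrable lborel S c2"
proof -
  have "compact (w ` {a\<^sup>2..b\<^sup>2})" by (intro compact_continuous_image continuous_w compact_Icc)
  from compact_imp_bounded[OF this] obtain W where W: "\<forall>y\<in>w ` {a\<^sup>2..b\<^sup>2}. norm y \<le> W" unfolding bounded_iff ..
  have b: "\<bar>2 * s * (k s \<bullet> v)\<bar> \<le> (2 * b\<^sup>2 * W) * norm (k s)" if s: "s \<in> S" and v: "norm v = norm (w s)" for s v
  proof -
    have "\<bar>k s \<bullet> v\<bar> \<le> norm (k s) * W"
      using Cauchy_Schwarz_ineq2[of "k s" v] W s v mult_left_mono[of "norm v" W "norm (k s)"] by force
    then have "(2 * s) * \<bar>k s \<bullet> v\<bar> \<le> (2 * b\<^sup>2) * (norm (k s) * W)"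
      using s S_pos[OF s] by (intro mult_mono) auto
    then show ?thesis using S_pos[OF s] by (simp add: abs_mult algebra_simps)
  qed
  show "set_integrable lborel S c1" "set_integrable lborel S c2"
    by (rule k_bound[of _ "2 * b\<^sup>2 * W"]; use b in \<open>simp add: c1_def c2_def\<close>)+
qed

lemma bounded_on_S:
  fixes c :: "real \<Rightarrow> real"
  assumes "continuous_on {a\<^sup>2..b\<^sup>2} c"
  shows "\<exists>B\<ge>0. \<forall>s\<in>{a\<^sup>2..b\<^sup>2}. \<bar>c s\<bar> \<le> B"
proof -
  have "compact (c ` {a\<^sup>2..b\<^sup>2})" by (intro compact_continuous_image assms compact_Icc)
  from compact_imp_bounded[OF this] obtain B where "\<forall>y\<in>c ` {a\<^sup>2..b\<^sup>2}. norm y \<le> B" unfolding bounded_iff ..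
  then show ?thesis by (intro exI[of _ "max B 0"]) (auto simp: le_max_iff_disj)
qed

lemma mult_integrable:
  fixes c f :: "real \<Rightarrow> real"
  assumes c: "continuous_on {a\<^sup>2..b\<^sup>2} c" and f: "f \<in> borel_measurable borel" "set_integrable lborel S f"
  shows "set_integrable lborel S (\<lambda>s. c s * f s)"
proof -
  obtain B where B: "0 \<le> B" "\<forall>s\<in>{a\<^sup>2..b\<^sup>2}. \<bar>c s\<bar> \<le> B" using bounded_on_S[OF c] by blast
  have "set_integrable lborel S (\<lambda>s. B * \<bar>f s\<bar>)" using set_integrable_abs[OF f(2)] by simp
  then show ?thesis
  proof (rule set_integrable_bound)
    have "(\<lambda>s. indicator S s *\<^sub>R c s) \<in> borel_measurable borel"
      by (rule borel_measurable_continuous_on_indicator[OF _ continuous_on_subset[OF c]]) auto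
    then have "(\<lambda>s. (indicator S s *\<^sub>R c s) * f s) \<in> borel_measurable borel" using f(1) by measurable
    then show "set_borel_measurable lborel S (\<lambda>s. c s * f s)"
      by (simp add: set_borel_measurable_def mult.assoc)
    show "AE s in lborel. s \<in> S \<longrightarrow> norm (c s * f s) \<le> norm (B * \<bar>f s\<bar>)"
      using B by (intro AE_I2) (auto simp: abs_mult intro!: mult_right_mono)
  qed
qed

text \<open>A pure rotation leaves the determinant alone and changes the energy by a quadratic
  polynomial in \<epsilon>. It is nonnegative for both signs of \<epsilon>, so its linear
  coefficient vanishes: \<open>c2\<close> has weak derivative 0.\<close>

lemma c2_const: "\<exists>\<omega>. AE s in lborel. s \<in> S \<longrightarrow> c2 s = \<omega>"
proof (rule weak_derivative_zero[OF a2b2 _ c_integrable(2)])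
  fix \<eta> :: "real \<Rightarrow> real" and p q
  assume pq: "a\<^sup>2 < p" "p < q" "q < b\<^sup>2" and \<eta>: "smooth \<eta>" "\<And>s. s \<le> p \<or> q \<le> s \<Longrightarrow> \<eta> s = 0"
  note d\<eta> = smooth_DERIV[OF \<eta>(1)]
  have i1: "set_integrable lborel S (\<lambda>s. deriv \<eta> s * c2 s)"
    by (rule mult_integrable[OF smooth_continuous_on[OF d\<eta>(2)] _ c_integrable(2)]) simp
  have i2: "set_integrable lborel S (\<lambda>s. s * R s * (deriv \<eta> s)\<^sup>2)"
    by (rule set_integrable_subset[OF borel_integrable_atLeastAtMost'[of "a\<^sup>2" "b\<^sup>2"]])
      (auto intro!: continuous_intros continuous_R smooth_continuous_on[OF d\<eta>(2)])
  define X where "X = (LINT s:S|lborel. deriv \<eta> s * c2 s)"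
  define Y where "Y = (LINT s:S|lborel. s * R s * (deriv \<eta> s)\<^sup>2)"
  have "0 \<le> 2 * \<epsilon> * X + 2 * \<epsilon>\<^sup>2 * Y" for \<epsilon> :: real
  proof -
    define \<eta>' where "\<eta>' s = \<epsilon> * \<eta> s" for s
    have d': "deriv \<eta>' s = \<epsilon> * deriv \<eta> s" for s
      unfolding \<eta>'_def by (rule DERIV_imp_deriv) (auto intro!: derivative_eq_intros d\<eta>(1))
    have "smooth \<eta>'" unfolding \<eta>'_def[abs_def] by (rule smooth_mult[OF smooth_const \<eta>(1)])
    then have tm: "twist_map a b p q (\<lambda>_. 1) \<eta>' 0"
      by unfold_locales (use ab pq \<eta>(2) in \<open>auto simp: \<eta>'_def smooth_const\<close>)
    define f where "f s = ((c1 s)\<^sup>2 + (c2 s + 2 * s * (\<epsilon> * deriv \<eta> s) * R s)\<^sup>2) / R s / (2 * s) + R s / (2 * s) + hI (c1 s / s)" for s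
    have fd: "f s - e0 s = 2 * \<epsilon> * (deriv \<eta> s * c2 s) + 2 * \<epsilon>\<^sup>2 * (s * R s * (deriv \<eta> s)\<^sup>2)" if s: "s \<in> S" for s
    proof -
      have p: "0 < R s" "0 < s" using R_pos[of s] S_pos[OF s] s by auto
      have "f s - e0 s = ((c2 s + 2 * s * (\<epsilon> * deriv \<eta> s) * R s)\<^sup>2 - (c2 s)\<^sup>2) / (R s * (2 * s))"
        using p by (simp add: f_def e0_def Q_def field_simps)
      also have "\<dots> = 2 * \<epsilon> * (deriv \<eta> s * c2 s) + 2 * \<epsilon>\<^sup>2 * (s * R s * (deriv \<eta> s)\<^sup>2)"
        using p by (simp add: field_simps power2_eq_square)
      finally show ?thesis .
    qed
    have i: "set_integrable lborel S (\<lambda>s. 2 * \<epsilon> * (deriv \<eta> s * c2 s) + 2 * \<epsilon>\<^sup>2 * (s * R s * (deriv \<eta> s)\<^sup>2))"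
      by (intro set_integral_add(1) set_integrable_mult_right i1 i2)
    have "0 \<le> (LINT s:S|lborel. f s - e0 s)"
    proof (rule variation_nonneg)
      have "energy a b h0 (\<lambda>x. u (twist (\<lambda>_. 1) \<eta>' x)) = ennreal pi * (\<integral>\<^sup>+s\<in>S. ennreal (f s) \<partial>lborel)"
        unfolding energy_rotation[OF tm]
      proof (intro arg_cong[where f = "\<lambda>x. ennreal pi * x"] nn_integral_cong_AE)
        show "AE s in lborel. dens h0 1 (2 * s * deriv \<eta>' s) s s * indicator S s = ennreal (f s) * indicator S s"
          using c1_pos
        proof eventually_elim
          case (elim s)
          show ?case
          proof (cases "s \<in> S")
            case True
            then have p: "0 < R s" "0 < s" "0 < c1 s" using R_pos[of s] S_pos[OF True] elim by auto
            then show ?thesis using True hI_nonneg[of "c1 s / s"]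
              by (simp add: dens_def h0_eq f_def d' ennreal_plus[symmetric] add_divide_distrib del: ennreal_plus)
          qed simp
        qed
      qed
      then show "energy a b h0 u \<le> ennreal pi * (\<integral>\<^sup>+s\<in>S. ennreal (f s) \<partial>lborel)" using minimal[OF tm] by simp
      show "set_integrable lborel S (\<lambda>s. f s - e0 s)"
        using i by (subst set_integrable_cong[OF refl refl fd]) auto
      show "AE s in lborel. s \<in> S \<longrightarrow> 0 \<le> f s"
      proof (intro AE_I2 impI)
        fix s assume s: "s \<in> S"
        then show "0 \<le> f s" using R_pos[of s] S_pos[OF s] hI_nonneg[of "c1 s / s"] by (simp add: f_def)
      qed
    qed
    also have "(LINT s:S|lborel. f s - e0 s) = (LINT s:S|lborel. 2 * \<epsilon> * (deriv \<eta> s * c2 s) + 2 * \<epsilon>\<^sup>2 * (s * R s * (deriv \<eta> s)\<^sup>2))"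
      by (rule set_lebesgue_integral_cong) (use fd in auto)
    also have "\<dots> = 2 * \<epsilon> * X + 2 * \<epsilon>\<^sup>2 * Y"
      unfolding X_def Y_def
      by (subst set_integral_add(2)[OF set_integrable_mult_right[OF i1] set_integrable_mult_right[OF i2]]) simp
    finally show ?thesis .
  qed
  then have lin: "0 \<le> \<epsilon> * X + \<epsilon>\<^sup>2 * Y" for \<epsilon> :: real by (metis (no_types, opaque_lifting) mult.assoc distrib_left zero_le_mult_iff zero_less_numeral not_le)
  have "X = 0"
  proof (rule ccontr)
    assume "X \<noteq> 0"
    \<comment> \<open>With this \<epsilon> the linear term is -2 r \<epsilon>^2, which outweighs the
      quadratic one because r exceeds |Y|; r is positive even if Y is 0.\<close>
    define r \<epsilon> where "r = \<bar>Y\<bar> + 1" and "\<epsilon> = - X / (2 * r)"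
    have r: "0 < r" by (simp add: r_def)
    have "X = - (2 * r) * \<epsilon>" using r by (simp add: \<epsilon>_def)
    then have "\<epsilon> * X = - (2 * r) * \<epsilon>\<^sup>2" by (metis mult.left_commute power2_eq_square)
    moreover have "\<epsilon>\<^sup>2 * Y \<le> \<epsilon>\<^sup>2 * r" unfolding r_def by (intro mult_left_mono) auto
    moreover have "0 < r * \<epsilon>\<^sup>2" using \<open>X \<noteq> 0\<close> r by (simp add: \<epsilon>_def)
    ultimately show False using lin[of \<epsilon>] by (simp add: algebra_simps)
  qed
  then show "(LINT s:S|lborel. deriv \<eta> s * c2 s) = 0" by (simp add: X_def)
qed simp

end

section \<open>Variation by dilations and the integrated Euler-Lagrange equation\<close>

context polar_minimizer
begin

text \<open>The energy density of a dilated map after the substitution \<open>t = s * (A s)\<^sup>2\<close>, in which the dilation no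
  longer acts on the argument of the merely measurable functions \<open>c1\<close> and \<open>c2\<close>.\<close>

definition "dil A \<mu> t = (\<mu> * Q t + R t / \<mu>) / (2 * t) + hI (A\<^sup>2 * \<mu> * (c1 t / t)) / (A\<^sup>2 * \<mu>)"

text \<open>\<kappa> is the inverse of the map induced on squared radii, and only smooth quantities
  are evaluated at it. The density of the composed map at s is \<open>dil\<close> at the image t
  times the Jacobian, so the change of variables for twists removes the Jacobian.\<close>

lemma energy_dilation:
  assumes tm: "twist_map a b p q A (\<lambda>_. 0) 0"
  shows "\<exists>\<kappa>. \<kappa> \<in> borel_measurable borel \<and> (\<forall>t\<in>S. \<kappa> t \<in> S \<and> \<kappa> t * (A (\<kappa> t))\<^sup>2 = t) \<and>
    energy a b h0 (\<lambda>x. u (twist A (\<lambda>_. 0) x)) =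
      ennreal pi * (\<integral>\<^sup>+t\<in>S. ennreal (dil (A (\<kappa> t)) (1 + 2 * (\<kappa> t * deriv A (\<kappa> t)) / A (\<kappa> t)) t) \<partial>lborel)"
proof -
  interpret tm: twist_map a b p q A "\<lambda>_. 0" 0 by (rule tm)
  let ?m = tm.m and ?I = "{a\<^sup>2..b\<^sup>2}"
  have A0: "0 < A s" for s by (rule tm.Apos)
  have [measurable]: "A \<in> borel_measurable borel" "deriv A \<in> borel_measurable borel"
    by (intro smooth_borel_measurable tm.smA smooth_DERIV(2)[OF tm.smA])+
  have inj: "inj_on ?m ?I"
  proof (rule inj_onI)
    fix s t assume "s \<in> ?I" "t \<in> ?I" "?m s = ?m t"
    then show "s = t" using tm.m_mono[of s t] tm.m_mono[of t s] by (cases s t rule: linorder_cases) auto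
  qed
  \<comment> \<open>The inverse is taken on the closed interval, where compactness makes it
    continuous; \<kappa> is its restriction to the open interval, extended by 0 to be Borel.\<close>
  define \<kappa>0 where "\<kappa>0 = inv_into ?I ?m"
  have \<kappa>0: "\<kappa>0 (?m s) = s" if "s \<in> ?I" for s using inj that by (simp add: \<kappa>0_def)
  have "continuous_on (?m ` ?I) \<kappa>0"
    by (rule continuous_on_inv) (use \<kappa>0 in \<open>auto intro!: continuous_at_imp_continuous_on DERIV_isCont[OF tm.m_DERIV]\<close>)
  moreover have sub: "S \<subseteq> ?m ` ?I" using tm.m_image by (auto simp: set_eq_iff image_iff) (metis atLeastAtMost_iff greaterThanLessThan_iff less_imp_le)
  ultimately have \<kappa>c: "continuous_on S \<kappa>0" by (rule continuous_on_subset)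
  define \<kappa> where "\<kappa> t = indicator S t *\<^sub>R \<kappa>0 t" for t
  have \<kappa>m[measurable]: "\<kappa> \<in> borel_measurable borel"
    unfolding \<kappa>_def[abs_def] by (rule borel_measurable_continuous_on_indicator[OF _ \<kappa>c]) simp
  have \<kappa>: "\<kappa> (?m s) = s" if "s \<in> S" for s using tm.m_in[OF that] \<kappa>0[of s] that by (simp add: \<kappa>_def)
  have \<kappa>S: "\<kappa> t \<in> S \<and> \<kappa> t * (A (\<kappa> t))\<^sup>2 = t" if t: "t \<in> S" for t
  proof -
    obtain s where "s \<in> S" "?m s = t" using tm.m_image t by (metis imageE)
    then show ?thesis using \<kappa>[of s] by (simp add: tm.m_def)
  qed
  define F where "F t = ennreal (dil (A (\<kappa> t)) (1 + 2 * (\<kappa> t * deriv A (\<kappa> t)) / A (\<kappa> t)) t)" for t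
  have [measurable]: "F \<in> borel_measurable borel" unfolding F_def dil_def by measurable
  have Fn: "(\<lambda>y::real^2. F ((norm y)\<^sup>2)) \<in> borel_measurable borel" by measurable
  have "energy a b h0 (\<lambda>x. u (twist A (\<lambda>_. 0) x)) =
    (\<integral>\<^sup>+x\<in>annulus a b. F ((norm (twist A (\<lambda>_. 0) x))\<^sup>2) * ennreal (tm.J (x \<bullet> x)) \<partial>lborel)"
    unfolding energy_twist[OF tm]
  proof (rule nn_integral_cong_AE)
    show "AE x in lborel. dens h0 (1 + 2 * (norm x)\<^sup>2 * deriv A ((norm x)\<^sup>2) / A ((norm x)\<^sup>2)) (2 * (norm x)\<^sup>2 * deriv (\<lambda>_. 0) ((norm x)\<^sup>2))
         ((norm x)\<^sup>2 * (A ((norm x)\<^sup>2))\<^sup>2) ((norm x)\<^sup>2) * indicator (annulus a b) x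
       = F ((norm (twist A (\<lambda>_. 0) x))\<^sup>2) * ennreal (tm.J (x \<bullet> x)) * indicator (annulus a b) x"
      using tm.AE_tw[OF AE_radialI[OF ab c1_pos]]
    proof eventually_elim
      case (elim x)
      show ?case
      proof (cases "x \<in> annulus a b")
        case True
        define s where "s = (norm x)\<^sup>2"
        define t where "t = s * (A s)\<^sup>2"
        define \<mu> where "\<mu> = 1 + 2 * (s * deriv A s) / A s"
        have s: "s \<in> S" using True by (simp add: tm.ann_iff s_def)
        have s0: "0 < s" by (rule S_pos[OF s])
        have t: "t \<in> S" using tm.m_in[OF s] by (simp add: t_def tm.m_def)
        have t0: "0 < t" by (rule S_pos[OF t])
        have c: "0 < c1 t" using elim True tm.norm_tw[of x] by (simp add: s_def t_def tm.m_def)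
        have Rt: "0 < R t" using R_pos[of t] t by auto
        have J: "tm.J s = (A s)\<^sup>2 * \<mu>" using A0[of s] by (simp add: tm.J_def \<mu>_def field_simps power2_eq_square)
        have Jp: "0 < (A s)\<^sup>2 * \<mu>" using tm.J_ann_pos[OF True] J by (simp add: power2_norm_eq_inner[symmetric] s_def)
        then have \<mu>: "0 < \<mu>" using A0[of s] by (simp add: zero_less_mult_iff)
        have \<kappa>t: "\<kappa> t = s" using \<kappa>[OF s] by (simp add: t_def tm.m_def)
        have e1: "\<mu> * c1 t / s = (A s)\<^sup>2 * \<mu> * (c1 t / t)" using s0 A0[of s] by (simp add: t_def)
        have p1: "0 < \<mu> * c1 t / s" using \<mu> c s0 by simp
        have e2: "((\<mu>\<^sup>2 * (c1 t)\<^sup>2 + (\<mu> * c2 t)\<^sup>2) / R t + R t) / (2 * s) + hI (\<mu> * c1 t / s)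
            = dil (A s) \<mu> t * ((A s)\<^sup>2 * \<mu>)"
        proof -
          have "(\<mu>\<^sup>2 * (c1 t)\<^sup>2 + (\<mu> * c2 t)\<^sup>2) / R t = \<mu>\<^sup>2 * Q t"
            by (simp add: Q_def power_mult_distrib distrib_left add_divide_distrib)
          moreover have "(\<mu>\<^sup>2 * Q t + R t) / (2 * s) = (\<mu> * Q t + R t / \<mu>) / (2 * t) * ((A s)\<^sup>2 * \<mu>)"
            using \<mu> s0 A0[of s] by (simp add: t_def field_simps power2_eq_square)
          moreover have "x / j * j = x" if "0 < j" for x j :: real using that by simp
          note this[OF Jp]
          ultimately show ?thesis unfolding dil_def e1 distrib_right by (simp only:)
        qed
        have "dens h0 \<mu> 0 t s = ennreal (((\<mu>\<^sup>2 * (c1 t)\<^sup>2 + (\<mu> * c2 t)\<^sup>2) / R t + R t) / (2 * s) + hI (\<mu> * c1 t / s))"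
          using p1 hI_nonneg[of "\<mu> * c1 t / s"] Rt s0 by (simp add: dens_def h0_eq ennreal_plus[symmetric] del: ennreal_plus)
        also have "\<dots> = F t * ennreal (tm.J s)"
          unfolding e2 J F_def \<kappa>t \<mu>_def[symmetric] by (rule ennreal_mult'') (use Jp in simp)
        finally show ?thesis using True tm.norm_tw[of x]
          by (simp add: s_def[symmetric] power2_norm_eq_inner[symmetric] tm.m_def t_def[symmetric] \<mu>_def mult.assoc)
      qed simp
    qed
  qed
  also have "\<dots> = (\<integral>\<^sup>+y\<in>annulus a b. F ((norm y)\<^sup>2) \<partial>lborel)" by (rule tm.nn_integral_tw[OF Fn, symmetric])
  also have "\<dots> = ennreal pi * (\<integral>\<^sup>+t\<in>S. F t \<partial>lborel)" by (rule nn_integral_radial[OF ab]) measurable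
  finally show ?thesis using \<kappa>m \<kappa>S unfolding F_def by blast
qed

lemma continuous_on_inverse_S: "continuous_on {a\<^sup>2..b\<^sup>2} (\<lambda>t. 1 / t)"
proof -
  have "0 < a\<^sup>2" using ab by simp
  then show ?thesis by (intro continuous_intros) auto
qed

lemma d_integrable: "set_integrable lborel S (\<lambda>t. c1 t / t)"
  using mult_integrable[OF continuous_on_inverse_S _ c_integrable(1)] by simp

lemma hI_integrable: "set_integrable lborel S (\<lambda>t. hI (c1 t / t))"
proof (rule set_integrable_bound[OF e0_integrable])
  show "set_borel_measurable lborel S (\<lambda>t. hI (c1 t / t))" unfolding set_borel_measurable_def by measurable
  show "AE t in lborel. t \<in> S \<longrightarrow> norm (hI (c1 t / t)) \<le> norm (e0 t)"
  proof (intro AE_I2 impI)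
    fix t assume t: "t \<in> S"
    then have "0 \<le> (Q t + R t) / (2 * t)" using Q_nonneg[of t] R_pos[of t] S_pos[of t] by simp
    then show "norm (hI (c1 t / t)) \<le> norm (e0 t)" using hI_nonneg[of "c1 t / t"] by (simp add: e0_def)
  qed
qed

lemma Q_integrable: "set_integrable lborel S Q"
proof -
  have "set_integrable lborel S (\<lambda>t. (2 * t) * e0 t)"
    by (rule mult_integrable[OF _ _ e0_integrable]) (auto intro!: continuous_intros)
  then show ?thesis
  proof (rule set_integrable_bound)
    show "set_borel_measurable lborel S Q" unfolding set_borel_measurable_def by measurable
    show "AE t in lborel. t \<in> S \<longrightarrow> norm (Q t) \<le> norm (2 * t * e0 t)"
    proof (intro AE_I2 impI)
      fix t assume t: "t \<in> S"
      have p: "0 < t" "0 \<le> Q t" "0 \<le> R t" using S_pos[OF t] Q_nonneg[OF t] R_pos[of t] t by auto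
      have "2 * t * e0 t = Q t + R t + 2 * t * hI (c1 t / t)" using p by (simp add: e0_def field_simps)
      moreover have "0 \<le> 2 * t * hI (c1 t / t)" using p hI_nonneg by simp
      ultimately show "norm (Q t) \<le> norm (2 * t * e0 t)" using p by simp
    qed
  qed
qed

lemma const_integrable: "set_integrable lborel S (\<lambda>_. c :: real)"
  by (rule set_integrable_subset[OF borel_integrable_atLeastAtMost'[of "a\<^sup>2" "b\<^sup>2"]]) auto

lemma R_integrable: "set_integrable lborel S R"
  by (rule set_integrable_subset[OF borel_integrable_atLeastAtMost'[OF continuous_R[of "{a\<^sup>2..b\<^sup>2}"]]]) auto

text \<open>The factor of \<delta> in \<open>dilation_bound\<close> at d = c1 t / t, serving as
  integrable majorant of all difference quotients.\<close>

definition "W t = 2 * (Q t / t) + 2 * (R t / t) + 6 * ((12 * C + 2) * (1 + c1 t / t + hI (c1 t / t)))"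

lemma W_integrable: "set_integrable lborel S W"
proof -
  have "set_integrable lborel S (\<lambda>t. Q t / t)" "set_integrable lborel S (\<lambda>t. R t / t)"
    using mult_integrable[OF continuous_on_inverse_S _ Q_integrable] mult_integrable[OF continuous_on_inverse_S _ R_integrable] by simp_all
  then show ?thesis unfolding W_def[abs_def]
    by (intro set_integral_add(1) set_integrable_mult_right const_integrable d_integrable hI_integrable)
qed

lemma HI_integrable: "set_integrable lborel S (\<lambda>t. HI (c1 t / t))"
proof -
  have "set_integrable lborel S (\<lambda>t. (4 * C + 1) * (1 + c1 t / t + hI (c1 t / t)))"
    by (intro set_integral_add(1) set_integrable_mult_right const_integrable d_integrable hI_integrable)
  then show ?thesis
  proof (rule set_integrable_bound)
    show "set_borel_measurable lborel S (\<lambda>t. HI (c1 t / t))" unfolding set_borel_measurable_def by measurable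
    show "AE t in lborel. t \<in> S \<longrightarrow> norm (HI (c1 t / t)) \<le> norm ((4 * C + 1) * (1 + c1 t / t + hI (c1 t / t)))"
      using c1_pos
    proof eventually_elim
      case (elim t)
      show ?case
      proof
        assume t: "t \<in> S"
        then have "0 < c1 t / t" using elim S_pos[OF t] by simp
        from H_bound[OF this] this
        show "norm (HI (c1 t / t)) \<le> norm ((4 * C + 1) * (1 + c1 t / t + hI (c1 t / t)))"
          by (simp add: HI_def hI_def)
      qed
    qed
  qed
qed

text \<open>With A = 1 + \<epsilon> \<xi> and \<epsilon> decreasing to 0, minimality makes the
  integrated difference quotients nonnegative. They converge pointwise by
  \<open>dilation_limit\<close> and are dominated by a multiple of \<open>W\<close>, so the integral
  of the limit is nonnegative as well.\<close>

lemma dilation_inequality: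
  assumes pq: "a\<^sup>2 < p" "p < q" "q < b\<^sup>2" and \<xi>: "smooth \<xi>" and z: "\<And>s. s \<le> p \<or> q \<le> s \<Longrightarrow> \<xi> s = 0"
  shows "0 \<le> (LINT t:S|lborel. deriv \<xi> t * (Q t - R t) + (2 * \<xi> t + 2 * (t * deriv \<xi> t)) * HI (c1 t / t))"
proof -
  note d\<xi> = smooth_DERIV[OF \<xi>]
  have [measurable]: "\<xi> \<in> borel_measurable borel" "deriv \<xi> \<in> borel_measurable borel"
    by (intro smooth_borel_measurable \<xi> d\<xi>(2))+
  obtain B1 where B1: "0 \<le> B1" "\<forall>s\<in>{a\<^sup>2..b\<^sup>2}. \<bar>\<xi> s\<bar> \<le> B1"
    using bounded_on_S[OF smooth_continuous_on[OF \<xi>]] by blast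
  have "continuous_on {a\<^sup>2..b\<^sup>2} (\<lambda>s. s * deriv \<xi> s)" by (intro continuous_intros smooth_continuous_on[OF d\<xi>(2)])
  from bounded_on_S[OF this] obtain B2 where B2: "0 \<le> B2" "\<forall>s\<in>{a\<^sup>2..b\<^sup>2}. \<bar>s * deriv \<xi> s\<bar> \<le> B2" by blast
  define B where "B = B1 + B2 + 1"
  have B0: "0 < B" using B1(1) B2(1) by (simp add: B_def)
  have Ba: "\<bar>\<xi> s\<bar> \<le> B" for s
  proof (cases "s \<le> p \<or> q \<le> s")
    case False
    then have "\<bar>\<xi> s\<bar> \<le> B1" using B1(2) pq by auto
    then show ?thesis using B2(1) by (simp add: B_def)
  qed (use z B0 in auto)
  have Bb: "\<bar>s * deriv \<xi> s\<bar> \<le> B" if "s \<in> {a\<^sup>2..b\<^sup>2}" for s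
  proof -
    have "\<bar>s * deriv \<xi> s\<bar> \<le> B2" using B2(2) that by blast
    then show ?thesis using B1(1) by (simp add: B_def)
  qed
  \<comment> \<open>\<open>B\<close> bounds both \<xi> and s \<xi>'(s). The factor 1/(20 B) makes
    \<epsilon> B at most 1/20, the smallness demanded by \<open>dilation_bound\<close> and also the
    source of positivity of A and of the Jacobian.\<close>
  define \<epsilon> where "\<epsilon> n = (1 / (20 * B)) * inverse (real (Suc n))" for n
  have \<epsilon>0: "0 < \<epsilon> n" for n using B0 by (simp add: \<epsilon>_def)
  have \<epsilon>B: "\<epsilon> n * B \<le> 1 / 20" for n
  proof -
    have "\<epsilon> n * B = inverse (real (Suc n)) / 20" using B0 by (simp add: \<epsilon>_def)
    moreover have "inverse (real (Suc n)) \<le> 1" by (simp add: field_simps)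
    ultimately show ?thesis by simp
  qed
  have \<epsilon>l: "\<epsilon> \<longlonglongrightarrow> 0"
    unfolding \<epsilon>_def using tendsto_mult[OF tendsto_const LIMSEQ_inverse_real_of_nat, of "1 / (20 * B)"] by simp
  define A where "A n s = 1 + \<epsilon> n * \<xi> s" for n s
  have dA: "deriv (A n) s = \<epsilon> n * deriv \<xi> s" for n s
    unfolding A_def by (rule DERIV_imp_deriv) (auto intro!: derivative_eq_intros d\<xi>(1))
  have A1: "\<bar>A n s - 1\<bar> \<le> \<epsilon> n * B" for n s
    using Ba[of s] \<epsilon>0[of n] by (simp add: A_def abs_mult)
  have A0: "0 < A n s" for n s using A1[of n s] \<epsilon>B[of n] by linarith
  have \<beta>: "\<bar>\<epsilon> n * (s * deriv \<xi> s)\<bar> \<le> \<epsilon> n * B" if "s \<in> {a\<^sup>2..b\<^sup>2}" for n s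
    using Bb[OF that] \<epsilon>0[of n] by (simp add: abs_mult)
  have \<epsilon>B0: "0 \<le> \<epsilon> n * B" for n using \<epsilon>0[of n] B0 by simp
  have \<mu>p: "0 < 1 + 2 * (\<epsilon> n * (s * deriv \<xi> s)) / A n s" if "s \<in> {a\<^sup>2..b\<^sup>2}" for n s
    by (rule dilation_bound(1)[of 1 0 0 1 "\<epsilon> n * B" "A n s" "\<epsilon> n * (s * deriv \<xi> s)"])
      (use \<epsilon>B0[of n] \<epsilon>B[of n] A1[of n s] \<beta>[OF that, of n] in auto)
  have tm: "twist_map a b p q (A n) (\<lambda>_. 0) 0" for n
  proof unfold_locales
    show "smooth (A n)" unfolding A_def[abs_def] by (intro smooth_add smooth_const smooth_mult[OF smooth_const \<xi>])
    show "A n s = 1" if "s \<le> p \<or> q \<le> s" for s using z[OF that] by (simp add: A_def)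
    show "0 < (A n s)\<^sup>2 + 2 * s * A n s * deriv (A n) s" if s: "s \<in> {a\<^sup>2..b\<^sup>2}" for s
    proof -
      have "0 < (A n s)\<^sup>2 * (1 + 2 * (\<epsilon> n * (s * deriv \<xi> s)) / A n s)" using \<mu>p[OF s] A0[of n s] by simp
      also have "\<dots> = (A n s)\<^sup>2 + 2 * s * A n s * deriv (A n) s"
        using A0[of n s] by (simp add: dA field_simps power2_eq_square)
      finally show ?thesis .
    qed
  qed (use ab pq A0 in \<open>auto simp: smooth_const\<close>)
  have "\<forall>n. \<exists>\<kappa>. \<kappa> \<in> borel_measurable borel \<and> (\<forall>t\<in>S. \<kappa> t \<in> S \<and> \<kappa> t * (A n (\<kappa> t))\<^sup>2 = t) \<and>
    energy a b h0 (\<lambda>x. u (twist (A n) (\<lambda>_. 0) x)) =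
      ennreal pi * (\<integral>\<^sup>+t\<in>S. ennreal (dil (A n (\<kappa> t)) (1 + 2 * (\<kappa> t * deriv (A n) (\<kappa> t)) / A n (\<kappa> t)) t) \<partial>lborel)"
    using energy_dilation[OF tm] by blast
  from choice[OF this] obtain \<kappa> where \<kappa>: "\<forall>n. \<kappa> n \<in> borel_measurable borel \<and> (\<forall>t\<in>S. \<kappa> n t \<in> S \<and> \<kappa> n t * (A n (\<kappa> n t))\<^sup>2 = t) \<and>
    energy a b h0 (\<lambda>x. u (twist (A n) (\<lambda>_. 0) x)) =
      ennreal pi * (\<integral>\<^sup>+t\<in>S. ennreal (dil (A n (\<kappa> n t)) (1 + 2 * (\<kappa> n t * deriv (A n) (\<kappa> n t)) / A n (\<kappa> n t)) t) \<partial>lborel)" ..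
  have \<kappa>m[measurable]: "\<kappa> n \<in> borel_measurable borel" for n using \<kappa> by simp
  have \<kappa>S: "\<kappa> n t \<in> S" and \<kappa>A: "\<kappa> n t * (A n (\<kappa> n t))\<^sup>2 = t" if "t \<in> S" for n t using \<kappa> that by simp_all
  have en: "energy a b h0 (\<lambda>x. u (twist (A n) (\<lambda>_. 0) x)) =
      ennreal pi * (\<integral>\<^sup>+t\<in>S. ennreal (dil (A n (\<kappa> n t)) (1 + 2 * (\<kappa> n t * deriv (A n) (\<kappa> n t)) / A n (\<kappa> n t)) t) \<partial>lborel)" for n
    using \<kappa> by simp
  define \<beta>n where "\<beta>n n t = \<kappa> n t * deriv \<xi> (\<kappa> n t)" for n t
  define \<mu> where "\<mu> n t = 1 + 2 * (\<epsilon> n * \<beta>n n t) / A n (\<kappa> n t)" for n t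
  have \<mu>eq: "1 + 2 * (\<kappa> n t * deriv (A n) (\<kappa> n t)) / A n (\<kappa> n t) = \<mu> n t" for n t
    by (simp add: \<mu>_def \<beta>n_def dA mult.left_commute)
  define f where "f n t = dil (A n (\<kappa> n t)) (\<mu> n t) t" for n t
  have [measurable]: "A n \<in> borel_measurable borel" for n
    unfolding A_def[abs_def] by measurable
  have [measurable]: "\<beta>n n \<in> borel_measurable borel" for n
    unfolding \<beta>n_def[abs_def] by measurable
  have [measurable]: "\<mu> n \<in> borel_measurable borel" for n
    unfolding \<mu>_def[abs_def] by measurable
  have fm[measurable]: "f n \<in> borel_measurable borel" for n
    unfolding f_def[abs_def] dil_def by measurable
  have pt: "0 < t" "0 \<le> Q t" "0 < R t" "\<kappa> n t \<in> {a\<^sup>2..b\<^sup>2}" "0 < \<mu> n t" if t: "t \<in> S" for t n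
  proof -
    show "0 < t" "0 \<le> Q t" "0 < R t" using S_pos[OF t] Q_nonneg[OF t] R_pos[of t] t by auto
    show *: "\<kappa> n t \<in> {a\<^sup>2..b\<^sup>2}" using \<kappa>S[OF t, of n] by auto
    show "0 < \<mu> n t" using \<mu>p[OF *] by (simp add: \<mu>_def \<beta>n_def)
  qed
  have bnd: "AE t in lborel. t \<in> S \<longrightarrow> (\<forall>n. \<bar>f n t - e0 t\<bar> \<le> \<epsilon> n * B * W t)"
    using c1_pos
  proof eventually_elim
    case (elim t)
    show ?case
    proof (intro impI allI)
      fix n assume t: "t \<in> S"
      have d: "0 < c1 t / t" using elim t pt(1)[OF t] by simp
      have Jd: "0 < (A n (\<kappa> n t))\<^sup>2 * \<mu> n t * (c1 t / t)" using d A0[of n "\<kappa> n t"] pt(5)[OF t, of n] by (intro mult_pos_pos) auto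
      have eqs: "hI ((A n (\<kappa> n t))\<^sup>2 * \<mu> n t * (c1 t / t)) = h ((A n (\<kappa> n t))\<^sup>2 * \<mu> n t * (c1 t / t))" "hI (c1 t / t) = h (c1 t / t)"
        using d Jd by (simp_all add: hI_def)
      show "\<bar>f n t - e0 t\<bar> \<le> \<epsilon> n * B * W t"
        unfolding f_def dil_def e0_def W_def eqs
        by (rule dilation_bound(4)[where \<beta> = "\<epsilon> n * \<beta>n n t"])
          (use d pt(1-3)[OF t] pt(4,5)[OF t, of n] \<epsilon>B0[of n] \<epsilon>B[of n] A1[of n] \<beta>[OF pt(4)[OF t, of n], of n] in \<open>auto simp: \<mu>_def \<beta>n_def\<close>)
    qed
  qed
  have lim: "AE t in lborel. t \<in> S \<longrightarrow> (\<lambda>n. (f n t - e0 t) / \<epsilon> n) \<longlonglongrightarrow>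
      deriv \<xi> t * (Q t - R t) + (2 * \<xi> t + 2 * (t * deriv \<xi> t)) * HI (c1 t / t)"
    using c1_pos
  proof eventually_elim
    case (elim t)
    show ?case
    proof
      assume t: "t \<in> S"
      have d: "0 < c1 t / t" using elim t pt(1)[OF t] by simp
      have Jd: "0 < (A n (\<kappa> n t))\<^sup>2 * \<mu> n t * (c1 t / t)" for n using d A0[of n "\<kappa> n t"] pt(5)[OF t, of n] by (intro mult_pos_pos) auto
      have eqs: "hI ((A n (\<kappa> n t))\<^sup>2 * \<mu> n t * (c1 t / t)) = h ((A n (\<kappa> n t))\<^sup>2 * \<mu> n t * (c1 t / t))" "hI (c1 t / t) = h (c1 t / t)"
        "HI (c1 t / t) = H (c1 t / t)" for n
        using d Jd[of n] by (simp_all add: hI_def HI_def)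
      \<comment> \<open>The bound on A - 1 is uniform in the point, so it holds at the moving point
        \<kappa> n t; since \<kappa> n t equals t / A^2 there, this point converges to t.\<close>
      have "(\<lambda>n. A n (\<kappa> n t) - 1) \<longlonglongrightarrow> 0"
      proof (rule Lim_null_comparison)
        show "(\<lambda>n. \<epsilon> n * B) \<longlonglongrightarrow> 0" using tendsto_mult[OF \<epsilon>l tendsto_const, of B] by simp
        show "\<forall>\<^sub>F n in sequentially. norm (A n (\<kappa> n t) - 1) \<le> \<epsilon> n * B" using A1 by (simp add: always_eventually)
      qed
      then have Al: "(\<lambda>n. A n (\<kappa> n t)) \<longlonglongrightarrow> 1" by (simp add: LIM_zero_iff)
      have "(\<lambda>n. t / (A n (\<kappa> n t))\<^sup>2) \<longlonglongrightarrow> t / 1\<^sup>2" by (intro tendsto_intros Al) simp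
      moreover have "t / (A n (\<kappa> n t))\<^sup>2 = \<kappa> n t" for n using \<kappa>A[OF t, of n] A0[of n "\<kappa> n t"] by (simp add: field_simps)
      ultimately have \<kappa>l: "(\<lambda>n. \<kappa> n t) \<longlonglongrightarrow> t" by simp
      have "(\<lambda>n. (f n t - e0 t) / \<epsilon> n) \<longlonglongrightarrow> (t * deriv \<xi> t / t) * (Q t - R t) + (2 * \<xi> t + 2 * (t * deriv \<xi> t)) * H (c1 t / t)"
        unfolding f_def dil_def e0_def eqs
      proof (rule dilation_limit[OF d pt(1)[OF t] \<epsilon>l])
        show "(\<lambda>n. \<xi> (\<kappa> n t)) \<longlonglongrightarrow> \<xi> t"
          by (rule isCont_tendsto_compose[OF DERIV_isCont[OF d\<xi>(1)] \<kappa>l])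
        show "(\<lambda>n. \<beta>n n t) \<longlonglongrightarrow> t * deriv \<xi> t" unfolding \<beta>n_def
          by (intro tendsto_mult \<kappa>l isCont_tendsto_compose[OF DERIV_isCont[OF smooth_DERIV(1)[OF d\<xi>(2)]] \<kappa>l])
        show "\<epsilon> n \<noteq> 0" for n using \<epsilon>0[of n] by simp
        show "A n (\<kappa> n t) = 1 + \<epsilon> n * \<xi> (\<kappa> n t)" for n by (simp add: A_def)
        show "0 < A n (\<kappa> n t)" "0 < \<mu> n t" for n using A0 pt(5)[OF t] by auto
        show "\<mu> n t = 1 + 2 * (\<epsilon> n * \<beta>n n t) / A n (\<kappa> n t)" for n by (simp add: \<mu>_def)
      qed
      then show "(\<lambda>n. (f n t - e0 t) / \<epsilon> n) \<longlonglongrightarrow>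
        deriv \<xi> t * (Q t - R t) + (2 * \<xi> t + 2 * (t * deriv \<xi> t)) * HI (c1 t / t)"
        using pt(1)[OF t] by (simp add: eqs)
    qed
  qed
  define D where "D n t = indicator S t * ((f n t - e0 t) / \<epsilon> n)" for n t
  have BW: "integrable lborel (\<lambda>t. B * (indicator S t * W t))"
    using W_integrable by (simp add: set_integrable_def)
  have Db: "AE t in lborel. norm (D n t) \<le> B * (indicator S t * W t)" for n
    using bnd
  proof eventually_elim
    case (elim t)
    show ?case
    proof (cases "t \<in> S")
      case True
      then have "\<bar>f n t - e0 t\<bar> \<le> \<epsilon> n * B * W t" using elim by blast
      then show ?thesis using True \<epsilon>0[of n] by (simp add: D_def abs_divide pos_divide_le_eq mult.commute mult.left_commute)
    qed (simp add: D_def)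
  qed
  have Dm[measurable]: "D n \<in> borel_measurable borel" for n unfolding D_def by measurable
  have Di: "integrable lborel (D n)" for n
  proof (rule Bochner_Integration.integrable_bound[OF BW])
    show "AE t in lborel. norm (D n t) \<le> norm (B * (indicator S t * W t))" using Db[of n] by eventually_elim simp
  qed measurable
  have D0: "0 \<le> (LINT t|lborel. D n t)" for n
  proof -
    have "0 \<le> (LINT t:S|lborel. f n t - e0 t)"
    proof (rule variation_nonneg)
      show "energy a b h0 u \<le> ennreal pi * (\<integral>\<^sup>+t\<in>S. ennreal (f n t) \<partial>lborel)"
        using minimal[OF tm[of n]] unfolding en \<mu>eq f_def .
      have "integrable lborel (\<lambda>t. \<epsilon> n * D n t)" using Di[of n] by simp
      then show "set_integrable lborel S (\<lambda>t. f n t - e0 t)"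
        using \<epsilon>0[of n] by (simp add: set_integrable_def D_def mult.left_commute)
      show "AE t in lborel. t \<in> S \<longrightarrow> 0 \<le> f n t"
      proof (intro AE_I2 impI)
        fix t assume t: "t \<in> S"
        show "0 \<le> f n t" using pt(1-3)[OF t] pt(4,5)[OF t, of n] hI_nonneg by (simp add: f_def dil_def)
      qed
    qed
    also have "(LINT t:S|lborel. f n t - e0 t) = (LINT t|lborel. \<epsilon> n * D n t)"
      unfolding set_lebesgue_integral_def using \<epsilon>0[of n]
      by (intro Bochner_Integration.integral_cong) (auto simp: D_def)
    also have "\<dots> = \<epsilon> n * (LINT t|lborel. D n t)" by simp
    finally show ?thesis using \<epsilon>0[of n] by (simp add: zero_le_mult_iff)
  qed
  have "(\<lambda>n. LINT t|lborel. D n t) \<longlonglongrightarrow> (LINT t|lborel. indicator S t *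
      (deriv \<xi> t * (Q t - R t) + (2 * \<xi> t + 2 * (t * deriv \<xi> t)) * HI (c1 t / t)))"
  proof (rule integral_dominated_convergence[OF _ _ BW _ Db])
    show "AE t in lborel. (\<lambda>n. D n t) \<longlonglongrightarrow> indicator S t *
      (deriv \<xi> t * (Q t - R t) + (2 * \<xi> t + 2 * (t * deriv \<xi> t)) * HI (c1 t / t))"
      using lim
    proof eventually_elim
      case (elim t)
      show ?case
      proof (cases "t \<in> S")
        case True
        then show ?thesis unfolding D_def using elim by simp
      qed (simp add: D_def)
    qed
  qed measurable
  then show ?thesis
    unfolding set_lebesgue_integral_def real_scaleR_def by (rule LIMSEQ_le_const) (use D0 in blast)
qed

text \<open>Inserting both \<xi> and its negative turns the inequality into an equality. The terms
  are grouped by \<xi>' and \<xi> to exhibit a function together with its weak derivative.\<close>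

lemma weak_Euler_Lagrange:
  assumes pq: "a\<^sup>2 < p" "p < q" "q < b\<^sup>2" and \<xi>: "smooth \<xi>" and z: "\<And>s. s \<le> p \<or> q \<le> s \<Longrightarrow> \<xi> s = 0"
  shows "(LINT t:S|lborel. deriv \<xi> t * (Q t - R t + 2 * (t * HI (c1 t / t))) + \<xi> t * (2 * HI (c1 t / t))) = 0"
    (is "?I = 0")
proof -
  have "0 \<le> ?I" using dilation_inequality[OF pq \<xi> z] by (simp add: algebra_simps)
  moreover have "0 \<le> - ?I"
  proof -
    define \<zeta> where "\<zeta> s = - \<xi> s" for s
    have s\<zeta>: "smooth \<zeta>" using smooth_mult[OF smooth_const \<xi>, of "-1"] by (simp add: \<zeta>_def[abs_def])
    have d\<zeta>: "deriv \<zeta> s = - deriv \<xi> s" for s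
      unfolding \<zeta>_def by (rule DERIV_imp_deriv) (auto intro!: derivative_eq_intros smooth_DERIV(1)[OF \<xi>])
    have "0 \<le> (LINT t:S|lborel. deriv \<zeta> t * (Q t - R t) + (2 * \<zeta> t + 2 * (t * deriv \<zeta> t)) * HI (c1 t / t))"
      by (rule dilation_inequality[OF pq s\<zeta>]) (use z in \<open>simp add: \<zeta>_def\<close>)
    also have "\<dots> = (LINT t:S|lborel. - (deriv \<xi> t * (Q t - R t + 2 * (t * HI (c1 t / t))) + \<xi> t * (2 * HI (c1 t / t))))"
      unfolding set_lebesgue_integral_def
      by (intro Bochner_Integration.integral_cong) (auto simp: d\<zeta> \<zeta>_def algebra_simps)
    also have "\<dots> = - ?I"
      unfolding set_lebesgue_integral_def scaleR_minus_right by (rule Bochner_Integration.integral_minus)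
    finally show ?thesis .
  qed
  ultimately show ?thesis by simp
qed

text \<open>By the weak equation, Q - R + 2 t H(d) is up to a null set a continuous function on the
  closed interval, although its summands are so far only integrable. Substituting c1 = t d and c2 =
  \<omega> leaves an equation whose coefficients are continuous up to the ends and whose unknown is
  d, to which \<open>continuous_root\<close> applies.\<close>

lemma c1_continuous:
  "\<exists>\<delta> \<omega>. continuous_on {a\<^sup>2..b\<^sup>2} \<delta> \<and> (\<forall>s\<in>{a\<^sup>2..b\<^sup>2}. 0 < \<delta> s) \<and>
    (AE s in lborel. s \<in> S \<longrightarrow> c1 s = s * \<delta> s \<and> c2 s = \<omega>)"
proof -
  obtain \<omega> where \<omega>: "AE s in lborel. s \<in> S \<longrightarrow> c2 s = \<omega>" using c2_const by blast
  have tH: "set_integrable lborel S (\<lambda>t. 2 * (t * HI (c1 t / t)))"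
    by (intro set_integrable_mult_right mult_integrable[OF _ _ HI_integrable]) (auto intro!: continuous_intros)
  have "\<exists>L G. continuous_on {a\<^sup>2..b\<^sup>2} G \<and> (AE t in lborel. t \<in> S \<longrightarrow> Q t - R t + 2 * (t * HI (c1 t / t)) = L + G t)"
    by (rule weak_primitive[where g = "\<lambda>t. 2 * HI (c1 t / t)", OF a2b2])
      (use weak_Euler_Lagrange in \<open>auto intro!: set_integral_add(1) set_integral_diff(1) Q_integrable R_integrable tH set_integrable_mult_right HI_integrable\<close>)
  then obtain L G where G: "continuous_on {a\<^sup>2..b\<^sup>2} G"
    and K: "AE t in lborel. t \<in> S \<longrightarrow> Q t - R t + 2 * (t * HI (c1 t / t)) = L + G t" by blast
  \<comment> \<open>Both come from solving (t d)^2 / R + \<omega>^2 / R - R + 2 t H(d) = L + G for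
    the terms in d and dividing by 2t.\<close>
  define c where "c t = t / (2 * R t)" for t
  define M where "M t = (L + G t + R t - \<omega>\<^sup>2 / R t) / (2 * t)" for t
  have pos: "0 < t" "0 < R t" if "t \<in> {a\<^sup>2..b\<^sup>2}" for t
  proof -
    have "0 < a\<^sup>2" using ab by simp
    with that show "0 < t" unfolding atLeastAtMost_iff by linarith
    show "0 < R t" by (rule R_pos[OF that])
  qed
  have cc: "continuous_on {a\<^sup>2..b\<^sup>2} c" unfolding c_def
    by (intro continuous_intros continuous_R) (use pos in force)
  have Mc: "continuous_on {a\<^sup>2..b\<^sup>2} M" unfolding M_def
    by (intro continuous_intros continuous_R G) (use pos in force)+
  have "\<exists>\<delta>. continuous_on {a\<^sup>2..b\<^sup>2} \<delta> \<and> (\<forall>t\<in>{a\<^sup>2..b\<^sup>2}. 0 < \<delta> t) \<and>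
    (\<forall>t\<in>{a\<^sup>2..b\<^sup>2}. \<forall>d>0. c t * d\<^sup>2 + H d = M t \<longrightarrow> d = \<delta> t)"
    by (rule continuous_root[OF cc _ Mc]) (use pos in \<open>simp add: c_def\<close>)
  then obtain \<delta> where \<delta>: "continuous_on {a\<^sup>2..b\<^sup>2} \<delta>" "\<forall>t\<in>{a\<^sup>2..b\<^sup>2}. 0 < \<delta> t"
    and root: "\<forall>t\<in>{a\<^sup>2..b\<^sup>2}. \<forall>d>0. c t * d\<^sup>2 + H d = M t \<longrightarrow> d = \<delta> t" by blast
  have "AE s in lborel. s \<in> S \<longrightarrow> c1 s = s * \<delta> s \<and> c2 s = \<omega>"
    using \<omega> K c1_pos
  proof eventually_elim
    case (elim t)
    show ?case
    proof
      assume t: "t \<in> S"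
      then have t': "t \<in> {a\<^sup>2..b\<^sup>2}" by auto
      have p: "0 < t" "0 < R t" using pos[OF t'] by auto
      define d where "d = c1 t / t"
      have d: "0 < d" using elim t p by (simp add: d_def)
      have c: "c1 t = t * d" using p by (simp add: d_def)
      have "Q t = ((t * d)\<^sup>2 + \<omega>\<^sup>2) / R t" using elim t c by (simp add: Q_def)
      then have "(t * d)\<^sup>2 / R t = Q t - \<omega>\<^sup>2 / R t" by (simp add: add_divide_distrib)
      moreover have "Q t - R t + 2 * (t * H d) = L + G t" using elim t d by (simp add: d_def[symmetric] HI_def)
      ultimately have "(t * d)\<^sup>2 / R t + 2 * (t * H d) = L + G t + R t - \<omega>\<^sup>2 / R t" by linarith
      moreover have "c t * d\<^sup>2 + H d = ((t * d)\<^sup>2 / R t + 2 * (t * H d)) / (2 * t)"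
        using p by (simp add: c_def field_simps power2_eq_square)
      ultimately have "c t * d\<^sup>2 + H d = M t" by (simp add: M_def)
      then have "d = \<delta> t" using root t' d by blast
      then show "c1 t = t * \<delta> t \<and> c2 t = \<omega>" using elim t c by simp
    qed
  qed
  then show ?thesis using \<delta> by blast
qed

text \<open>The components of \<open>k\<close> in the frame \<open>w\<close>, \<open>perp w\<close>
  are now known to agree almost everywhere with continuous functions, so \<open>w\<close> is a
  primitive of a continuous function and hence differentiable. The regularity of \<rho> is read off
  from \<rho>^2, the squared norm of \<open>w\<close>.\<close>

lemma radial_regularity:
  assumes prim: "\<And>s. s \<in> {a\<^sup>2..b\<^sup>2} \<Longrightarrow> w s = C0 + integral {a\<^sup>2..s} (\<lambda>s. indicator S s *\<^sub>R k s)"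
  shows "\<exists>D. continuous_on {a..b} D \<and> (\<forall>r\<in>{a..b}. 0 < D r) \<and> (\<forall>r\<in>{a<..<b}. (\<rho> has_real_derivative D r) (at r))"
proof -
  obtain \<delta> \<omega> where \<delta>: "continuous_on {a\<^sup>2..b\<^sup>2} \<delta>" "\<forall>s\<in>{a\<^sup>2..b\<^sup>2}. 0 < \<delta> s"
    and c: "AE s in lborel. s \<in> S \<longrightarrow> c1 s = s * \<delta> s \<and> c2 s = \<omega>" using c1_continuous by blast
  have ww: "w s \<bullet> w s = R s" for s by (simp add: w_def R_def power2_norm_eq_inner[symmetric])
  have pos: "0 < s" "0 < R s" if "s \<in> {a\<^sup>2..b\<^sup>2}" for s
  proof -
    have "0 < a\<^sup>2" using ab by simp
    with that show "0 < s" unfolding atLeastAtMost_iff by linarith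
    show "0 < R s" by (rule R_pos[OF that])
  qed
  \<comment> \<open>The frame has squared length \<open>R\<close>, and the inner products of
    \<open>k\<close> with it are \<delta>/2 and \<omega>/(2s) by the definitions of
    \<open>c1\<close> and \<open>c2\<close>.\<close>
  define kc where "kc s = (\<delta> s / (2 * R s)) *\<^sub>R w s + (\<omega> / (2 * s * R s)) *\<^sub>R perp (w s)" for s
  have kcc: "continuous_on {a\<^sup>2..b\<^sup>2} kc" unfolding kc_def
    by (intro continuous_intros continuous_R \<delta>(1) continuous_w continuous_on_perp)
      (use pos in force)+
  have kk: "AE s in lborel. s \<in> S \<longrightarrow> k s = kc s"
    using c
  proof eventually_elim
    case (elim s)
    show ?case
    proof
      assume s: "s \<in> S"
      then have p: "0 < s" "0 < R s" using pos[of s] by auto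
      have e: "(v \<bullet> v) *\<^sub>R x = (x \<bullet> v) *\<^sub>R v + (x \<bullet> perp v) *\<^sub>R perp v" for v x :: "real^2"
        by (simp add: vec_eq_iff forall_2 inner_real2 algebra_simps)
      have "k s \<bullet> w s = \<delta> s / 2" "k s \<bullet> perp (w s) = \<omega> / (2 * s)"
        using elim s p by (auto simp: c1_def c2_def field_simps)
      then have "R s *\<^sub>R k s = (\<delta> s / 2) *\<^sub>R w s + (\<omega> / (2 * s)) *\<^sub>R perp (w s)" using e[of "w s" "k s"] ww[of s] by simp
      then have "(1 / R s) *\<^sub>R (R s *\<^sub>R k s) = (1 / R s) *\<^sub>R ((\<delta> s / 2) *\<^sub>R w s + (\<omega> / (2 * s)) *\<^sub>R perp (w s))" by simp
      then show "k s = kc s" using p by (simp add: kc_def scaleR_add_right mult.commute mult.left_commute)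
    qed
  qed
  have weq: "w s = C0 + integral {a\<^sup>2..s} kc" if s: "s \<in> {a\<^sup>2..b\<^sup>2}" for s
  proof -
    have i1: "set_integrable lborel {a\<^sup>2..s} (\<lambda>s. indicator S s *\<^sub>R k s)"
      unfolding set_integrable_def
      by (rule integrable_mult_indicator[OF _ k_integrable[unfolded set_integrable_def]]) simp
    have i2: "set_integrable lborel {a\<^sup>2..s} kc"
      by (rule borel_integrable_atLeastAtMost'[OF continuous_on_subset[OF kcc]]) (use s in auto)
    have "integral {a\<^sup>2..s} (\<lambda>s. indicator S s *\<^sub>R k s) = (LINT r:{a\<^sup>2..s}|lborel. indicator S r *\<^sub>R k r)"
      using set_borel_integral_eq_integral(2)[OF i1] by simp
    also have "\<dots> = (LINT r:{a\<^sup>2..s}|lborel. kc r)"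
      unfolding set_lebesgue_integral_def
    proof (rule integral_cong_AE)
      show "(\<lambda>r. indicat_real {a\<^sup>2..s} r *\<^sub>R kc r) \<in> borel_measurable lborel"
        using i2 by (simp add: set_integrable_def)
      have "AE r in lborel. r \<noteq> a\<^sup>2" "AE r in lborel. r \<noteq> b\<^sup>2" by (rule AE_lborel_singleton)+
      then show "AE r in lborel. indicat_real {a\<^sup>2..s} r *\<^sub>R indicat_real S r *\<^sub>R k r = indicat_real {a\<^sup>2..s} r *\<^sub>R kc r"
        using kk by eventually_elim (use s in \<open>auto simp: indicator_def\<close>)
    qed measurable
    also have "\<dots> = integral {a\<^sup>2..s} kc" by (rule set_borel_integral_eq_integral(2)[OF i2])
    finally show ?thesis using prim[OF s] by simp
  qed
  have wd: "(w has_vector_derivative kc s) (at s)" if s: "s \<in> S" for s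
  proof -
    have "((\<lambda>s. integral {a\<^sup>2..s} kc) has_vector_derivative kc s) (at s within {a\<^sup>2..b\<^sup>2})"
      by (rule integral_has_vector_derivative[OF kcc]) (use s in auto)
    then have "((\<lambda>s. C0 + integral {a\<^sup>2..s} kc) has_vector_derivative kc s) (at s within {a\<^sup>2..b\<^sup>2})"
      using has_vector_derivative_add[OF has_vector_derivative_const] by fastforce
    then have "((\<lambda>s. C0 + integral {a\<^sup>2..s} kc) has_vector_derivative kc s) (at s within S)"
      by (rule has_vector_derivative_within_subset) auto
    then have "((\<lambda>s. C0 + integral {a\<^sup>2..s} kc) has_vector_derivative kc s) (at s)"
      using s by (simp add: at_within_open[of s S])
    then show ?thesis
      by (rule has_vector_derivative_transform_within_open[of _ _ _ S]) (use s weq in auto)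
  qed
  have Rd: "(R has_real_derivative \<delta> s) (at s)" if s: "s \<in> S" for s
  proof -
    have p: "0 < s" "0 < R s" using pos[of s] s by auto
    have "((\<lambda>s. w s \<bullet> w s) has_derivative (\<lambda>v. w s \<bullet> (v *\<^sub>R kc s) + (v *\<^sub>R kc s) \<bullet> w s)) (at s)"
      using wd[OF s] unfolding has_vector_derivative_def by (intro has_derivative_inner)
    moreover have "w s \<bullet> perp (w s) = 0" by (simp add: inner_real2)
    then have "w s \<bullet> kc s = \<delta> s / 2" using p by (simp add: kc_def inner_add_right ww)
    then have "(\<lambda>v. w s \<bullet> (v *\<^sub>R kc s) + (v *\<^sub>R kc s) \<bullet> w s) = (*) (\<delta> s)"
      by (simp add: fun_eq_iff inner_commute[of "kc s"])
    ultimately show ?thesis unfolding has_field_derivative_def ww by simp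
  qed
  \<comment> \<open>Since the derivative of \<rho>^2 in the squared radius is \<delta>, the chain
    rule gives 2 \<rho> \<rho>' = 2 r \<delta>(r^2). The right-hand side is defined and positive at
    the end points too.\<close>
  define D where "D r = r * \<delta> (r\<^sup>2) / \<rho> r" for r
  have sq: "r\<^sup>2 \<in> {a\<^sup>2..b\<^sup>2}" if "r \<in> {a..b}" for r
    using that ab by (auto intro!: power_mono)
  have "continuous_on {a..b} D" unfolding D_def
  proof (intro continuous_intros)
    show "continuous_on {a..b} (\<lambda>r. \<delta> (r\<^sup>2))"
      by (rule continuous_on_compose2[OF \<delta>(1)]) (use sq in \<open>auto intro!: continuous_intros\<close>)
    show "continuous_on {a..b} \<rho>" by (rule continuous_on_subset[OF cont(1)]) simp
    show "\<forall>r\<in>{a..b}. \<rho> r \<noteq> 0" using \<rho>_pos by force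
  qed
  moreover have "0 < D r" if "r \<in> {a..b}" for r
    using \<delta>(2) sq[OF that] \<rho>_pos[OF that] that ab by (simp add: D_def)
  moreover have "(\<rho> has_real_derivative D r) (at r)" if r: "r \<in> {a<..<b}" for r
  proof -
    have r0: "0 < r" using r ab by simp
    have r2: "r\<^sup>2 \<in> S" using r ab by (auto intro!: power_strict_mono)
    have \<rho>R: "R (x\<^sup>2) = (\<rho> x)\<^sup>2" if "0 < x" for x using that by (simp add: R_def)
    have Rr: "0 < R (r\<^sup>2)" using pos[of "r\<^sup>2"] r2 by auto
    have "((\<lambda>x. R (x\<^sup>2)) has_real_derivative \<delta> (r\<^sup>2) * (2 * r)) (at r)"
      by (rule DERIV_chain2[where g = "\<lambda>x. x\<^sup>2", OF Rd[OF r2]]) (auto intro!: derivative_eq_intros)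
    from DERIV_chain2[where g = "\<lambda>x. R (x\<^sup>2)", OF DERIV_real_sqrt[OF Rr] this]
    have "((\<lambda>x. sqrt (R (x\<^sup>2))) has_real_derivative inverse (sqrt (R (r\<^sup>2))) / 2 * (\<delta> (r\<^sup>2) * (2 * r))) (at r)" .
    moreover have "inverse (sqrt (R (r\<^sup>2))) / 2 * (\<delta> (r\<^sup>2) * (2 * r)) = D r"
      using \<rho>_pos[of r] r r0 by (simp add: \<rho>R D_def field_simps)
    ultimately have "((\<lambda>x. sqrt (R (x\<^sup>2))) has_real_derivative D r) (at r)" by simp
    then show ?thesis
    proof (rule has_field_derivative_transform_within_open[where S = "{a<..<b}"])
      show "sqrt (R (x\<^sup>2)) = \<rho> x" if "x \<in> {a<..<b}" for x
        using that ab \<rho>_pos[of x] by (simp add: \<rho>R)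
    qed (use r in auto)
  qed
  ultimately show ?thesis by blast
qed

end

theorem lemma9:
  fixes a b :: real and h\<^sub>0 :: "real \<Rightarrow> ereal" and N :: int
    and u :: "real^2 \<Rightarrow> real^2" and \<rho> \<psi> :: "real \<Rightarrow> real"
  assumes "0 < a" and "a < b"
    and "hyp_H1 h\<^sub>0" and "hyp_H2 h\<^sub>0" and "hyp_H3 h\<^sub>0" and "hyp_H4 h\<^sub>0"
    and "1 \<le> N"
    and minimizer: "is_arg_min (energy a b h\<^sub>0) (\<lambda>v. v \<in> admissible_sym a b N) u"
    and "continuous_on {a..b} \<rho>" and "continuous_on {a..b} \<psi>"
    and "\<And>r. r \<in> {a..b} \<Longrightarrow> 0 \<le> \<rho> r"
    and polar_form: "AE x in lebesgue. x \<in> annulus a b \<longrightarrow>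
          (\<forall>\<theta>. x = norm x *\<^sub>R e\<^sub>r \<theta> \<longrightarrow> u x = \<rho> (norm x) *\<^sub>R e\<^sub>r (\<theta> + \<psi> (norm x)))"
  shows "\<exists>D :: real \<Rightarrow> real. continuous_on {a..b} D \<and>
           (\<forall>r\<in>{a<..<b}. (\<rho> has_real_derivative D r) (at r)) \<and>
           0 < D a \<and> ereal (D b) < \<infinity>"
proof -
  note ab = \<open>0 < a\<close> \<open>a < b\<close>
  note cont = \<open>continuous_on {a..b} \<rho>\<close> \<open>continuous_on {a..b} \<psi>\<close>
  have adm: "u \<in> admissible_sym a b N" and min: "\<And>v. v \<in> admissible_sym a b N \<Longrightarrow> energy a b h\<^sub>0 u \<le> energy a b h\<^sub>0 v"
    using minimizer unfolding is_arg_min_def by (auto simp: not_less[symmetric])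
  then have uW: "u \<in> W12 (annulus a b)" and tr: "has_trace a b u (\<lambda>x. x)"
    and det: "AE x in lborel. x \<in> annulus a b \<longrightarrow> 0 \<le> det (weak_grad (annulus a b) u x)"
    and wind: "has_radial_winding a b N u"
    by (auto simp: admissible_sym_def admissible_def AE_completion_iff)
  have pol: "AE x in lborel. x \<in> annulus a b \<longrightarrow> u x = polar_map \<rho> \<psi> x"
    using polar_form unfolding polar_form_iff[OF ab(1)] .
  have rad: "0 < \<rho> r" if "r \<in> {a..b}" for r
    by (rule has_radial_windingD(1)[OF ab cont _ pol wind that]) (rule assms(11))
  have rad2: "\<psi> b - \<psi> a = 2 * pi * of_int N"
    by (rule has_radial_windingD(2)[OF ab cont _ pol wind]) (rule assms(11))
  \<comment> \<open>Clamping the argument extends both functions continuously to the whole line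
    without changing them on the closed interval, so that continuity and measurability hold
    globally.\<close>
  define \<rho>' \<psi>' where "\<rho>' r = \<rho> (max a (min b r))" and "\<psi>' r = \<psi> (max a (min b r))" for r
  have clamp: "\<rho>' r = \<rho> r" "\<psi>' r = \<psi> r" if "r \<in> {a..b}" for r using that by (auto simp: \<rho>'_def \<psi>'_def)
  have cont': "continuous_on T \<rho>'" "continuous_on T \<psi>'" for T
    unfolding \<rho>'_def[abs_def] \<psi>'_def[abs_def]
    by (rule continuous_on_compose2[OF cont(1)] continuous_on_compose2[OF cont(2)]; use ab in \<open>auto intro!: continuous_intros\<close>)+
  have pos: "0 < \<rho>' r" if "r \<in> {a..b}" for r using rad[OF that] clamp that by simp
  have N: "\<psi>' b - \<psi>' a = 2 * pi * of_int N" using rad2 ab clamp by simp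
  have pol': "AE x in lborel. x \<in> annulus a b \<longrightarrow> u x = polar_map \<rho>' \<psi>' x"
    using pol by eventually_elim (auto simp: polar_map_def clamp annulus_def)
  have "\<exists>k C0. k \<in> borel_measurable borel \<and> set_integrable lborel {a\<^sup>2<..<b\<^sup>2} k \<and>
    (\<forall>s\<in>{a\<^sup>2..b\<^sup>2}. \<rho>' (sqrt s) *\<^sub>R e\<^sub>r (\<psi>' (sqrt s)) = C0 + integral {a\<^sup>2..s} (\<lambda>s. indicator {a\<^sup>2<..<b\<^sup>2} s *\<^sub>R k s)) \<and>
    (AE x in lborel. x \<in> annulus a b \<longrightarrow>
      weak_grad (annulus a b) u x *v perp x = perp (polar_map \<rho>' \<psi>' x) \<and>
      (weak_grad (annulus a b) u x *v x) \<bullet> polar_map \<rho>' \<psi>' x =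
        2 * (norm x)\<^sup>2 * (k ((norm x)\<^sup>2) \<bullet> (\<rho>' (norm x) *\<^sub>R e\<^sub>r (\<psi>' (norm x)))) \<and>
      (weak_grad (annulus a b) u x *v x) \<bullet> perp (polar_map \<rho>' \<psi>' x) =
        2 * (norm x)\<^sup>2 * (k ((norm x)\<^sup>2) \<bullet> perp (\<rho>' (norm x) *\<^sub>R e\<^sub>r (\<psi>' (norm x)))))"
    using polar_sobolev_structure[OF ab uW tr cont' pol'] by simp
  then obtain k C0 where km: "k \<in> borel_measurable borel" and ki: "set_integrable lborel {a\<^sup>2<..<b\<^sup>2} k"
    and prim: "\<forall>s\<in>{a\<^sup>2..b\<^sup>2}. \<rho>' (sqrt s) *\<^sub>R e\<^sub>r (\<psi>' (sqrt s)) = C0 + integral {a\<^sup>2..s} (\<lambda>s. indicator {a\<^sup>2<..<b\<^sup>2} s *\<^sub>R k s)"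
    and grad: "AE x in lborel. x \<in> annulus a b \<longrightarrow>
      weak_grad (annulus a b) u x *v perp x = perp (polar_map \<rho>' \<psi>' x) \<and>
      (weak_grad (annulus a b) u x *v x) \<bullet> polar_map \<rho>' \<psi>' x =
        2 * (norm x)\<^sup>2 * (k ((norm x)\<^sup>2) \<bullet> (\<rho>' (norm x) *\<^sub>R e\<^sub>r (\<psi>' (norm x)))) \<and>
      (weak_grad (annulus a b) u x *v x) \<bullet> perp (polar_map \<rho>' \<psi>' x) =
        2 * (norm x)\<^sup>2 * (k ((norm x)\<^sup>2) \<bullet> perp (\<rho>' (norm x) *\<^sub>R e\<^sub>r (\<psi>' (norm x))))"
    by (elim exE conjE) (rule that)
  have g1: "AE x in lborel. x \<in> annulus a b \<longrightarrow>
      weak_grad (annulus a b) u x *v perp x = perp (polar_map \<rho>' \<psi>' x)"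
    using grad by eventually_elim simp
  have g2: "AE x in lborel. x \<in> annulus a b \<longrightarrow>
      (weak_grad (annulus a b) u x *v x) \<bullet> polar_map \<rho>' \<psi>' x =
        2 * (norm x)\<^sup>2 * (k ((norm x)\<^sup>2) \<bullet> (\<rho>' (norm x) *\<^sub>R e\<^sub>r (\<psi>' (norm x)))) \<and>
      (weak_grad (annulus a b) u x *v x) \<bullet> perp (polar_map \<rho>' \<psi>' x) =
        2 * (norm x)\<^sup>2 * (k ((norm x)\<^sup>2) \<bullet> perp (\<rho>' (norm x) *\<^sub>R e\<^sub>r (\<psi>' (norm x))))"
    using grad by eventually_elim blast
  define h where "h t = real_of_ereal (h\<^sub>0 t)" for t
  note se = stored_energyI[OF \<open>hyp_H1 h\<^sub>0\<close> \<open>hyp_H2 h\<^sub>0\<close> \<open>hyp_H4 h\<^sub>0\<close>]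
  obtain C where se1: "stored_energy h (deriv h) C" using se(1) unfolding h_def[abs_def] by blast
  have se2: "h\<^sub>0 t = ereal (h t)" if "0 < t" for t using se(2)[OF that] by (simp add: h_def)
  \<comment> \<open>Being a minimiser does not by itself exclude infinite energy; the explicit
    competitor with winding number \<open>N\<close> does.\<close>
  have fin: "energy a b h\<^sub>0 u < \<infinity>"
  proof -
    have h1: "\<bar>h\<^sub>0 1\<bar> \<noteq> \<infinity>" using se2[of 1] by simp
    obtain v where "v \<in> admissible_sym a b N" "energy a b h\<^sub>0 v < \<infinity>"
      using finite_energy_competitor[where h = h\<^sub>0 and N = N, OF ab h1] by blast
    then show ?thesis using min le_less_trans by blast
  qed
  interpret M: polar_minimizer a b u \<rho>' \<psi>' k h "deriv h" C h\<^sub>0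
  proof (rule polar_minimizer.intro)
    show "polar_sobolev a b u \<rho>' \<psi>' k"
      by unfold_locales (fact ab uW tr cont' pos km ki g1 g2)+
    show "stored_energy h (deriv h) C" by (rule se1)
    show "polar_minimizer_axioms a b u h h\<^sub>0"
    proof
      show "h\<^sub>0 t = \<infinity>" if "t \<le> 0" for t using \<open>hyp_H3 h\<^sub>0\<close> that by (simp add: hyp_H3_def)
      show "energy a b h\<^sub>0 u \<le> energy a b h\<^sub>0 (\<lambda>x. u (twist A \<eta> x))" if tm: "twist_map a b p q A \<eta> 0" for p q A \<eta>
        using twist_map.admissible_tw[OF tm uW tr det pol' cont' pos N] by (intro min) simp
    qed (use se2 fin in auto)
  qed
  have "\<exists>D. continuous_on {a..b} D \<and> (\<forall>r\<in>{a..b}. 0 < D r) \<and> (\<forall>r\<in>{a<..<b}. (\<rho>' has_real_derivative D r) (at r))"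
    by (rule M.radial_regularity[of C0]) (use prim in \<open>simp add: M.w_def\<close>)
  then obtain D where D: "continuous_on {a..b} D" "\<forall>r\<in>{a..b}. 0 < D r"
    and d: "\<forall>r\<in>{a<..<b}. (\<rho>' has_real_derivative D r) (at r)" by blast
  have "(\<rho> has_real_derivative D r) (at r)" if "r \<in> {a<..<b}" for r
    by (rule has_field_derivative_transform_within_open[where f = \<rho>' and S = "{a<..<b}"]) (use that d clamp in auto)
  then show ?thesis using D ab by (intro exI[of _ D]) auto
qed

end
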